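(* Let $(\mathcal N^3,g,\phi)$ be a three-dimensional manifold with density and let $\Sigma\subset(\mathcal N^3,g,\phi)$ be a complete weighted $H_\phi$-stable surface, with Gaussian curvature $K$. Then $$\int_\Sigma(V-aK)f^2\,dv_\Sigma\le\int_\Sigma|\nabla f|^2\,dv_\Sigma$$ for every compactly supported piecewise smooth function $f$ on $\Sigma$, where $$V:=\frac13\left(\frac12R_\phi^\infty+\frac12H_\phi^2+\frac12|A|^2+\frac18|\nabla\phi|^2\right),\qquad a:=\frac13.$$ In other words, the Schrödinger operator $L_0:=\Delta-aK+V$ on $\Sigma$ is stable.
   Context: All manifolds and (immersed) surfaces are smooth, connected, orientable and without boundary unless stated otherwise. A manifold with density $(\mathcal N,g,\phi)$ is a Riemannian manifold $(\mathcal N,g)$ together with $\phi\in C^\infty(\mathcal N)$. $\overline\nabla$, $\overline\nabla^2$, $\Delta_g$ are the gradient, Hessian and Laplacian of $(\mathcal N,g)$, $R$ its scalar curvature; $\nabla$, $\Delta$, $dv_\Sigma$ are the gradient, Laplacian and area element of $\Sigma$ in the induced metric, so $\nabla\phi$ is the gradient on $\Sigma$ of $\phi|_\Sigma$. The Bakry-Émery-Ricci tensor is $\mathrm{Ric}_\phi^\infty=\mathrm{Ric}-\overline\nabla^2\phi$, and the Perelman scalar curvature is $R_\phi^\infty=R-2\Delta_g\phi-|\overline\nabla\phi|^2$. For an immersed oriented surface $\Sigma$ with unit normal $N$, second fundamental form $A$ and mean curvature $H$ (the trace of the second fundamental form, with the sign $H=\mathrm{div}_\Sigma N$), the weighted mean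 curvature is $H_\phi=H+g(N,\overline\nabla\phi)$. $\Sigma$ is weighted $H_\phi$-stable if $H_\phi$ is constant and, for all compactly supported variations $\Psi_t$ of $\Sigma$, the second derivative at $t=0$ of $A_\phi(\Psi_t(\Sigma))-H_\phi V_\phi(\Psi_t(\Sigma))$ is nonnegative, where $A_\phi$, $V_\phi$ are the area and volume weighted by $e^\phi$. Equivalently (second variation formula), $H_\phi$ is constant and $$\int_\Sigma(\mathrm{Ric}_\phi^\infty(N,N)+|A|^2)u^2e^\phi\,dv_\Sigma\le\int_\Sigma|\nabla u|^2e^\phi\,dv_\Sigma$$ for all compactly supported piecewise smooth functions $u$ on $\Sigma$. A Schrödinger operator $\Delta+q$, $q\in C^\infty(\Sigma)$, is stable if $\int_\Sigma(|\nabla f|^2-qf^2)\,dv_\Sigma\ge 0$ for all compactly supported piecewise smooth $f$. *)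

theory Defs
  imports "HOL-Analysis.Analysis"
begin

section \<open>Smooth manifolds\<close>

primrec Ck_on :: "nat \<Rightarrow> 'e::euclidean_space set \<Rightarrow> ('e \<Rightarrow> 'f::real_normed_vector) \<Rightarrow> bool" where
  "Ck_on 0 S f = continuous_on S f"
| "Ck_on (Suc k) S f =
     ((\<forall>x\<in>S. f differentiable (at x)) \<and>
      (\<forall>v. Ck_on k S (\<lambda>x. frechet_derivative f (at x) v)))"

text \<open>Used for open sets only.\<close>

definition smooth_on :: "'e::euclidean_space set \<Rightarrow> ('e \<Rightarrow> 'f::real_normed_vector) \<Rightarrow> bool" where
  "smooth_on S f \<longleftrightarrow> (\<forall>k. Ck_on k S f)"

text \<open>
  The underlying set of a manifold is a whole type. A chart is a pair of its domain and its
  coordinate map; values of the coordinate map outside the domain are irrelevant. The smooth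
  structure is given by an atlas, which need not be maximal.
\<close>

type_synonym ('a, 'n) chart = "'a set \<times> ('a \<Rightarrow> real ^ 'n)"

definition chart_inv :: "('a, 'n) chart \<Rightarrow> real ^ 'n \<Rightarrow> 'a" where
  "chart_inv c = inv_into (fst c) (snd c)"

definition transition_deriv ::
    "('a, 'n::finite) chart \<Rightarrow> ('a, 'n) chart \<Rightarrow> 'a \<Rightarrow> real ^ 'n ^ 'n" where
  "transition_deriv c d p = matrix (frechet_derivative (snd d \<circ> chart_inv c) (at (snd c p)))"

definition smooth_atlas :: "('a::topological_space, 'n::finite) chart set \<Rightarrow> bool" where
  "smooth_atlas \<A> \<longleftrightarrow>
     (\<Union>c\<in>\<A>. fst c) = UNIV \<and>
     (\<forall>c\<in>\<A>. open (fst c) \<and> open (snd c ` fst c) \<and>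
        homeomorphism (fst c) (snd c ` fst c) (snd c) (chart_inv c)) \<and>
     (\<forall>c\<in>\<A>. \<forall>d\<in>\<A>. smooth_on (snd c ` (fst c \<inter> fst d)) (snd d \<circ> chart_inv c))"

definition orientable :: "('a::topological_space, 'n::finite) chart set \<Rightarrow> bool" where
  "orientable \<A> \<longleftrightarrow>
     (\<exists>\<B>. smooth_atlas \<B> \<and> smooth_atlas (\<A> \<union> \<B>) \<and>
        (\<forall>c\<in>\<B>. \<forall>d\<in>\<B>. \<forall>p\<in>fst c \<inter> fst d. det (transition_deriv c d p) > 0))"

definition smooth_manifold ::
    "('a::{t2_space,second_countable_topology}, 'n::finite) chart set \<Rightarrow> bool" where
  "smooth_manifold \<A> \<longleftrightarrow> smooth_atlas \<A> \<and> connected (UNIV :: 'a set) \<and> orientable \<A>"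

definition smooth_fun_on ::
    "('a::topological_space, 'n::finite) chart set \<Rightarrow> 'a set \<Rightarrow> ('a \<Rightarrow> real) \<Rightarrow> bool" where
  "smooth_fun_on \<A> W f \<longleftrightarrow> (\<forall>c\<in>\<A>. smooth_on (snd c ` (fst c \<inter> W)) (f \<circ> chart_inv c))"

abbreviation smooth_fun ::
    "('a::topological_space, 'n::finite) chart set \<Rightarrow> ('a \<Rightarrow> real) \<Rightarrow> bool" where
  "smooth_fun \<A> \<equiv> smooth_fun_on \<A> UNIV"

text \<open>
  Pointwise quantities below are computed in coordinates. Those which do not depend on the
  coordinates are turned into functions on the manifold by evaluating them in some chart
  around each point.
\<close>

definition chart_at :: "('a, 'n) chart set \<Rightarrow> 'a \<Rightarrow> ('a, 'n) chart" where
  "chart_at \<A> p = (SOME c. c \<in> \<A> \<and> p \<in> fst c)"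

definition coord_deriv ::
    "('a, 'n::finite) chart \<Rightarrow> 'n \<Rightarrow> ('a \<Rightarrow> 'b::real_normed_vector) \<Rightarrow> 'a \<Rightarrow> 'b" where
  "coord_deriv c i f p = frechet_derivative (f \<circ> chart_inv c) (at (snd c p)) (axis i 1)"

section \<open>Riemannian metrics\<close>

text \<open>
  A covariant 2-tensor is a family of component matrices, indexed by charts and points and
  subject to the usual transformation law.
\<close>

type_synonym ('a, 'n) metric = "('a, 'n) chart \<Rightarrow> 'a \<Rightarrow> real ^ 'n ^ 'n"

definition riemannian_metric ::
    "('a::topological_space, 'n::finite) chart set \<Rightarrow> ('a, 'n) metric \<Rightarrow> bool" where
  "riemannian_metric \<A> g \<longleftrightarrow>
     (\<forall>c\<in>\<A>. smooth_on (snd c ` fst c) (g c \<circ> chart_inv c) \<and>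
        (\<forall>p\<in>fst c. transpose (g c p) = g c p \<and> (\<forall>v. v \<noteq> 0 \<longrightarrow> v \<bullet> (g c p *v v) > 0))) \<and>
     (\<forall>c\<in>\<A>. \<forall>d\<in>\<A>. \<forall>p\<in>fst c \<inter> fst d.
        g c p = transpose (transition_deriv c d p) ** g d p ** transition_deriv c d p)"

definition manifold_with_density ::
    "('a::{t2_space,second_countable_topology}, 'n::finite) chart set \<Rightarrow> ('a, 'n) metric \<Rightarrow>
     ('a \<Rightarrow> real) \<Rightarrow> bool" where
  "manifold_with_density \<A> g \<phi> \<longleftrightarrow>
     smooth_manifold \<A> \<and> riemannian_metric \<A> g \<and> smooth_fun \<A> \<phi>"

definition inner_with :: "real ^ 'n ^ 'n \<Rightarrow> real ^ 'n \<Rightarrow> real ^ 'n \<Rightarrow> real" where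
  "inner_with M u v = u \<bullet> (M *v v)"

definition grad ::
    "('a, 'n::finite) chart \<Rightarrow> ('a, 'n) metric \<Rightarrow> ('a \<Rightarrow> real) \<Rightarrow> 'a \<Rightarrow> real ^ 'n" where
  "grad c g f p = matrix_inv (g c p) *v (\<chi> i. coord_deriv c i f p)"

definition grad_norm_sq ::
    "('a, 'n::finite) chart set \<Rightarrow> ('a, 'n) metric \<Rightarrow> ('a \<Rightarrow> real) \<Rightarrow> 'a \<Rightarrow> real" where
  "grad_norm_sq \<A> g f p =
     (let c = chart_at \<A> p in inner_with (g c p) (grad c g f p) (grad c g f p))"

definition christoffel ::
    "('a, 'n::finite) chart \<Rightarrow> ('a, 'n) metric \<Rightarrow> 'n \<Rightarrow> 'n \<Rightarrow> 'n \<Rightarrow> 'a \<Rightarrow> real" where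
  "christoffel c g k i j p =
     (\<Sum>l\<in>UNIV. matrix_inv (g c p) $ k $ l *
        (coord_deriv c i (\<lambda>q. g c q $ j $ l) p
         + coord_deriv c j (\<lambda>q. g c q $ i $ l) p
         - coord_deriv c l (\<lambda>q. g c q $ i $ j) p)) / 2"

text \<open>The \<open>\<partial>\<^sub>l\<close>-component of \<open>R(\<partial>\<^sub>i,\<partial>\<^sub>j)\<partial>\<^sub>k\<close>, where
  \<open>R(X,Y) = [\<nabla>\<^sub>X,\<nabla>\<^sub>Y] - \<nabla>\<^bsub>[X,Y]\<^esub>\<close>.\<close>

definition riemann ::
    "('a, 'n::finite) chart \<Rightarrow> ('a, 'n) metric \<Rightarrow> 'n \<Rightarrow> 'n \<Rightarrow> 'n \<Rightarrow> 'n \<Rightarrow> 'a \<Rightarrow> real" where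
  "riemann c g i j k l p =
     coord_deriv c i (christoffel c g l j k) p - coord_deriv c j (christoffel c g l i k) p
     + (\<Sum>m\<in>UNIV. christoffel c g m j k p * christoffel c g l i m p
                 - christoffel c g m i k p * christoffel c g l j m p)"

definition ricci ::
    "('a, 'n::finite) chart \<Rightarrow> ('a, 'n) metric \<Rightarrow> 'a \<Rightarrow> real ^ 'n ^ 'n" where
  "ricci c g p = (\<chi> j k. \<Sum>i\<in>UNIV. riemann c g i j k i p)"

definition hessian ::
    "('a, 'n::finite) chart \<Rightarrow> ('a, 'n) metric \<Rightarrow> ('a \<Rightarrow> real) \<Rightarrow> 'a \<Rightarrow> real ^ 'n ^ 'n" where
  "hessian c g f p =
     (\<chi> i j. coord_deriv c i (coord_deriv c j f) p
            - (\<Sum>k\<in>UNIV. christoffel c g k i j p * coord_deriv c k f p))"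

definition metric_trace ::
    "('a, 'n::finite) chart \<Rightarrow> ('a, 'n) metric \<Rightarrow> real ^ 'n ^ 'n \<Rightarrow> 'a \<Rightarrow> real" where
  "metric_trace c g T p = (\<Sum>i\<in>UNIV. \<Sum>j\<in>UNIV. matrix_inv (g c p) $ i $ j * T $ i $ j)"

definition scalar_curvature ::
    "('a, 'n::finite) chart set \<Rightarrow> ('a, 'n) metric \<Rightarrow> 'a \<Rightarrow> real" where
  "scalar_curvature \<A> g p = (let c = chart_at \<A> p in metric_trace c g (ricci c g p) p)"

definition laplacian ::
    "('a, 'n::finite) chart set \<Rightarrow> ('a, 'n) metric \<Rightarrow> ('a \<Rightarrow> real) \<Rightarrow> 'a \<Rightarrow> real" where
  "laplacian \<A> g f p = (let c = chart_at \<A> p in metric_trace c g (hessian c g f p) p)"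

definition gaussian_curvature ::
    "('a, 2) chart set \<Rightarrow> ('a, 2) metric \<Rightarrow> 'a \<Rightarrow> real" where
  "gaussian_curvature \<A> g p =
     (let c = chart_at \<A> p
      in (\<Sum>l\<in>UNIV. riemann c g 1 2 2 l p * g c p $ l $ 1) / det (g c p))"

definition bakry_emery_ricci ::
    "('a, 'n::finite) chart \<Rightarrow> ('a, 'n) metric \<Rightarrow> ('a \<Rightarrow> real) \<Rightarrow> 'a \<Rightarrow> real ^ 'n ^ 'n" where
  "bakry_emery_ricci c g \<phi> p = ricci c g p - hessian c g \<phi> p"

definition perelman_scalar_curvature ::
    "('a, 'n::finite) chart set \<Rightarrow> ('a, 'n) metric \<Rightarrow> ('a \<Rightarrow> real) \<Rightarrow> 'a \<Rightarrow> real" where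
  "perelman_scalar_curvature \<A> g \<phi> p =
     scalar_curvature \<A> g p - 2 * laplacian \<A> g \<phi> p - grad_norm_sq \<A> g \<phi> p"

section \<open>Riemannian measure and completeness\<close>

text \<open>
  The measure is completed because the gradient of a piecewise smooth function is an
  unspecified vector on a null set, which need not be a Borel function there.
\<close>

definition riemannian_measure ::
    "('a::topological_space, 'n::finite) chart set \<Rightarrow> ('a, 'n) metric \<Rightarrow> 'a measure" where
  "riemannian_measure \<A> g = completion (THE \<mu>.
     sets \<mu> = sets borel \<and>
     (\<forall>c\<in>\<A>. \<forall>B\<in>sets borel. B \<subseteq> fst c \<longrightarrow>
        emeasure \<mu> B =
          (\<integral>\<^sup>+ z\<in>snd c ` B. ennreal (sqrt (det (g c (chart_inv c z)))) \<partial>lborel)))"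

definition piecewise_C1_curve ::
    "('a::topological_space, 'n::finite) chart set \<Rightarrow> (real \<Rightarrow> 'a) \<Rightarrow> bool" where
  "piecewise_C1_curve \<A> \<gamma> \<longleftrightarrow>
     continuous_on {0..1} \<gamma> \<and>
     (\<forall>c\<in>\<A>. \<forall>s t. {s..t} \<subseteq> {0..1} \<longrightarrow> \<gamma> ` {s..t} \<subseteq> fst c \<longrightarrow>
        (snd c \<circ> \<gamma>) piecewise_C1_differentiable_on {s..t})"

definition curve_length ::
    "('a, 'n::finite) chart set \<Rightarrow> ('a, 'n) metric \<Rightarrow> (real \<Rightarrow> 'a) \<Rightarrow> ennreal" where
  "curve_length \<A> g \<gamma> =
     (\<integral>\<^sup>+ t\<in>{0..1}.
        (let c = chart_at \<A> (\<gamma> t); v = vector_derivative (snd c \<circ> \<gamma>) (at t)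
         in ennreal (sqrt (inner_with (g c (\<gamma> t)) v v))) \<partial>lborel)"

definition riemannian_dist ::
    "('a::topological_space, 'n::finite) chart set \<Rightarrow> ('a, 'n) metric \<Rightarrow> 'a \<Rightarrow> 'a \<Rightarrow> real" where
  "riemannian_dist \<A> g p q =
     enn2real (INF \<gamma>\<in>{\<gamma>. piecewise_C1_curve \<A> \<gamma> \<and> \<gamma> 0 = p \<and> \<gamma> 1 = q}. curve_length \<A> g \<gamma>)"

definition complete_metric ::
    "('a::topological_space, 'n::finite) chart set \<Rightarrow> ('a, 'n) metric \<Rightarrow> bool" where
  "complete_metric \<A> g \<longleftrightarrow> Metric_space.mcomplete UNIV (riemannian_dist \<A> g)"

section \<open>Immersed oriented surfaces\<close>

text \<open>The coordinate expression of \<open>dF(\<partial>\<^sub>i)\<close>.\<close>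

definition push_vec ::
    "('s, 2) chart \<Rightarrow> ('a, 3) chart \<Rightarrow> ('s \<Rightarrow> 'a) \<Rightarrow> 2 \<Rightarrow> 's \<Rightarrow> real ^ 3" where
  "push_vec c d F i p = coord_deriv c i (snd d \<circ> F) p"

definition immersion ::
    "('s::topological_space, 2) chart set \<Rightarrow> ('a::topological_space, 3) chart set \<Rightarrow>
     ('s \<Rightarrow> 'a) \<Rightarrow> bool" where
  "immersion \<S> \<N> F \<longleftrightarrow>
     continuous_on UNIV F \<and>
     (\<forall>c\<in>\<S>. \<forall>d\<in>\<N>.
        smooth_on (snd c ` (fst c \<inter> F -` fst d)) (snd d \<circ> F \<circ> chart_inv c) \<and>
        (\<forall>p\<in>fst c \<inter> F -` fst d.
           inj (frechet_derivative (snd d \<circ> F \<circ> chart_inv c) (at (snd c p)))))"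

definition induced_metric ::
    "('a, 3) chart set \<Rightarrow> ('a, 3) metric \<Rightarrow> ('s \<Rightarrow> 'a) \<Rightarrow> ('s, 2) metric" where
  "induced_metric \<N> g F c p =
     (let d = chart_at \<N> (F p)
      in \<chi> i j. inner_with (g d (F p)) (push_vec c d F i p) (push_vec c d F j p))"

text \<open>A vector field along \<open>F\<close> is given by its components in each ambient chart.\<close>

definition unit_normal ::
    "('s::topological_space, 2) chart set \<Rightarrow> ('a::topological_space, 3) chart set \<Rightarrow>
     ('a, 3) metric \<Rightarrow> ('s \<Rightarrow> 'a) \<Rightarrow> (('a, 3) chart \<Rightarrow> 's \<Rightarrow> real ^ 3) \<Rightarrow> bool" where
  "unit_normal \<S> \<N> g F \<nu> \<longleftrightarrow>
     (\<forall>d\<in>\<N>. \<forall>e\<in>\<N>. \<forall>p. F p \<in> fst d \<inter> fst e \<longrightarrow>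
        \<nu> e p = transition_deriv d e (F p) *v \<nu> d p) \<and>
     (\<forall>c\<in>\<S>. \<forall>d\<in>\<N>.
        smooth_on (snd c ` (fst c \<inter> F -` fst d)) (\<nu> d \<circ> chart_inv c) \<and>
        (\<forall>p\<in>fst c \<inter> F -` fst d.
           inner_with (g d (F p)) (\<nu> d p) (\<nu> d p) = 1 \<and>
           (\<forall>i. inner_with (g d (F p)) (\<nu> d p) (push_vec c d F i p) = 0)))"

text \<open>The coordinate expression of the covariant derivative of \<open>\<nu>\<close> in direction \<open>\<partial>\<^sub>i\<close>.\<close>

definition covariant_deriv_along ::
    "('s, 2) chart \<Rightarrow> ('a, 3) chart \<Rightarrow> ('a, 3) metric \<Rightarrow> ('s \<Rightarrow> 'a) \<Rightarrow>
     (('a, 3) chart \<Rightarrow> 's \<Rightarrow> real ^ 3) \<Rightarrow> 2 \<Rightarrow> 's \<Rightarrow> real ^ 3" where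
  "covariant_deriv_along c d g F \<nu> i p =
     coord_deriv c i (\<nu> d) p
     + (\<chi> k. \<Sum>a\<in>UNIV. \<Sum>b\<in>UNIV.
          christoffel d g k a b (F p) * push_vec c d F i p $ a * \<nu> d p $ b)"

text \<open>Sign: \<open>A(X,Y) = g(\<nabla>\<^sub>X \<nu>, Y)\<close>, so that the trace of \<open>A\<close> is the divergence of \<open>\<nu>\<close>.\<close>

definition second_fundamental_form ::
    "('s, 2) chart \<Rightarrow> ('a, 3) chart set \<Rightarrow> ('a, 3) metric \<Rightarrow> ('s \<Rightarrow> 'a) \<Rightarrow>
     (('a, 3) chart \<Rightarrow> 's \<Rightarrow> real ^ 3) \<Rightarrow> 's \<Rightarrow> real ^ 2 ^ 2" where
  "second_fundamental_form c \<N> g F \<nu> p =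
     (let d = chart_at \<N> (F p)
      in \<chi> i j. inner_with (g d (F p)) (covariant_deriv_along c d g F \<nu> i p) (push_vec c d F j p))"

definition sff_norm_sq ::
    "('s, 2) chart set \<Rightarrow> ('a, 3) chart set \<Rightarrow> ('a, 3) metric \<Rightarrow> ('s \<Rightarrow> 'a) \<Rightarrow>
     (('a, 3) chart \<Rightarrow> 's \<Rightarrow> real ^ 3) \<Rightarrow> 's \<Rightarrow> real" where
  "sff_norm_sq \<S> \<N> g F \<nu> p =
     (let c = chart_at \<S> p; A = second_fundamental_form c \<N> g F \<nu> p;
          G = matrix_inv (induced_metric \<N> g F c p)
      in \<Sum>i\<in>UNIV. \<Sum>j\<in>UNIV. \<Sum>k\<in>UNIV. \<Sum>l\<in>UNIV.
           G $ i $ k * G $ j $ l * A $ i $ j * A $ k $ l)"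

definition mean_curvature ::
    "('s, 2) chart set \<Rightarrow> ('a, 3) chart set \<Rightarrow> ('a, 3) metric \<Rightarrow> ('s \<Rightarrow> 'a) \<Rightarrow>
     (('a, 3) chart \<Rightarrow> 's \<Rightarrow> real ^ 3) \<Rightarrow> 's \<Rightarrow> real" where
  "mean_curvature \<S> \<N> g F \<nu> p =
     (let c = chart_at \<S> p
      in metric_trace c (induced_metric \<N> g F) (second_fundamental_form c \<N> g F \<nu> p) p)"

definition weighted_mean_curvature ::
    "('s, 2) chart set \<Rightarrow> ('a, 3) chart set \<Rightarrow> ('a, 3) metric \<Rightarrow> ('a \<Rightarrow> real) \<Rightarrow> ('s \<Rightarrow> 'a) \<Rightarrow>
     (('a, 3) chart \<Rightarrow> 's \<Rightarrow> real ^ 3) \<Rightarrow> 's \<Rightarrow> real" where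
  "weighted_mean_curvature \<S> \<N> g \<phi> F \<nu> p =
     mean_curvature \<S> \<N> g F \<nu> p +
     (let d = chart_at \<N> (F p) in inner_with (g d (F p)) (\<nu> d p) (grad d g \<phi> (F p)))"

text \<open>\<open>Ric\<^sub>\<phi>\<^sup>\<infinity>(\<nu>,\<nu>)\<close> along \<open>F\<close>.\<close>

definition bakry_emery_ricci_normal ::
    "('a, 3) chart set \<Rightarrow> ('a, 3) metric \<Rightarrow> ('a \<Rightarrow> real) \<Rightarrow> ('s \<Rightarrow> 'a) \<Rightarrow>
     (('a, 3) chart \<Rightarrow> 's \<Rightarrow> real ^ 3) \<Rightarrow> 's \<Rightarrow> real" where
  "bakry_emery_ricci_normal \<N> g \<phi> F \<nu> p =
     (let d = chart_at \<N> (F p)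
      in inner_with (bakry_emery_ricci d g \<phi> (F p)) (\<nu> d p) (\<nu> d p))"

section \<open>Stability\<close>

text \<open>
  A piecewise smooth function is a continuous function which locally is pieced together from
  finitely many smooth functions. No regularity is imposed on the pieces
  \<open>{q. f q = h q}\<close>; functions that are smooth up to the boundary on each simplex of a
  triangulation are an example.
\<close>

definition piecewise_smooth ::
    "('a::topological_space, 'n::finite) chart set \<Rightarrow> ('a \<Rightarrow> real) \<Rightarrow> bool" where
  "piecewise_smooth \<A> f \<longleftrightarrow>
     continuous_on UNIV f \<and>
     (\<forall>p. \<exists>W H. open W \<and> p \<in> W \<and> finite H \<and> (\<forall>h\<in>H. smooth_fun_on \<A> W h) \<and>
        (\<forall>q\<in>W. \<exists>h\<in>H. f q = h q))"

definition compactly_supported :: "('a::topological_space \<Rightarrow> real) \<Rightarrow> bool" where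
  "compactly_supported f \<longleftrightarrow> compact (closure {p. f p \<noteq> 0})"

text \<open>
  If \<open>H\<^sub>\<phi>\<close> is constant, then the right-hand side minus the left-hand side of the inequality
  is the second derivative at \<open>t = 0\<close> of \<open>A\<^sub>\<phi> - H\<^sub>\<phi> V\<^sub>\<phi>\<close> along a compactly supported
  variation with normal velocity \<open>u \<nu>\<close> (second variation formula). Here \<open>A\<^sub>\<phi>\<close> and
  \<open>V\<^sub>\<phi>\<close> are area and volume weighted by \<open>e\<^sup>\<phi>\<close>.
\<close>

definition weighted_stable ::
    "('s::topological_space, 2) chart set \<Rightarrow> ('a::topological_space, 3) chart set \<Rightarrow>
     ('a, 3) metric \<Rightarrow> ('a \<Rightarrow> real) \<Rightarrow> ('s \<Rightarrow> 'a) \<Rightarrow>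
     (('a, 3) chart \<Rightarrow> 's \<Rightarrow> real ^ 3) \<Rightarrow> bool" where
  "weighted_stable \<S> \<N> g \<phi> F \<nu> \<longleftrightarrow>
     (\<exists>H0. \<forall>p. weighted_mean_curvature \<S> \<N> g \<phi> F \<nu> p = H0) \<and>
     (\<forall>u. piecewise_smooth \<S> u \<longrightarrow> compactly_supported u \<longrightarrow>
        (\<integral>p. (bakry_emery_ricci_normal \<N> g \<phi> F \<nu> p + sff_norm_sq \<S> \<N> g F \<nu> p)
              * (u p)\<^sup>2 * exp (\<phi> (F p)) \<partial>riemannian_measure \<S> (induced_metric \<N> g F))
        \<le> (\<integral>p. grad_norm_sq \<S> (induced_metric \<N> g F) u p * exp (\<phi> (F p))
              \<partial>riemannian_measure \<S> (induced_metric \<N> g F)))"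

text \<open>Stability of the Schroedinger operator \<open>\<Delta> + q\<close>.\<close>

definition schroedinger_stable ::
    "('s::topological_space, 2) chart set \<Rightarrow> ('s, 2) metric \<Rightarrow> ('s \<Rightarrow> real) \<Rightarrow> bool" where
  "schroedinger_stable \<S> h q \<longleftrightarrow>
     smooth_fun \<S> q \<and>
     (\<forall>f. piecewise_smooth \<S> f \<longrightarrow> compactly_supported f \<longrightarrow>
        (\<integral>p. grad_norm_sq \<S> h f p - q p * (f p)\<^sup>2 \<partial>riemannian_measure \<S> h) \<ge> 0)"

end

theory Submission
  imports Defs
begin

text \<open>
  Insert \<open>u = f e\<^sup>-\<^sup>\<phi>\<^sup>/\<^sup>2\<close> into the stability inequality. The Gauss equation
  \<open>R = 2 K + 2 Ric(N,N) - H\<^sup>2 + |A|\<^sup>2\<close> and the splitting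
  \<open>\<Delta>\<^sub>g \<phi> = \<Delta> \<phi> + Hess \<phi> (N,N) + H \<langle>N, grad \<phi>\<rangle>\<close> of the ambient Laplacian turn the potential
  \<open>Ric\<^sub>\<phi>(N,N) + |A|\<^sup>2\<close> into \<open>R\<^sub>\<phi>/2 + H\<^sub>\<phi>\<^sup>2/2 + |A|\<^sup>2/2 - K + |\<nabla>\<phi>|\<^sup>2/2 + \<Delta> \<phi>\<close>. Integrating
  \<open>f\<^sup>2 \<Delta> \<phi>\<close> by parts leaves the cross term \<open>f \<langle>\<nabla>f, \<nabla>\<phi>\<rangle>\<close>, which is at most
  \<open>2 |\<nabla>f|\<^sup>2 + f\<^sup>2 |\<nabla>\<phi>|\<^sup>2/8\<close> by Young's inequality; division by 3 gives the claim.

  The Gauss equation is obtained by pulling back the Levi-Civita connection along the coordinate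
  expression of the immersion, whose curvature is the pulled back curvature. In codimension 0 the
  same computation shows that the curvatures do not depend on the chart.

  A piecewise smooth function is locally Lipschitz and differentiable almost everywhere, which
  suffices for integration by parts in a chart: difference quotients of a compactly supported
  function have vanishing integral by translation invariance, and dominated convergence applies.
\<close>

section \<open>Calculus of smooth functions\<close>

text \<open>The constants come from a balance. Put d = \<integral>|\<nabla>f|^2, x =
  \<integral>f<\<nabla>f,\<nabla>\<phi>> and b = \<integral>f^2|\<nabla>\<phi>|^2. The substitution
  makes the right side d - x + b/4, and the integration by parts adds 2x to it. Of the b/2 in the
  potential, b/4 is then left on the left side, against d + x. Young's inequality is tuned so that
  b/8 survives, which is the 1/8 in V, at the price of 2d; the total 3d is the origin of the factor
  1/3 in V and a.

  Three features of the setting shape the proof. The Bochner integral of a nonintegrable function is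
  0, so every integral that is split needs an integrability proof. The measure is a definite
  description, so its existence and uniqueness precede every computation. The pieces of a piecewise
  smooth function may be irregular sets without usable boundary, so one cannot integrate piece by
  piece and add boundary terms; the whole function is treated at once.\<close>

lemma frechet_derivative_cong_open:
  assumes "open S" "x \<in> S" "\<And>y. y \<in> S \<Longrightarrow> f y = g y"
  shows "frechet_derivative f (at x) = frechet_derivative g (at x)"
proof -
  have "(f has_derivative D) (at x) = (g has_derivative D) (at x)" for D
    using assms by (metis has_derivative_transform_within_open)
  then show ?thesis by (simp add: frechet_derivative_def)
qed

lemma differentiable_cong_open:
  assumes "open S" "x \<in> S" "\<And>y. y \<in> S \<Longrightarrow> f y = g y"
  shows "f differentiable (at x) \<longleftrightarrow> g differentiable (at x)"
  using assms unfolding differentiable_def by (metis has_derivative_transform_within_open)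

lemma Ck_on_cong:
  assumes "open S" "\<And>y. y \<in> S \<Longrightarrow> f y = g y"
  shows "Ck_on k S f \<longleftrightarrow> Ck_on k S g"
  using assms(2)
proof (induction k arbitrary: f g)
  case 0
  then show ?case by (simp cong: continuous_on_cong)
next
  case (Suc k)
  have "Ck_on k S (\<lambda>x. frechet_derivative f (at x) v) \<longleftrightarrow>
        Ck_on k S (\<lambda>x. frechet_derivative g (at x) v)" for v
    by (rule Suc.IH) (metis Suc.prems assms(1) frechet_derivative_cong_open)
  moreover have "f differentiable (at x) \<longleftrightarrow> g differentiable (at x)" if "x \<in> S" for x
    using differentiable_cong_open[OF assms(1) that] Suc.prems by blast
  ultimately show ?case by simp
qed

lemma Ck_on_SucD: "Ck_on (Suc k) S f \<Longrightarrow> Ck_on k S f"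
proof (induction k arbitrary: f)
  case 0
  then show ?case
    by (auto simp: continuous_on_eq_continuous_within
        intro: differentiable_imp_continuous_within differentiable_at_withinI)
next
  case (Suc k)
  from Suc.prems have "\<forall>v. Ck_on (Suc k) S (\<lambda>x. frechet_derivative f (at x) v)"
    using Ck_on.simps(2) by blast
  with Suc.IH have "\<forall>v. Ck_on k S (\<lambda>x. frechet_derivative f (at x) v)" by blast
  with Suc.prems show ?case using Ck_on.simps(2) by blast
qed

lemma Ck_on_subset: "Ck_on k S f \<Longrightarrow> T \<subseteq> S \<Longrightarrow> Ck_on k T f"
  by (induction k arbitrary: f) (auto intro: continuous_on_subset)

text \<open>\<open>Ck_on\<close> speaks of the chosen \<open>frechet_derivative\<close>; this rule
  lets an induction step work with an explicit formula for the derivative instead.\<close>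

lemma Ck_on_SucI:
  assumes "open S" "\<And>x. x \<in> S \<Longrightarrow> (f has_derivative D x) (at x)"
    and "\<And>v. Ck_on k S (\<lambda>x. D x v)"
  shows "Ck_on (Suc k) S f"
proof -
  have *: "frechet_derivative f (at x) = D x" if "x \<in> S" for x
    using assms(2)[OF that] by (metis frechet_derivative_at)
  have "Ck_on k S (\<lambda>x. frechet_derivative f (at x) v)" for v
    using assms(3)[of v] * by (subst Ck_on_cong[OF assms(1), of _ "\<lambda>x. D x v"]) auto
  then show ?thesis using assms(2) by (auto simp: differentiable_def)
qed

lemma Ck_on_has_derivative:
  "Ck_on (Suc k) S f \<Longrightarrow> x \<in> S \<Longrightarrow> (f has_derivative frechet_derivative f (at x)) (at x)"
  by (simp add: frechet_derivative_works)

lemma Ck_on_const: "open S \<Longrightarrow> Ck_on k S (\<lambda>_. c)"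
  by (induction k arbitrary: c) simp_all

lemma Ck_on_id: "open S \<Longrightarrow> Ck_on k S (\<lambda>x. x)"
proof (cases k)
  case (Suc m)
  then show "open S \<Longrightarrow> ?thesis"
    by (auto intro!: Ck_on_SucI[where D="\<lambda>_ v. v"] Ck_on_const has_derivative_ident)
qed simp

lemma Ck_on_add:
  assumes "open S" "Ck_on k S f" "Ck_on k S g"
  shows "Ck_on k S (\<lambda>x. f x + g x)"
  using assms(2,3)
proof (induction k arbitrary: f g)
  case 0
  then show ?case by (auto intro: continuous_on_add)
next
  case (Suc k)
  note d = Suc.prems[THEN Ck_on_has_derivative]
  show ?case
    by (rule Ck_on_SucI[OF assms(1) has_derivative_add[OF d]]) (use Suc in auto)
qed

lemma Ck_on_bounded_linear:
  assumes "bounded_linear h" "open S" "Ck_on k S f"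
  shows "Ck_on k S (\<lambda>x. h (f x))"
  using assms(3)
proof (induction k arbitrary: f)
  case 0
  then show ?case using assms by (auto intro: bounded_linear.continuous_on)
next
  case (Suc k)
  note d = Suc.prems[THEN Ck_on_has_derivative]
  show ?case
    by (rule Ck_on_SucI[OF assms(2) bounded_linear.has_derivative[OF assms(1) d]]) (use Suc in auto)
qed

lemma Ck_on_bounded_bilinear:
  assumes "bounded_bilinear h" "open S" "Ck_on k S f" "Ck_on k S g"
  shows "Ck_on k S (\<lambda>x. h (f x) (g x))"
  using assms(3,4)
proof (induction k arbitrary: f g)
  case 0
  then show ?case using assms(1) by (auto intro: bounded_bilinear.continuous_on)
next
  case (Suc k)
  have fg: "Ck_on k S f" "Ck_on k S g"
    using Suc.prems Ck_on_SucD by blast+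
  note d = Suc.prems[THEN Ck_on_has_derivative]
  show ?case
    by (rule Ck_on_SucI[OF assms(2) bounded_bilinear.FDERIV[OF assms(1) d]])
       (use Suc fg in \<open>auto intro!: Ck_on_add assms(2)\<close>)
qed

lemma Ck_on_sum:
  assumes "open S" "\<And>i. i \<in> I \<Longrightarrow> Ck_on k S (f i)"
  shows "Ck_on k S (\<lambda>x. \<Sum>i\<in>I. f i x)"
proof (cases "finite I")
  case True
  then show ?thesis using assms(2)
    by (induction I rule: finite_induct) (auto intro!: Ck_on_const Ck_on_add assms(1))
next
  case False
  then show ?thesis by (simp add: Ck_on_const assms(1))
qed

text \<open>In the chain rule the direction in which f is differentiated depends on the point, which
  the induction hypothesis cannot handle. Expanding that direction in \<open>Basis\<close> leaves
  derivatives of f in fixed directions, composed with g; hence the induction generalizes over f and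
  keeps g.\<close>

lemma Ck_on_compose:
  fixes g :: "'a::euclidean_space \<Rightarrow> 'b::euclidean_space"
    and f :: "'b \<Rightarrow> 'c::real_normed_vector"
  assumes "open S" "open T" "g ` S \<subseteq> T" "Ck_on k S g" "Ck_on k T f"
  shows "Ck_on k S (\<lambda>x. f (g x))"
  using assms(4,5)
proof (induction k arbitrary: f)
  case 0
  then show ?case using assms(3) by (auto intro: continuous_on_compose2)
next
  case (Suc k)
  have g: "Ck_on k S g" using Suc.prems(1) by (rule Ck_on_SucD)
  let ?D = "\<lambda>x v. \<Sum>b\<in>Basis. (frechet_derivative g (at x) v \<bullet> b) *\<^sub>R frechet_derivative f (at (g x)) b"
  have der: "((\<lambda>x. f (g x)) has_derivative ?D x) (at x)" if "x \<in> S" for x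
  proof -
    have gx: "g x \<in> T" using that assms(3) by auto
    have 1: "(f has_derivative frechet_derivative f (at (g x))) (at (g x))"
      using Ck_on_has_derivative[OF Suc.prems(2) gx] .
    have lin: "linear (frechet_derivative f (at (g x)))"
      using 1 has_derivative_linear by blast
    have *: "((\<lambda>x. f (g x)) has_derivative
        (\<lambda>v. frechet_derivative f (at (g x)) (frechet_derivative g (at x) v))) (at x)"
      using has_derivative_compose[OF Ck_on_has_derivative[OF Suc.prems(1) that] 1] .
    have "frechet_derivative f (at (g x)) w =
        (\<Sum>b\<in>Basis. (w \<bullet> b) *\<^sub>R frechet_derivative f (at (g x)) b)" for w
    proof -
      have "frechet_derivative f (at (g x)) w =
          frechet_derivative f (at (g x)) (\<Sum>b\<in>Basis. (w \<bullet> b) *\<^sub>R b)"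
        by (simp only: euclidean_representation)
      then show ?thesis by (simp only: linear_sum[OF lin] linear_scale[OF lin] o_def)
    qed
    then have "(\<lambda>v. frechet_derivative f (at (g x)) (frechet_derivative g (at x) v)) = ?D x"
      by (intro ext)
    with * show ?thesis by (rule has_derivative_eq_rhs)
  qed
  show ?case
  proof (rule Ck_on_SucI[OF assms(1) der])
    fix v
    have Dg: "Ck_on k S (\<lambda>x. frechet_derivative g (at x) v)" using Suc.prems(1) by simp
    have Df: "Ck_on k T (\<lambda>x. frechet_derivative f (at x) b)" for b using Suc.prems(2) by simp
    show "Ck_on k S (\<lambda>x. ?D x v)"
      by (intro Ck_on_sum[OF assms(1)] Ck_on_bounded_bilinear[OF bounded_bilinear_scaleR assms(1)]
          Ck_on_bounded_linear[OF bounded_linear_inner_left assms(1) Dg] Suc.IH[OF g Df])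
  qed
qed

text \<open>Bootstrapping: if the derivative of f is always as smooth as f itself, then f gains one
  order in each step. This serves functions whose derivative is an expression in themselves:
  \<open>exp\<close>, \<open>inverse\<close> and \<open>sqrt\<close>.\<close>

lemma Ck_on_real_ODE:
  fixes f :: "real \<Rightarrow> real"
  assumes "open S" "\<And>x. x \<in> S \<Longrightarrow> (f has_real_derivative d x) (at x)"
    and "\<And>k. Ck_on k S f \<Longrightarrow> Ck_on k S d"
  shows "Ck_on k S f"
proof (induction k)
  case 0
  then show ?case using assms(2)
    by (simp, intro continuous_at_imp_continuous_on ballI) (rule DERIV_isCont)
next
  case (Suc k)
  show ?case
  proof (rule Ck_on_SucI[OF assms(1), where D="\<lambda>x v. d x * v"])
    show "(f has_derivative (*) (d x)) (at x)" if "x \<in> S" for x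
      using assms(2)[OF that] by (simp add: has_field_derivative_def)
    show "Ck_on k S (\<lambda>x. d x * v)" for v
      by (rule Ck_on_bounded_linear[OF bounded_linear_mult_left assms(1) assms(3)[OF Suc]])
  qed
qed

lemma Ck_on_mult:
  fixes f g :: "'a::euclidean_space \<Rightarrow> real"
  shows "open S \<Longrightarrow> Ck_on k S f \<Longrightarrow> Ck_on k S g \<Longrightarrow> Ck_on k S (\<lambda>x. f x * g x)"
  by (rule Ck_on_bounded_bilinear[OF bounded_bilinear_mult])

lemma Ck_on_exp: "Ck_on k UNIV (exp :: real \<Rightarrow> real)"
  by (rule Ck_on_real_ODE[where d=exp]) (auto intro: DERIV_exp)

lemma Ck_on_inverse: "Ck_on k {x. x \<noteq> 0} (inverse :: real \<Rightarrow> real)"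
proof -
  have op: "open {x::real. x \<noteq> 0}" by (simp add: open_Collect_neq)
  have n: "Ck_on k {x::real. x \<noteq> 0} (\<lambda>x. - (inverse x * inverse x))"
    if "Ck_on k {x::real. x \<noteq> 0} inverse" for k
    by (rule Ck_on_bounded_linear[OF bounded_linear_minus[OF bounded_linear_ident] op])
       (intro Ck_on_mult op that)
  show ?thesis
    by (rule Ck_on_real_ODE[OF op _ n]) (auto intro!: derivative_eq_intros simp: field_simps power2_eq_square)
qed

lemma Ck_on_sqrt: "Ck_on k {x. x > 0} (sqrt :: real \<Rightarrow> real)"
proof -
  have op: "open {x::real. x > 0}" by (simp add: open_Collect_less)
  have op0: "open {x::real. x \<noteq> 0}" by (simp add: open_Collect_neq)
  have n: "Ck_on k {x::real. x > 0} (\<lambda>x. inverse (sqrt x) / 2)"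
    if "Ck_on k {x::real. x > 0} sqrt" for k
    by (rule Ck_on_bounded_linear[OF bounded_linear_divide op],
        rule Ck_on_compose[OF op op0 _ that Ck_on_inverse]) auto
  show ?thesis
    by (rule Ck_on_real_ODE[OF op _ n]) (auto intro!: derivative_eq_intros simp: field_simps)
qed

text \<open>The rules below assume openness as the last premise, so that they can be chained
  as introduction rules.\<close>

lemma smooth_on_cong:
  "open S \<Longrightarrow> (\<And>y. y \<in> S \<Longrightarrow> f y = g y) \<Longrightarrow> smooth_on S f \<longleftrightarrow> smooth_on S g"
  unfolding smooth_on_def by (simp cong: Ck_on_cong)

lemma smooth_on_subset: "smooth_on S f \<Longrightarrow> T \<subseteq> S \<Longrightarrow> smooth_on T f"
  by (auto simp: smooth_on_def intro: Ck_on_subset)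

lemma smooth_on_const: "open S \<Longrightarrow> smooth_on S (\<lambda>_. c)"
  by (simp add: smooth_on_def Ck_on_const)

lemma smooth_on_id: "open S \<Longrightarrow> smooth_on S (\<lambda>x. x)"
  by (simp add: smooth_on_def Ck_on_id)

lemma smooth_on_add:
  "smooth_on S f \<Longrightarrow> smooth_on S g \<Longrightarrow> open S \<Longrightarrow> smooth_on S (\<lambda>x. f x + g x)"
  by (simp add: smooth_on_def Ck_on_add)

lemma smooth_on_bounded_linear:
  "bounded_linear h \<Longrightarrow> smooth_on S f \<Longrightarrow> open S \<Longrightarrow> smooth_on S (\<lambda>x. h (f x))"
  by (simp add: smooth_on_def Ck_on_bounded_linear)

lemma smooth_on_bounded_bilinear:
  "bounded_bilinear h \<Longrightarrow> smooth_on S f \<Longrightarrow> smooth_on S g \<Longrightarrow> open S \<Longrightarrow> smooth_on S (\<lambda>x. h (f x) (g x))"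
  by (simp add: smooth_on_def Ck_on_bounded_bilinear)

lemma smooth_on_minus: "smooth_on S f \<Longrightarrow> open S \<Longrightarrow> smooth_on S (\<lambda>x. - f x)"
  by (rule smooth_on_bounded_linear[OF bounded_linear_minus[OF bounded_linear_ident]])

lemma smooth_on_diff:
  "smooth_on S f \<Longrightarrow> smooth_on S g \<Longrightarrow> open S \<Longrightarrow> smooth_on S (\<lambda>x. f x - g x)"
  using smooth_on_add[of S f "\<lambda>x. - g x"] smooth_on_minus[of S g] by simp

lemma smooth_on_mult:
  fixes f g :: "'a::euclidean_space \<Rightarrow> real"
  shows "smooth_on S f \<Longrightarrow> smooth_on S g \<Longrightarrow> open S \<Longrightarrow> smooth_on S (\<lambda>x. f x * g x)"
  by (rule smooth_on_bounded_bilinear[OF bounded_bilinear_mult])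

lemma smooth_on_divide_const:
  fixes f :: "'a::euclidean_space \<Rightarrow> real"
  shows "smooth_on S f \<Longrightarrow> open S \<Longrightarrow> smooth_on S (\<lambda>x. f x / c)"
  by (rule smooth_on_bounded_linear[OF bounded_linear_divide])

lemma smooth_on_power:
  fixes f :: "'a::euclidean_space \<Rightarrow> real"
  shows "smooth_on S f \<Longrightarrow> open S \<Longrightarrow> smooth_on S (\<lambda>x. f x ^ n)"
  by (induction n) (auto intro: smooth_on_const smooth_on_mult)

lemma smooth_on_sum:
  "(\<And>i. i \<in> I \<Longrightarrow> smooth_on S (f i)) \<Longrightarrow> open S \<Longrightarrow> smooth_on S (\<lambda>x. \<Sum>i\<in>I. f i x)"
  by (simp add: smooth_on_def Ck_on_sum)

lemma smooth_on_prod: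
  fixes f :: "'i \<Rightarrow> 'a::euclidean_space \<Rightarrow> real"
  shows "(\<And>i. i \<in> I \<Longrightarrow> smooth_on S (f i)) \<Longrightarrow> open S \<Longrightarrow> smooth_on S (\<lambda>x. \<Prod>i\<in>I. f i x)"
  by (induction I rule: infinite_finite_induct) (auto intro: smooth_on_const smooth_on_mult)

lemma smooth_on_compose:
  fixes g :: "'a::euclidean_space \<Rightarrow> 'b::euclidean_space"
  shows "smooth_on T f \<Longrightarrow> smooth_on S g \<Longrightarrow> g ` S \<subseteq> T \<Longrightarrow> open S \<Longrightarrow> open T \<Longrightarrow> smooth_on S (\<lambda>x. f (g x))"
  by (simp add: smooth_on_def Ck_on_compose)

lemma smooth_on_exp:
  fixes f :: "'a::euclidean_space \<Rightarrow> real"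
  shows "smooth_on S f \<Longrightarrow> open S \<Longrightarrow> smooth_on S (\<lambda>x. exp (f x))"
  by (rule smooth_on_compose[of UNIV exp S f]) (simp_all add: smooth_on_def Ck_on_exp)

lemma smooth_on_divide:
  fixes f :: "'a::euclidean_space \<Rightarrow> real"
  assumes "smooth_on S f" "smooth_on S g" "\<And>x. x \<in> S \<Longrightarrow> g x \<noteq> 0" "open S"
  shows "smooth_on S (\<lambda>x. f x / g x)"
proof -
  have "smooth_on S (\<lambda>x. inverse (g x))"
    using assms
    by (intro smooth_on_compose[of "{x. x \<noteq> 0}" inverse S g])
       (auto simp: smooth_on_def Ck_on_inverse open_Collect_neq)
  with assms(1,4) have "smooth_on S (\<lambda>x. f x * inverse (g x))" by (intro smooth_on_mult)
  then show ?thesis by (simp add: divide_inverse)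
qed

lemma smooth_on_sqrt:
  fixes f :: "'a::euclidean_space \<Rightarrow> real"
  assumes "smooth_on S f" "\<And>x. x \<in> S \<Longrightarrow> f x > 0" "open S"
  shows "smooth_on S (\<lambda>x. sqrt (f x))"
  using assms
  by (intro smooth_on_compose[of "{x. x > 0}" sqrt S f])
     (auto simp: smooth_on_def Ck_on_sqrt open_Collect_less)

lemma smooth_on_nth: "smooth_on S f \<Longrightarrow> open S \<Longrightarrow> smooth_on S (\<lambda>x. f x $ i)"
  by (rule smooth_on_bounded_linear[OF bounded_linear_vec_nth])

lemma smooth_on_vec:
  fixes f :: "'a::euclidean_space \<Rightarrow> 'b::real_normed_vector ^ 'n::finite"
  assumes "\<And>i. smooth_on S (\<lambda>x. f x $ i)" "open S"
  shows "smooth_on S f"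
proof -
  have lin: "bounded_linear (axis i :: 'b \<Rightarrow> 'b ^ 'n)" for i
  proof (rule bounded_linear_intro[where K=1])
    show "axis i (x + y) = axis i x + axis i y" for x y :: 'b
      by (simp add: vec_eq_iff axis_def)
    show "axis i (r *\<^sub>R x) = r *\<^sub>R axis i x" for r and x :: 'b
      by (simp add: vec_eq_iff axis_def)
    show "norm (axis i x) \<le> norm x * 1" for x :: 'b
      by (simp add: norm_vec_def L2_set_def axis_def if_distrib[of norm]
          if_distrib[of "\<lambda>x. x\<^sup>2"] cong: if_cong)
  qed
  have "f = (\<lambda>x. \<Sum>i\<in>UNIV. axis i (f x $ i))"
    by (auto simp: fun_eq_iff vec_eq_iff axis_def if_distrib cong: if_cong)
  moreover have "smooth_on S (\<lambda>x. \<Sum>i\<in>UNIV. axis i (f x $ i))"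
    by (intro smooth_on_sum smooth_on_bounded_linear[OF lin] assms)
  ultimately show ?thesis by simp
qed

lemma smooth_on_continuous_on: "smooth_on S f \<Longrightarrow> continuous_on S f"
  unfolding smooth_on_def by (metis Ck_on.simps(1))

lemma smooth_on_differentiable: "smooth_on S f \<Longrightarrow> x \<in> S \<Longrightarrow> f differentiable (at x)"
  unfolding smooth_on_def by (metis Ck_on.simps(2))

lemma smooth_on_frechet_derivative:
  "smooth_on S f \<Longrightarrow> smooth_on S (\<lambda>x. frechet_derivative f (at x) v)"
  unfolding smooth_on_def by (metis Ck_on.simps(2))

text \<open>The preimages of ambient chart domains cover the domain of a surface chart only in
  pieces, so smoothness along the immersion is obtained on each piece and glued.\<close>

lemma smooth_on_local:
  assumes "\<And>x. x \<in> S \<Longrightarrow> \<exists>T. open T \<and> x \<in> T \<and> smooth_on T f"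
  shows "smooth_on S f"
proof -
  have *: "Ck_on k S f" if "\<And>x. x \<in> S \<Longrightarrow> \<exists>T. open T \<and> x \<in> T \<and> Ck_on k T f" for k and f :: "'a \<Rightarrow> 'b"
    using that
  proof (induction k arbitrary: f)
    case 0
    then show ?case
      by (simp, intro continuous_at_imp_continuous_on ballI) (metis continuous_on_eq_continuous_at)
  next
    case (Suc k)
    then show ?case by (simp, meson)
  qed
  show ?thesis
    unfolding smooth_on_def
  proof (intro allI *)
    show "\<exists>T. open T \<and> x \<in> T \<and> Ck_on k T f" if "x \<in> S" for k x
      using assms[OF that] unfolding smooth_on_def by auto
  qed
qed

section \<open>Smooth dependence of the inverse matrix on the matrix\<close>

lemma invertible_mat_inv:
  fixes A :: "real^'n^'n"
  assumes "invertible A"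
  shows "A ** matrix_inv A = mat 1" "matrix_inv A ** A = mat 1"
  using someI_ex[OF assms[unfolded invertible_def]] by (simp_all add: matrix_inv_def)

text \<open>Cramer's rule: the entries of the inverse are quotients of determinants, so smoothness
  of the inverse metric reduces to sums, products and one division.\<close>

lemma matrix_inv_component:
  fixes A :: "real^'n^'n"
  assumes "det A \<noteq> 0"
  shows "matrix_inv A $ i $ j = det (\<chi> r s. if s = i then (if r = j then 1 else 0) else A $ r $ s) / det A"
proof -
  have "A ** matrix_inv A = mat 1"
    using assms using invertible_det_nz invertible_mat_inv by blast
  then have "A *v (matrix_inv A *v axis j 1) = axis j 1"
    by (simp add: matrix_vector_mul_assoc)
  then have "matrix_inv A *v axis j 1 =
      (\<chi> k. det (\<chi> r s. if s = k then axis j 1 $ r else A $ r $ s) / det A)"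
    using cramer[OF assms] by blast
  then have "(matrix_inv A *v axis j 1) $ i =
      det (\<chi> r s. if s = i then axis j 1 $ r else A $ r $ s) / det A"
    by simp
  moreover have "(\<chi> r s. if s = i then axis j 1 $ r else A $ r $ s) =
      (\<chi> r s. if s = i then (if r = j then 1 else 0) else A $ r $ s)"
    by (simp add: vec_eq_iff axis_def)
  ultimately show ?thesis by (simp add: matrix_vector_mul_component inner_axis)
qed

lemma smooth_on_det:
  fixes f :: "'a::euclidean_space \<Rightarrow> real^'n^'n"
  assumes "\<And>i j. smooth_on S (\<lambda>x. f x $ i $ j)" "open S"
  shows "smooth_on S (\<lambda>x. det (f x))"
  unfolding det_def by (intro smooth_on_sum smooth_on_mult smooth_on_const smooth_on_prod assms)

lemma smooth_on_matrix_inv: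
  fixes f :: "'a::euclidean_space \<Rightarrow> real^'n^'n"
  assumes "\<And>i j. smooth_on S (\<lambda>x. f x $ i $ j)" "\<And>x. x \<in> S \<Longrightarrow> det (f x) \<noteq> 0" "open S"
  shows "smooth_on S (\<lambda>x. matrix_inv (f x) $ i $ j)"
proof -
  have "smooth_on S (\<lambda>x. det (\<chi> r s. if s = i then (if r = j then 1 else 0) else f x $ r $ s) / det (f x))"
  proof (intro smooth_on_divide smooth_on_det assms)
    show "smooth_on S (\<lambda>x. (\<chi> r s. if s = i then if r = j then 1 else 0 else f x $ r $ s) $ k $ l)" for k l
      by (cases "l = i") (auto intro: assms smooth_on_const)
  qed
  then show ?thesis
    by (subst smooth_on_cong[OF assms(3) matrix_inv_component[OF assms(2)]])
qed

section \<open>Partial derivatives\<close>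

lemma has_real_derivative_along_line:
  fixes f :: "'a::real_normed_vector \<Rightarrow> real"
  assumes "(f has_derivative D) (at (a + s *\<^sub>R u))"
  shows "((\<lambda>s. f (a + s *\<^sub>R u)) has_real_derivative D u) (at s)"
proof -
  have "((\<lambda>s. a + s *\<^sub>R u) has_derivative (\<lambda>r. r *\<^sub>R u)) (at s)"
    by (auto intro!: derivative_eq_intros)
  from has_derivative_compose[OF this, of f D] assms
  have "((\<lambda>s. f (a + s *\<^sub>R u)) has_derivative (\<lambda>r. D (r *\<^sub>R u))) (at s)"
    by simp
  then show ?thesis
    using has_derivative_linear[OF assms]
    by (simp add: has_field_derivative_def linear_scale mult_commute_abs)
qed

text \<open>The mean value theorem is applied twice, first along u to the difference of f in the
  direction v, then along v to the derivative along u. The left side is symmetric in u and v, while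
  the right side is a mixed second derivative at a nearby point.\<close>

lemma second_difference_mvt:
  fixes f :: "'a::euclidean_space \<Rightarrow> real"
  assumes "Ck_on 2 S f" "open S" "ball x r \<subseteq> S" "h > 0" "h * (norm u + norm v) < r"
  obtains p where "p \<in> ball x r"
    "f (x + h *\<^sub>R u + h *\<^sub>R v) - f (x + h *\<^sub>R u) - f (x + h *\<^sub>R v) + f x =
     h * h * frechet_derivative (\<lambda>y. frechet_derivative f (at y) u) (at p) v"
proof -
  have C: "Ck_on (Suc (Suc 0)) S f" using assms(1) by (simp add: numeral_2_eq_2)
  let ?g = "\<lambda>y. frechet_derivative f (at y) u"
  have g: "Ck_on (Suc 0) S ?g" using C by simp
  have inball: "x + s *\<^sub>R u + t *\<^sub>R v \<in> S \<and> x + s *\<^sub>R u + t *\<^sub>R v \<in> ball x r"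
    if "0 \<le> s" "s \<le> h" "0 \<le> t" "t \<le> h" for s t
  proof -
    have "dist x (x + s *\<^sub>R u + t *\<^sub>R v) = norm (s *\<^sub>R u + t *\<^sub>R v)"
      by (metis add.assoc add_diff_cancel_left' dist_commute dist_norm)
    also have "\<dots> \<le> s * norm u + t * norm v"
      using that norm_triangle_ineq[of "s *\<^sub>R u" "t *\<^sub>R v"] by simp
    also have "\<dots> \<le> h * (norm u + norm v)"
      using that by (simp add: distrib_left add_mono mult_right_mono)
    finally show ?thesis using assms(3,5) by auto
  qed
  have df: "(f has_derivative frechet_derivative f (at y)) (at y)" if "y \<in> S" for y
    using Ck_on_has_derivative[OF C that] .
  have dg: "(?g has_derivative frechet_derivative ?g (at y)) (at y)" if "y \<in> S" for y
    using Ck_on_has_derivative[OF g that] .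
  define \<phi> where "\<phi> s = f (x + s *\<^sub>R u + h *\<^sub>R v) - f (x + s *\<^sub>R u)" for s
  have d1: "((\<lambda>s. f (x + s *\<^sub>R u + t *\<^sub>R v)) has_real_derivative ?g (x + s *\<^sub>R u + t *\<^sub>R v)) (at s)"
    if "0 \<le> s" "s \<le> h" "0 \<le> t" "t \<le> h" for s t
  proof -
    have "(f has_derivative frechet_derivative f (at (x + s *\<^sub>R u + t *\<^sub>R v))) (at ((x + t *\<^sub>R v) + s *\<^sub>R u))"
      using df[of "x + s *\<^sub>R u + t *\<^sub>R v"] inball that by (simp add: add_ac)
    from has_real_derivative_along_line[OF this] show ?thesis by (simp add: add_ac)
  qed
  have d2: "((\<lambda>t. ?g (x + s *\<^sub>R u + t *\<^sub>R v)) has_real_derivative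
      frechet_derivative ?g (at (x + s *\<^sub>R u + t *\<^sub>R v)) v) (at t)"
    if "0 \<le> s" "s \<le> h" "0 \<le> t" "t \<le> h" for s t
  proof -
    have y: "x + s *\<^sub>R u + t *\<^sub>R v \<in> S" using inball that by blast
    show ?thesis by (rule has_real_derivative_along_line[OF dg[OF y]])
  qed
  have "\<exists>s>0. s < h \<and> \<phi> h - \<phi> 0 = (h - 0) * (?g (x + s *\<^sub>R u + h *\<^sub>R v) - ?g (x + s *\<^sub>R u))"
  proof (rule MVT2[OF assms(4)])
    fix s assume "0 \<le> s" "s \<le> h"
    then show "(\<phi> has_real_derivative ?g (x + s *\<^sub>R u + h *\<^sub>R v) - ?g (x + s *\<^sub>R u)) (at s)"
      unfolding \<phi>_def using d1[of s h] d1[of s 0] assms(4) by (auto intro!: DERIV_diff)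
  qed
  then obtain s where s: "0 < s" "s < h"
    "\<phi> h - \<phi> 0 = h * (?g (x + s *\<^sub>R u + h *\<^sub>R v) - ?g (x + s *\<^sub>R u))" by auto
  have "\<exists>t>0. t < h \<and> ?g (x + s *\<^sub>R u + h *\<^sub>R v) - ?g (x + s *\<^sub>R u + 0 *\<^sub>R v) =
      (h - 0) * frechet_derivative ?g (at (x + s *\<^sub>R u + t *\<^sub>R v)) v"
    by (rule MVT2[OF assms(4)]) (use d2 s in auto)
  then obtain t where t: "0 < t" "t < h" "?g (x + s *\<^sub>R u + h *\<^sub>R v) - ?g (x + s *\<^sub>R u) =
      h * frechet_derivative ?g (at (x + s *\<^sub>R u + t *\<^sub>R v)) v" by auto
  show thesis
  proof (rule that)
    show "x + s *\<^sub>R u + t *\<^sub>R v \<in> ball x r" using inball[of s t] s t by auto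
    show "f (x + h *\<^sub>R u + h *\<^sub>R v) - f (x + h *\<^sub>R u) - f (x + h *\<^sub>R v) + f x =
        h * h * frechet_derivative ?g (at (x + s *\<^sub>R u + t *\<^sub>R v)) v"
      using s(3) t(3) by (simp add: \<phi>_def)
  qed
qed

theorem second_derivative_symmetric:
  fixes f :: "'a::euclidean_space \<Rightarrow> real"
  assumes "Ck_on 2 S f" "open S" "x \<in> S"
  shows "frechet_derivative (\<lambda>y. frechet_derivative f (at y) u) (at x) v =
         frechet_derivative (\<lambda>y. frechet_derivative f (at y) v) (at x) u"
    (is "?A x = ?B x")
proof (rule ccontr)
  assume ne: "?A x \<noteq> ?B x"
  \<comment> \<open>Near x both mixed derivatives stay within half of the assumed gap from their
    values at x, which the equal values at p and q contradict.\<close>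
  define e where "e = \<bar>?A x - ?B x\<bar> / 2"
  have e: "e > 0" using ne by (simp add: e_def)
  have "continuous_on S ?A" "continuous_on S ?B"
    using assms(1) by (simp_all add: numeral_2_eq_2)
  then have "isCont ?A x" "isCont ?B x"
    using assms continuous_on_eq_continuous_at by blast+
  then obtain d1 d2 where d: "d1 > 0" "\<And>y. dist y x < d1 \<Longrightarrow> dist (?A y) (?A x) < e"
      "d2 > 0" "\<And>y. dist y x < d2 \<Longrightarrow> dist (?B y) (?B x) < e"
    using e unfolding continuous_at_eps_delta by metis
  obtain d3 where d3: "d3 > 0" "ball x d3 \<subseteq> S"
    using assms open_contains_ball by blast
  define r where "r = min d1 (min d2 d3)"
  have r: "r > 0" "ball x r \<subseteq> S" using d d3 by (auto simp: r_def)
  \<comment> \<open>The parallelogram spanned by h u and h v must stay in the ball of radius r; the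
    summand 1 keeps the denominator positive when u and v vanish.\<close>
  define h where "h = r / (2 * (norm u + norm v + 1))"
  have pos: "norm u + norm v + 1 > 0" by (meson add_nonneg_pos add_nonneg_nonneg norm_ge_zero zero_less_one)
  have h: "h > 0" using r pos by (simp add: h_def)
  have "h * (norm u + norm v) \<le> h * (norm u + norm v + 1)" using h by simp
  also have "\<dots> = r / 2" using pos by (simp add: h_def field_simps)
  also have "\<dots> < r" using r by simp
  finally have hr: "h * (norm u + norm v) < r" .
  obtain p where p: "p \<in> ball x r" "f (x + h *\<^sub>R u + h *\<^sub>R v) - f (x + h *\<^sub>R u) - f (x + h *\<^sub>R v) + f x =
     h * h * ?A p"
    using second_difference_mvt[OF assms(1,2) r(2) h hr] .
  have hr': "h * (norm v + norm u) < r" using hr by (simp add: add.commute)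
  obtain q where q: "q \<in> ball x r" "f (x + h *\<^sub>R v + h *\<^sub>R u) - f (x + h *\<^sub>R v) - f (x + h *\<^sub>R u) + f x =
     h * h * ?B q"
    using second_difference_mvt[OF assms(1,2) r(2) h hr'] .
  have comm: "x + h *\<^sub>R v + h *\<^sub>R u = x + h *\<^sub>R u + h *\<^sub>R v" by simp
  have "h * h * ?A p = h * h * ?B q" using p(2) q(2) unfolding comm by linarith
  then have "?A p = ?B q" using h by simp
  moreover have "dist (?A p) (?A x) < e" "dist (?B q) (?B x) < e"
    using d p q by (auto simp: r_def dist_commute)
  ultimately show False unfolding e_def dist_real_def by (smt (verit) field_sum_of_halves)
qed

section \<open>Partial derivatives and the chain rule in coordinates\<close>

definition pd :: "'n::finite \<Rightarrow> (real ^ 'n \<Rightarrow> 'b::real_normed_vector) \<Rightarrow> real ^ 'n \<Rightarrow> 'b" where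
  "pd i f x = frechet_derivative f (at x) (axis i 1)"

lemma pd_cong:
  "open S \<Longrightarrow> x \<in> S \<Longrightarrow> (\<And>y. y \<in> S \<Longrightarrow> f y = g y) \<Longrightarrow> pd i f x = pd i g x"
  unfolding pd_def by (metis frechet_derivative_cong_open)

lemma smooth_on_pd: "smooth_on S f \<Longrightarrow> smooth_on S (pd i f)"
  using smooth_on_frechet_derivative[of S f "axis i 1"] by (simp add: pd_def[abs_def])

lemma has_derivative_pd: "(f has_derivative D) (at x) \<Longrightarrow> pd i f x = D (axis i 1)"
  by (metis frechet_derivative_at pd_def)

lemma pd_const: "pd i (\<lambda>_. c) x = 0"
  by (simp add: pd_def)

lemma pd_add:
  "f differentiable at x \<Longrightarrow> g differentiable at x \<Longrightarrow> pd i (\<lambda>x. f x + g x) x = pd i f x + pd i g x"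
  by (auto simp: pd_def frechet_derivative_works
      intro!: has_derivative_pd[unfolded pd_def] derivative_eq_intros)

lemma pd_diff:
  "f differentiable at x \<Longrightarrow> g differentiable at x \<Longrightarrow> pd i (\<lambda>x. f x - g x) x = pd i f x - pd i g x"
  by (auto simp: pd_def frechet_derivative_works
      intro!: has_derivative_pd[unfolded pd_def] derivative_eq_intros)

lemma pd_mult:
  fixes f g :: "real ^ 'n::finite \<Rightarrow> real"
  shows "f differentiable at x \<Longrightarrow> g differentiable at x \<Longrightarrow>
    pd i (\<lambda>x. f x * g x) x = pd i f x * g x + f x * pd i g x"
  by (auto simp: pd_def frechet_derivative_works
      intro!: has_derivative_pd[unfolded pd_def] derivative_eq_intros)

lemma pd_sum:
  "finite I \<Longrightarrow> (\<And>k. k \<in> I \<Longrightarrow> f k differentiable at x) \<Longrightarrow>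
    pd i (\<lambda>x. \<Sum>k\<in>I. f k x) x = (\<Sum>k\<in>I. pd i (f k) x)"
  using has_derivative_pd[OF has_derivative_sum, of I f "\<lambda>k. frechet_derivative (f k) (at x)" x i]
  by (simp add: pd_def frechet_derivative_works)

lemma differentiable_nth:
  "f differentiable at x \<Longrightarrow> (\<lambda>x. f x $ a) differentiable at x"
  unfolding differentiable_def
  using bounded_linear.has_derivative[OF bounded_linear_vec_nth] by blast

lemma pd_nth: "f differentiable at x \<Longrightarrow> pd i (\<lambda>x. f x $ a) x = pd i f x $ a"
  unfolding pd_def frechet_derivative_works
  by (rule has_derivative_pd[unfolded pd_def])
     (rule bounded_linear.has_derivative[OF bounded_linear_vec_nth])

lemma linear_axis_expansion:
  fixes D :: "real ^ 'n::finite \<Rightarrow> 'b::real_normed_vector"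
  assumes "linear D"
  shows "D v = (\<Sum>a\<in>UNIV. (v $ a) *\<^sub>R D (axis a 1))"
proof -
  have "D v = D (\<Sum>a\<in>UNIV. (v $ a) *\<^sub>R axis a 1)"
    by (simp only: basis_expansion flip: scalar_mult_eq_scaleR)
  then show ?thesis
    by (simp only: linear_sum[OF assms] linear_scale[OF assms])
qed

lemma frechet_derivative_pd:
  assumes "f differentiable at x"
  shows "frechet_derivative f (at x) v = (\<Sum>a\<in>UNIV. (v $ a) *\<^sub>R pd a f x)"
  unfolding pd_def using assms
  by (intro linear_axis_expansion linear_frechet_derivative)

lemma pd_compose:
  fixes \<Phi> :: "real ^ 'm::finite \<Rightarrow> real ^ 'n::finite" and f :: "real ^ 'n \<Rightarrow> real"
  assumes "\<Phi> differentiable at x" "f differentiable at (\<Phi> x)"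
  shows "pd i (\<lambda>x. f (\<Phi> x)) x = (\<Sum>a\<in>UNIV. pd a f (\<Phi> x) * pd i \<Phi> x $ a)"
proof -
  have "((\<lambda>x. f (\<Phi> x)) has_derivative
      (\<lambda>v. frechet_derivative f (at (\<Phi> x)) (frechet_derivative \<Phi> (at x) v))) (at x)"
    using assms unfolding frechet_derivative_works by (rule has_derivative_compose)
  then have "pd i (\<lambda>x. f (\<Phi> x)) x = frechet_derivative f (at (\<Phi> x)) (pd i \<Phi> x)"
    using has_derivative_pd by (fastforce simp: pd_def)
  then show ?thesis
    using frechet_derivative_pd[OF assms(2)] by (simp add: mult.commute)
qed

lemma pd_commute:
  fixes f :: "real ^ 'n::finite \<Rightarrow> real"
  assumes "smooth_on S f" "open S" "x \<in> S"
  shows "pd i (pd j f) x = pd j (pd i f) x"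
  using second_derivative_symmetric[OF _ assms(2,3)] assms(1)
  unfolding pd_def[abs_def] smooth_on_def by blast

section \<open>The pulled back Levi-Civita connection\<close>

lemma inner_with_sum: "inner_with M u v = (\<Sum>a\<in>UNIV. \<Sum>b\<in>UNIV. u $ a * M $ a $ b * v $ b)"
  by (simp add: inner_with_def inner_vec_def matrix_vector_mult_def sum_distrib_left mult.assoc)

lemma inner_with_add_left: "inner_with M (u + v) w = inner_with M u w + inner_with M v w"
  by (simp add: inner_with_def inner_add_left)

lemma inner_with_add_right: "inner_with M u (v + w) = inner_with M u v + inner_with M u w"
  by (simp add: inner_with_def inner_add_right matrix_vector_right_distrib)

lemma inner_with_diff_left: "inner_with M (u - v) w = inner_with M u w - inner_with M v w"
  by (simp add: inner_with_def inner_diff_left)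

lemma inner_with_diff_right: "inner_with M u (v - w) = inner_with M u v - inner_with M u w"
  by (simp add: inner_with_def inner_diff_right matrix_vector_mult_diff_distrib)

lemma inner_with_scale_left: "inner_with M (r *\<^sub>R u) w = r * inner_with M u w"
  by (simp add: inner_with_def)

lemma inner_with_scale_right: "inner_with M u (r *\<^sub>R w) = r * inner_with M u w"
  by (simp add: inner_with_sum sum_distrib_left mult_ac)

lemma inner_with_zero [simp]: "inner_with M 0 w = 0" "inner_with M u 0 = 0"
  by (simp_all add: inner_with_sum)

lemma inner_with_sum_left: "inner_with M (\<Sum>i\<in>I. u i) w = (\<Sum>i\<in>I. inner_with M (u i) w)"
  by (simp add: inner_with_def inner_sum_left)

lemma inner_with_sum_right: "inner_with M u (\<Sum>i\<in>I. w i) = (\<Sum>i\<in>I. inner_with M u (w i))"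
  by (induction I rule: infinite_finite_induct) (simp_all add: inner_with_add_right)

lemma inner_with_axis: "inner_with M (axis i 1) (axis j 1) = M $ i $ j"
  by (simp add: inner_with_def inner_axis' matrix_vector_mul_component inner_axis)

lemma inner_with_commute:
  assumes "\<And>a b. M $ a $ b = M $ b $ a"
  shows "inner_with M u v = inner_with M v u"
proof -
  have "inner_with M u v = (\<Sum>b\<in>UNIV. \<Sum>a\<in>UNIV. u $ a * M $ a $ b * v $ b)"
    unfolding inner_with_sum by (rule sum.swap)
  also have "\<dots> = inner_with M v u"
    unfolding inner_with_sum using assms by (simp add: mult_ac)
  finally show ?thesis .
qed

text \<open>Christoffel symbols of the first kind. They contain no inverse metric, so they can be
  pulled back and differentiated without differentiating an inverse.\<close>

definition chr1 :: "(real ^ 'n::finite \<Rightarrow> real ^ 'n ^ 'n) \<Rightarrow> 'n \<Rightarrow> 'n \<Rightarrow> 'n \<Rightarrow> real ^ 'n \<Rightarrow> real" where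
  "chr1 G i j l x =
     (pd i (\<lambda>x. G x $ j $ l) x + pd j (\<lambda>x. G x $ i $ l) x - pd l (\<lambda>x. G x $ i $ j) x) / 2"

definition chr :: "(real ^ 'n::finite \<Rightarrow> real ^ 'n ^ 'n) \<Rightarrow> 'n \<Rightarrow> 'n \<Rightarrow> 'n \<Rightarrow> real ^ 'n \<Rightarrow> real" where
  "chr G k i j x = (\<Sum>l\<in>UNIV. matrix_inv (G x) $ k $ l * chr1 G i j l x)"

definition riem ::
    "(real ^ 'n::finite \<Rightarrow> real ^ 'n ^ 'n) \<Rightarrow> 'n \<Rightarrow> 'n \<Rightarrow> 'n \<Rightarrow> 'n \<Rightarrow> real ^ 'n \<Rightarrow> real" where
  "riem G i j k l x = pd i (chr G l j k) x - pd j (chr G l i k) x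
     + (\<Sum>m\<in>UNIV. chr G m j k x * chr G l i m x - chr G m i k x * chr G l j m x)"

text \<open>The connection form: the difference between covariant and plain derivative, as a
  bilinear map at each point.\<close>

definition Gam :: "(real ^ 'n::finite \<Rightarrow> real ^ 'n ^ 'n) \<Rightarrow> real ^ 'n \<Rightarrow> real ^ 'n \<Rightarrow> real ^ 'n \<Rightarrow> real ^ 'n" where
  "Gam G y u v = (\<chi> k. \<Sum>a\<in>UNIV. \<Sum>b\<in>UNIV. chr G k a b y * u $ a * v $ b)"

text \<open>The curvature operator R(u,v)w; \<open>rlow\<close> below is the corresponding (0,4)
  tensor g(R(u,v)w, z).\<close>

definition rop ::
    "(real ^ 'n::finite \<Rightarrow> real ^ 'n ^ 'n) \<Rightarrow> real ^ 'n \<Rightarrow> real ^ 'n \<Rightarrow> real ^ 'n \<Rightarrow> real ^ 'n \<Rightarrow> real ^ 'n" where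
  "rop G y u v w = (\<chi> l. \<Sum>a\<in>UNIV. \<Sum>b\<in>UNIV. \<Sum>c\<in>UNIV. riem G a b c l y * u $ a * v $ b * w $ c)"

definition rlow ::
    "(real ^ 'n::finite \<Rightarrow> real ^ 'n ^ 'n) \<Rightarrow> real ^ 'n \<Rightarrow> real ^ 'n \<Rightarrow> real ^ 'n \<Rightarrow> real ^ 'n \<Rightarrow> real ^ 'n \<Rightarrow> real" where
  "rlow G y u v w z = inner_with (G y) (rop G y u v w) z"

text \<open>The covariant derivative, in the i-th coordinate direction of the source, of a vector
  field Y along the map \<Phi>.\<close>

definition cov ::
    "(real ^ 'n::finite \<Rightarrow> real ^ 'n ^ 'n) \<Rightarrow> (real ^ 'm::finite \<Rightarrow> real ^ 'n) \<Rightarrow> 'm \<Rightarrow>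
     (real ^ 'm \<Rightarrow> real ^ 'n) \<Rightarrow> real ^ 'm \<Rightarrow> real ^ 'n" where
  "cov G \<Phi> i Y x = pd i Y x + Gam G (\<Phi> x) (pd i \<Phi> x) (Y x)"

definition pullback ::
    "(real ^ 'm::finite \<Rightarrow> real ^ 'n::finite) \<Rightarrow> (real ^ 'n \<Rightarrow> real ^ 'n ^ 'n) \<Rightarrow> real ^ 'm \<Rightarrow> real ^ 'm ^ 'm" where
  "pullback \<Phi> G x = (\<chi> i j. inner_with (G (\<Phi> x)) (pd i \<Phi> x) (pd j \<Phi> x))"

locale metric_field =
  fixes G :: "real ^ 'n::finite \<Rightarrow> real ^ 'n ^ 'n" and W :: "(real ^ 'n) set"
  assumes W: "open W" and smooth: "smooth_on W G"
    and sym: "\<And>y a b. y \<in> W \<Longrightarrow> G y $ a $ b = G y $ b $ a"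
    and nondeg: "\<And>y. y \<in> W \<Longrightarrow> det (G y) \<noteq> 0"
begin

lemma smooth_G: "smooth_on W (\<lambda>y. G y $ a $ b)"
  by (intro smooth_on_nth W smooth)

lemma smooth_chr1: "smooth_on W (chr1 G i j l)"
  unfolding chr1_def[abs_def]
  by (intro smooth_on_divide_const smooth_on_add smooth_on_diff smooth_on_pd smooth_G W)

lemma smooth_chr: "smooth_on W (chr G k i j)"
  unfolding chr_def[abs_def]
  by (intro smooth_on_sum smooth_on_mult smooth_chr1 smooth_on_matrix_inv smooth_G W nondeg)

lemma smooth_riem: "smooth_on W (riem G i j k l)"
  unfolding riem_def[abs_def]
  by (intro smooth_on_sum smooth_on_add smooth_on_diff smooth_on_mult smooth_on_pd smooth_chr W)

lemma pd_G_sym: "y \<in> W \<Longrightarrow> pd i (\<lambda>x. G x $ a $ b) y = pd i (\<lambda>x. G x $ b $ a) y"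
  by (rule pd_cong[OF W]) (auto simp: sym)

lemma chr1_sym: "y \<in> W \<Longrightarrow> chr1 G i j l y = chr1 G j i l y"
  unfolding chr1_def using pd_G_sym[of y l i j] by simp

lemma chr_sym: "y \<in> W \<Longrightarrow> chr G k i j y = chr G k j i y"
  unfolding chr_def using chr1_sym by simp

text \<open>Coordinate form of metric compatibility: in the sum, the derivatives in the directions j
  and l cancel.\<close>

lemma chr1_compatible: "y \<in> W \<Longrightarrow> chr1 G i j l y + chr1 G i l j y = pd i (\<lambda>x. G x $ j $ l) y"
  unfolding chr1_def
  using pd_G_sym[of y i j l] pd_G_sym[of y j i l] pd_G_sym[of y l i j] by (simp add: field_simps)

lemma chr_lower:
  assumes "y \<in> W"
  shows "(\<Sum>m\<in>UNIV. chr G m i j y * G y $ m $ l) = chr1 G i j l y"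
proof -
  have inv: "G y ** matrix_inv (G y) = mat 1"
    using nondeg[OF assms] invertible_det_nz invertible_mat_inv by blast
  have "(\<Sum>m\<in>UNIV. chr G m i j y * G y $ m $ l) =
      (\<Sum>m\<in>UNIV. \<Sum>l'\<in>UNIV. (G y $ l $ m * matrix_inv (G y) $ m $ l') * chr1 G i j l' y)"
    unfolding chr_def sum_distrib_right by (intro sum.cong) (simp_all add: sym[OF assms, of _ l])
  also have "\<dots> = (\<Sum>l'\<in>UNIV. \<Sum>m\<in>UNIV. (G y $ l $ m * matrix_inv (G y) $ m $ l') * chr1 G i j l' y)"
    by (rule sum.swap)
  also have "\<dots> = (\<Sum>l'\<in>UNIV. (G y ** matrix_inv (G y)) $ l $ l' * chr1 G i j l' y)"
    by (simp add: matrix_matrix_mult_def sum_distrib_right)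
  also have "\<dots> = chr1 G i j l y"
    unfolding inv by (simp add: mat_def if_distrib[of "\<lambda>x. x * _"] cong: if_cong)
  finally show ?thesis .
qed

text \<open>Pairing with the metric cancels the inverse metric hidden in \<open>chr\<close>, so that
  only first-kind symbols remain.\<close>

lemma inner_Gam:
  assumes "y \<in> W"
  shows "inner_with (G y) (Gam G y u v) z =
    (\<Sum>a\<in>UNIV. \<Sum>b\<in>UNIV. \<Sum>c\<in>UNIV. chr1 G a b c y * u $ a * v $ b * z $ c)"
proof -
  have "inner_with (G y) (Gam G y u v) z =
      (\<Sum>k\<in>UNIV. \<Sum>c\<in>UNIV. \<Sum>a\<in>UNIV. \<Sum>b\<in>UNIV. (chr G k a b y * G y $ k $ c) * (u $ a * v $ b * z $ c))"
    by (simp add: inner_with_sum Gam_def sum_distrib_right sum_distrib_left mult_ac)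
  also have "\<dots> = (\<Sum>c\<in>UNIV. \<Sum>k\<in>UNIV. \<Sum>a\<in>UNIV. \<Sum>b\<in>UNIV. (chr G k a b y * G y $ k $ c) * (u $ a * v $ b * z $ c))"
    by (rule sum.swap)
  also have "\<dots> = (\<Sum>c\<in>UNIV. \<Sum>a\<in>UNIV. \<Sum>k\<in>UNIV. \<Sum>b\<in>UNIV. (chr G k a b y * G y $ k $ c) * (u $ a * v $ b * z $ c))"
    by (intro sum.cong refl sum.swap)
  also have "\<dots> = (\<Sum>c\<in>UNIV. \<Sum>a\<in>UNIV. \<Sum>b\<in>UNIV. \<Sum>k\<in>UNIV. (chr G k a b y * G y $ k $ c) * (u $ a * v $ b * z $ c))"
    by (intro sum.cong refl sum.swap)
  also have "\<dots> = (\<Sum>c\<in>UNIV. \<Sum>a\<in>UNIV. \<Sum>b\<in>UNIV. chr1 G a b c y * (u $ a * v $ b * z $ c))"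
    by (simp add: chr_lower[OF assms] flip: sum_distrib_right)
  also have "\<dots> = (\<Sum>a\<in>UNIV. \<Sum>c\<in>UNIV. \<Sum>b\<in>UNIV. chr1 G a b c y * (u $ a * v $ b * z $ c))"
    by (rule sum.swap)
  also have "\<dots> = (\<Sum>a\<in>UNIV. \<Sum>b\<in>UNIV. \<Sum>c\<in>UNIV. chr1 G a b c y * (u $ a * v $ b * z $ c))"
    by (intro sum.cong refl sum.swap)
  finally show ?thesis by (simp add: mult_ac)
qed

end

lemma pd_sum2:
  fixes f :: "'i::finite \<Rightarrow> 'j::finite \<Rightarrow> real ^ 'n::finite \<Rightarrow> real"
  assumes "\<And>a b. smooth_on U (f a b)" "open U" "x \<in> U"
  shows "pd i (\<lambda>x. \<Sum>a\<in>UNIV. \<Sum>b\<in>UNIV. f a b x) x = (\<Sum>a\<in>UNIV. \<Sum>b\<in>UNIV. pd i (f a b) x)"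
  using assms by (subst pd_sum)
    (auto intro!: sum.cong pd_sum intro: smooth_on_differentiable smooth_on_sum)

lemma pd_mult3:
  fixes f g h :: "real ^ 'n::finite \<Rightarrow> real"
  assumes "smooth_on U f" "smooth_on U g" "smooth_on U h" "open U" "x \<in> U"
  shows "pd i (\<lambda>x. f x * g x * h x) x = pd i f x * g x * h x + f x * pd i g x * h x + f x * g x * pd i h x"
proof -
  have "smooth_on U (\<lambda>x. f x * g x)" using assms by (intro smooth_on_mult)
  then have d: "(\<lambda>x. f x * g x) differentiable at x" "f differentiable at x" "g differentiable at x"
    "h differentiable at x"
    using assms smooth_on_differentiable by blast+
  show ?thesis by (simp add: pd_mult d algebra_simps)
qed

locale metric_map = metric_field G W
  for G :: "real ^ 'n::finite \<Rightarrow> real ^ 'n ^ 'n" and W +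
  fixes \<Phi> :: "real ^ 'm::finite \<Rightarrow> real ^ 'n" and U :: "(real ^ 'm) set"
  assumes U: "open U" and smooth_\<Phi>: "smooth_on U \<Phi>" and maps: "\<And>x. x \<in> U \<Longrightarrow> \<Phi> x \<in> W"
begin

lemma smooth_comp:
  "smooth_on W f \<Longrightarrow> smooth_on U (\<lambda>x. f (\<Phi> x))"
  by (rule smooth_on_compose[OF _ smooth_\<Phi> _ U W]) (use maps in auto)

lemma pd_comp:
  fixes f :: "real ^ 'n \<Rightarrow> real"
  assumes "smooth_on W f" "x \<in> U"
  shows "pd i (\<lambda>x. f (\<Phi> x)) x = (\<Sum>a\<in>UNIV. pd a f (\<Phi> x) * pd i \<Phi> x $ a)"
  using assms maps by (intro pd_compose smooth_on_differentiable[OF smooth_\<Phi>]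
      smooth_on_differentiable[OF assms(1)])

lemma smooth_pd\<Phi>: "smooth_on U (\<lambda>x. pd i \<Phi> x $ a)" "smooth_on U (pd i \<Phi>)"
  by (intro smooth_on_nth smooth_on_pd smooth_\<Phi> U)+

lemma smooth_cov:
  assumes "smooth_on U Y"
  shows "smooth_on U (cov G \<Phi> i Y)"
proof (rule smooth_on_vec[OF _ U])
  show "smooth_on U (\<lambda>x. cov G \<Phi> i Y x $ k)" for k
    unfolding cov_def Gam_def vector_add_component vec_lambda_beta
    by (intro smooth_on_add smooth_on_sum smooth_on_mult smooth_comp smooth_chr smooth_on_nth
        smooth_on_pd smooth_pd\<Phi> U assms)
qed

text \<open>The pulled back connection is metric: the chain rule turns the derivative of the metric
  coefficients into ambient derivatives, and \<open>chr1_compatible\<close> splits these into one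
  connection term for each of the two fields.\<close>

lemma pd_inner:
  assumes x: "x \<in> U" and Y: "smooth_on U Y" and Z: "smooth_on U Z"
  shows "pd i (\<lambda>x. inner_with (G (\<Phi> x)) (Y x) (Z x)) x =
    inner_with (G (\<Phi> x)) (cov G \<Phi> i Y x) (Z x) + inner_with (G (\<Phi> x)) (Y x) (cov G \<Phi> i Z x)"
proof -
  let ?y = "\<Phi> x" and ?P = "pd i \<Phi> x"
  have y: "?y \<in> W" using maps x by blast
  have sY: "smooth_on U (\<lambda>x. Y x $ a)" and sZ: "smooth_on U (\<lambda>x. Z x $ a)" for a
    by (intro smooth_on_nth Y Z U)+
  have nY: "pd i (\<lambda>x. Y x $ a) x = pd i Y x $ a" and nZ: "pd i (\<lambda>x. Z x $ a) x = pd i Z x $ a" for a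
    using pd_nth smooth_on_differentiable Y Z x by blast+
  have "pd i (\<lambda>x. inner_with (G (\<Phi> x)) (Y x) (Z x)) x =
      (\<Sum>a\<in>UNIV. \<Sum>b\<in>UNIV. pd i (\<lambda>x. Y x $ a * G (\<Phi> x) $ a $ b * Z x $ b) x)"
    unfolding inner_with_sum
    by (rule pd_sum2[OF _ U x]) (intro smooth_on_mult sY sZ smooth_comp[OF smooth_G] U)
  also have "\<dots> = (\<Sum>a\<in>UNIV. \<Sum>b\<in>UNIV. pd i Y x $ a * G ?y $ a $ b * Z x $ b
      + Y x $ a * (\<Sum>c\<in>UNIV. pd c (\<lambda>y. G y $ a $ b) ?y * ?P $ c) * Z x $ b
      + Y x $ a * G ?y $ a $ b * pd i Z x $ b)"
    by (simp only: pd_mult3[OF sY smooth_comp[OF smooth_G] sZ U x] nY nZ pd_comp[OF smooth_G x])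
  also have "\<dots> = inner_with (G ?y) (pd i Y x) (Z x) + inner_with (G ?y) (Y x) (pd i Z x)
      + (\<Sum>a\<in>UNIV. \<Sum>b\<in>UNIV. \<Sum>c\<in>UNIV. pd c (\<lambda>y. G y $ a $ b) ?y * ?P $ c * Y x $ a * Z x $ b)"
    by (simp add: inner_with_sum sum.distrib sum_distrib_left sum_distrib_right mult_ac)
  also have "(\<Sum>a\<in>UNIV. \<Sum>b\<in>UNIV. \<Sum>c\<in>UNIV. pd c (\<lambda>y. G y $ a $ b) ?y * ?P $ c * Y x $ a * Z x $ b) =
      (\<Sum>a\<in>UNIV. \<Sum>c\<in>UNIV. \<Sum>b\<in>UNIV. pd c (\<lambda>y. G y $ a $ b) ?y * ?P $ c * Y x $ a * Z x $ b)"
    by (intro sum.cong refl sum.swap)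
  also have "\<dots> = (\<Sum>c\<in>UNIV. \<Sum>a\<in>UNIV. \<Sum>b\<in>UNIV. pd c (\<lambda>y. G y $ a $ b) ?y * ?P $ c * Y x $ a * Z x $ b)"
    by (rule sum.swap)
  also have "\<dots> = (\<Sum>c\<in>UNIV. \<Sum>a\<in>UNIV. \<Sum>b\<in>UNIV. chr1 G c a b ?y * ?P $ c * Y x $ a * Z x $ b)
      + (\<Sum>c\<in>UNIV. \<Sum>a\<in>UNIV. \<Sum>b\<in>UNIV. chr1 G c b a ?y * ?P $ c * Y x $ a * Z x $ b)"
    by (simp add: chr1_compatible[OF y, symmetric] sum.distrib algebra_simps)
  also have "(\<Sum>c\<in>UNIV. \<Sum>a\<in>UNIV. \<Sum>b\<in>UNIV. chr1 G c b a ?y * ?P $ c * Y x $ a * Z x $ b) =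
      (\<Sum>c\<in>UNIV. \<Sum>b\<in>UNIV. \<Sum>a\<in>UNIV. chr1 G c b a ?y * ?P $ c * Y x $ a * Z x $ b)"
    by (intro sum.cong refl sum.swap)
  also have "\<dots> = inner_with (G ?y) (Gam G ?y ?P (Z x)) (Y x)"
    unfolding inner_Gam[OF y] by (simp add: mult_ac)
  also have "\<dots> = inner_with (G ?y) (Y x) (Gam G ?y ?P (Z x))"
    by (rule inner_with_commute[OF sym[OF y]])
  finally show ?thesis
    by (simp add: cov_def inner_with_add_left inner_with_add_right inner_Gam[OF y])
qed

text \<open>Vanishing torsion: the second partial derivatives of \<Phi> and the lower indices of the
  Christoffel symbols are both symmetric.\<close>

lemma cov_pd_sym:
  assumes "x \<in> U"
  shows "cov G \<Phi> i (pd j \<Phi>) x = cov G \<Phi> j (pd i \<Phi>) x"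
proof -
  have n: "pd i (pd j \<Phi>) x $ a = pd i (pd j (\<lambda>x. \<Phi> x $ a)) x" for i j a
  proof -
    have "pd i (pd j \<Phi>) x $ a = pd i (\<lambda>x. pd j \<Phi> x $ a) x"
      using pd_nth[OF smooth_on_differentiable[OF smooth_pd\<Phi>(2) assms]] by simp
    also have "\<dots> = pd i (pd j (\<lambda>x. \<Phi> x $ a)) x"
      by (rule pd_cong[OF U assms])
         (use pd_nth smooth_on_differentiable[OF smooth_\<Phi>] in \<open>metis (full_types)\<close>)
    finally show ?thesis .
  qed
  have "pd i (pd j \<Phi>) x = pd j (pd i \<Phi>) x"
    using pd_commute[OF smooth_on_nth[OF smooth_\<Phi> U] U assms] by (simp add: vec_eq_iff n)
  moreover have "Gam G (\<Phi> x) (pd i \<Phi> x) (pd j \<Phi> x) = Gam G (\<Phi> x) (pd j \<Phi> x) (pd i \<Phi> x)"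
  proof -
    have "(\<Sum>a\<in>UNIV. \<Sum>b\<in>UNIV. chr G k a b (\<Phi> x) * pd i \<Phi> x $ a * pd j \<Phi> x $ b) =
        (\<Sum>b\<in>UNIV. \<Sum>a\<in>UNIV. chr G k b a (\<Phi> x) * pd j \<Phi> x $ b * pd i \<Phi> x $ a)" for k
      by (subst sum.swap) (simp add: chr_sym[OF maps[OF assms], of k] mult_ac)
    then show ?thesis by (simp add: Gam_def)
  qed
  ultimately show ?thesis by (simp add: cov_def)
qed

end

lemma sum_rotate3:
  fixes f :: "'a \<Rightarrow> 'b \<Rightarrow> 'c \<Rightarrow> 'd::comm_monoid_add"
  shows "(\<Sum>a\<in>A. \<Sum>b\<in>B. \<Sum>c\<in>C. f a b c) = (\<Sum>c\<in>C. \<Sum>a\<in>A. \<Sum>b\<in>B. f a b c)"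
proof -
  have "(\<Sum>a\<in>A. \<Sum>b\<in>B. \<Sum>c\<in>C. f a b c) = (\<Sum>a\<in>A. \<Sum>c\<in>C. \<Sum>b\<in>B. f a b c)"
    by (intro sum.cong refl sum.swap)
  also have "\<dots> = (\<Sum>c\<in>C. \<Sum>a\<in>A. \<Sum>b\<in>B. f a b c)" by (rule sum.swap)
  finally show ?thesis .
qed

context metric_map
begin

lemma pd_pd_nth:
  assumes "smooth_on U Y" "x \<in> U"
  shows "pd i (pd j Y) x $ a = pd i (pd j (\<lambda>x. Y x $ a)) x"
proof -
  have "pd i (pd j Y) x $ a = pd i (\<lambda>x. pd j Y x $ a) x"
    using pd_nth[OF smooth_on_differentiable[OF smooth_on_pd[OF assms(1)] assms(2)]] by simp
  also have "\<dots> = pd i (pd j (\<lambda>x. Y x $ a)) x"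
    by (rule pd_cong[OF U assms(2)])
       (use pd_nth smooth_on_differentiable[OF assms(1)] in \<open>metis (full_types)\<close>)
  finally show ?thesis .
qed

lemma pd_pd_commute:
  assumes "smooth_on U Y" "x \<in> U"
  shows "pd i (pd j Y) x = (pd j (pd i Y) x :: real ^ 'k)"
  using pd_commute[OF smooth_on_nth[OF assms(1) U] U assms(2)]
  by (simp add: vec_eq_iff pd_pd_nth assms)

text \<open>The terms are arranged for antisymmetrization in i and j: the first and third summands
  are symmetric, the fourth and fifth are exchanged, and the remaining two, the derivative of the
  symbols and their product, form the curvature.\<close>

lemma cov_cov_component:
  assumes Y: "smooth_on U Y" and x: "x \<in> U"
  shows "cov G \<Phi> i (cov G \<Phi> j Y) x $ k = pd i (pd j Y) x $ k
    + (\<Sum>a\<in>UNIV. \<Sum>b\<in>UNIV. \<Sum>c\<in>UNIV.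
        pd a (chr G k b c) (\<Phi> x) * pd i \<Phi> x $ a * pd j \<Phi> x $ b * Y x $ c)
    + (\<Sum>a\<in>UNIV. \<Sum>b\<in>UNIV. chr G k a b (\<Phi> x) * pd i (pd j \<Phi>) x $ a * Y x $ b)
    + (\<Sum>a\<in>UNIV. \<Sum>b\<in>UNIV. chr G k a b (\<Phi> x) * pd j \<Phi> x $ a * pd i Y x $ b)
    + (\<Sum>a\<in>UNIV. \<Sum>b\<in>UNIV. chr G k a b (\<Phi> x) * pd i \<Phi> x $ a * pd j Y x $ b)
    + (\<Sum>a\<in>UNIV. \<Sum>b\<in>UNIV. \<Sum>c\<in>UNIV. \<Sum>m\<in>UNIV.
        chr G k a m (\<Phi> x) * chr G m b c (\<Phi> x) * pd i \<Phi> x $ a * pd j \<Phi> x $ b * Y x $ c)"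
proof -
  let ?y = "\<Phi> x"
  have sY: "smooth_on U (\<lambda>x. Y x $ a)" "smooth_on U (\<lambda>x. pd j Y x $ a)" for a
    by (intro smooth_on_nth smooth_on_pd Y U)+
  have nY: "pd i (\<lambda>x. Y x $ a) x = pd i Y x $ a" for a
    using pd_nth smooth_on_differentiable Y x by blast
  have nP: "pd i (\<lambda>x. pd j \<Phi> x $ a) x = pd i (pd j \<Phi>) x $ a" for a
    using pd_nth smooth_on_differentiable smooth_pd\<Phi>(2) x by blast
  have nYY: "pd i (\<lambda>x. pd j Y x $ a) x = pd i (pd j Y) x $ a" for a
    using pd_nth smooth_on_differentiable smooth_on_pd[OF Y] x by blast
  have sm: "smooth_on U (\<lambda>x. \<Sum>a\<in>UNIV. \<Sum>b\<in>UNIV. chr G k a b (\<Phi> x) * pd j \<Phi> x $ a * Y x $ b)"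
    by (intro smooth_on_sum smooth_on_mult smooth_comp[OF smooth_chr] smooth_pd\<Phi> sY U)
  have "pd i (cov G \<Phi> j Y) x $ k = pd i (\<lambda>x. cov G \<Phi> j Y x $ k) x"
    using pd_nth[OF smooth_on_differentiable[OF smooth_cov[OF Y] x]] by simp
  also have "\<dots> = pd i (\<lambda>x. pd j Y x $ k
      + (\<Sum>a\<in>UNIV. \<Sum>b\<in>UNIV. chr G k a b (\<Phi> x) * pd j \<Phi> x $ a * Y x $ b)) x"
    by (simp add: cov_def Gam_def)
  also have "\<dots> = pd i (pd j Y) x $ k + (\<Sum>a\<in>UNIV. \<Sum>b\<in>UNIV.
        pd i (\<lambda>x. chr G k a b (\<Phi> x) * pd j \<Phi> x $ a * Y x $ b) x)"
    unfolding pd_add[OF smooth_on_differentiable[OF sY(2) x] smooth_on_differentiable[OF sm x]] nYY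
    by (simp only: pd_sum2[OF smooth_on_mult[OF smooth_on_mult[OF smooth_comp[OF smooth_chr]
        smooth_pd\<Phi>(1) U] sY(1) U] U x])
  also have "\<dots> = pd i (pd j Y) x $ k + (\<Sum>a\<in>UNIV. \<Sum>b\<in>UNIV.
        (\<Sum>e\<in>UNIV. pd e (chr G k a b) ?y * pd i \<Phi> x $ e) * pd j \<Phi> x $ a * Y x $ b
        + chr G k a b ?y * pd i (pd j \<Phi>) x $ a * Y x $ b
        + chr G k a b ?y * pd j \<Phi> x $ a * pd i Y x $ b)"
    by (simp only: pd_mult3[OF smooth_comp[OF smooth_chr] smooth_pd\<Phi>(1) sY(1) U x]
        pd_comp[OF smooth_chr x] nY nP)
  also have "\<dots> = pd i (pd j Y) x $ k
    + (\<Sum>a\<in>UNIV. \<Sum>b\<in>UNIV. \<Sum>e\<in>UNIV. pd e (chr G k a b) ?y * pd i \<Phi> x $ e * pd j \<Phi> x $ a * Y x $ b)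
    + (\<Sum>a\<in>UNIV. \<Sum>b\<in>UNIV. chr G k a b (\<Phi> x) * pd i (pd j \<Phi>) x $ a * Y x $ b)
    + (\<Sum>a\<in>UNIV. \<Sum>b\<in>UNIV. chr G k a b (\<Phi> x) * pd j \<Phi> x $ a * pd i Y x $ b)"
    by (simp add: sum.distrib sum_distrib_right)
  also have "(\<Sum>a\<in>UNIV. \<Sum>b\<in>UNIV. \<Sum>e\<in>UNIV. pd e (chr G k a b) ?y * pd i \<Phi> x $ e * pd j \<Phi> x $ a * Y x $ b) =
      (\<Sum>a\<in>UNIV. \<Sum>b\<in>UNIV. \<Sum>c\<in>UNIV. pd a (chr G k b c) ?y * pd i \<Phi> x $ a * pd j \<Phi> x $ b * Y x $ c)"
    by (rule sum_rotate3)
  finally have 1: "pd i (cov G \<Phi> j Y) x $ k = pd i (pd j Y) x $ k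
    + (\<Sum>a\<in>UNIV. \<Sum>b\<in>UNIV. \<Sum>c\<in>UNIV.
        pd a (chr G k b c) (\<Phi> x) * pd i \<Phi> x $ a * pd j \<Phi> x $ b * Y x $ c)
    + (\<Sum>a\<in>UNIV. \<Sum>b\<in>UNIV. chr G k a b (\<Phi> x) * pd i (pd j \<Phi>) x $ a * Y x $ b)
    + (\<Sum>a\<in>UNIV. \<Sum>b\<in>UNIV. chr G k a b (\<Phi> x) * pd j \<Phi> x $ a * pd i Y x $ b)"
    .
  have "Gam G ?y (pd i \<Phi> x) (cov G \<Phi> j Y x) $ k =
      (\<Sum>a\<in>UNIV. \<Sum>m\<in>UNIV. chr G k a m ?y * pd i \<Phi> x $ a * pd j Y x $ m)
    + (\<Sum>a\<in>UNIV. \<Sum>m\<in>UNIV. \<Sum>b\<in>UNIV. \<Sum>c\<in>UNIV.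
        chr G k a m ?y * chr G m b c ?y * pd i \<Phi> x $ a * pd j \<Phi> x $ b * Y x $ c)"
    by (simp add: cov_def Gam_def sum.distrib sum_distrib_left distrib_left mult_ac)
  also have "(\<Sum>a\<in>UNIV. \<Sum>m\<in>UNIV. \<Sum>b\<in>UNIV. \<Sum>c\<in>UNIV.
        chr G k a m ?y * chr G m b c ?y * pd i \<Phi> x $ a * pd j \<Phi> x $ b * Y x $ c) =
      (\<Sum>a\<in>UNIV. \<Sum>b\<in>UNIV. \<Sum>c\<in>UNIV. \<Sum>m\<in>UNIV.
        chr G k a m ?y * chr G m b c ?y * pd i \<Phi> x $ a * pd j \<Phi> x $ b * Y x $ c)"
    by (intro sum.cong refl sum_rotate3[symmetric])
  finally show ?thesis using 1 by (subst cov_def) simp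
qed

lemma cov_commutator:
  assumes Y: "smooth_on U Y" and x: "x \<in> U"
  shows "cov G \<Phi> i (cov G \<Phi> j Y) x - cov G \<Phi> j (cov G \<Phi> i Y) x =
    rop G (\<Phi> x) (pd i \<Phi> x) (pd j \<Phi> x) (Y x)"
proof (subst vec_eq_iff, rule allI)
  fix k
  let ?y = "\<Phi> x" and ?P = "pd i \<Phi> x" and ?Q = "pd j \<Phi> x"
  have "rop G ?y ?P ?Q (Y x) $ k =
      (\<Sum>a\<in>UNIV. \<Sum>b\<in>UNIV. \<Sum>c\<in>UNIV. pd a (chr G k b c) ?y * ?P $ a * ?Q $ b * Y x $ c)
    - (\<Sum>a\<in>UNIV. \<Sum>b\<in>UNIV. \<Sum>c\<in>UNIV. pd b (chr G k a c) ?y * ?P $ a * ?Q $ b * Y x $ c)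
    + (\<Sum>a\<in>UNIV. \<Sum>b\<in>UNIV. \<Sum>c\<in>UNIV. \<Sum>m\<in>UNIV.
        chr G k a m ?y * chr G m b c ?y * ?P $ a * ?Q $ b * Y x $ c)
    - (\<Sum>a\<in>UNIV. \<Sum>b\<in>UNIV. \<Sum>c\<in>UNIV. \<Sum>m\<in>UNIV.
        chr G k b m ?y * chr G m a c ?y * ?P $ a * ?Q $ b * Y x $ c)"
    by (simp add: rop_def riem_def sum.distrib sum_subtractf sum_distrib_right sum_distrib_left
        algebra_simps)
  also have "(\<Sum>a\<in>UNIV. \<Sum>b\<in>UNIV. \<Sum>c\<in>UNIV. pd b (chr G k a c) ?y * ?P $ a * ?Q $ b * Y x $ c) =
      (\<Sum>a\<in>UNIV. \<Sum>b\<in>UNIV. \<Sum>c\<in>UNIV. pd a (chr G k b c) ?y * ?Q $ a * ?P $ b * Y x $ c)"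
    by (subst sum.swap) (simp add: mult_ac)
  also have "(\<Sum>a\<in>UNIV. \<Sum>b\<in>UNIV. \<Sum>c\<in>UNIV. \<Sum>m\<in>UNIV.
        chr G k b m ?y * chr G m a c ?y * ?P $ a * ?Q $ b * Y x $ c) =
      (\<Sum>a\<in>UNIV. \<Sum>b\<in>UNIV. \<Sum>c\<in>UNIV. \<Sum>m\<in>UNIV.
        chr G k a m ?y * chr G m b c ?y * ?Q $ a * ?P $ b * Y x $ c)"
    by (subst sum.swap) (simp add: mult_ac)
  finally show "(cov G \<Phi> i (cov G \<Phi> j Y) x - cov G \<Phi> j (cov G \<Phi> i Y) x) $ k = rop G ?y ?P ?Q (Y x) $ k"
    unfolding vector_minus_component cov_cov_component[OF Y x]
      pd_pd_commute[OF Y x, of i j] pd_pd_commute[OF smooth_\<Phi> x, of i j]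
    by linarith
qed

text \<open>Koszul's argument: since the connection is metric and torsion-free, the three
  derivatives of the induced metric combine to twice a single inner product.\<close>

lemma pullback_chr1:
  assumes "x \<in> U"
  shows "chr1 (pullback \<Phi> G) i j l x =
    inner_with (G (\<Phi> x)) (cov G \<Phi> i (pd j \<Phi>) x) (pd l \<Phi> x)"
proof -
  let ?I = "inner_with (G (\<Phi> x))"
  have d: "pd i (\<lambda>x. pullback \<Phi> G x $ j $ l) x =
      ?I (cov G \<Phi> i (pd j \<Phi>) x) (pd l \<Phi> x) + ?I (cov G \<Phi> i (pd l \<Phi>) x) (pd j \<Phi> x)" for i j l
    using pd_inner[OF assms smooth_pd\<Phi>(2) smooth_pd\<Phi>(2), of i j l]
      inner_with_commute[OF sym[OF maps[OF assms]]]
    by (simp add: pullback_def)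
  show ?thesis
    unfolding chr1_def d
    using cov_pd_sym[OF assms, of i j] cov_pd_sym[OF assms, of i l] cov_pd_sym[OF assms, of j l]
    by simp
qed

text \<open>Two covariant derivatives are commuted, and one of them is moved to the other factor by
  metric compatibility. No normal occurs in the formula, so with the identity map it also describes
  the intrinsic curvature; comparing the two instances yields the Gauss equation.\<close>

lemma pullback_curvature:
  assumes x: "x \<in> U"
  shows "rlow G (\<Phi> x) (pd i \<Phi> x) (pd j \<Phi> x) (pd k \<Phi> x) (pd l \<Phi> x) =
    pd i (chr1 (pullback \<Phi> G) j k l) x - pd j (chr1 (pullback \<Phi> G) i k l) x
    - inner_with (G (\<Phi> x)) (cov G \<Phi> j (pd k \<Phi>) x) (cov G \<Phi> i (pd l \<Phi>) x)
    + inner_with (G (\<Phi> x)) (cov G \<Phi> i (pd k \<Phi>) x) (cov G \<Phi> j (pd l \<Phi>) x)"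
proof -
  have d: "pd i (chr1 (pullback \<Phi> G) j k l) x =
      inner_with (G (\<Phi> x)) (cov G \<Phi> i (cov G \<Phi> j (pd k \<Phi>)) x) (pd l \<Phi> x)
    + inner_with (G (\<Phi> x)) (cov G \<Phi> j (pd k \<Phi>) x) (cov G \<Phi> i (pd l \<Phi>) x)" for i j
  proof -
    have "pd i (chr1 (pullback \<Phi> G) j k l) x =
        pd i (\<lambda>x. inner_with (G (\<Phi> x)) (cov G \<Phi> j (pd k \<Phi>) x) (pd l \<Phi> x)) x"
      by (rule pd_cong[OF U x pullback_chr1])
    then show ?thesis
      using pd_inner[OF x smooth_cov[OF smooth_pd\<Phi>(2)] smooth_pd\<Phi>(2)] by simp
  qed
  show ?thesis
    unfolding rlow_def cov_commutator[OF smooth_pd\<Phi>(2) x, symmetric] inner_with_diff_left d by simp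
qed

end

lemma pd_ident: "pd i (\<lambda>x. x) x = axis i 1"
  by (rule has_derivative_pd[OF has_derivative_ident])

lemma pullback_ident: "pullback (\<lambda>x. x) G = G"
  by (simp add: fun_eq_iff vec_eq_iff pullback_def pd_ident inner_with_axis)

context metric_field
begin

lemma metric_map_ident: "metric_map G W (\<lambda>x. x) W"
  by unfold_locales (auto intro: W smooth_on_id)

lemma cov_ident: "cov G (\<lambda>x. x) i (pd j (\<lambda>x. x)) y = Gam G y (axis i 1) (axis j 1)"
  by (simp add: cov_def pd_ident[abs_def] pd_const)

lemma inner_Gam_axis:
  "y \<in> W \<Longrightarrow> inner_with (G y) (Gam G y (axis i 1) (axis j 1)) (axis l 1) = chr1 G i j l y"
  using metric_map.pullback_chr1[OF metric_map_ident] by (simp add: pullback_ident cov_ident pd_ident)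

lemma rlow_axis:
  assumes "y \<in> W"
  shows "rlow G y (axis i 1) (axis j 1) (axis k 1) (axis l 1) =
    pd i (chr1 G j k l) y - pd j (chr1 G i k l) y
    - inner_with (G y) (Gam G y (axis j 1) (axis k 1)) (Gam G y (axis i 1) (axis l 1))
    + inner_with (G y) (Gam G y (axis i 1) (axis k 1)) (Gam G y (axis j 1) (axis l 1))"
  using metric_map.pullback_curvature[OF metric_map_ident assms]
  by (simp add: pullback_ident cov_ident pd_ident)

text \<open>When the two values are added, the derivative terms become commuting second derivatives
  of one metric coefficient, and the products of connection terms cancel by symmetry of the
  metric.\<close>

lemma rlow_skew34:
  assumes "y \<in> W"
  shows "rlow G y (axis i 1) (axis j 1) (axis k 1) (axis l 1) =
    - rlow G y (axis i 1) (axis j 1) (axis l 1) (axis k 1)"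
proof -
  have d: "pd i (chr1 G j k l) y + pd i (chr1 G j l k) y = pd i (pd j (\<lambda>x. G x $ k $ l)) y" for i j
  proof -
    have "pd i (chr1 G j k l) y + pd i (chr1 G j l k) y =
        pd i (\<lambda>y. chr1 G j k l y + chr1 G j l k y) y"
      by (intro pd_add[symmetric] smooth_on_differentiable[OF smooth_chr1 assms])
    also have "\<dots> = pd i (pd j (\<lambda>x. G x $ k $ l)) y"
      by (rule pd_cong[OF W assms chr1_compatible])
    finally show ?thesis .
  qed
  note c = inner_with_commute[OF sym[OF assms], of "Gam G y (axis j 1) (axis k 1)" "Gam G y (axis i 1) (axis l 1)"]
    inner_with_commute[OF sym[OF assms], of "Gam G y (axis i 1) (axis k 1)" "Gam G y (axis j 1) (axis l 1)"]
  show ?thesis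
    unfolding rlow_axis[OF assms] using d[of i j] d[of j i] c pd_commute[OF smooth_G W assms, of i j k l]
    by linarith
qed

end

section \<open>Algebraic symmetries of the curvature tensor\<close>

lemma riem_skew: "riem G i j k l x = - riem G j i k l x"
  by (simp add: riem_def sum_subtractf)

lemma rlow_skew12: "rlow G y u v w z = - rlow G y v u w z"
proof -
  have "rop G y u v w $ l = - rop G y v u w $ l" for l
  proof -
    have "rop G y u v w $ l = (\<Sum>b\<in>UNIV. \<Sum>a\<in>UNIV. \<Sum>c\<in>UNIV. riem G a b c l y * u $ a * v $ b * w $ c)"
      unfolding rop_def vec_lambda_beta by (rule sum.swap)
    also have "\<dots> = (\<Sum>b\<in>UNIV. \<Sum>a\<in>UNIV. \<Sum>c\<in>UNIV. - (riem G b a c l y * v $ b * u $ a * w $ c))"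
      by (intro sum.cong refl) (subst riem_skew, simp)
    finally show ?thesis by (simp add: rop_def sum_negf)
  qed
  then have "rop G y u v w = - rop G y v u w" by (simp add: vec_eq_iff)
  then show ?thesis by (simp add: rlow_def inner_with_def)
qed

lemma rop_add:
  "rop G y (u + u') v w = rop G y u v w + rop G y u' v w"
  "rop G y u (v + v') w = rop G y u v w + rop G y u v' w"
  "rop G y u v (w + w') = rop G y u v w + rop G y u v w'"
  by (simp_all add: rop_def vec_eq_iff distrib_left distrib_right sum.distrib)

lemma rop_scale:
  "rop G y (r *\<^sub>R u) v w = r *\<^sub>R rop G y u v w"
  "rop G y u (r *\<^sub>R v) w = r *\<^sub>R rop G y u v w"
  "rop G y u v (r *\<^sub>R w) = r *\<^sub>R rop G y u v w"
  by (simp_all add: rop_def vec_eq_iff sum_distrib_left mult_ac)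

lemma rlow_linear:
  "linear (\<lambda>u. rlow G y u v w z)" "linear (\<lambda>v. rlow G y u v w z)"
  "linear (\<lambda>w. rlow G y u v w z)" "linear (\<lambda>z. rlow G y u v w z)"
  by (auto intro!: linearI simp: rlow_def rop_add rop_scale inner_with_add_left inner_with_add_right
      inner_with_scale_left inner_with_scale_right)

lemma linear_axis_ext:
  fixes f g :: "real ^ 'n::finite \<Rightarrow> 'b::real_normed_vector"
  assumes "linear f" "linear g" "\<And>a. f (axis a 1) = g (axis a 1)"
  shows "f v = g v"
  using linear_axis_expansion[OF assms(1), of v] linear_axis_expansion[OF assms(2), of v]
  by (simp only: assms(3))

text \<open>The identity on axis vectors is extended by linearity, one slot at a time.\<close>

lemma (in metric_field) rlow_skew34_vec:
  assumes "y \<in> W"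
  shows "rlow G y u v w z = - rlow G y u v z w"
proof -
  have 1: "rlow G y u (axis j 1) (axis k 1) (axis l 1) = - rlow G y u (axis j 1) (axis l 1) (axis k 1)" for j k l
    by (rule linear_axis_ext[OF rlow_linear(1) linear_compose_neg[OF rlow_linear(1)]])
       (rule rlow_skew34[OF assms])
  have 2: "rlow G y u v (axis k 1) (axis l 1) = - rlow G y u v (axis l 1) (axis k 1)" for k l
    by (rule linear_axis_ext[OF rlow_linear(2) linear_compose_neg[OF rlow_linear(2)]]) (rule 1)
  have 3: "rlow G y u v w (axis l 1) = - rlow G y u v (axis l 1) w" for l
    by (rule linear_axis_ext[OF rlow_linear(3) linear_compose_neg[OF rlow_linear(4)]]) (rule 2)
  show ?thesis
    by (rule linear_axis_ext[OF rlow_linear(4) linear_compose_neg[OF rlow_linear(3)]]) (rule 3)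
qed

section \<open>Adapted frames and traces\<close>

text \<open>The frame consists of the vectors \<open>e i\<close> with inverse Gram matrix \<open>Hi\<close> and of a unit normal
  \<open>n\<close>. The choice \<open>n = 0\<close> expresses that the \<open>e i\<close> alone are a basis.\<close>

definition frame ::
    "real ^ 'n::finite ^ 'n \<Rightarrow> real ^ 'm::finite ^ 'm \<Rightarrow> ('m \<Rightarrow> real ^ 'n) \<Rightarrow> real ^ 'n \<Rightarrow> bool" where
  "frame g Hi e n \<longleftrightarrow> (\<forall>w. w = (\<Sum>i\<in>UNIV. \<Sum>j\<in>UNIV. (Hi $ i $ j * inner_with g w (e j)) *\<^sub>R e i)
                          + inner_with g w n *\<^sub>R n)"

lemma frame_inner:
  assumes "frame g Hi e n"
  shows "inner_with g v w = (\<Sum>i\<in>UNIV. \<Sum>j\<in>UNIV. Hi $ i $ j * inner_with g v (e j) * inner_with g (e i) w)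
    + inner_with g v n * inner_with g n w"
proof -
  have "inner_with g v w = inner_with g ((\<Sum>i\<in>UNIV. \<Sum>j\<in>UNIV. (Hi $ i $ j * inner_with g v (e j)) *\<^sub>R e i)
      + inner_with g v n *\<^sub>R n) w"
    using assms unfolding frame_def by metis
  then show ?thesis
    by (simp add: inner_with_add_left inner_with_sum_left inner_with_scale_left)
qed

lemma matrix_inv_unique_left:
  fixes A M :: "real ^ 'n::finite ^ 'n"
  assumes "M ** A = mat 1"
  shows "matrix_inv A = M"
proof -
  have "invertible A" using assms matrix_left_right_inverse unfolding invertible_def by blast
  from invertible_mat_inv(1)[OF this] show ?thesis
    using assms by (metis matrix_mul_assoc matrix_mul_lid matrix_mul_rid)
qed

text \<open>The frame expansion of all vectors says that this matrix is a left inverse of g, and a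
  left inverse of a square matrix is its inverse.\<close>

lemma frame_matrix_inv:
  fixes g :: "real ^ 'n::finite ^ 'n"
  assumes "frame g Hi e n" "\<And>a b. g $ a $ b = g $ b $ a"
  shows "matrix_inv g $ a $ b = (\<Sum>i\<in>UNIV. \<Sum>j\<in>UNIV. Hi $ i $ j * e i $ a * e j $ b) + n $ a * n $ b"
proof -
  define M :: "real ^ 'n ^ 'n" where
    "M = (\<chi> a b. (\<Sum>i\<in>UNIV. \<Sum>j\<in>UNIV. Hi $ i $ j * e i $ a * e j $ b) + n $ a * n $ b)"
  have ip: "inner_with g w v = (\<Sum>b\<in>UNIV. v $ b * (g *v w) $ b)" for v w
    using inner_with_commute[OF assms(2), of w v] by (simp add: inner_with_def inner_vec_def)
  have "(M ** g) *v w = mat 1 *v w" for w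
  proof -
    have "(M *v (g *v w)) $ a = w $ a" for a
    proof -
      have "(M *v (g *v w)) $ a =
          (\<Sum>b\<in>UNIV. \<Sum>i\<in>UNIV. \<Sum>j\<in>UNIV. Hi $ i $ j * (e j $ b * (g *v w) $ b) * e i $ a)
          + (\<Sum>b\<in>UNIV. n $ b * (g *v w) $ b) * n $ a"
        by (simp add: M_def matrix_vector_mult_def[of M] matrix_vector_mult_def[of "vec_lambda _"]
            sum.distrib sum_distrib_left sum_distrib_right algebra_simps)
      also have "(\<Sum>b\<in>UNIV. \<Sum>i\<in>UNIV. \<Sum>j\<in>UNIV. Hi $ i $ j * (e j $ b * (g *v w) $ b) * e i $ a) =
          (\<Sum>i\<in>UNIV. \<Sum>j\<in>UNIV. \<Sum>b\<in>UNIV. Hi $ i $ j * (e j $ b * (g *v w) $ b) * e i $ a)"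
        by (rule sum_rotate3[symmetric])
      also have "\<dots> + (\<Sum>b\<in>UNIV. n $ b * (g *v w) $ b) * n $ a =
          (\<Sum>i\<in>UNIV. \<Sum>j\<in>UNIV. (Hi $ i $ j * inner_with g w (e j)) * e i $ a) + inner_with g w n * n $ a"
        by (simp add: ip sum_distrib_left sum_distrib_right)
      also have "\<dots> = ((\<Sum>i\<in>UNIV. \<Sum>j\<in>UNIV. (Hi $ i $ j * inner_with g w (e j)) *\<^sub>R e i)
                          + inner_with g w n *\<^sub>R n) $ a"
        by simp
      also have "\<dots> = w $ a" using assms(1) unfolding frame_def by metis
      finally show ?thesis .
    qed
    then show ?thesis by (simp add: vec_eq_iff matrix_vector_mul_assoc)
  qed
  then have "M ** g = mat 1" by (simp add: matrix_eq)
  then have "matrix_inv g = M" by (rule matrix_inv_unique_left)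
  then show ?thesis by (simp add: M_def)
qed

lemma bilinear_axis_expansion:
  fixes B :: "real ^ 'n::finite \<Rightarrow> real ^ 'k::finite \<Rightarrow> real"
  assumes "\<And>v. linear (\<lambda>u. B u v)" "\<And>u. linear (\<lambda>v. B u v)"
  shows "B u v = (\<Sum>a\<in>UNIV. \<Sum>b\<in>UNIV. u $ a * v $ b * B (axis a 1) (axis b 1))"
proof -
  have "B u v = (\<Sum>a\<in>UNIV. u $ a * B (axis a 1) v)"
    using linear_axis_expansion[OF assms(1)[of v], of u] by simp
  also have "\<dots> = (\<Sum>a\<in>UNIV. u $ a * (\<Sum>b\<in>UNIV. v $ b * B (axis a 1) (axis b 1)))"
    using linear_axis_expansion[OF assms(2), of _ v] by simp
  finally show ?thesis by (simp add: sum_distrib_left mult.assoc)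
qed

text \<open>The bilinear map is left arbitrary so that the same splitting into tangential and normal
  part serves traces of the curvature tensor, Hessians and products of differentials.\<close>

lemma frame_trace:
  fixes B :: "real ^ 'n::finite \<Rightarrow> real ^ 'n \<Rightarrow> real"
  assumes "frame g Hi e n" "\<And>a b. g $ a $ b = g $ b $ a"
    and "\<And>v. linear (\<lambda>u. B u v)" "\<And>u. linear (\<lambda>v. B u v)"
  shows "(\<Sum>a\<in>UNIV. \<Sum>b\<in>UNIV. matrix_inv g $ a $ b * B (axis a 1) (axis b 1)) =
    (\<Sum>i\<in>UNIV. \<Sum>j\<in>UNIV. Hi $ i $ j * B (e i) (e j)) + B n n"
proof -
  have "(\<Sum>i\<in>UNIV. \<Sum>j\<in>UNIV. Hi $ i $ j * B (e i) (e j)) =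
      (\<Sum>i\<in>UNIV. \<Sum>j\<in>UNIV. \<Sum>a\<in>UNIV. \<Sum>b\<in>UNIV. Hi $ i $ j * e i $ a * e j $ b * B (axis a 1) (axis b 1))"
    by (subst bilinear_axis_expansion[OF assms(3,4)]) (simp add: sum_distrib_left mult.assoc)
  also have "\<dots> = (\<Sum>a\<in>UNIV. \<Sum>i\<in>UNIV. \<Sum>j\<in>UNIV. \<Sum>b\<in>UNIV. Hi $ i $ j * e i $ a * e j $ b * B (axis a 1) (axis b 1))"
    by (rule sum_rotate3)
  also have "\<dots> = (\<Sum>a\<in>UNIV. \<Sum>b\<in>UNIV. \<Sum>i\<in>UNIV. \<Sum>j\<in>UNIV. Hi $ i $ j * e i $ a * e j $ b * B (axis a 1) (axis b 1))"
    by (intro sum.cong refl sum_rotate3)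
  finally show ?thesis
    using bilinear_axis_expansion[OF assms(3,4), of n n]
    by (simp add: frame_matrix_inv[OF assms(1,2)] sum.distrib sum_distrib_right distrib_right)
qed

lemma inner_with_linear: "linear (\<lambda>u. inner_with M u v)" "linear (\<lambda>v. inner_with M u v)"
  by (auto intro!: linearI simp: inner_with_add_left inner_with_add_right
      inner_with_scale_left inner_with_scale_right)

lemma frame_metric_trace:
  assumes "frame g Hi e n" "\<And>a b. g $ a $ b = g $ b $ a"
  shows "(\<Sum>a\<in>UNIV. \<Sum>b\<in>UNIV. matrix_inv g $ a $ b * T $ a $ b) =
    (\<Sum>i\<in>UNIV. \<Sum>j\<in>UNIV. Hi $ i $ j * inner_with T (e i) (e j)) + inner_with T n n"
  using frame_trace[OF assms inner_with_linear, of T] by (simp add: inner_with_axis)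

section \<open>The Gauss equation\<close>

definition hess :: "(real ^ 'n::finite \<Rightarrow> real ^ 'n ^ 'n) \<Rightarrow> (real ^ 'n \<Rightarrow> real) \<Rightarrow> real ^ 'n \<Rightarrow> real ^ 'n ^ 'n" where
  "hess G f y = (\<chi> i j. pd i (pd j f) y - (\<Sum>k\<in>UNIV. chr G k i j y * pd k f y))"

definition ric :: "(real ^ 'n::finite \<Rightarrow> real ^ 'n ^ 'n) \<Rightarrow> real ^ 'n \<Rightarrow> real ^ 'n ^ 'n" where
  "ric G y = (\<chi> j k. \<Sum>i\<in>UNIV. riem G i j k i y)"

definition scal :: "(real ^ 'n::finite \<Rightarrow> real ^ 'n ^ 'n) \<Rightarrow> real ^ 'n \<Rightarrow> real" where
  "scal G y = (\<Sum>i\<in>UNIV. \<Sum>j\<in>UNIV. matrix_inv (G y) $ i $ j * ric G y $ i $ j)"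

definition dirder :: "(real ^ 'n::finite \<Rightarrow> real) \<Rightarrow> real ^ 'n \<Rightarrow> real ^ 'n \<Rightarrow> real" where
  "dirder f y v = (\<Sum>a\<in>UNIV. pd a f y * v $ a)"

lemma rop_axis:
  "rop G y (axis a 1) v w $ l = (\<Sum>b\<in>UNIV. \<Sum>c\<in>UNIV. riem G a b c l y * v $ b * w $ c)"
proof -
  have "(\<Sum>b\<in>UNIV. \<Sum>c\<in>UNIV. riem G a' b c l y * axis a 1 $ a' * v $ b * w $ c) =
      (if a' = a then \<Sum>b\<in>UNIV. \<Sum>c\<in>UNIV. riem G a b c l y * v $ b * w $ c else 0)" for a'
    by (simp add: axis_def)
  then show ?thesis by (simp add: rop_def)
qed

context metric_field
begin

lemma sum_matrix_inv_G:
  assumes "y \<in> W"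
  shows "(\<Sum>b\<in>UNIV. matrix_inv (G y) $ a $ b * G y $ l $ b) = (if a = l then 1 else 0)"
proof -
  have inv: "matrix_inv (G y) ** G y = mat 1"
    using nondeg[OF assms] invertible_det_nz invertible_mat_inv by blast
  have "(\<Sum>b\<in>UNIV. matrix_inv (G y) $ a $ b * G y $ l $ b) = (matrix_inv (G y) ** G y) $ a $ l"
    by (simp add: matrix_matrix_mult_def sym[OF assms, of l])
  then show ?thesis by (simp add: inv mat_def)
qed

text \<open>\<open>ric\<close> contracts an upper with a lower index. Written as a metric trace over
  the first and last slot of \<open>rlow\<close>, it can be evaluated in an adapted frame.\<close>

lemma ric_rlow:
  assumes "y \<in> W"
  shows "inner_with (ric G y) v w =
    (\<Sum>a\<in>UNIV. \<Sum>b\<in>UNIV. matrix_inv (G y) $ a $ b * rlow G y (axis a 1) v w (axis b 1))"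
proof -
  have lo: "rlow G y u v w (axis b 1) = (\<Sum>l\<in>UNIV. rop G y u v w $ l * G y $ l $ b)" for u b
    by (simp add: rlow_def inner_with_sum axis_def if_distrib[of "\<lambda>x. _ * x"] cong: if_cong)
  have "(\<Sum>a\<in>UNIV. \<Sum>b\<in>UNIV. matrix_inv (G y) $ a $ b * rlow G y (axis a 1) v w (axis b 1)) =
      (\<Sum>a\<in>UNIV. \<Sum>b\<in>UNIV. \<Sum>l\<in>UNIV. rop G y (axis a 1) v w $ l * (matrix_inv (G y) $ a $ b * G y $ l $ b))"
    by (simp add: lo sum_distrib_left mult_ac)
  also have "\<dots> = (\<Sum>a\<in>UNIV. \<Sum>l\<in>UNIV. \<Sum>b\<in>UNIV. rop G y (axis a 1) v w $ l * (matrix_inv (G y) $ a $ b * G y $ l $ b))"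
    by (intro sum.cong refl sum.swap)
  also have "\<dots> = (\<Sum>a\<in>UNIV. rop G y (axis a 1) v w $ a)"
    by (simp add: sum_matrix_inv_G[OF assms] if_distrib[of "\<lambda>x. _ * x"] flip: sum_distrib_left cong: if_cong)
  also have "\<dots> = (\<Sum>a\<in>UNIV. \<Sum>b\<in>UNIV. \<Sum>c\<in>UNIV. riem G a b c a y * v $ b * w $ c)"
    by (simp add: rop_axis)
  also have "\<dots> = (\<Sum>b\<in>UNIV. \<Sum>c\<in>UNIV. \<Sum>a\<in>UNIV. riem G a b c a y * v $ b * w $ c)"
    by (rule sum_rotate3[symmetric])
  also have "\<dots> = inner_with (ric G y) v w"
    by (simp add: inner_with_sum ric_def sum_distrib_left sum_distrib_right mult_ac)
  finally show ?thesis by simp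
qed

lemma ric_frame:
  assumes "y \<in> W" "frame (G y) Hi e n"
  shows "inner_with (ric G y) v w =
    (\<Sum>i\<in>UNIV. \<Sum>j\<in>UNIV. Hi $ i $ j * rlow G y (e i) v w (e j)) + rlow G y n v w n"
  unfolding ric_rlow[OF assms(1)]
  by (rule frame_trace[OF assms(2) sym[OF assms(1)] rlow_linear(1,4)])

text \<open>The coordinate basis is itself a frame without normal; it supplies the intrinsic
  counterpart when the inner products in the Gauss equation are expanded.\<close>

lemma frame_axis: 
  assumes "y \<in> W"
  shows "frame (G y) (matrix_inv (G y)) (\<lambda>i. axis i 1) 0"
  unfolding frame_def
proof
  fix w
  have "(\<Sum>i\<in>UNIV. \<Sum>j\<in>UNIV. (matrix_inv (G y) $ i $ j * inner_with (G y) w (axis j 1)) *\<^sub>R axis i 1) =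
      (\<Sum>i\<in>UNIV. w $ i *\<^sub>R axis i (1::real))"
  proof (intro sum.cong refl)
    fix i
    have "inner_with (G y) w (axis j 1) = (\<Sum>l\<in>UNIV. w $ l * G y $ l $ j)" for j
      by (simp add: inner_with_sum axis_def if_distrib[of "\<lambda>x. _ * x"] cong: if_cong)
    then have "(\<Sum>j\<in>UNIV. matrix_inv (G y) $ i $ j * inner_with (G y) w (axis j 1)) =
        (\<Sum>j\<in>UNIV. \<Sum>l\<in>UNIV. w $ l * (matrix_inv (G y) $ i $ j * G y $ l $ j))"
      by (simp add: sum_distrib_left mult_ac)
    also have "\<dots> = (\<Sum>l\<in>UNIV. \<Sum>j\<in>UNIV. w $ l * (matrix_inv (G y) $ i $ j * G y $ l $ j))"
      by (rule sum.swap)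
    also have "\<dots> = w $ i"
      by (simp add: sum_matrix_inv_G[OF assms] if_distrib[of "\<lambda>x. _ * x"] flip: sum_distrib_left cong: if_cong)
    finally show "(\<Sum>j\<in>UNIV. (matrix_inv (G y) $ i $ j * inner_with (G y) w (axis j 1)) *\<^sub>R axis i 1) =
        w $ i *\<^sub>R axis i (1::real)"
      by (simp flip: scaleR_sum_left)
  qed
  also have "\<dots> = w" using basis_expansion[of w] by (simp add: scalar_mult_eq_scaleR)
  finally show "w = (\<Sum>i\<in>UNIV. \<Sum>j\<in>UNIV. (matrix_inv (G y) $ i $ j * inner_with (G y) w (axis j 1)) *\<^sub>R axis i 1)
      + inner_with (G y) w 0 *\<^sub>R 0" by simp
qed

end

lemma linear_inj_imp_surj_dim:
  fixes f :: "'a::euclidean_space \<Rightarrow> 'b::euclidean_space"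
  assumes "linear f" "inj f" "DIM('a) = DIM('b)"
  shows "surj f"
proof -
  have "dim (f ` UNIV) = dim (UNIV :: 'a set)"
    by (rule dim_image_eq) (use assms in \<open>auto intro: inj_on_subset\<close>)
  then have "dim (range f) = DIM('b)" using assms(3) by simp
  moreover have "subspace (range f)" using assms(1) subspace_UNIV linear_subspace_image by blast
  ultimately show ?thesis by (simp add: dim_eq_full span_eq_iff[THEN iffD2])
qed

text \<open>The condition \<open>inner_with g n n *\<^sub>R n = n\<close> holds for a unit vector
  and for \<open>n = 0\<close>, so one argument covers codimension 1 and codimension 0.\<close>

lemma frameI:
  fixes e :: "'m::finite \<Rightarrow> real ^ 'n::finite"
  assumes inv: "Hi ** h = mat 1" and h: "\<And>i j. h $ i $ j = inner_with g (e i) (e j)"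
    and hsym: "\<And>i j. h $ i $ j = h $ j $ i"
    and n: "\<And>i. inner_with g n (e i) = 0" "\<And>i. inner_with g (e i) n = 0" "inner_with g n n *\<^sub>R n = n"
    and span: "\<And>w. \<exists>c d. w = (\<Sum>k\<in>UNIV. c k *\<^sub>R e k) + d *\<^sub>R n"
  shows "frame g Hi e n"
  unfolding frame_def
proof
  fix w
  obtain c d where w: "w = (\<Sum>k\<in>UNIV. c k *\<^sub>R e k) + d *\<^sub>R n" using span by blast
  have hh: "inner_with g (e k) (e j) = h $ j $ k" for j k using h hsym by metis
  have we: "inner_with g w (e j) = (\<Sum>k\<in>UNIV. c k * h $ j $ k)" for j
    by (simp add: w inner_with_add_left inner_with_sum_left inner_with_scale_left n hh)
  have wn: "inner_with g w n = d * inner_with g n n"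
    by (simp add: w inner_with_add_left inner_with_sum_left inner_with_scale_left n)
  have "(\<Sum>j\<in>UNIV. Hi $ i $ j * inner_with g w (e j)) = c i" for i
  proof -
    have "(\<Sum>j\<in>UNIV. Hi $ i $ j * inner_with g w (e j)) =
        (\<Sum>j\<in>UNIV. \<Sum>k\<in>UNIV. c k * (Hi $ i $ j * h $ j $ k))"
      by (simp add: we sum_distrib_left mult_ac)
    also have "\<dots> = (\<Sum>k\<in>UNIV. \<Sum>j\<in>UNIV. c k * (Hi $ i $ j * h $ j $ k))" by (rule sum.swap)
    also have "\<dots> = (\<Sum>k\<in>UNIV. c k * (Hi ** h) $ i $ k)"
      by (simp add: matrix_matrix_mult_def sum_distrib_left)
    finally show ?thesis by (simp add: inv mat_def if_distrib[of "\<lambda>x. _ * x"] cong: if_cong)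
  qed
  then have "(\<Sum>i\<in>UNIV. \<Sum>j\<in>UNIV. (Hi $ i $ j * inner_with g w (e j)) *\<^sub>R e i) = (\<Sum>i\<in>UNIV. c i *\<^sub>R e i)"
    by (simp flip: scaleR_sum_left)
  moreover have "inner_with g w n *\<^sub>R n = d *\<^sub>R n"
    using n(3) by (simp add: wn flip: scaleR_scaleR)
  ultimately have "(\<Sum>i\<in>UNIV. \<Sum>j\<in>UNIV. (Hi $ i $ j * inner_with g w (e j)) *\<^sub>R e i)
      + inner_with g w n *\<^sub>R n = (\<Sum>k\<in>UNIV. c k *\<^sub>R e k) + d *\<^sub>R n"
    by (simp only:)
  with w show "w = (\<Sum>i\<in>UNIV. \<Sum>j\<in>UNIV. (Hi $ i $ j * inner_with g w (e j)) *\<^sub>R e i)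
      + inner_with g w n *\<^sub>R n" by (rule trans[OF _ sym])
qed

text \<open>Linear independence of the frame, from its invertible Gram matrix.\<close>

lemma frame_coefficients_zero:
  fixes e :: "'m::finite \<Rightarrow> real ^ 'n::finite"
  assumes inv: "Hi ** h = mat 1" and h: "\<And>i j. h $ i $ j = inner_with g (e i) (e j)"
    and hsym: "\<And>i j. h $ i $ j = h $ j $ i"
    and z: "\<And>j. inner_with g (\<Sum>k\<in>UNIV. c k *\<^sub>R e k) (e j) = 0"
  shows "c i = 0"
proof -
  have hh: "inner_with g (e k) (e j) = h $ j $ k" for j k using h hsym by metis
  have "(\<Sum>k\<in>UNIV. h $ j $ k * c k) = 0" for j
    using z[of j] by (simp add: inner_with_sum_left inner_with_scale_left hh mult.commute)
  then have "h *v (\<chi> k. c k) = 0" by (simp add: vec_eq_iff matrix_vector_mult_def)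
  then have "(Hi ** h) *v (\<chi> k. c k) = 0"
    by (metis matrix_vector_mul_assoc matrix_vector_mult_0_right)
  then show ?thesis by (simp add: inv vec_eq_iff)
qed

lemma frame_codim0:
  fixes e :: "'n::finite \<Rightarrow> real ^ 'n"
  assumes inv: "Hi ** h = mat 1" and h: "\<And>i j. h $ i $ j = inner_with g (e i) (e j)"
    and hsym: "\<And>i j. h $ i $ j = h $ j $ i"
  shows "frame g Hi e 0"
proof (rule frameI[OF inv h hsym])
  let ?L = "\<lambda>c :: real ^ 'n. \<Sum>k\<in>UNIV. c $ k *\<^sub>R e k"
  have lin: "linear ?L"
    by (auto intro!: linearI simp: sum.distrib scaleR_left_distrib scaleR_sum_right)
  have "c = 0" if z: "?L c = 0" for c
  proof -
    have "c $ i = 0" for i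
      by (rule frame_coefficients_zero[OF inv h hsym, of "\<lambda>k. c $ k"]) (simp add: z)
    then show ?thesis by (simp add: vec_eq_iff)
  qed
  then have "inj ?L" using lin linear_injective_0 by blast
  then have surj: "surj ?L" using linear_inj_imp_surj_dim[OF lin] by simp
  show "\<exists>c d. w = (\<Sum>k\<in>UNIV. c k *\<^sub>R e k) + d *\<^sub>R 0" for w
  proof -
    obtain c where "w = ?L c" using surj unfolding surj_def by blast
    then have "w = (\<Sum>k\<in>UNIV. c $ k *\<^sub>R e k) + 0 *\<^sub>R 0" by simp
    then show ?thesis by blast
  qed
qed simp_all

text \<open>Pairing with n and then with the vectors e i shows that the map from coefficients to
  vectors is injective. Source and target have equal dimension, so it is onto and the frame
  spans.\<close>

lemma frame_codim1:
  fixes e :: "'m::finite \<Rightarrow> real ^ 'n::finite"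
  assumes inv: "Hi ** h = mat 1" and h: "\<And>i j. h $ i $ j = inner_with g (e i) (e j)"
    and hsym: "\<And>i j. h $ i $ j = h $ j $ i"
    and gsym: "\<And>a b. g $ a $ b = g $ b $ a"
    and n: "\<And>i. inner_with g n (e i) = 0" "inner_with g n n = 1"
    and card: "CARD('n) = CARD('m) + 1"
  shows "frame g Hi e n"
proof (rule frameI[OF inv h hsym n(1)])
  show n': "inner_with g (e i) n = 0" for i
    using n(1) inner_with_commute[OF gsym] by metis
  show "inner_with g n n *\<^sub>R n = n" using n by simp
  let ?L = "\<lambda>c :: (real ^ 'm) \<times> real. (\<Sum>k\<in>UNIV. fst c $ k *\<^sub>R e k) + snd c *\<^sub>R n"
  have lin: "linear ?L"
    by (auto intro!: linearI simp: sum.distrib scaleR_left_distrib scaleR_sum_right scaleR_right_distrib)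
  have "c = 0" if z: "?L c = 0" for c
  proof -
    have "inner_with g (?L c) n = snd c"
      by (simp add: inner_with_add_left inner_with_sum_left inner_with_scale_left n n')
    then have s: "snd c = 0" using z by simp
    have zz: "(\<Sum>k\<in>UNIV. fst c $ k *\<^sub>R e k) = 0" using z s by simp
    have "fst c $ i = 0" for i
      by (rule frame_coefficients_zero[OF inv h hsym, of "\<lambda>k. fst c $ k"]) (simp add: zz)
    then have "fst c = 0" by (simp add: vec_eq_iff)
    with s show ?thesis by (simp add: prod_eq_iff)
  qed
  then have "inj ?L" using lin linear_injective_0 by blast
  then have surj: "surj ?L" using linear_inj_imp_surj_dim[OF lin] card by simp
  show "\<exists>c d. w = (\<Sum>k\<in>UNIV. c k *\<^sub>R e k) + d *\<^sub>R n" for w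
  proof -
    obtain c where "w = ?L c" using surj unfolding surj_def by blast
    then show ?thesis by blast
  qed
qed

lemma matrix_inv_symmetric:
  fixes M :: "real ^ 'n::finite ^ 'n"
  assumes "det M \<noteq> 0" "\<And>a b. M $ a $ b = M $ b $ a"
  shows "matrix_inv M $ i $ j = matrix_inv M $ j $ i"
proof -
  have "transpose M = M" using assms(2) by (simp add: transpose_def vec_eq_iff)
  moreover have "M ** matrix_inv M = mat 1"
    using assms(1) invertible_det_nz invertible_mat_inv by blast
  ultimately have "transpose (matrix_inv M) ** M = mat 1"
    by (metis matrix_transpose_mul transpose_mat)
  then have "matrix_inv M = transpose (matrix_inv M)" by (rule matrix_inv_unique_left)
  from this[THEN arg_cong, of "\<lambda>M. M $ i $ j"] show ?thesis by (simp add: transpose_def)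
qed

lemma (in metric_map) smooth_pullback: "smooth_on U (pullback \<Phi> G)"
proof (intro smooth_on_vec U)
  show "smooth_on U (\<lambda>x. pullback \<Phi> G x $ i $ j)" for i j
    unfolding pullback_def inner_with_sum vec_lambda_beta
    by (intro smooth_on_sum smooth_on_mult smooth_pd\<Phi> smooth_comp smooth_G U)
qed

text \<open>The dimensions of source and target stay independent: surfaces in a 3-manifold and
  coordinate changes of one manifold are both instances, the latter with \<open>n = 0\<close> as
  normal.\<close>

locale metric_immersion = metric_map G W \<Phi> U
  for G :: "real ^ 'n::finite \<Rightarrow> real ^ 'n ^ 'n" and W
    and \<Phi> :: "real ^ 'm::finite \<Rightarrow> real ^ 'n" and U +
  assumes nondeg_pullback: "\<And>x. x \<in> U \<Longrightarrow> det (pullback \<Phi> G x) \<noteq> 0"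
begin

abbreviation "H \<equiv> pullback \<Phi> G"

abbreviation "Hi x \<equiv> matrix_inv (H x)"

lemma H_sym: "x \<in> U \<Longrightarrow> H x $ i $ j = H x $ j $ i"
  unfolding pullback_def using inner_with_commute[OF sym[OF maps]] by simp

sublocale pull: metric_field H U
  by unfold_locales (simp_all add: U smooth_pullback H_sym nondeg_pullback)

text \<open>The normal component of the second derivatives of the immersion. By
  \<open>sff_II\<close> it is minus \<open>second_fundamental_form\<close>, where the normal is
  differentiated. It vanishes for \<open>n = 0\<close>.\<close>

definition II :: "'m \<Rightarrow> 'm \<Rightarrow> real ^ 'm \<Rightarrow> real ^ 'n \<Rightarrow> real" where
  "II i j x n = inner_with (G (\<Phi> x)) (cov G \<Phi> i (pd j \<Phi>) x) n"

lemma II_sym: "x \<in> U \<Longrightarrow> II i j x n = II j i x n"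
  unfolding II_def using cov_pd_sym by simp

lemma Hi_sym: "x \<in> U \<Longrightarrow> Hi x $ i $ j = Hi x $ j $ i"
  by (rule matrix_inv_symmetric[OF nondeg_pullback H_sym])

context
  fixes x n
  assumes x: "x \<in> U" and fr: "frame (G (\<Phi> x)) (Hi x) (\<lambda>i. pd i \<Phi> x) n"
begin

text \<open>The frame splits each second derivative of the immersion into a tangential part, which
  \<open>pullback_chr1\<close> identifies with the connection of the induced metric, and a multiple
  of n. The products of tangential parts recombine with the derivative terms to the intrinsic
  curvature.\<close>

lemma gauss:
  "rlow G (\<Phi> x) (pd i \<Phi> x) (pd j \<Phi> x) (pd k \<Phi> x) (pd l \<Phi> x) =
    rlow H x (axis i 1) (axis j 1) (axis k 1) (axis l 1)
    - II j k x n * II i l x n + II i k x n * II j l x n"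
proof -
  let ?D = "\<lambda>i j. cov G \<Phi> i (pd j \<Phi>) x" and ?\<Gamma> = "\<lambda>i j. Gam H x (axis i 1) (axis j 1)"
  have t: "inner_with (G (\<Phi> x)) (?D i j) (pd l \<Phi> x) = inner_with (H x) (?\<Gamma> i j) (axis l 1)" for i j l
    unfolding pull.inner_Gam_axis[OF x] pullback_chr1[OF x] ..
  have t': "inner_with (G (\<Phi> x)) (pd l \<Phi> x) (?D i j) = inner_with (H x) (axis l 1) (?\<Gamma> i j)" for i j l
    using t inner_with_commute[OF sym[OF maps[OF x]]] inner_with_commute[OF H_sym[OF x]] by metis
  have n': "inner_with (G (\<Phi> x)) n (?D i j) = II i j x n" for i j
    unfolding II_def by (rule inner_with_commute[OF sym[OF maps[OF x]]])
  have n'': "inner_with (G (\<Phi> x)) (?D i j) n = II i j x n" for i j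
    unfolding II_def ..
  have d: "inner_with (G (\<Phi> x)) (?D i j) (?D k l) =
      inner_with (H x) (?\<Gamma> i j) (?\<Gamma> k l) + II i j x n * II k l x n" for i j k l
    using frame_inner[OF fr, of "?D i j" "?D k l"]
      frame_inner[OF pull.frame_axis[OF x], of "?\<Gamma> i j" "?\<Gamma> k l"]
    by (simp add: t t' n' n'')
  show ?thesis
    unfolding pullback_curvature[OF x] pull.rlow_axis[OF x] d by simp
qed

text \<open>The second derivative of the composition consists of second derivatives of f and of the
  differential of f on the second derivatives of \<Phi>. Both are completed to covariant
  derivatives. Splitting the latter in the frame gives the connection terms of the induced metric,
  which belong to the left side, and the normal term.\<close>

lemma hess_pullback:
  assumes f: "smooth_on W f"
  shows "hess H (\<lambda>x. f (\<Phi> x)) x $ i $ j =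
    inner_with (hess G f (\<Phi> x)) (pd i \<Phi> x) (pd j \<Phi> x) + II i j x n * dirder f (\<Phi> x) n"
proof -
  let ?y = "\<Phi> x" and ?D = "cov G \<Phi> i (pd j \<Phi>) x"
  have sf: "smooth_on U (\<lambda>x. pd a f (\<Phi> x))" for a by (intro smooth_comp smooth_on_pd f)
  have "pd i (pd j (\<lambda>x. f (\<Phi> x))) x = pd i (\<lambda>x. \<Sum>a\<in>UNIV. pd a f (\<Phi> x) * pd j \<Phi> x $ a) x"
    by (rule pd_cong[OF U x pd_comp[OF f]])
  also have "\<dots> = (\<Sum>a\<in>UNIV. pd i (\<lambda>x. pd a f (\<Phi> x) * pd j \<Phi> x $ a) x)"
    by (intro pd_sum smooth_on_differentiable[OF _ x] smooth_on_mult sf smooth_pd\<Phi> U) simp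
  also have "\<dots> = (\<Sum>a\<in>UNIV. (\<Sum>b\<in>UNIV. pd b (pd a f) ?y * pd i \<Phi> x $ b) * pd j \<Phi> x $ a
      + pd a f ?y * pd i (pd j \<Phi>) x $ a)"
    by (intro sum.cong refl, subst pd_mult)
       (simp_all add: smooth_on_differentiable[OF sf x] smooth_on_differentiable[OF smooth_pd\<Phi>(1) x]
         pd_comp[OF smooth_on_pd[OF f] x] pd_nth[OF smooth_on_differentiable[OF smooth_pd\<Phi>(2) x]])
  also have "\<dots> = (\<Sum>a\<in>UNIV. \<Sum>b\<in>UNIV. pd b (pd a f) ?y * pd i \<Phi> x $ b * pd j \<Phi> x $ a)
      + (\<Sum>a\<in>UNIV. pd a f ?y * pd i (pd j \<Phi>) x $ a)"
    by (simp add: sum.distrib sum_distrib_right)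
  also have "(\<Sum>a\<in>UNIV. \<Sum>b\<in>UNIV. pd b (pd a f) ?y * pd i \<Phi> x $ b * pd j \<Phi> x $ a) =
      (\<Sum>a\<in>UNIV. \<Sum>b\<in>UNIV. pd a (pd b f) ?y * pd i \<Phi> x $ a * pd j \<Phi> x $ b)"
    by (rule sum.swap)
  finally have 1: "pd i (pd j (\<lambda>x. f (\<Phi> x))) x =
      (\<Sum>a\<in>UNIV. \<Sum>b\<in>UNIV. pd a (pd b f) ?y * pd i \<Phi> x $ a * pd j \<Phi> x $ b)
      + (\<Sum>a\<in>UNIV. pd a f ?y * pd i (pd j \<Phi>) x $ a)" .
  have 2: "inner_with (hess G f ?y) (pd i \<Phi> x) (pd j \<Phi> x) =
      (\<Sum>a\<in>UNIV. \<Sum>b\<in>UNIV. pd a (pd b f) ?y * pd i \<Phi> x $ a * pd j \<Phi> x $ b)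
      - (\<Sum>a\<in>UNIV. \<Sum>b\<in>UNIV. \<Sum>k\<in>UNIV. pd k f ?y * (chr G k a b ?y * pd i \<Phi> x $ a * pd j \<Phi> x $ b))"
    by (simp add: inner_with_sum hess_def sum_subtractf sum_distrib_left algebra_simps)
  have 3: "dirder f ?y ?D = (\<Sum>a\<in>UNIV. pd a f ?y * pd i (pd j \<Phi>) x $ a)
      + (\<Sum>k\<in>UNIV. \<Sum>a\<in>UNIV. \<Sum>b\<in>UNIV. pd k f ?y * (chr G k a b ?y * pd i \<Phi> x $ a * pd j \<Phi> x $ b))"
    by (simp add: dirder_def cov_def Gam_def distrib_left sum.distrib sum_distrib_left)
  have lin: "linear (dirder f ?y)"
    by (auto intro!: linearI simp: dirder_def distrib_left sum.distrib sum_distrib_left mult_ac)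
  have fx: "dirder f ?y (pd k \<Phi> x) = pd k (\<lambda>x. f (\<Phi> x)) x" for k
    by (simp add: dirder_def pd_comp[OF f x])
  have ch: "chr H k i j x = (\<Sum>l\<in>UNIV. Hi x $ k $ l * inner_with (G ?y) ?D (pd l \<Phi> x))" for k
    by (simp add: chr_def pullback_chr1[OF x])
  have "?D = (\<Sum>k\<in>UNIV. chr H k i j x *\<^sub>R pd k \<Phi> x) + II i j x n *\<^sub>R n"
    using fr unfolding frame_def ch II_def by (simp add: scaleR_sum_left)
  then have "dirder f ?y ?D = dirder f ?y ((\<Sum>k\<in>UNIV. chr H k i j x *\<^sub>R pd k \<Phi> x) + II i j x n *\<^sub>R n)"
    by simp
  also have "\<dots> = (\<Sum>k\<in>UNIV. chr H k i j x * pd k (\<lambda>x. f (\<Phi> x)) x) + II i j x n * dirder f ?y n"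
    by (simp add: linear_add[OF lin] linear_sum[OF lin] linear_scale[OF lin] fx)
  finally have 4: "dirder f ?y ?D =
      (\<Sum>k\<in>UNIV. chr H k i j x * pd k (\<lambda>x. f (\<Phi> x)) x) + II i j x n * dirder f ?y n" .
  have "(\<Sum>a\<in>UNIV. \<Sum>b\<in>UNIV. \<Sum>k\<in>UNIV. pd k f ?y * (chr G k a b ?y * pd i \<Phi> x $ a * pd j \<Phi> x $ b)) =
      (\<Sum>k\<in>UNIV. \<Sum>a\<in>UNIV. \<Sum>b\<in>UNIV. pd k f ?y * (chr G k a b ?y * pd i \<Phi> x $ a * pd j \<Phi> x $ b))"
    by (rule sum_rotate3)
  then show ?thesis using 1 2 3 4 by (simp add: hess_def)
qed

lemma laplacian_pullback:
  assumes f: "smooth_on W f"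
  shows "(\<Sum>i\<in>UNIV. \<Sum>j\<in>UNIV. Hi x $ i $ j * hess H (\<lambda>x. f (\<Phi> x)) x $ i $ j) =
    (\<Sum>a\<in>UNIV. \<Sum>b\<in>UNIV. matrix_inv (G (\<Phi> x)) $ a $ b * hess G f (\<Phi> x) $ a $ b)
    - inner_with (hess G f (\<Phi> x)) n n
    + (\<Sum>i\<in>UNIV. \<Sum>j\<in>UNIV. Hi x $ i $ j * II i j x n) * dirder f (\<Phi> x) n"
  unfolding frame_metric_trace[OF fr sym[OF maps[OF x]]] hess_pullback[OF f]
  by (simp add: distrib_left sum.distrib sum_distrib_left sum_distrib_right mult_ac)

text \<open>The ambient trace is taken twice in the adapted frame. Terms with two normals occur once
  inside the tangential Ricci traces and once as Ric(n,n), hence the factor 2; the purely tangential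
  terms are evaluated by \<open>gauss\<close>.\<close>

lemma scal_gauss:
  "scal G (\<Phi> x) = scal H x + 2 * inner_with (ric G (\<Phi> x)) n n
    - (\<Sum>i\<in>UNIV. \<Sum>j\<in>UNIV. Hi x $ i $ j * II i j x n)\<^sup>2
    + (\<Sum>i\<in>UNIV. \<Sum>j\<in>UNIV. \<Sum>k\<in>UNIV. \<Sum>l\<in>UNIV.
        Hi x $ i $ k * Hi x $ j $ l * II i j x n * II k l x n)"
proof -
  let ?y = "\<Phi> x" and ?R = "rlow G (\<Phi> x)" and ?e = "\<lambda>i. pd i \<Phi> x" and ?h = "Hi x"
  let ?B = "\<lambda>i j. II i j x n"
  let ?S = "\<lambda>f. \<Sum>j\<in>UNIV. \<Sum>k\<in>UNIV. \<Sum>i\<in>UNIV. \<Sum>l\<in>UNIV. f i j k l :: real"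
  note y = maps[OF x]
  \<comment> \<open>Skew symmetry in both pairs moves the normals from the outer to the inner slots,
    where they form summands of Ric(n,n).\<close>
  have sk: "?R n v w n = ?R v n n w" for v w
    using rlow_skew12[of G ?y n v w n] rlow_skew34_vec[OF y, of v n w n] by simp
  have nn: "?R n n n n = 0" using rlow_skew12[of G ?y n n n n] by simp
  have a: "inner_with (ric G ?y) n n = (\<Sum>i\<in>UNIV. \<Sum>l\<in>UNIV. ?h $ i $ l * ?R (?e i) n n (?e l))"
    using ric_frame[OF y fr, of n n] nn by simp
  have "scal G ?y = (\<Sum>j\<in>UNIV. \<Sum>k\<in>UNIV. ?h $ j $ k * inner_with (ric G ?y) (?e j) (?e k))
      + inner_with (ric G ?y) n n"
    unfolding scal_def by (rule frame_metric_trace[OF fr sym[OF y]])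
  also have "(\<Sum>j\<in>UNIV. \<Sum>k\<in>UNIV. ?h $ j $ k * inner_with (ric G ?y) (?e j) (?e k)) =
      (\<Sum>j\<in>UNIV. \<Sum>k\<in>UNIV. ?h $ j $ k * (\<Sum>i\<in>UNIV. \<Sum>l\<in>UNIV. ?h $ i $ l * ?R (?e i) (?e j) (?e k) (?e l)))
      + (\<Sum>j\<in>UNIV. \<Sum>k\<in>UNIV. ?h $ j $ k * ?R (?e j) n n (?e k))"
    by (simp add: ric_frame[OF y fr] sk distrib_left sum.distrib)
  finally have 1: "scal G ?y =
      ?S (\<lambda>i j k l. ?h $ j $ k * ?h $ i $ l * ?R (?e i) (?e j) (?e k) (?e l))
      + 2 * inner_with (ric G ?y) n n"
    by (simp add: a sum_distrib_left mult.assoc)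
  have "ric H x $ j $ k = (\<Sum>i\<in>UNIV. \<Sum>l\<in>UNIV. ?h $ i $ l * rlow H x (axis i 1) (axis j 1) (axis k 1) (axis l 1))"
    for j k using pull.ric_rlow[OF x, of "axis j 1" "axis k 1"] by (simp add: inner_with_axis)
  then have 2: "scal H x =
      ?S (\<lambda>i j k l. ?h $ j $ k * ?h $ i $ l * rlow H x (axis i 1) (axis j 1) (axis k 1) (axis l 1))"
    by (simp add: scal_def sum_distrib_left mult.assoc)
  \<comment> \<open>The two quadratic expressions in \<open>II\<close> are brought to the index
    pattern of the double trace; the second one uses the symmetry of \<open>II\<close> and of the
    inverse metric.\<close>
  have 3: "(\<Sum>i\<in>UNIV. \<Sum>j\<in>UNIV. ?h $ i $ j * ?B i j)\<^sup>2 = ?S (\<lambda>i j k l. ?h $ j $ k * ?h $ i $ l * (?B j k * ?B i l))"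
    unfolding power2_eq_square sum_distrib_right unfolding sum_distrib_left by (simp add: mult_ac)
  have "(\<Sum>i\<in>UNIV. \<Sum>j\<in>UNIV. \<Sum>k\<in>UNIV. \<Sum>l\<in>UNIV. ?h $ i $ k * ?h $ j $ l * ?B i j * ?B k l) =
      (\<Sum>i\<in>UNIV. \<Sum>k\<in>UNIV. \<Sum>l\<in>UNIV. \<Sum>j\<in>UNIV. ?h $ i $ k * ?h $ j $ l * ?B i j * ?B k l)"
    by (intro sum.cong refl sum_rotate3[symmetric])
  also have "\<dots> = ?S (\<lambda>i j k l. ?h $ j $ k * ?h $ i $ l * (?B i k * ?B j l))"
    by (intro sum.cong refl)
       (simp add: Hi_sym[OF x, of _ i for i] II_sym[OF x] mult_ac)
  finally have 4: "(\<Sum>i\<in>UNIV. \<Sum>j\<in>UNIV. \<Sum>k\<in>UNIV. \<Sum>l\<in>UNIV. ?h $ i $ k * ?h $ j $ l * ?B i j * ?B k l) =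
      ?S (\<lambda>i j k l. ?h $ j $ k * ?h $ i $ l * (?B i k * ?B j l))" .
  show ?thesis
    unfolding 1 2 3 4 gauss by (simp add: algebra_simps sum.distrib sum_subtractf)
qed

end

end

section \<open>Charts\<close>

abbreviation chart_image :: "('a, 'n) chart \<Rightarrow> (real ^ 'n) set" where
  "chart_image c \<equiv> snd c ` fst c"

lemma chart_inv_left: "smooth_atlas \<A> \<Longrightarrow> c \<in> \<A> \<Longrightarrow> p \<in> fst c \<Longrightarrow> chart_inv c (snd c p) = p"
  unfolding smooth_atlas_def by (auto simp: homeomorphism_def)

lemma chart_inv_right: "z \<in> chart_image c \<Longrightarrow> snd c (chart_inv c z) = z"
  by (simp add: chart_inv_def f_inv_into_f)

lemma chart_inv_in: "z \<in> chart_image c \<Longrightarrow> chart_inv c z \<in> fst c"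
  by (simp add: chart_inv_def inv_into_into)

lemma open_chart: "smooth_atlas \<A> \<Longrightarrow> c \<in> \<A> \<Longrightarrow> open (fst c)"
  by (simp add: smooth_atlas_def)

lemma open_chart_image: "smooth_atlas \<A> \<Longrightarrow> c \<in> \<A> \<Longrightarrow> open (chart_image c)"
  by (simp add: smooth_atlas_def)

lemma continuous_on_chart: "smooth_atlas \<A> \<Longrightarrow> c \<in> \<A> \<Longrightarrow> continuous_on (fst c) (snd c)"
  by (auto simp: smooth_atlas_def homeomorphism_def)

lemma continuous_on_chart_inv: "smooth_atlas \<A> \<Longrightarrow> c \<in> \<A> \<Longrightarrow> continuous_on (chart_image c) (chart_inv c)"
  by (auto simp: smooth_atlas_def homeomorphism_def)

lemma chart_image_Int:
  assumes "smooth_atlas \<A>" "c \<in> \<A>"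
  shows "snd c ` (fst c \<inter> W) = chart_image c \<inter> chart_inv c -` W"
  using chart_inv_left[OF assms] by (auto simp: image_iff)

lemma open_chart_image_Int:
  assumes "smooth_atlas \<A>" "c \<in> \<A>" "open W"
  shows "open (snd c ` (fst c \<inter> W))"
  unfolding chart_image_Int[OF assms(1,2)]
  using continuous_open_preimage[OF continuous_on_chart_inv open_chart_image] assms by blast

lemma chart_at_in:
  assumes "smooth_atlas \<A>"
  shows "chart_at \<A> p \<in> \<A>" "p \<in> fst (chart_at \<A> p)"
proof -
  have "p \<in> (\<Union>c\<in>\<A>. fst c)" using assms by (simp add: smooth_atlas_def)
  then have "\<exists>c. c \<in> \<A> \<and> p \<in> fst c" by blast
  from someI_ex[OF this] show "chart_at \<A> p \<in> \<A>" "p \<in> fst (chart_at \<A> p)"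
    by (auto simp: chart_at_def)
qed

lemma coord_deriv_pd: "coord_deriv c i f p = pd i (f \<circ> chart_inv c) (snd c p)"
  by (simp add: coord_deriv_def pd_def)

section \<open>Locality\<close>

context
  fixes U :: "(real ^ 'n::finite) set" and G G' :: "real ^ 'n \<Rightarrow> real ^ 'n ^ 'n"
  assumes U: "open U" and eq: "\<And>x. x \<in> U \<Longrightarrow> G x = G' x"
begin

text \<open>The pulled back metric agrees with the metric of the chart on an open set only.
  Curvature and Hessian involve derivatives, so agreement near the point is what transfers
  them.\<close>

lemma chr1_cong: "x \<in> U \<Longrightarrow> chr1 G i j l x = chr1 G' i j l x"
proof -
  assume x: "x \<in> U"
  have "pd i (\<lambda>x. G x $ j $ l) x = pd i (\<lambda>x. G' x $ j $ l) x" for i j l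
    by (rule pd_cong[OF U x]) (simp add: eq)
  then show ?thesis by (simp add: chr1_def)
qed

lemma chr_cong: "x \<in> U \<Longrightarrow> chr G k i j x = chr G' k i j x"
  by (simp add: chr_def chr1_cong eq)

lemma riem_cong: "x \<in> U \<Longrightarrow> riem G i j k l x = riem G' i j k l x"
proof -
  assume x: "x \<in> U"
  have "pd i (chr G l j k) x = pd i (chr G' l j k) x" for i l j k
    by (rule pd_cong[OF U x]) (rule chr_cong)
  then show ?thesis by (simp add: riem_def chr_cong[OF x])
qed

lemma ric_cong: "x \<in> U \<Longrightarrow> ric G x = ric G' x"
  by (simp add: ric_def riem_cong)

lemma scal_cong: "x \<in> U \<Longrightarrow> scal G x = scal G' x"
  by (simp add: scal_def ric_cong eq)

lemma hess_cong:
  assumes "x \<in> U" "\<And>x. x \<in> U \<Longrightarrow> f x = f' x"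
  shows "hess G f x = hess G' f' x"
proof -
  have 1: "pd k f y = pd k f' y" if "y \<in> U" for k y
    by (rule pd_cong[OF U that assms(2)])
  have "pd i (pd j f) x = pd i (pd j f') x" for i j
    by (rule pd_cong[OF U assms(1) 1])
  then show ?thesis by (simp add: hess_def 1[OF assms(1)] chr_cong[OF assms(1)])
qed

end

section \<open>Geometry in a chart\<close>

abbreviation metric_in :: "('a, 'n) chart \<Rightarrow> ('a, 'n) metric \<Rightarrow> real ^ 'n \<Rightarrow> real ^ 'n ^ 'n" where
  "metric_in c g \<equiv> g c \<circ> chart_inv c"

lemma pos_def_det_nonzero:
  fixes M :: "real ^ 'n::finite ^ 'n"
  assumes "\<And>v. v \<noteq> 0 \<Longrightarrow> v \<bullet> (M *v v) > 0"
  shows "det M \<noteq> 0"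
proof -
  have "v = 0" if "M *v v = 0" for v
    using assms[of v] that by auto
  then have "inj ((*v) M)" by (simp add: linear_injective_0[of "(*v) M"])
  then show ?thesis by (metis det_nz_iff_inj matrix_of_matrix_vector_mul matrix_vector_mul_linear)
qed

lemma riemannian_metricD:
  assumes "riemannian_metric \<A> g" "c \<in> \<A>"
  shows "smooth_on (chart_image c) (metric_in c g)"
    and "p \<in> fst c \<Longrightarrow> g c p $ a $ b = g c p $ b $ a"
    and "p \<in> fst c \<Longrightarrow> v \<noteq> 0 \<Longrightarrow> v \<bullet> (g c p *v v) > 0"
    and "p \<in> fst c \<Longrightarrow> det (g c p) \<noteq> 0"
proof -
  note D = assms(1)[unfolded riemannian_metric_def, THEN conjunct1, THEN bspec, OF assms(2)]
  show "smooth_on (chart_image c) (metric_in c g)" by (rule D[THEN conjunct1])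
  note D = D[THEN conjunct2, THEN bspec]
  show "g c p $ a $ b = g c p $ b $ a" if "p \<in> fst c"
    using D[OF that, THEN conjunct1, THEN arg_cong, of "\<lambda>M. M $ b $ a"] by (simp add: transpose_def)
  show *: "v \<bullet> (g c p *v v) > 0" if "p \<in> fst c" "v \<noteq> 0" for v
    using D[OF that(1), THEN conjunct2] that(2) by simp
  show "det (g c p) \<noteq> 0" if "p \<in> fst c"
    by (rule pos_def_det_nonzero) (rule *[OF that])
qed

lemma metric_field_chart:
  assumes "smooth_atlas \<A>" "riemannian_metric \<A> g" "c \<in> \<A>"
  shows "metric_field (metric_in c g) (chart_image c)"
proof
  show "open (chart_image c)" using assms open_chart_image by blast
  show "smooth_on (chart_image c) (metric_in c g)" using riemannian_metricD assms by blast
  show "metric_in c g y $ a $ b = metric_in c g y $ b $ a" if "y \<in> chart_image c" for y a b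
    using riemannian_metricD(2)[OF assms(2,3) chart_inv_in[OF that]] by simp
  show "det (metric_in c g y) \<noteq> 0" if "y \<in> chart_image c" for y
    using riemannian_metricD(4)[OF assms(2,3) chart_inv_in[OF that]] by simp
qed

context
  fixes \<A> :: "('a::topological_space, 'n::finite) chart set" and c p
  assumes A: "smooth_atlas \<A>" "c \<in> \<A>" and p: "p \<in> fst c"
begin

lemma christoffel_chr: "christoffel c g k i j p = chr (metric_in c g) k i j (snd c p)"
  by (simp add: christoffel_def chr_def chr1_def coord_deriv_pd o_def sum_divide_distrib chart_inv_left[OF A p])

lemma snd_in_chart_image: "snd c p \<in> chart_image c"
  using p by simp

end

context
  fixes \<A> :: "('a::topological_space, 'n::finite) chart set" and c p
  assumes A: "smooth_atlas \<A>" "c \<in> \<A>" and p: "p \<in> fst c"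
begin

lemma riemann_riem: "riemann c g i j k l p = riem (metric_in c g) i j k l (snd c p)"
proof -
  have "coord_deriv c i (christoffel c g l j k) p = pd i (chr (metric_in c g) l j k) (snd c p)" for i l j k
    unfolding coord_deriv_pd
  proof (rule pd_cong[OF open_chart_image[OF A] snd_in_chart_image[OF A p]])
    fix z assume z: "z \<in> chart_image c"
    show "(christoffel c g l j k \<circ> chart_inv c) z = chr (metric_in c g) l j k z"
      using christoffel_chr[OF A chart_inv_in[OF z]] chart_inv_right[OF z] by simp
  qed
  then show ?thesis by (simp add: riemann_def riem_def christoffel_chr[OF A p])
qed

lemma ricci_ric: "ricci c g p = ric (metric_in c g) (snd c p)"
  by (simp add: ricci_def ric_def riemann_riem)

lemma hessian_hess: "hessian c g f p = hess (metric_in c g) (f \<circ> chart_inv c) (snd c p)"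
proof -
  have "coord_deriv c i (coord_deriv c j f) p = pd i (pd j (f \<circ> chart_inv c)) (snd c p)" for i j
    unfolding coord_deriv_pd[of c i]
  proof (rule pd_cong[OF open_chart_image[OF A] snd_in_chart_image[OF A p]])
    fix z assume z: "z \<in> chart_image c"
    show "(coord_deriv c j f \<circ> chart_inv c) z = pd j (f \<circ> chart_inv c) z"
      by (simp add: coord_deriv_pd chart_inv_right[OF z])
  qed
  then show ?thesis by (simp add: hessian_def hess_def christoffel_chr[OF A p] coord_deriv_pd)
qed

lemma metric_trace_ricci: "metric_trace c g (ricci c g p) p = scal (metric_in c g) (snd c p)"
  by (simp add: metric_trace_def scal_def ricci_ric chart_inv_left[OF A p])

end

section \<open>Isometric immersions in charts\<close>

text \<open>An isometric immersion read in one pair of charts. With F the identity it is a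
  coordinate change of a single manifold; with F the given immersion it relates the surface to the
  ambient space.\<close>

locale chart_map =
  fixes \<A> :: "('s::topological_space, 'm::finite) chart set" and h :: "('s, 'm) metric"
    and \<B> :: "('a::topological_space, 'n::finite) chart set" and g :: "('a, 'n) metric"
    and F :: "'s \<Rightarrow> 'a" and c d
  assumes A: "smooth_atlas \<A>" and B: "smooth_atlas \<B>"
    and hR: "riemannian_metric \<A> h" and gR: "riemannian_metric \<B> g"
    and F: "continuous_on UNIV F" and c: "c \<in> \<A>" and d: "d \<in> \<B>"
    and smooth_F: "smooth_on (snd c ` (fst c \<inter> F -` fst d)) (snd d \<circ> F \<circ> chart_inv c)"
    and iso: "\<And>p i j. p \<in> fst c \<Longrightarrow> F p \<in> fst d \<Longrightarrow> h c p $ i $ j =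
      inner_with (g d (F p)) (coord_deriv c i (snd d \<circ> F) p) (coord_deriv c j (snd d \<circ> F) p)"
begin

abbreviation "\<Phi> \<equiv> snd d \<circ> F \<circ> chart_inv c"
abbreviation "U \<equiv> snd c ` (fst c \<inter> F -` fst d)"

lemma U_in: "x \<in> U \<Longrightarrow> chart_inv c x \<in> fst c \<and> F (chart_inv c x) \<in> fst d \<and> snd c (chart_inv c x) = x"
  using chart_inv_left[OF A c] by auto

lemma open_U: "open U"
proof -
  have "open (F -` fst d)" using F open_chart[OF B d] by (simp add: open_vimage)
  then show ?thesis by (rule open_chart_image_Int[OF A c])
qed

lemma pullback_eq:
  assumes "x \<in> U"
  shows "pullback \<Phi> (metric_in d g) x = metric_in c h x"
proof -
  have x: "snd c (chart_inv c x) = x" "F (chart_inv c x) \<in> fst d" using U_in[OF assms] by auto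
  have "h c (chart_inv c x) $ i $ j = inner_with (g d (F (chart_inv c x))) (pd i \<Phi> x) (pd j \<Phi> x)" for i j
    using iso[of "chart_inv c x" i j] U_in[OF assms] unfolding coord_deriv_pd x(1) comp_assoc by blast
  then have "pullback \<Phi> (metric_in d g) x $ i $ j = metric_in c h x $ i $ j" for i j
    by (simp add: pullback_def chart_inv_left[OF B d x(2)])
  then show ?thesis by (simp only: vec_eq_iff) blast
qed

sublocale metric_immersion "metric_in d g" "chart_image d" \<Phi> U
proof -
  interpret G: metric_field "metric_in d g" "chart_image d"
    by (rule metric_field_chart[OF B gR d])
  show "metric_immersion (metric_in d g) (chart_image d) \<Phi> U"
  proof
    show "open U" by (rule open_U)
    show "smooth_on U \<Phi>" by (rule smooth_F)
    show "\<Phi> x \<in> chart_image d" if "x \<in> U" for x using U_in[OF that] by simp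
    show "det (pullback \<Phi> (metric_in d g) x) \<noteq> 0" if "x \<in> U" for x
      unfolding pullback_eq[OF that] using riemannian_metricD(4)[OF hR c] U_in[OF that] by simp
  qed
qed

context
  fixes p n
  assumes p: "p \<in> fst c" "F p \<in> fst d"
    and fr: "frame (g d (F p)) (matrix_inv (h c p)) (\<lambda>i. coord_deriv c i (snd d \<circ> F) p) n"
begin

lemma pU: "snd c p \<in> U" using p by auto

lemma \<Phi>p: "\<Phi> (snd c p) = snd d (F p)" using chart_inv_left[OF A c p(1)] by simp

lemma fr': "frame (metric_in d g (\<Phi> (snd c p))) (matrix_inv (pullback \<Phi> (metric_in d g) (snd c p)))
    (\<lambda>i. pd i \<Phi> (snd c p)) n"
  using fr chart_inv_left[OF A c p(1)] chart_inv_left[OF B d p(2)]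
  unfolding pullback_eq[OF pU] by (simp add: coord_deriv_pd comp_assoc)

lemma scal_chart: "scal (metric_in d g) (snd d (F p)) = scal (metric_in c h) (snd c p)
    + 2 * inner_with (ricci d g (F p)) n n
    - (\<Sum>i\<in>UNIV. \<Sum>j\<in>UNIV. matrix_inv (h c p) $ i $ j * II i j (snd c p) n)\<^sup>2
    + (\<Sum>i\<in>UNIV. \<Sum>j\<in>UNIV. \<Sum>k\<in>UNIV. \<Sum>l\<in>UNIV.
        matrix_inv (h c p) $ i $ k * matrix_inv (h c p) $ j $ l * II i j (snd c p) n * II k l (snd c p) n)"
  using scal_gauss[OF pU fr']
  unfolding pullback_eq[OF pU] \<Phi>p ricci_ric[OF B d p(2)]
  by (simp add: chart_inv_left[OF A c p(1)] scal_cong[where G=H and G'="metric_in c h", OF open_U pullback_eq pU])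

lemma laplacian_chart:
  assumes "smooth_on (chart_image d) (f \<circ> chart_inv d)"
  shows "metric_trace c h (hessian c h (f \<circ> F) p) p =
    metric_trace d g (hessian d g f (F p)) (F p) - inner_with (hessian d g f (F p)) n n
    + (\<Sum>i\<in>UNIV. \<Sum>j\<in>UNIV. matrix_inv (h c p) $ i $ j * II i j (snd c p) n)
      * dirder (f \<circ> chart_inv d) (snd d (F p)) n"
proof -
  have eq: "(f \<circ> chart_inv d) (\<Phi> x) = (f \<circ> F \<circ> chart_inv c) x" if "x \<in> U" for x
    using U_in[OF that] by (simp add: chart_inv_left[OF B d])
  have "hess (pullback \<Phi> (metric_in d g)) (\<lambda>x. (f \<circ> chart_inv d) (\<Phi> x)) (snd c p) =
      hessian c h (f \<circ> F) p"
    unfolding hessian_hess[OF A c p(1)] by (rule hess_cong[OF open_U pullback_eq pU eq])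
  then show ?thesis
    using laplacian_pullback[OF pU fr' assms]
    unfolding pullback_eq[OF pU] \<Phi>p metric_trace_def hessian_hess[OF B d p(2)]
    by (simp add: chart_inv_left[OF A c p(1)] chart_inv_left[OF B d p(2)])
qed

text \<open>Differentiability is asked for at the one point, because piecewise smooth functions are
  differentiable just almost everywhere.\<close>

lemma grad_chart:
  assumes "f \<circ> chart_inv d differentiable at (snd d (F p))" "k \<circ> chart_inv d differentiable at (snd d (F p))"
  shows "(\<Sum>a\<in>UNIV. \<Sum>b\<in>UNIV. matrix_inv (g d (F p)) $ a $ b * coord_deriv d a f (F p) * coord_deriv d b k (F p)) =
    (\<Sum>i\<in>UNIV. \<Sum>j\<in>UNIV. matrix_inv (h c p) $ i $ j * coord_deriv c i (f \<circ> F) p * coord_deriv c j (k \<circ> F) p)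
    + dirder (f \<circ> chart_inv d) (snd d (F p)) n * dirder (k \<circ> chart_inv d) (snd d (F p)) n"
proof -
  let ?y = "snd d (F p)"
  have ch: "coord_deriv c i (f \<circ> F) p = dirder (f \<circ> chart_inv d) ?y (coord_deriv c i (snd d \<circ> F) p)"
    if "f \<circ> chart_inv d differentiable at ?y" for f :: "'a \<Rightarrow> real" and i
  proof -
    have "coord_deriv c i (f \<circ> F) p = pd i (\<lambda>x. (f \<circ> chart_inv d) (\<Phi> x)) (snd c p)"
      unfolding coord_deriv_pd
      by (rule pd_cong[OF open_U pU]) (use U_in in \<open>auto simp: chart_inv_left[OF B d]\<close>)
    also have "\<dots> = (\<Sum>a\<in>UNIV. pd a (f \<circ> chart_inv d) (\<Phi> (snd c p)) * pd i \<Phi> (snd c p) $ a)"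
      by (rule pd_compose[OF smooth_on_differentiable[OF smooth_F pU]]) (unfold \<Phi>p, rule that)
    finally show ?thesis unfolding \<Phi>p by (simp only: dirder_def coord_deriv_pd comp_assoc)
  qed
  have lin: "linear (dirder f y)" for f :: "real ^ 'n \<Rightarrow> real" and y
    by (auto intro!: linearI simp: dirder_def distrib_left sum.distrib sum_distrib_left mult_ac)
  have ax: "dirder f y (axis a 1) = pd a f y" for f :: "real ^ 'n \<Rightarrow> real" and y a
    by (simp add: dirder_def axis_def if_distrib[of "\<lambda>x. _ * x"] cong: if_cong)
  have "(\<Sum>a\<in>UNIV. \<Sum>b\<in>UNIV. matrix_inv (g d (F p)) $ a $ b *
      (dirder (f \<circ> chart_inv d) ?y (axis a 1) * dirder (k \<circ> chart_inv d) ?y (axis b 1))) =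
    (\<Sum>i\<in>UNIV. \<Sum>j\<in>UNIV. matrix_inv (h c p) $ i $ j *
      (dirder (f \<circ> chart_inv d) ?y (coord_deriv c i (snd d \<circ> F) p) *
       dirder (k \<circ> chart_inv d) ?y (coord_deriv c j (snd d \<circ> F) p)))
    + dirder (f \<circ> chart_inv d) ?y n * dirder (k \<circ> chart_inv d) ?y n"
  proof (rule frame_trace[OF fr riemannian_metricD(2)[OF gR d p(2)]])
    show "linear (\<lambda>u. dirder (f \<circ> chart_inv d) ?y u * dirder (k \<circ> chart_inv d) ?y v)" for v
      by (auto intro!: linearI simp: linear_add[OF lin] linear_scale[OF lin] distrib_right)
    show "linear (\<lambda>v. dirder (f \<circ> chart_inv d) ?y u * dirder (k \<circ> chart_inv d) ?y v)" for u
      by (auto intro!: linearI simp: linear_add[OF lin] linear_scale[OF lin] distrib_left)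
  qed
  then show ?thesis
    by (simp add: ax ch assms coord_deriv_pd[of d] mult.assoc)
qed

end

end

section \<open>Independence of the chart\<close>

text \<open>The inner product of the two gradients, the polarization of
  \<open>grad_norm_sq\<close>.\<close>

definition gip ::
    "('a, 'n::finite) chart set \<Rightarrow> ('a, 'n) metric \<Rightarrow> ('a \<Rightarrow> real) \<Rightarrow> ('a \<Rightarrow> real) \<Rightarrow> 'a \<Rightarrow> real" where
  "gip \<A> g f k p = (let c = chart_at \<A> p in inner_with (g c p) (grad c g f p) (grad c g k p))"

lemma grad_norm_sq_gip: "grad_norm_sq \<A> g f p = gip \<A> g f f p"
  by (simp add: grad_norm_sq_def gip_def)

definition differentiable_fun :: "('a, 'n::finite) chart set \<Rightarrow> ('a \<Rightarrow> real) \<Rightarrow> 'a \<Rightarrow> bool" where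
  "differentiable_fun \<A> f p \<longleftrightarrow> (\<forall>c\<in>\<A>. p \<in> fst c \<longrightarrow> (f \<circ> chart_inv c) differentiable at (snd c p))"

lemma smooth_fun_iff: "smooth_fun \<A> f \<longleftrightarrow> (\<forall>c\<in>\<A>. smooth_on (chart_image c) (f \<circ> chart_inv c))"
  by (simp add: smooth_fun_on_def)

lemma smooth_fun_differentiable:
  assumes "smooth_fun \<A> f" shows "differentiable_fun \<A> f p"
  unfolding differentiable_fun_def
proof (intro ballI impI)
  fix c assume "c \<in> \<A>" "p \<in> fst c"
  then show "(f \<circ> chart_inv c) differentiable at (snd c p)"
    using assms smooth_on_differentiable[of "chart_image c" "f \<circ> chart_inv c" "snd c p"]
    by (auto simp: smooth_fun_iff)
qed

locale riemannian =
  fixes \<A> :: "('a::topological_space, 'n::finite) chart set" and g :: "('a, 'n) metric"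
  assumes A: "smooth_atlas \<A>" and R: "riemannian_metric \<A> g"
begin

text \<open>The transformation law of the metric says precisely that the identity, read in two
  charts, is isometric. Chart independence thus becomes the codimension 0 case of the immersion
  formulas.\<close>

lemma chart_map_transition:
  assumes "c \<in> \<A>" "d \<in> \<A>"
  shows "chart_map \<A> g \<A> g (\<lambda>x. x) c d"
proof
  have o: "snd d \<circ> (\<lambda>x. x) = snd d" by (simp add: fun_eq_iff)
  show "smooth_on (snd c ` (fst c \<inter> (\<lambda>x. x) -` fst d)) (snd d \<circ> (\<lambda>x. x) \<circ> chart_inv c)"
    using A assms by (simp add: smooth_atlas_def o)
  fix p i j assume p: "p \<in> fst c" "p \<in> fst d"
  let ?T = "transition_deriv c d p"
  have T: "coord_deriv c i (snd d) p $ a = ?T $ a $ i" for i a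
    by (simp add: coord_deriv_def transition_deriv_def matrix_def)
  have "g c p = transpose ?T ** g d p ** ?T"
    using R assms p unfolding riemannian_metric_def by blast
  then have "g c p $ i $ j = (transpose ?T ** g d p ** ?T) $ i $ j" by simp
  also have "\<dots> = (\<Sum>b\<in>UNIV. \<Sum>a\<in>UNIV. ?T $ a $ i * g d p $ a $ b * ?T $ b $ j)"
    by (simp add: matrix_matrix_mult_def transpose_def sum_distrib_right)
  also have "\<dots> = inner_with (g d p) (coord_deriv c i (snd d) p) (coord_deriv c j (snd d) p)"
    unfolding inner_with_sum T by (rule sum.swap)
  finally show "g c p $ i $ j = inner_with (g d p) (coord_deriv c i (snd d \<circ> (\<lambda>x. x)) p)
      (coord_deriv c j (snd d \<circ> (\<lambda>x. x)) p)"
    by (simp add: o)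
qed (use A R assms in auto)

lemma matrix_inv_mult:
  assumes "c \<in> \<A>" "p \<in> fst c"
  shows "matrix_inv (g c p) ** g c p = mat 1" "g c p ** matrix_inv (g c p) = mat 1"
  using riemannian_metricD(4)[OF R assms] invertible_det_nz invertible_mat_inv by blast+

lemma frame_transition:
  assumes "c \<in> \<A>" "d \<in> \<A>" "p \<in> fst c" "p \<in> fst d"
  shows "frame (g d p) (matrix_inv (g c p)) (\<lambda>i. coord_deriv c i (snd d \<circ> (\<lambda>x. x)) p) 0"
proof -
  interpret chart_map \<A> g \<A> g "\<lambda>x. x" c d by (rule chart_map_transition[OF assms(1,2)])
  show ?thesis
    by (rule frame_codim0[OF matrix_inv_mult(1)[OF assms(1,3)] iso[OF assms(3,4)]
        riemannian_metricD(2)[OF R assms(1,3)]])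
qed

lemma scal_invariant:
  assumes "c \<in> \<A>" "d \<in> \<A>" "p \<in> fst c" "p \<in> fst d"
  shows "scal (metric_in d g) (snd d p) = scal (metric_in c g) (snd c p)"
proof -
  interpret chart_map \<A> g \<A> g "\<lambda>x. x" c d by (rule chart_map_transition[OF assms(1,2)])
  show ?thesis
    using scal_chart[OF assms(3,4) frame_transition[OF assms]] by (simp add: II_def)
qed

lemma laplacian_invariant:
  assumes "c \<in> \<A>" "d \<in> \<A>" "p \<in> fst c" "p \<in> fst d" "smooth_fun \<A> f"
  shows "metric_trace d g (hessian d g f p) p = metric_trace c g (hessian c g f p) p"
proof -
  interpret chart_map \<A> g \<A> g "\<lambda>x. x" c d by (rule chart_map_transition[OF assms(1,2)])
  have f: "smooth_on (chart_image d) (f \<circ> chart_inv d)" using assms by (simp add: smooth_fun_iff)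
  show ?thesis
    using laplacian_chart[OF assms(3,4) frame_transition[OF assms(1-4)] f]
    by (simp add: dirder_def o_def)
qed

lemma gip_chart_at:
  "gip \<A> g f k p = (let c = chart_at \<A> p in
    \<Sum>i\<in>UNIV. \<Sum>j\<in>UNIV. matrix_inv (g c p) $ i $ j * coord_deriv c i f p * coord_deriv c j k p)"
proof -
  define c where "c = chart_at \<A> p"
  let ?I = "matrix_inv (g c p)" and ?v = "\<lambda>f. \<chi> i. coord_deriv c i f p"
  have c: "c \<in> \<A>" "p \<in> fst c" using chart_at_in[OF A] by (auto simp: c_def)
  have sy: "?I $ i $ j = ?I $ j $ i" for i j
    by (rule matrix_inv_symmetric[OF riemannian_metricD(4,2)[OF R c]])
  have "gip \<A> g f k p = (?I *v ?v f) \<bullet> (g c p *v (?I *v ?v k))"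
    by (simp add: gip_def inner_with_def grad_def Let_def c_def)
  also have "g c p *v (?I *v ?v k) = ?v k"
    by (simp add: matrix_vector_mul_assoc matrix_inv_mult(2)[OF c])
  also have "(?I *v ?v f) \<bullet> ?v k = (\<Sum>j\<in>UNIV. \<Sum>i\<in>UNIV. ?I $ i $ j * coord_deriv c i f p * coord_deriv c j k p)"
    by (simp add: inner_vec_def matrix_vector_mult_def sum_distrib_right sy)
  also have "\<dots> = (\<Sum>i\<in>UNIV. \<Sum>j\<in>UNIV. ?I $ i $ j * coord_deriv c i f p * coord_deriv c j k p)"
    by (rule sum.swap)
  finally show ?thesis unfolding Let_def c_def .
qed

lemma gip_in_chart:
  assumes "c \<in> \<A>" "p \<in> fst c" "differentiable_fun \<A> f p" "differentiable_fun \<A> k p"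
  shows "gip \<A> g f k p =
    (\<Sum>i\<in>UNIV. \<Sum>j\<in>UNIV. matrix_inv (g c p) $ i $ j * coord_deriv c i f p * coord_deriv c j k p)"
proof -
  define d where "d = chart_at \<A> p"
  have dA: "d \<in> \<A>" "p \<in> fst d" using chart_at_in[OF A] by (auto simp: d_def)
  interpret chart_map \<A> g \<A> g "\<lambda>x. x" c d by (rule chart_map_transition[OF assms(1) dA(1)])
  have "f \<circ> chart_inv d differentiable at (snd d p)" "k \<circ> chart_inv d differentiable at (snd d p)"
    using assms(3,4) dA unfolding differentiable_fun_def by blast+
  from grad_chart[OF assms(2) dA(2) frame_transition[OF assms(1) dA(1) assms(2) dA(2)] this]
  show ?thesis by (simp add: gip_chart_at Let_def d_def[symmetric] dirder_def o_def)
qed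

text \<open>With \<open>n = 0\<close> the Gauss equation equates the curvature tensors of both
  charts on the transported coordinate vectors, and these form a frame in which the trace is
  taken.\<close>

lemma ricci_invariant:
  assumes "c \<in> \<A>" "d \<in> \<A>" "p \<in> fst c" "p \<in> fst d"
  shows "inner_with (ricci d g p) (transition_deriv c d p *v v) (transition_deriv c d p *v v) =
    inner_with (ricci c g p) v v"
proof -
  interpret chart_map \<A> g \<A> g "\<lambda>x. x" c d by (rule chart_map_transition[OF assms(1,2)])
  let ?x = "snd c p" and ?y = "snd d p"
  note fr = frame_transition[OF assms]
  note pU = pU[OF assms(3,4) fr]
  note fr' = fr'[OF assms(3,4) fr]
  have y: "?y \<in> chart_image d" and x: "?x \<in> chart_image c" using assms by auto
  have eqx: "\<Phi> ?x = ?y" using \<Phi>p[OF assms(3,4) fr] .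
  have H: "matrix_inv (pullback \<Phi> (metric_in d g) ?x) = matrix_inv (g c p)"
    unfolding pullback_eq[OF pU] by (simp add: chart_inv_left[OF A assms(1,3)])
  have jk: "inner_with (ricci d g p) (pd j \<Phi> ?x) (pd k \<Phi> ?x) = ricci c g p $ j $ k" for j k
  proof -
    have "inner_with (ric (metric_in d g) (\<Phi> ?x)) (pd j \<Phi> ?x) (pd k \<Phi> ?x) =
        inner_with (ric (pullback \<Phi> (metric_in d g)) ?x) (axis j 1) (axis k 1)"
      unfolding ric_frame[OF y[folded eqx] fr'] pull.ric_rlow[OF pU] gauss[OF pU fr']
      using linear_0[OF rlow_linear(1)[of "metric_in d g" "\<Phi> ?x"]] by (simp add: II_def)
    also have "\<dots> = inner_with (ric (metric_in c g) ?x) (axis j 1) (axis k 1)"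
      using ric_cong[where G = "pullback \<Phi> (metric_in d g)" and G' = "metric_in c g",
          OF open_U pullback_eq pU] by simp
    finally show ?thesis
      unfolding eqx ricci_ric[OF A assms(2,4)] ricci_ric[OF A assms(1,3)] by (simp add: inner_with_axis)
  qed
  have T: "(transition_deriv c d p *v v) = (\<Sum>j\<in>UNIV. v $ j *\<^sub>R pd j \<Phi> ?x)"
    by (simp add: vec_eq_iff matrix_vector_mult_def transition_deriv_def matrix_def pd_def o_def mult.commute)
  have "inner_with (ricci d g p) (transition_deriv c d p *v v) (transition_deriv c d p *v v) =
      (\<Sum>k\<in>UNIV. \<Sum>j\<in>UNIV. v $ j * ricci c g p $ j $ k * v $ k)"
    unfolding T
    by (simp add: inner_with_sum_left inner_with_sum_right inner_with_scale_left inner_with_scale_right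
        jk sum_distrib_left mult_ac)
  also have "\<dots> = inner_with (ricci c g p) v v"
    unfolding inner_with_sum by (rule sum.swap)
  finally show ?thesis .
qed

lemma scalar_curvature_chart:
  assumes "c \<in> \<A>" "p \<in> fst c"
  shows "scalar_curvature \<A> g p = scal (metric_in c g) (snd c p)"
  using scal_invariant[OF assms(1) chart_at_in(1)[OF A] assms(2) chart_at_in(2)[OF A]]
    metric_trace_ricci[OF A chart_at_in[OF A]]
  by (simp add: scalar_curvature_def Let_def)

lemma laplacian_chart_eq:
  assumes "c \<in> \<A>" "p \<in> fst c" "smooth_fun \<A> f"
  shows "laplacian \<A> g f p = metric_trace c g (hessian c g f p) p"
  using laplacian_invariant[OF assms(1) chart_at_in(1)[OF A] assms(2) chart_at_in(2)[OF A] assms(3)]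
  by (simp add: laplacian_def Let_def)

lemma smooth_fun_scalar_curvature: "smooth_fun \<A> (scalar_curvature \<A> g)"
  unfolding smooth_fun_iff
proof
  fix c assume c: "c \<in> \<A>"
  interpret metric_field "metric_in c g" "chart_image c" by (rule metric_field_chart[OF A R c])
  have "smooth_on (chart_image c) (scal (metric_in c g))"
    unfolding scal_def[abs_def] ric_def vec_lambda_beta
    by (intro smooth_on_sum smooth_on_mult smooth_on_matrix_inv smooth_G nondeg smooth_riem W)
  then show "smooth_on (chart_image c) (scalar_curvature \<A> g \<circ> chart_inv c)"
    by (subst smooth_on_cong[OF W, of _ "scal (metric_in c g)"])
       (simp_all add: scalar_curvature_chart[OF c chart_inv_in] chart_inv_right)
qed

lemma smooth_fun_laplacian: 
  assumes "smooth_fun \<A> f"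
  shows "smooth_fun \<A> (laplacian \<A> g f)"
  unfolding smooth_fun_iff
proof
  fix c assume c: "c \<in> \<A>"
  interpret metric_field "metric_in c g" "chart_image c" by (rule metric_field_chart[OF A R c])
  have f: "smooth_on (chart_image c) (f \<circ> chart_inv c)" using assms c by (simp add: smooth_fun_iff)
  have "smooth_on (chart_image c) (\<lambda>x. \<Sum>i\<in>UNIV. \<Sum>j\<in>UNIV.
      matrix_inv (metric_in c g x) $ i $ j * hess (metric_in c g) (f \<circ> chart_inv c) x $ i $ j)"
    unfolding hess_def vec_lambda_beta
    by (intro smooth_on_sum smooth_on_mult smooth_on_diff smooth_on_pd smooth_on_matrix_inv smooth_G
        nondeg smooth_chr f W)
  then show "smooth_on (chart_image c) (laplacian \<A> g f \<circ> chart_inv c)"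
    by (subst smooth_on_cong[OF W, of _ "\<lambda>x. \<Sum>i\<in>UNIV. \<Sum>j\<in>UNIV.
        matrix_inv (metric_in c g x) $ i $ j * hess (metric_in c g) (f \<circ> chart_inv c) x $ i $ j"])
       (simp_all add: laplacian_chart_eq[OF c chart_inv_in assms] metric_trace_def
         hessian_hess[OF A c chart_inv_in] chart_inv_right)
qed

lemma smooth_fun_gip:
  assumes "smooth_fun \<A> f" "smooth_fun \<A> k"
  shows "smooth_fun \<A> (gip \<A> g f k)"
  unfolding smooth_fun_iff
proof
  fix c assume c: "c \<in> \<A>"
  interpret metric_field "metric_in c g" "chart_image c" by (rule metric_field_chart[OF A R c])
  have f: "smooth_on (chart_image c) (f \<circ> chart_inv c)" "smooth_on (chart_image c) (k \<circ> chart_inv c)"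
    using assms c by (auto simp: smooth_fun_iff)
  have "smooth_on (chart_image c) (\<lambda>x. \<Sum>i\<in>UNIV. \<Sum>j\<in>UNIV.
      matrix_inv (metric_in c g x) $ i $ j * pd i (f \<circ> chart_inv c) x * pd j (k \<circ> chart_inv c) x)"
    by (intro smooth_on_sum smooth_on_mult smooth_on_pd smooth_on_matrix_inv smooth_G nondeg f W)
  then show "smooth_on (chart_image c) (gip \<A> g f k \<circ> chart_inv c)"
    by (subst smooth_on_cong[OF W, of _ "\<lambda>x. \<Sum>i\<in>UNIV. \<Sum>j\<in>UNIV.
        matrix_inv (metric_in c g x) $ i $ j * pd i (f \<circ> chart_inv c) x * pd j (k \<circ> chart_inv c) x"])
       (simp_all add: gip_in_chart[OF c chart_inv_in] smooth_fun_differentiable[OF assms(1)]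
         smooth_fun_differentiable[OF assms(2)] coord_deriv_pd chart_inv_right)
qed

end

lemma smooth_fun_compose:
  assumes A: "smooth_atlas \<A>" and B: "smooth_atlas \<B>" and F: "continuous_on UNIV F"
    and smooth: "\<And>c d. c \<in> \<A> \<Longrightarrow> d \<in> \<B> \<Longrightarrow>
      smooth_on (snd c ` (fst c \<inter> F -` fst d)) (snd d \<circ> F \<circ> chart_inv c)"
    and f: "smooth_fun \<B> f"
  shows "smooth_fun \<A> (f \<circ> F)"
  unfolding smooth_fun_iff
proof (intro ballI smooth_on_local)
  fix c x assume c: "c \<in> \<A>" and x: "x \<in> chart_image c"
  define d where "d = chart_at \<B> (F (chart_inv c x))"
  have d: "d \<in> \<B>" "F (chart_inv c x) \<in> fst d" using chart_at_in[OF B] by (auto simp: d_def)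
  let ?U = "snd c ` (fst c \<inter> F -` fst d)"
  have U: "open ?U"
    by (rule open_chart_image_Int[OF A c]) (simp add: F open_chart[OF B d(1)] open_vimage)
  have "x \<in> ?U" using d(2) chart_inv_in[OF x] chart_inv_right[OF x] by force
  moreover have "smooth_on ?U (f \<circ> F \<circ> chart_inv c)"
  proof -
    have "smooth_on ?U (\<lambda>x. (f \<circ> chart_inv d) ((snd d \<circ> F \<circ> chart_inv c) x))"
    proof (rule smooth_on_compose[OF _ smooth[OF c d(1)] _ U open_chart_image[OF B d(1)]])
      show "smooth_on (chart_image d) (f \<circ> chart_inv d)" using f d by (simp add: smooth_fun_iff)
      show "(snd d \<circ> F \<circ> chart_inv c) ` ?U \<subseteq> chart_image d"
        using chart_inv_left[OF A c] by auto
    qed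
    then show ?thesis
      by (subst smooth_on_cong[OF U, of _ "\<lambda>x. (f \<circ> chart_inv d) ((snd d \<circ> F \<circ> chart_inv c) x)"])
         (auto simp: chart_inv_left[OF A c] chart_inv_left[OF B d(1)])
  qed
  ultimately show "\<exists>T. open T \<and> x \<in> T \<and> smooth_on T (f \<circ> F \<circ> chart_inv c)" using U by blast
qed

section \<open>The induced metric\<close>

lemma (in metric_field) rlow_axis_same:
  assumes "y \<in> W"
  shows "rlow G y (axis i 1) (axis i 1) w z = 0" "rlow G y u v (axis i 1) (axis i 1) = 0"
  using rlow_skew12[of G y "axis i 1" "axis i 1" w z] rlow_skew34_vec[OF assms, of u v "axis i 1" "axis i 1"]
  by simp_all

text \<open>By skew symmetry every component of the curvature is 0 or, up to sign, the component
  1221; its coefficients in the double trace add up to twice the determinant of the inverse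
  metric.\<close>

lemma scal_dim2:
  fixes G :: "real ^ 2 \<Rightarrow> real ^ 2 ^ 2"
  assumes "metric_field G W" "y \<in> W"
  shows "scal G y = 2 * ((\<Sum>l\<in>UNIV. riem G 1 2 2 l y * G y $ l $ 1) / det (G y))"
proof -
  interpret metric_field G W by fact
  note y = assms(2)
  let ?R = "\<lambda>i j k l. rlow G y (axis i 1) (axis j 1) (axis k 1) (axis l 1)" and ?I = "matrix_inv (G y)"
  have s: "?R 2 1 k l = - ?R 1 2 k l" "?R 1 2 1 2 = - ?R 1 2 2 1" for k l
    using rlow_skew12 rlow_skew34_vec[OF y] by blast+
  have "ric G y $ j $ k = (\<Sum>i\<in>UNIV. \<Sum>l\<in>UNIV. ?I $ i $ l * ?R i j k l)" for j k
    using ric_rlow[OF y, of "axis j 1" "axis k 1"] by (simp add: inner_with_axis)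
  then have "scal G y = 2 * (det ?I * ?R 1 2 2 1)"
    using matrix_inv_symmetric[OF nondeg[OF y] sym[OF y], of 1 2]
    by (simp add: scal_def sum_2 rlow_axis_same[OF y] s det_2 algebra_simps)
  moreover have "det ?I = 1 / det (G y)"
  proof -
    have "?I ** G y = mat 1" using nondeg[OF y] invertible_det_nz invertible_mat_inv by blast
    then have "det ?I * det (G y) = 1" by (metis det_mul det_I)
    then show ?thesis using nondeg[OF y] by (simp add: field_simps)
  qed
  moreover have "?R 1 2 2 1 = (\<Sum>l\<in>UNIV. riem G 1 2 2 l y * G y $ l $ 1)"
  proof -
    have "rop G y (axis 1 1) (axis 2 1) (axis 2 1) $ l = riem G 1 2 2 l y" for l
      unfolding rop_axis by (simp add: sum_2 axis_def)
    moreover have "inner_with (G y) v (axis 1 1) = (\<Sum>l\<in>UNIV. v $ l * G y $ l $ 1)" for v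
      by (simp add: inner_with_sum sum_2 axis_def)
    ultimately show ?thesis by (simp only: rlow_def)
  qed
  ultimately show ?thesis by simp
qed

text \<open>\<open>gaussian_curvature\<close> is computed in a chosen chart; as half the scalar
  curvature it inherits chart independence and smoothness.\<close>

lemma gaussian_curvature_scalar:
  assumes "smooth_atlas \<A>" "riemannian_metric \<A> g"
  shows "gaussian_curvature \<A> g p = scalar_curvature \<A> g p / 2"
proof -
  interpret riemannian \<A> g using assms by unfold_locales
  define c where "c = chart_at \<A> p"
  have c: "c \<in> \<A>" "p \<in> fst c" using chart_at_in[OF A] by (auto simp: c_def)
  have "snd c p \<in> chart_image c" using c by simp
  from scal_dim2[OF metric_field_chart[OF A R c(1)] this]
  show ?thesis
    unfolding scalar_curvature_chart[OF c]
    by (simp add: gaussian_curvature_def Let_def c_def[symmetric] riemann_riem[OF A c] chart_inv_left[OF A c])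
qed

lemma coord_deriv_change_target:
  fixes F :: "'s::topological_space \<Rightarrow> 'a::topological_space"
    and \<A> :: "('s, 'm::finite) chart set" and \<B> :: "('a, 'n::finite) chart set"
  assumes A: "smooth_atlas \<A>" and B: "smooth_atlas \<B>" and F: "continuous_on UNIV F"
    and c: "c \<in> \<A>" and de: "d \<in> \<B>" "e \<in> \<B>" and p: "p \<in> fst c" "F p \<in> fst d" "F p \<in> fst e"
    and smooth: "smooth_on (snd c ` (fst c \<inter> F -` fst d)) (snd d \<circ> F \<circ> chart_inv c)"
  shows "coord_deriv c i (snd e \<circ> F) p = transition_deriv d e (F p) *v coord_deriv c i (snd d \<circ> F) p"
proof -
  let ?\<Phi> = "snd d \<circ> F \<circ> chart_inv c" and ?\<tau> = "snd e \<circ> chart_inv d" and ?x = "snd c p"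
  let ?U = "snd c ` (fst c \<inter> F -` (fst d \<inter> fst e))"
  have U: "open ?U"
    using F open_chart[OF B de(1)] open_chart[OF B de(2)]
    by (intro open_chart_image_Int[OF A c] open_vimage open_Int)
  have x: "?x \<in> ?U" using p by auto
  have \<Phi>: "?\<Phi> differentiable at ?x"
    using smooth_on_differentiable[OF smooth] p by auto
  have \<Phi>x: "?\<Phi> ?x = snd d (F p)" using chart_inv_left[OF A c p(1)] by simp
  have "smooth_on (snd d ` (fst d \<inter> fst e)) ?\<tau>"
    using B de by (auto simp: smooth_atlas_def)
  then have \<tau>: "?\<tau> differentiable at (?\<Phi> ?x)"
    using smooth_on_differentiable[of _ ?\<tau> "snd d (F p)"] p \<Phi>x by auto
  have eq: "(snd e \<circ> F \<circ> chart_inv c) y = ?\<tau> (?\<Phi> y)" if "y \<in> ?U" for y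
    using that chart_inv_left[OF A c] chart_inv_left[OF B de(1)] by auto
  have diff: "(\<lambda>y. ?\<tau> (?\<Phi> y)) differentiable at ?x"
    using differentiable_chain_at[OF \<Phi> \<tau>] by (simp add: o_def)
  have "coord_deriv c i (snd e \<circ> F) p = pd i (\<lambda>y. ?\<tau> (?\<Phi> y)) ?x"
    unfolding coord_deriv_pd comp_assoc[symmetric] using eq by (intro pd_cong[OF U x]) auto
  then have "coord_deriv c i (snd e \<circ> F) p $ a = pd i (\<lambda>y. ?\<tau> (?\<Phi> y) $ a) ?x" for a
    using pd_nth[OF diff] by simp
  also have "pd i (\<lambda>y. ?\<tau> (?\<Phi> y) $ a) ?x = (\<Sum>b\<in>UNIV. pd b (\<lambda>z. ?\<tau> z $ a) (?\<Phi> ?x) * pd i ?\<Phi> ?x $ b)" for a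
    by (rule pd_compose[OF \<Phi>, of "\<lambda>z. ?\<tau> z $ a"]) (rule differentiable_nth[OF \<tau>])
  also have "\<dots> a = (transition_deriv d e (F p) *v coord_deriv c i (snd d \<circ> F) p) $ a" for a
    unfolding pd_nth[OF \<tau>] unfolding \<Phi>x coord_deriv_pd comp_assoc
    by (simp add: matrix_vector_mult_def transition_deriv_def matrix_def pd_def chart_inv_left[OF A c p(1)])
  finally show ?thesis by (simp add: vec_eq_iff)
qed

lemma coord_deriv_change_source:
  fixes f :: "'s::topological_space \<Rightarrow> real" and \<A> :: "('s, 'm::finite) chart set"
  assumes A: "smooth_atlas \<A>" and cd: "c \<in> \<A>" "d \<in> \<A>" and p: "p \<in> fst c" "p \<in> fst d"
    and f: "f \<circ> chart_inv d differentiable at (snd d p)"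
  shows "coord_deriv c i f p = (\<Sum>j\<in>UNIV. coord_deriv d j f p * transition_deriv c d p $ j $ i)"
proof -
  let ?\<tau> = "snd d \<circ> chart_inv c" and ?x = "snd c p" and ?U = "snd c ` (fst c \<inter> fst d)"
  have U: "open ?U" by (rule open_chart_image_Int[OF A cd(1) open_chart[OF A cd(2)]])
  have x: "?x \<in> ?U" using p by auto
  have "smooth_on ?U ?\<tau>" using A cd by (auto simp: smooth_atlas_def)
  then have \<tau>: "?\<tau> differentiable at ?x" using smooth_on_differentiable x by blast
  have \<tau>x: "?\<tau> ?x = snd d p" using chart_inv_left[OF A cd(1) p(1)] by simp
  have "coord_deriv c i f p = pd i (\<lambda>y. (f \<circ> chart_inv d) (?\<tau> y)) ?x"
    unfolding coord_deriv_pd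
    by (rule pd_cong[OF U x]) (auto simp: chart_inv_left[OF A cd(1)] chart_inv_left[OF A cd(2)])
  also have "\<dots> = (\<Sum>j\<in>UNIV. pd j (f \<circ> chart_inv d) (?\<tau> ?x) * pd i ?\<tau> ?x $ j)"
    by (rule pd_compose[OF \<tau>]) (unfold \<tau>x, rule f)
  finally show ?thesis
    unfolding \<tau>x by (simp add: coord_deriv_pd transition_deriv_def matrix_def pd_def)
qed

locale surface =
  fixes \<N> :: "('a::{t2_space,second_countable_topology}, 3) chart set"
    and g :: "('a, 3) metric" and \<phi> :: "'a \<Rightarrow> real"
    and \<S> :: "('s::{t2_space,second_countable_topology}, 2) chart set"
    and F :: "'s \<Rightarrow> 'a" and \<nu> :: "('a, 3) chart \<Rightarrow> 's \<Rightarrow> real ^ 3"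
  assumes mwd: "manifold_with_density \<N> g \<phi>" and msurf: "smooth_manifold \<S>"
    and imm: "immersion \<S> \<N> F" and normal: "unit_normal \<S> \<N> g F \<nu>"
begin

abbreviation "h \<equiv> induced_metric \<N> g F"

lemma N_atlas: "smooth_atlas \<N>" and N_metric: "riemannian_metric \<N> g" and \<phi>_smooth: "smooth_fun \<N> \<phi>"
  using mwd by (auto simp: manifold_with_density_def smooth_manifold_def)

lemma S_atlas: "smooth_atlas \<S>"
  using msurf by (simp add: smooth_manifold_def)

sublocale N: riemannian \<N> g by unfold_locales (rule N_atlas N_metric)+

lemma F_cont: "continuous_on UNIV F" using imm by (simp add: immersion_def)

lemma F_smooth:
  "c \<in> \<S> \<Longrightarrow> d \<in> \<N> \<Longrightarrow> smooth_on (snd c ` (fst c \<inter> F -` fst d)) (snd d \<circ> F \<circ> chart_inv c)"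
  using imm by (simp add: immersion_def)

lemma F_inj:
  "c \<in> \<S> \<Longrightarrow> d \<in> \<N> \<Longrightarrow> p \<in> fst c \<Longrightarrow> F p \<in> fst d \<Longrightarrow>
    inj (frechet_derivative (snd d \<circ> F \<circ> chart_inv c) (at (snd c p)))"
  using imm by (simp add: immersion_def)

text \<open>\<open>induced_metric\<close> is computed in the ambient chart picked by
  \<open>chart_at\<close>. Since every ambient chart gives the same value, one chart can be kept
  fixed near a point when smoothness is proved.\<close>

lemma induced_metric_chart:
  assumes "c \<in> \<S>" "d \<in> \<N>" "p \<in> fst c" "F p \<in> fst d"
  shows "h c p $ i $ j =
    inner_with (g d (F p)) (coord_deriv c i (snd d \<circ> F) p) (coord_deriv c j (snd d \<circ> F) p)"
proof -
  define e where "e = chart_at \<N> (F p)"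
  have e: "e \<in> \<N>" "F p \<in> fst e" using chart_at_in[OF N_atlas] by (auto simp: e_def)
  let ?T = "transition_deriv e d (F p)"
  have g: "g e (F p) = transpose ?T ** g d (F p) ** ?T"
    using N_metric assms e unfolding riemannian_metric_def by blast
  have "inner_with (g e (F p)) u v = inner_with (g d (F p)) (?T *v u) (?T *v v)" for u v
    using dot_lmul_matrix[of "g d (F p) *v (?T *v v)" ?T u]
    by (simp add: inner_with_def g inner_commute flip: matrix_vector_mul_assoc)
  then show ?thesis
    using coord_deriv_change_target[OF S_atlas N_atlas F_cont assms(1) e(1) assms(2,3) e(2) assms(4)
        F_smooth[OF assms(1) e(1)]]
    by (simp add: induced_metric_def Let_def push_vec_def e_def[symmetric])
qed

end

context surface
begin

section \<open>The induced metric as a Riemannian metric\<close>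

lemma coord_deriv_snd_nth:
  assumes "c \<in> \<S>" "d \<in> \<N>" "p \<in> fst c" "F p \<in> fst d"
  shows "(\<lambda>q. snd d (F q) $ a) \<circ> chart_inv c differentiable at (snd c p)"
    and "coord_deriv c i (snd d \<circ> F) p $ a = coord_deriv c i (\<lambda>q. snd d (F q) $ a) p"
proof -
  have D: "(snd d \<circ> F \<circ> chart_inv c) differentiable at (snd c p)"
    using smooth_on_differentiable[OF F_smooth[OF assms(1,2)]] assms by auto
  show "(\<lambda>q. snd d (F q) $ a) \<circ> chart_inv c differentiable at (snd c p)"
    using differentiable_nth[OF D, of a] by (simp add: o_def)
  show "coord_deriv c i (snd d \<circ> F) p $ a = coord_deriv c i (\<lambda>q. snd d (F q) $ a) p"
    using pd_nth[OF D, of i a] by (simp add: coord_deriv_pd o_def)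
qed

lemma induced_metric_sym:
  assumes "c \<in> \<S>" "p \<in> fst c"
  shows "h c p $ i $ j = h c p $ j $ i"
  using inner_with_commute[OF riemannian_metricD(2)[OF N_metric chart_at_in[OF N_atlas, of "F p"]]]
  by (simp add: induced_metric_chart[OF assms(1) chart_at_in(1)[OF N_atlas] assms(2) chart_at_in(2)[OF N_atlas]])

text \<open>The differential of the immersion is injective, so a nonzero v has a nonzero image, on
  which the ambient metric is positive.\<close>

lemma induced_metric_pos:
  assumes c: "c \<in> \<S>" "p \<in> fst c" and v: "v \<noteq> 0"
  shows "v \<bullet> (h c p *v v) > 0"
proof -
  define d where "d = chart_at \<N> (F p)"
  have d: "d \<in> \<N>" "F p \<in> fst d" using chart_at_in[OF N_atlas] by (auto simp: d_def)
  let ?D = "frechet_derivative (snd d \<circ> F \<circ> chart_inv c) (at (snd c p))"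
  have D: "(snd d \<circ> F \<circ> chart_inv c) differentiable at (snd c p)"
    using smooth_on_differentiable[OF F_smooth[OF c(1) d(1)]] c d by auto
  have Dv: "?D v = (\<Sum>i\<in>UNIV. v $ i *\<^sub>R coord_deriv c i (snd d \<circ> F) p)"
    using frechet_derivative_pd[OF D] by (simp add: coord_deriv_pd comp_assoc)
  have "?D v \<noteq> 0"
    using F_inj[OF c(1) d(1) c(2) d(2)] v linear_frechet_derivative[OF D]
    by (metis injD linear_0)
  then have "inner_with (g d (F p)) (?D v) (?D v) > 0"
    using riemannian_metricD(3)[OF N_metric d] by (simp add: inner_with_def)
  also have "inner_with (g d (F p)) (?D v) (?D v) = (\<Sum>j\<in>UNIV. \<Sum>i\<in>UNIV. v $ i * h c p $ i $ j * v $ j)"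
    unfolding Dv
    by (simp add: inner_with_sum_left inner_with_sum_right inner_with_scale_left inner_with_scale_right
        induced_metric_chart[OF c(1) d(1) c(2) d(2)] sum_distrib_left mult_ac)
  also have "\<dots> = v \<bullet> (h c p *v v)"
    unfolding inner_with_def[symmetric] inner_with_sum by (rule sum.swap)
  finally show ?thesis .
qed

lemma induced_metric_smooth:
  assumes c: "c \<in> \<S>"
  shows "smooth_on (chart_image c) (metric_in c h)"
proof (rule smooth_on_local)
  fix x assume x: "x \<in> chart_image c"
  define d where "d = chart_at \<N> (F (chart_inv c x))"
  have d: "d \<in> \<N>" "F (chart_inv c x) \<in> fst d" using chart_at_in[OF N_atlas] by (auto simp: d_def)
  let ?U = "snd c ` (fst c \<inter> F -` fst d)" and ?\<Phi> = "snd d \<circ> F \<circ> chart_inv c"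
  have U: "open ?U"
    by (rule open_chart_image_Int[OF S_atlas c]) (simp add: F_cont open_chart[OF N_atlas d(1)] open_vimage)
  interpret G: metric_field "metric_in d g" "chart_image d"
    by (rule metric_field_chart[OF N_atlas N_metric d(1)])
  interpret metric_map "metric_in d g" "chart_image d" ?\<Phi> ?U
    by unfold_locales (use U F_smooth[OF c d(1)] chart_inv_left[OF S_atlas c] in auto)
  have "metric_in c h y $ i $ j = pullback ?\<Phi> (metric_in d g) y $ i $ j" if "y \<in> ?U" for y i j
  proof -
    from that obtain q where q: "q \<in> fst c" "F q \<in> fst d" "y = snd c q" by auto
    show ?thesis
      using induced_metric_chart[OF c d(1) q(1,2)]
      by (simp add: q(3) chart_inv_left[OF S_atlas c q(1)] chart_inv_left[OF N_atlas d(1) q(2)]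
          pullback_def coord_deriv_pd comp_assoc)
  qed
  then have "metric_in c h y = pullback ?\<Phi> (metric_in d g) y" if "y \<in> ?U" for y
    using that by (simp only: vec_eq_iff) blast
  then have "smooth_on ?U (metric_in c h)"
    using smooth_pullback smooth_on_cong[OF U] by blast
  moreover have "x \<in> ?U" using d(2) chart_inv_in[OF x] chart_inv_right[OF x] by force
  ultimately show "\<exists>T. open T \<and> x \<in> T \<and> smooth_on T (metric_in c h)" using U by blast
qed

lemma induced_metric_transform:
  assumes c: "c \<in> \<S>" "d \<in> \<S>" and p: "p \<in> fst c" "p \<in> fst d"
  shows "h c p = transpose (transition_deriv c d p) ** h d p ** transition_deriv c d p"
proof -
  define e where "e = chart_at \<N> (F p)"
  have e: "e \<in> \<N>" "F p \<in> fst e" using chart_at_in[OF N_atlas] by (auto simp: e_def)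
  let ?T = "transition_deriv c d p" and ?w = "\<lambda>c i. coord_deriv c i (snd e \<circ> F) p"
  have w: "?w c i = (\<Sum>j\<in>UNIV. ?T $ j $ i *\<^sub>R ?w d j)" for i
    using coord_deriv_change_source[OF S_atlas c p coord_deriv_snd_nth(1)[OF c(2) e(1) p(2) e(2)]]
    by (simp add: vec_eq_iff coord_deriv_snd_nth(2)[OF c(1) e(1) p(1) e(2)]
        coord_deriv_snd_nth(2)[OF c(2) e(1) p(2) e(2)] mult.commute)
  have "h c p $ i $ j = (\<Sum>b\<in>UNIV. \<Sum>a\<in>UNIV. ?T $ a $ i * h d p $ a $ b * ?T $ b $ j)" for i j
    unfolding induced_metric_chart[OF c(1) e(1) p(1) e(2)] w
    by (simp add: inner_with_sum_left inner_with_sum_right inner_with_scale_left inner_with_scale_right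
        induced_metric_chart[OF c(2) e(1) p(2) e(2)] sum_distrib_left mult_ac)
  also have "\<dots> i j = (transpose ?T ** h d p ** ?T) $ i $ j" for i j
    by (simp add: matrix_matrix_mult_def transpose_def sum_distrib_right)
  finally show ?thesis by (simp add: vec_eq_iff)
qed

lemma S_metric: "riemannian_metric \<S> h"
proof -
  have "transpose (h c p) = h c p" if "c \<in> \<S>" "p \<in> fst c" for c p
    using induced_metric_sym[OF that] by (simp add: transpose_def vec_eq_iff)
  then show ?thesis
    unfolding riemannian_metric_def
    by (intro conjI ballI allI impI)
       (erule IntE | assumption
         | rule induced_metric_smooth induced_metric_pos induced_metric_transform)+
qed

sublocale S: riemannian \<S> h by unfold_locales (rule S_atlas S_metric)+

lemma chart_map_F: "c \<in> \<S> \<Longrightarrow> d \<in> \<N> \<Longrightarrow> chart_map \<S> h \<N> g F c d"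
  by unfold_locales
     (auto intro: S_atlas N_atlas S_metric N_metric F_cont F_smooth induced_metric_chart)

section \<open>The normal and the second fundamental form\<close>

lemma normal_props:
  assumes "c \<in> \<S>" "d \<in> \<N>" "p \<in> fst c" "F p \<in> fst d"
  shows "inner_with (g d (F p)) (\<nu> d p) (\<nu> d p) = 1"
    "inner_with (g d (F p)) (\<nu> d p) (coord_deriv c i (snd d \<circ> F) p) = 0"
  using normal assms unfolding unit_normal_def push_vec_def by blast+

lemma normal_smooth:
  "c \<in> \<S> \<Longrightarrow> d \<in> \<N> \<Longrightarrow> smooth_on (snd c ` (fst c \<inter> F -` fst d)) (\<nu> d \<circ> chart_inv c)"
  using normal unfolding unit_normal_def by blast

lemma normal_transform:
  "d \<in> \<N> \<Longrightarrow> e \<in> \<N> \<Longrightarrow> F p \<in> fst d \<Longrightarrow> F p \<in> fst e \<Longrightarrow> \<nu> e p = transition_deriv d e (F p) *v \<nu> d p"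
  using normal unfolding unit_normal_def by blast

lemma frame_normal:
  assumes "c \<in> \<S>" "d \<in> \<N>" "p \<in> fst c" "F p \<in> fst d"
  shows "frame (g d (F p)) (matrix_inv (h c p)) (\<lambda>i. coord_deriv c i (snd d \<circ> F) p) (\<nu> d p)"
  by (rule frame_codim1[OF S.matrix_inv_mult(1)[OF assms(1,3)] induced_metric_chart[OF assms]
      induced_metric_sym[OF assms(1,3)] riemannian_metricD(2)[OF N_metric assms(2,4)]
      normal_props(2,1)[OF assms]]) simp

text \<open>Differentiating the orthogonality of the normal and the j-th coordinate vector moves the
  derivative from the normal to the coordinate vector, which produces the minus sign.\<close>

lemma sff_II:
  assumes cS: "c \<in> \<S>" "p \<in> fst c" and dd: "d = chart_at \<N> (F p)"
  shows "second_fundamental_form c \<N> g F \<nu> p $ i $ j =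
    - metric_immersion.II (metric_in d g) (snd d \<circ> F \<circ> chart_inv c) i j (snd c p) (\<nu> d p)"
proof -
  have dN: "d \<in> \<N>" "F p \<in> fst d" using chart_at_in[OF N_atlas] by (auto simp: dd)
  interpret chart_map \<S> h \<N> g F c d by (rule chart_map_F[OF cS(1) dN(1)])
  let ?x = "snd c p" and ?G = "metric_in d g" and ?Y = "\<nu> d \<circ> chart_inv c"
  note fr = frame_normal[OF cS(1) dN(1) cS(2) dN(2)]
  have x: "?x \<in> U" using cS dN by auto
  have \<Phi>x: "\<Phi> ?x = snd d (F p)" using chart_inv_left[OF S_atlas cS] by simp
  have Gx: "?G (\<Phi> ?x) = g d (F p)" unfolding \<Phi>x using chart_inv_left[OF N_atlas dN] by simp
  have P: "pd j \<Phi> ?x = coord_deriv c j (snd d \<circ> F) p" for j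
    by (simp add: coord_deriv_pd comp_assoc)
  have Y: "smooth_on U ?Y" by (rule normal_smooth[OF cS(1) dN(1)])
  have Yx: "?Y ?x = \<nu> d p" using chart_inv_left[OF S_atlas cS] by simp
  have "pd i (\<lambda>x. inner_with (?G (\<Phi> x)) (?Y x) (pd j \<Phi> x)) ?x = pd i (\<lambda>x. 0) ?x"
  proof (rule pd_cong[OF open_U x])
    fix y assume "y \<in> U"
    then obtain q where q: "q \<in> fst c" "F q \<in> fst d" "y = snd c q" by auto
    show "inner_with (?G (\<Phi> y)) (?Y y) (pd j \<Phi> y) = 0"
      using normal_props(2)[OF cS(1) dN(1) q(1,2), of j]
      by (simp add: q(3) coord_deriv_pd comp_assoc chart_inv_left[OF S_atlas cS(1) q(1)]
          chart_inv_left[OF N_atlas dN(1) q(2)])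
  qed
  then have 0: "inner_with (?G (\<Phi> ?x)) (cov ?G \<Phi> i ?Y ?x) (pd j \<Phi> ?x) +
      inner_with (?G (\<Phi> ?x)) (?Y ?x) (cov ?G \<Phi> i (pd j \<Phi>) ?x) = 0"
    unfolding pd_inner[OF x Y smooth_pd\<Phi>(2)] pd_const .
  have "covariant_deriv_along c d g F \<nu> i p = cov ?G \<Phi> i ?Y ?x"
    unfolding covariant_deriv_along_def cov_def Gam_def push_vec_def christoffel_chr[OF N_atlas dN]
      \<Phi>x P Yx by (simp add: coord_deriv_pd)
  moreover have "inner_with (?G (\<Phi> ?x)) (?Y ?x) (cov ?G \<Phi> i (pd j \<Phi>) ?x) = II i j ?x (\<nu> d p)"
    unfolding II_def Yx by (rule inner_with_commute[OF sym[OF maps[OF x]]])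
  ultimately show ?thesis
    using 0 unfolding Gx P
    by (simp add: second_fundamental_form_def Let_def dd[symmetric] push_vec_def)
qed

end

context surface
begin

text \<open>The function g(N, grad \<phi>), written as the differential of \<phi> on the
  normal.\<close>

definition normal_deriv :: "'s \<Rightarrow> real" where
  "normal_deriv p = (let d = chart_at \<N> (F p) in dirder (\<phi> \<circ> chart_inv d) (snd d (F p)) (\<nu> d p))"

definition ricci_normal :: "'s \<Rightarrow> real" where
  "ricci_normal p = (let d = chart_at \<N> (F p) in inner_with (ricci d g (F p)) (\<nu> d p) (\<nu> d p))"

lemma \<phi>F_smooth: "smooth_fun \<S> (\<phi> \<circ> F)"
  by (rule smooth_fun_compose[OF S_atlas N_atlas F_cont F_smooth \<phi>_smooth])

lemma weighted_mean_curvature_eq: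
  "weighted_mean_curvature \<S> \<N> g \<phi> F \<nu> p = mean_curvature \<S> \<N> g F \<nu> p + normal_deriv p"
proof -
  define d where "d = chart_at \<N> (F p)"
  have d: "d \<in> \<N>" "F p \<in> fst d" using chart_at_in[OF N_atlas] by (auto simp: d_def)
  have "inner_with (g d (F p)) (\<nu> d p) (grad d g \<phi> (F p)) = \<nu> d p \<bullet> (\<chi> i. coord_deriv d i \<phi> (F p))"
    by (simp add: inner_with_def grad_def matrix_vector_mul_assoc N.matrix_inv_mult(2)[OF d])
  also have "\<dots> = dirder (\<phi> \<circ> chart_inv d) (snd d (F p)) (\<nu> d p)"
    by (simp add: inner_vec_def dirder_def coord_deriv_pd mult.commute)
  finally show ?thesis
    by (simp add: weighted_mean_curvature_def normal_deriv_def Let_def d_def[symmetric])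
qed

lemma mean_curvature_II:
  assumes "c = chart_at \<S> p" "d = chart_at \<N> (F p)"
  shows "mean_curvature \<S> \<N> g F \<nu> p = - (\<Sum>i\<in>UNIV. \<Sum>j\<in>UNIV. matrix_inv (h c p) $ i $ j *
    metric_immersion.II (metric_in d g) (snd d \<circ> F \<circ> chart_inv c) i j (snd c p) (\<nu> d p))"
  using sff_II[of c p d] chart_at_in[OF S_atlas] assms
  by (simp add: mean_curvature_def Let_def metric_trace_def sum_negf)

lemma scalar_curvature_gauss:
  "scalar_curvature \<N> g (F p) = 2 * gaussian_curvature \<S> h p + 2 * ricci_normal p
    - (mean_curvature \<S> \<N> g F \<nu> p)\<^sup>2 + sff_norm_sq \<S> \<N> g F \<nu> p"
proof -
  define c where "c = chart_at \<S> p"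
  define d where "d = chart_at \<N> (F p)"
  have cS: "c \<in> \<S>" "p \<in> fst c" using chart_at_in[OF S_atlas] by (auto simp: c_def)
  have dN: "d \<in> \<N>" "F p \<in> fst d" using chart_at_in[OF N_atlas] by (auto simp: d_def)
  interpret M: chart_map \<S> h \<N> g F c d by (rule chart_map_F[OF cS(1) dN(1)])
  have "sff_norm_sq \<S> \<N> g F \<nu> p = (\<Sum>i\<in>UNIV. \<Sum>j\<in>UNIV. \<Sum>k\<in>UNIV. \<Sum>l\<in>UNIV.
      matrix_inv (h c p) $ i $ k * matrix_inv (h c p) $ j $ l * M.II i j (snd c p) (\<nu> d p)
        * M.II k l (snd c p) (\<nu> d p))"
    using sff_II[OF cS d_def] by (simp add: sff_norm_sq_def Let_def c_def[symmetric])
  then show ?thesis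
    using M.scal_chart[OF cS(2) dN(2) frame_normal[OF cS(1) dN(1) cS(2) dN(2)]]
    by (simp add: gaussian_curvature_scalar[OF S_atlas S_metric] N.scalar_curvature_chart[OF dN]
        S.scalar_curvature_chart[OF cS] ricci_normal_def Let_def mean_curvature_II[OF c_def d_def]
        d_def[symmetric])
qed

text \<open>The mean curvature is minus the trace of \<open>II\<close>, which turns the plus sign in
  \<open>laplacian_chart\<close> into a minus sign.\<close>

lemma laplacian_split:
  "laplacian \<S> h (\<phi> \<circ> F) p = laplacian \<N> g \<phi> (F p)
    - (let d = chart_at \<N> (F p) in inner_with (hessian d g \<phi> (F p)) (\<nu> d p) (\<nu> d p))
    - mean_curvature \<S> \<N> g F \<nu> p * normal_deriv p"
proof -
  define c where "c = chart_at \<S> p"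
  define d where "d = chart_at \<N> (F p)"
  have cS: "c \<in> \<S>" "p \<in> fst c" using chart_at_in[OF S_atlas] by (auto simp: c_def)
  have dN: "d \<in> \<N>" "F p \<in> fst d" using chart_at_in[OF N_atlas] by (auto simp: d_def)
  interpret M: chart_map \<S> h \<N> g F c d by (rule chart_map_F[OF cS(1) dN(1)])
  have "smooth_on (chart_image d) (\<phi> \<circ> chart_inv d)" using \<phi>_smooth dN by (simp add: smooth_fun_iff)
  from M.laplacian_chart[OF cS(2) dN(2) frame_normal[OF cS(1) dN(1) cS(2) dN(2)] this]
  show ?thesis
    by (simp add: S.laplacian_chart_eq[OF cS \<phi>F_smooth] N.laplacian_chart_eq[OF dN \<phi>_smooth]
        normal_deriv_def Let_def mean_curvature_II[OF c_def d_def] d_def[symmetric])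
qed

lemma grad_norm_sq_split:
  "grad_norm_sq \<N> g \<phi> (F p) = grad_norm_sq \<S> h (\<phi> \<circ> F) p + (normal_deriv p)\<^sup>2"
proof -
  define c where "c = chart_at \<S> p"
  define d where "d = chart_at \<N> (F p)"
  have cS: "c \<in> \<S>" "p \<in> fst c" using chart_at_in[OF S_atlas] by (auto simp: c_def)
  have dN: "d \<in> \<N>" "F p \<in> fst d" using chart_at_in[OF N_atlas] by (auto simp: d_def)
  interpret M: chart_map \<S> h \<N> g F c d by (rule chart_map_F[OF cS(1) dN(1)])
  have "\<phi> \<circ> chart_inv d differentiable at (snd d (F p))"
    using smooth_fun_differentiable[OF \<phi>_smooth] dN by (auto simp: differentiable_fun_def)
  from M.grad_chart[OF cS(2) dN(2) frame_normal[OF cS(1) dN(1) cS(2) dN(2)] this this]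
  show ?thesis
    by (simp add: grad_norm_sq_gip
        S.gip_in_chart[OF cS smooth_fun_differentiable smooth_fun_differentiable, OF \<phi>F_smooth \<phi>F_smooth]
        N.gip_in_chart[OF dN smooth_fun_differentiable smooth_fun_differentiable, OF \<phi>_smooth \<phi>_smooth]
        normal_deriv_def Let_def d_def[symmetric] power2_eq_square)
qed

text \<open>The normal derivative of \<phi> cancels: its square enters with -1/2 from the ambient
  gradient and with +1/2 from the square of the weighted mean curvature, and its product with H
  enters with opposite signs from that square and from the Laplacian. The tangential
  -|\<nabla>\<phi>|^2/2 in the Perelman curvature is balanced by the explicit gradient
  summand.\<close>

lemma stability_potential:
  "bakry_emery_ricci_normal \<N> g \<phi> F \<nu> p + sff_norm_sq \<S> \<N> g F \<nu> p =
    1/2 * perelman_scalar_curvature \<N> g \<phi> (F p)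
    + 1/2 * (weighted_mean_curvature \<S> \<N> g \<phi> F \<nu> p)\<^sup>2
    + 1/2 * sff_norm_sq \<S> \<N> g F \<nu> p
    - gaussian_curvature \<S> h p
    + 1/2 * grad_norm_sq \<S> h (\<phi> \<circ> F) p
    + laplacian \<S> h (\<phi> \<circ> F) p"
proof -
  have 1: "bakry_emery_ricci_normal \<N> g \<phi> F \<nu> p = ricci_normal p
      - (let d = chart_at \<N> (F p) in inner_with (hessian d g \<phi> (F p)) (\<nu> d p) (\<nu> d p))"
    by (simp add: bakry_emery_ricci_normal_def bakry_emery_ricci_def ricci_normal_def Let_def
        inner_with_def matrix_vector_mult_diff_rdistrib inner_diff_right)
  show ?thesis
    unfolding 1 perelman_scalar_curvature_def scalar_curvature_gauss laplacian_split
      grad_norm_sq_split weighted_mean_curvature_eq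
    by (simp add: power2_eq_square algebra_simps)
qed

section \<open>Smoothness of the potential\<close>

lemma ricci_normal_chart:
  assumes "d \<in> \<N>" "F p \<in> fst d"
  shows "ricci_normal p = inner_with (ricci d g (F p)) (\<nu> d p) (\<nu> d p)"
  using N.ricci_invariant[OF assms(1) chart_at_in(1)[OF N_atlas] assms(2) chart_at_in(2)[OF N_atlas]]
    normal_transform[OF assms(1) chart_at_in(1)[OF N_atlas] assms(2) chart_at_in(2)[OF N_atlas]]
  by (simp add: ricci_normal_def Let_def)

lemma normal_deriv_chart:
  assumes "d \<in> \<N>" "F p \<in> fst d"
  shows "normal_deriv p = dirder (\<phi> \<circ> chart_inv d) (snd d (F p)) (\<nu> d p)"
proof -
  define e where "e = chart_at \<N> (F p)"
  have e: "e \<in> \<N>" "F p \<in> fst e" using chart_at_in[OF N_atlas] by (auto simp: e_def)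
  let ?T = "transition_deriv d e (F p)"
  have diff: "\<phi> \<circ> chart_inv e differentiable at (snd e (F p))"
    using smooth_fun_differentiable[OF \<phi>_smooth] e by (auto simp: differentiable_fun_def)
  have "dirder (\<phi> \<circ> chart_inv d) (snd d (F p)) (\<nu> d p) =
      (\<Sum>a\<in>UNIV. \<Sum>j\<in>UNIV. coord_deriv e j \<phi> (F p) * (?T $ j $ a * \<nu> d p $ a))"
    by (simp add: dirder_def coord_deriv_pd[symmetric] sum_distrib_right mult.assoc
        coord_deriv_change_source[OF N_atlas assms(1) e(1) assms(2) e(2) diff])
  also have "\<dots> = (\<Sum>j\<in>UNIV. \<Sum>a\<in>UNIV. coord_deriv e j \<phi> (F p) * (?T $ j $ a * \<nu> d p $ a))"
    by (rule sum.swap)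
  also have "\<dots> = dirder (\<phi> \<circ> chart_inv e) (snd e (F p)) (\<nu> e p)"
    unfolding normal_transform[OF assms(1) e(1) assms(2) e(2)]
    by (simp add: dirder_def coord_deriv_pd matrix_vector_mult_def sum_distrib_left)
  finally show ?thesis by (simp add: normal_deriv_def Let_def e_def)
qed

text \<open>The chart picked by \<open>chart_at\<close> may jump from point to point. If the value
  is given by the same expression in every ambient chart, then one chart can be fixed on a
  neighbourhood.\<close>

lemma smooth_along:
  assumes B: "\<And>d p. d \<in> \<N> \<Longrightarrow> F p \<in> fst d \<Longrightarrow> f p = B d (snd d (F p)) (\<nu> d p)"
    and sm: "\<And>d U Y \<Phi>. d \<in> \<N> \<Longrightarrow> metric_map (metric_in d g) (chart_image d) \<Phi> U \<Longrightarrow> smooth_on U Y \<Longrightarrow>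
      smooth_on (U :: (real ^ 2) set) (\<lambda>y. B d (\<Phi> y) (Y y))"
  shows "smooth_fun \<S> f"
  unfolding smooth_fun_iff
proof (intro ballI smooth_on_local)
  fix c x assume c: "c \<in> \<S>" and x: "x \<in> chart_image c"
  define d where "d = chart_at \<N> (F (chart_inv c x))"
  have d: "d \<in> \<N>" "F (chart_inv c x) \<in> fst d" using chart_at_in[OF N_atlas] by (auto simp: d_def)
  let ?U = "snd c ` (fst c \<inter> F -` fst d)" and ?\<Phi> = "snd d \<circ> F \<circ> chart_inv c"
  interpret M: chart_map \<S> h \<N> g F c d by (rule chart_map_F[OF c d(1)])
  have "smooth_on ?U (\<lambda>y. B d (?\<Phi> y) ((\<nu> d \<circ> chart_inv c) y))"
    by (rule sm[OF d(1) M.metric_map_axioms normal_smooth[OF c d(1)]])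
  then have "smooth_on ?U (f \<circ> chart_inv c)"
    using B[OF d(1)] by (subst smooth_on_cong[OF M.open_U, of _ "\<lambda>y. B d (?\<Phi> y) ((\<nu> d \<circ> chart_inv c) y)"])
      (auto simp: chart_inv_left[OF S_atlas c])
  moreover have "x \<in> ?U" using d(2) chart_inv_in[OF x] chart_inv_right[OF x] by force
  ultimately show "\<exists>T. open T \<and> x \<in> T \<and> smooth_on T (f \<circ> chart_inv c)" using M.open_U by blast
qed

lemma smooth_ricci_normal: "smooth_fun \<S> ricci_normal"
proof (rule smooth_along[where B = "\<lambda>d y v. inner_with (ric (metric_in d g) y) v v"])
  show "ricci_normal p = inner_with (ric (metric_in d g) (snd d (F p))) (\<nu> d p) (\<nu> d p)"
    if "d \<in> \<N>" "F p \<in> fst d" for d p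
    using ricci_normal_chart[OF that] ricci_ric[OF N_atlas that] by simp
  fix d U and Y \<Phi> :: "real ^ 2 \<Rightarrow> real ^ 3"
  assume "d \<in> \<N>" "metric_map (metric_in d g) (chart_image d) \<Phi> U" and Y: "smooth_on U Y"
  interpret metric_map "metric_in d g" "chart_image d" \<Phi> U by fact
  show "smooth_on U (\<lambda>y. inner_with (ric (metric_in d g) (\<Phi> y)) (Y y) (Y y))"
    unfolding inner_with_sum ric_def vec_lambda_beta
    by (intro smooth_on_sum smooth_on_mult smooth_comp smooth_riem smooth_on_nth Y U)
qed

lemma smooth_normal_deriv: "smooth_fun \<S> normal_deriv"
proof (rule smooth_along[where B = "\<lambda>d y v. dirder (\<phi> \<circ> chart_inv d) y v"])
  fix d U and Y \<Phi> :: "real ^ 2 \<Rightarrow> real ^ 3"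
  assume d: "d \<in> \<N>" and "metric_map (metric_in d g) (chart_image d) \<Phi> U" and Y: "smooth_on U Y"
  interpret metric_map "metric_in d g" "chart_image d" \<Phi> U by fact
  have "smooth_on (chart_image d) (\<phi> \<circ> chart_inv d)" using \<phi>_smooth d by (simp add: smooth_fun_iff)
  then show "smooth_on U (\<lambda>y. dirder (\<phi> \<circ> chart_inv d) (\<Phi> y) (Y y))"
    unfolding dirder_def
    by (intro smooth_on_sum smooth_on_mult smooth_comp smooth_on_pd smooth_on_nth Y U)
qed (rule normal_deriv_chart)

text \<open>H and |A|^2 are not differentiated in coordinates: constancy of the weighted mean
  curvature gives H from the normal derivative of \<phi>, and the Gauss equation then gives |A|^2
  from functions already known to be smooth.\<close>

lemma smooth_schroedinger_potential:
  assumes H0: "\<And>p. weighted_mean_curvature \<S> \<N> g \<phi> F \<nu> p = H0"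
  shows "smooth_fun \<S> (\<lambda>p. 1/3 * (1/2 * perelman_scalar_curvature \<N> g \<phi> (F p)
      + 1/2 * (weighted_mean_curvature \<S> \<N> g \<phi> F \<nu> p)\<^sup>2
      + 1/2 * sff_norm_sq \<S> \<N> g F \<nu> p
      + 1/8 * grad_norm_sq \<S> h (\<phi> \<circ> F) p) - 1/3 * gaussian_curvature \<S> h p)"
    (is "smooth_fun \<S> ?q")
proof -
  define R where "R = scalar_curvature \<N> g \<circ> F"
  define L where "L = laplacian \<N> g \<phi> \<circ> F"
  define E where "E = gip \<N> g \<phi> \<phi> \<circ> F"
  define K where "K = scalar_curvature \<S> h"
  define E' where "E' = gip \<S> h (\<phi> \<circ> F) (\<phi> \<circ> F)"
  note comp = smooth_fun_compose[OF S_atlas N_atlas F_cont F_smooth]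
  have sm: "smooth_fun \<S> R" "smooth_fun \<S> L" "smooth_fun \<S> E" "smooth_fun \<S> K" "smooth_fun \<S> E'"
    unfolding R_def L_def E_def K_def E'_def
    by (intro comp N.smooth_fun_scalar_curvature N.smooth_fun_laplacian N.smooth_fun_gip \<phi>_smooth
        S.smooth_fun_scalar_curvature S.smooth_fun_gip \<phi>F_smooth; assumption?)+
  have mean: "mean_curvature \<S> \<N> g F \<nu> p = H0 - normal_deriv p" for p
    using weighted_mean_curvature_eq[of p] H0[of p] by simp
  have sff: "sff_norm_sq \<S> \<N> g F \<nu> p = R p - K p - 2 * ricci_normal p + (H0 - normal_deriv p)\<^sup>2" for p
    using scalar_curvature_gauss[of p]
    by (simp add: mean R_def K_def gaussian_curvature_scalar[OF S_atlas S_metric])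
  have q: "?q = (\<lambda>p. 1/3 * (1/2 * (R p - 2 * L p - E p) + 1/2 * H0\<^sup>2
      + 1/2 * (R p - K p - 2 * ricci_normal p + (H0 - normal_deriv p)\<^sup>2) + 1/8 * E' p) - 1/3 * (K p / 2))"
    by (simp add: fun_eq_iff H0 sff perelman_scalar_curvature_def grad_norm_sq_gip R_def L_def E_def K_def
        E'_def gaussian_curvature_scalar[OF S_atlas S_metric])
  show ?thesis
    unfolding q smooth_fun_iff
  proof
    fix c assume c: "c \<in> \<S>"
    have W: "open (chart_image c)" by (rule open_chart_image[OF S_atlas c])
    have *: "smooth_on (chart_image c) (\<lambda>x. f (chart_inv c x))" if "smooth_fun \<S> f" for f
      using that c by (simp add: smooth_fun_iff o_def)
    show "smooth_on (chart_image c) ((\<lambda>p. 1/3 * (1/2 * (R p - 2 * L p - E p) + 1/2 * H0\<^sup>2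
      + 1/2 * (R p - K p - 2 * ricci_normal p + (H0 - normal_deriv p)\<^sup>2) + 1/8 * E' p) - 1/3 * (K p / 2))
      \<circ> chart_inv c)"
      unfolding o_def
      by (intro smooth_on_diff smooth_on_add smooth_on_mult smooth_on_power smooth_on_divide_const
          smooth_on_const sm[THEN *] smooth_ricci_normal[THEN *] smooth_normal_deriv[THEN *] W)
  qed
qed

end

section \<open>The Riemannian measure\<close>

text \<open>\<open>has_measure_differentiable_image\<close> equates a finite measure with a
  convergent integral. As an equivalence it also shows that one side is finite exactly if the other
  is, so both are infinite together.\<close>

lemma emeasure_differentiable_image:
  fixes \<Phi> :: "real ^ 'n::{finite,wellorder} \<Rightarrow> real ^ 'n::_"
  assumes B: "B \<in> sets borel" and D: "\<And>x. x \<in> B \<Longrightarrow> (\<Phi> has_derivative D x) (at x)"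
    and inj: "inj_on \<Phi> B" and im: "\<Phi> ` B \<in> sets borel"
    and meas: "(\<lambda>x. \<bar>det (matrix (D x))\<bar> * indicator B x) \<in> borel_measurable borel"
  shows "emeasure lborel (\<Phi> ` B) = (\<integral>\<^sup>+ x. ennreal \<bar>det (matrix (D x))\<bar> * indicator B x \<partial>lborel)"
proof -
  let ?J = "\<lambda>x. \<bar>det (matrix (D x))\<bar>"
  have I: "(\<integral>\<^sup>+ x. ennreal (?J x) * indicator B x \<partial>lborel) = (\<integral>\<^sup>+ x. ennreal (?J x * indicator B x) \<partial>lborel)"
    by (intro nn_integral_cong) (auto simp: indicator_def)
  have iff: "\<Phi> ` B \<in> lmeasurable \<and> measure lebesgue (\<Phi> ` B) = m \<longleftrightarrow> (?J has_integral m) B" for m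
    by (rule has_measure_differentiable_image)
       (use B D inj in \<open>auto intro: has_derivative_at_withinI\<close>)
  have eB: "emeasure lborel (\<Phi> ` B) = emeasure lebesgue (\<Phi> ` B)"
    using im by simp
  show ?thesis
  proof (cases "emeasure lborel (\<Phi> ` B) = \<infinity>")
    case False
    then have "\<Phi> ` B \<in> lmeasurable"
      unfolding fmeasurable_def eB using sets_completionI_sets[of "\<Phi> ` B" lborel] im
      by (simp add: less_top)
    then have hi: "(?J has_integral measure lebesgue (\<Phi> ` B)) B" using iff by blast
    have "(\<integral>\<^sup>+ x. ennreal (indicator B x * ?J x) \<partial>lborel) = measure lebesgue (\<Phi> ` B)"
      by (rule nn_integral_has_integral_lebesgue[OF _ hi]) simp
    moreover have "emeasure lborel (\<Phi> ` B) = measure lebesgue (\<Phi> ` B)"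
      using False eB emeasure_eq_ennreal_measure by auto
    ultimately show ?thesis unfolding I by (simp add: mult.commute)
  next
    case True
    have "(\<integral>\<^sup>+ x. ennreal (?J x * indicator B x) \<partial>lborel) = \<infinity>"
    proof (rule ccontr)
      assume "\<not> ?thesis"
      then obtain r where r: "0 \<le> r" "(\<integral>\<^sup>+ x. ennreal (?J x * indicator B x) \<partial>lborel) = ennreal r"
        by (cases "\<integral>\<^sup>+ x. ennreal (?J x * indicator B x) \<partial>lborel" rule: ennreal_cases) auto
      have "((\<lambda>x. ?J x * indicator B x) has_integral r) UNIV"
        by (rule nn_integral_has_integral[OF meas _ r(2,1)]) simp
      moreover have "(\<lambda>x. ?J x * indicator B x) = (\<lambda>x. if x \<in> B then ?J x else 0)"
        by (auto simp: indicator_def)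
      ultimately have "(?J has_integral r) B"
        by (simp only: has_integral_restrict_UNIV)
      then have "\<Phi> ` B \<in> lmeasurable" using iff by blast
      then show False using True unfolding eB fmeasurable_def by (simp del: emeasure_completion)
    qed
    with True I show ?thesis by simp
  qed
qed

text \<open>Instead of approximating f, the density |det D| on U is pushed forward by \<Phi>. The
  result is Lebesgue measure on the image, since both agree on Borel sets by the preceding lemma,
  and f is then integrated against equal measures.\<close>

lemma nn_integral_change_of_variables:
  fixes \<Phi> :: "real ^ 'n::{finite,wellorder} \<Rightarrow> real ^ 'n::_"
  assumes U: "open U" and V: "open (\<Phi> ` U)" and D: "\<And>x. x \<in> U \<Longrightarrow> (\<Phi> has_derivative D x) (at x)"
    and inj: "inj_on \<Phi> U" and inv: "continuous_on (\<Phi> ` U) (inv_into U \<Phi>)"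
    and J: "continuous_on U (\<lambda>x. det (matrix (D x)))" and f: "f \<in> borel_measurable borel"
  shows "(\<integral>\<^sup>+ y. f y * indicator (\<Phi> ` U) y \<partial>lborel) =
    (\<integral>\<^sup>+ x. ennreal \<bar>det (matrix (D x))\<bar> * f (\<Phi> x) * indicator U x \<partial>lborel)"
proof -
  define J where "J x = ennreal (\<bar>det (matrix (D x))\<bar> * indicator U x)" for x
  \<comment> \<open>A total Borel map is needed for \<open>distr\<close>; the value outside U is
    arbitrary, since the density J vanishes there.\<close>
  define \<Psi> where "\<Psi> x = (if x \<in> U then \<Phi> x else 0)" for x
  have c\<Phi>: "continuous_on U \<Phi>"
    using D has_derivative_continuous continuous_at_imp_continuous_on by blast
  have Jm: "(\<lambda>x. \<bar>det (matrix (D x))\<bar> * indicator U x) \<in> borel_measurable borel"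
    using borel_measurable_continuous_on_indicator[OF borel_open[OF U] continuous_on_rabs[OF J]]
    by (simp add: mult.commute)
  then have [measurable]: "J \<in> borel_measurable borel" unfolding J_def by measurable
  have [measurable]: "\<Psi> \<in> borel_measurable borel"
    unfolding \<Psi>_def[abs_def] using borel_measurable_continuous_on_if[OF borel_open[OF U] c\<Phi>] by simp
  have [measurable]: "U \<in> sets borel" "\<Phi> ` U \<in> sets borel" "f \<in> borel_measurable borel" using U V f by auto
  have "distr (density lborel J) borel \<Psi> = density lborel (indicator (\<Phi> ` U))"
  proof (rule measure_eqI)
    fix A assume "A \<in> sets (distr (density lborel J) borel \<Psi>)"
    then have [measurable]: "A \<in> sets borel" by simp
    let ?B = "U \<inter> \<Psi> -` A"
    have [measurable]: "\<Psi> -` A \<in> sets borel"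
      using measurable_sets_borel[of \<Psi> borel A] by simp
    have im: "\<Phi> ` ?B = \<Phi> ` U \<inter> A" by (auto simp: \<Psi>_def)
    have "emeasure (distr (density lborel J) borel \<Psi>) A = (\<integral>\<^sup>+ x. J x * indicator (\<Psi> -` A) x \<partial>lborel)"
      by (simp add: emeasure_distr emeasure_density)
    also have "\<dots> = (\<integral>\<^sup>+ x. ennreal \<bar>det (matrix (D x))\<bar> * indicator ?B x \<partial>lborel)"
      by (intro nn_integral_cong) (auto simp: J_def indicator_def)
    also have "\<dots> = emeasure lborel (\<Phi> ` ?B)"
    proof (rule emeasure_differentiable_image[symmetric])
      show "?B \<in> sets borel" by measurable
      show "(\<Phi> has_derivative D x) (at x)" if "x \<in> ?B" for x using D that by simp
      show "inj_on \<Phi> ?B" using inj by (rule inj_on_subset) auto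
      show "\<Phi> ` ?B \<in> sets borel" unfolding im by measurable
      have "(\<lambda>x. (\<bar>det (matrix (D x))\<bar> * indicator U x) * indicator (\<Psi> -` A) x) \<in> borel_measurable borel"
        using Jm by measurable
      then show "(\<lambda>x. \<bar>det (matrix (D x))\<bar> * indicator ?B x) \<in> borel_measurable borel"
        by (rule measurable_cong[THEN iffD1, rotated]) (auto simp: indicator_def)
    qed
    also have "\<dots> = emeasure (density lborel (indicator (\<Phi> ` U))) A"
      unfolding im by (simp add: emeasure_density nn_integral_indicator flip: indicator_inter_arith)
    finally show "emeasure (distr (density lborel J) borel \<Psi>) A = emeasure (density lborel (indicator (\<Phi> ` U))) A" .
  qed simp
  then have "(\<integral>\<^sup>+ y. f y \<partial>distr (density lborel J) borel \<Psi>) = (\<integral>\<^sup>+ y. f y \<partial>density lborel (indicator (\<Phi> ` U)))"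
    by simp
  then have "(\<integral>\<^sup>+ x. J x * f (\<Psi> x) \<partial>lborel) = (\<integral>\<^sup>+ y. indicator (\<Phi> ` U) y * f y \<partial>lborel)"
    by (simp add: nn_integral_distr nn_integral_density)
  moreover have "(\<integral>\<^sup>+ x. J x * f (\<Psi> x) \<partial>lborel) =
      (\<integral>\<^sup>+ x. ennreal \<bar>det (matrix (D x))\<bar> * f (\<Phi> x) * indicator U x \<partial>lborel)"
    by (intro nn_integral_cong) (auto simp: J_def \<Psi>_def indicator_def)
  ultimately show ?thesis by (simp add: mult.commute)
qed

text \<open>The sort \<open>wellorder\<close> on the index type is inherited from the change of
  variables theorem.\<close>

locale riemannian_space = riemannian \<A> g
  for \<A> :: "('a::{t2_space,second_countable_topology}, 'n::{finite,wellorder}) chart set"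
    and g :: "('a, 'n::_) metric"
begin

definition vol :: "('a, 'n::_) chart \<Rightarrow> real ^ 'n::_ \<Rightarrow> real" where
  "vol c z = sqrt (det (g c (chart_inv c z)))"

text \<open>A measure on the whole manifold, concentrated on the domain of the chart; the value
  \<open>undefined\<close> occurs only where the density is 0.\<close>

definition chart_measure :: "('a, 'n::_) chart \<Rightarrow> 'a measure" where
  "chart_measure c = distr (density lborel (\<lambda>z. ennreal (indicator (chart_image c) z * vol c z))) borel
     (\<lambda>z. if z \<in> chart_image c then chart_inv c z else undefined)"

lemma smooth_on_det_metric:
  assumes "c \<in> \<A>"
  shows "smooth_on (chart_image c) (\<lambda>z. det (g c (chart_inv c z)))"
proof -
  interpret metric_field "metric_in c g" "chart_image c" by (rule metric_field_chart[OF A R assms])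
  have "smooth_on (chart_image c) (\<lambda>z. det (metric_in c g z))" by (intro smooth_on_det smooth_G W)
  then show ?thesis by (simp add: o_def)
qed

lemma vol_continuous: "c \<in> \<A> \<Longrightarrow> continuous_on (chart_image c) (vol c)"
  unfolding vol_def[abs_def]
  by (intro continuous_on_real_sqrt smooth_on_continuous_on smooth_on_det_metric)

lemma measurable_vol [measurable]:
  "c \<in> \<A> \<Longrightarrow> (\<lambda>z. indicator (chart_image c) z * vol c z) \<in> borel_measurable borel"
  using borel_measurable_continuous_on_indicator[OF borel_open[OF open_chart_image[OF A]] vol_continuous]
  by simp

lemma measurable_chart_inv [measurable]:
  "c \<in> \<A> \<Longrightarrow> (\<lambda>z. if z \<in> chart_image c then chart_inv c z else undefined) \<in> borel \<rightarrow>\<^sub>M borel"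
  by (rule borel_measurable_continuous_on_if)
     (auto intro: borel_open open_chart_image[OF A] continuous_on_chart_inv[OF A] continuous_on_const)

lemma borel_chart_image:
  assumes "c \<in> \<A>" "B \<in> sets borel"
  shows "snd c ` (fst c \<inter> B) \<in> sets borel"
proof -
  let ?u = "\<lambda>z. if z \<in> chart_image c then chart_inv c z else undefined"
  have "?u -` B \<in> sets borel" using measurable_sets_borel[OF measurable_chart_inv[OF assms(1)] assms(2)] by simp
  then have "chart_image c \<inter> ?u -` B \<in> sets borel" using borel_open[OF open_chart_image[OF A assms(1)]] by blast
  moreover have "chart_image c \<inter> ?u -` B = snd c ` (fst c \<inter> B)"
    unfolding chart_image_Int[OF A assms(1)] by auto
  ultimately show ?thesis by simp
qed

lemma emeasure_chart_measure:
  assumes "c \<in> \<A>" "B \<in> sets borel"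
  shows "emeasure (chart_measure c) B = (\<integral>\<^sup>+ z\<in>snd c ` (fst c \<inter> B). ennreal (vol c z) \<partial>lborel)"
proof -
  let ?u = "\<lambda>z. if z \<in> chart_image c then chart_inv c z else undefined"
  note [measurable] = measurable_vol[OF assms(1)] measurable_chart_inv[OF assms(1)]
  have [measurable]: "?u -` B \<in> sets borel" using measurable_sets_borel[OF measurable_chart_inv[OF assms(1)] assms(2)] by simp
  have "emeasure (chart_measure c) B =
      (\<integral>\<^sup>+ z. ennreal (indicator (chart_image c) z * vol c z) * indicator (?u -` B) z \<partial>lborel)"
    using assms unfolding chart_measure_def by (simp add: emeasure_distr emeasure_density)
  also have "\<dots> = (\<integral>\<^sup>+ z\<in>snd c ` (fst c \<inter> B). ennreal (vol c z) \<partial>lborel)"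
    unfolding chart_image_Int[OF A assms(1)] by (intro nn_integral_cong) (auto simp: indicator_def)
  finally show ?thesis .
qed

lemma vol_transition:
  assumes "c \<in> \<A>" "d \<in> \<A>" "p \<in> fst c" "p \<in> fst d"
  shows "vol c (snd c p) = \<bar>det (transition_deriv c d p)\<bar> * vol d (snd d p)"
proof -
  have "g c p = transpose (transition_deriv c d p) ** g d p ** transition_deriv c d p"
    using R assms unfolding riemannian_metric_def by blast
  then have "det (g c p) = (det (transition_deriv c d p))\<^sup>2 * det (g d p)"
    by (simp add: det_mul power2_eq_square)
  then show ?thesis
    using chart_inv_left[OF A assms(1,3)] chart_inv_left[OF A assms(2,4)]
    by (simp add: vol_def real_sqrt_mult)
qed

text \<open>\<open>vol\<close> transforms by the absolute value of the Jacobian determinant of the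
  transition map, so the change of variables formula makes the two densities agree on the
  overlap.\<close>

lemma chart_measure_agree:
  assumes c: "c \<in> \<A>" and d: "d \<in> \<A>" and B: "B \<in> sets borel" "B \<subseteq> fst c" "B \<subseteq> fst d"
  shows "emeasure (chart_measure c) B = emeasure (chart_measure d) B"
proof -
  let ?\<Phi> = "snd d \<circ> chart_inv c" and ?U = "snd c ` (fst c \<inter> fst d)"
  let ?f = "\<lambda>y. ennreal (indicator (chart_image d) y * vol d y) * indicator (snd d ` (fst d \<inter> B)) y"
  have U: "open ?U" by (rule open_chart_image_Int[OF A c open_chart[OF A d]])
  have im: "?\<Phi> ` ?U = snd d ` (fst d \<inter> fst c)"
    using chart_inv_left[OF A c] by (force simp: image_iff)
  have smooth: "smooth_on ?U ?\<Phi>" using A c d unfolding smooth_atlas_def by blast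
  have inj: "inj_on ?\<Phi> ?U"
    using chart_inv_left[OF A c] chart_inv_left[OF A d] by (intro inj_onI) (auto, metis)
  have inv: "inv_into ?U ?\<Phi> y = (snd c \<circ> chart_inv d) y" if y: "y \<in> ?\<Phi> ` ?U" for y
  proof (rule inv_into_f_eq[OF inj])
    obtain q where q: "q \<in> fst c" "q \<in> fst d" "y = snd d q" using y unfolding im by blast
    show "(snd c \<circ> chart_inv d) y \<in> ?U" using q chart_inv_left[OF A d] by auto
    show "?\<Phi> ((snd c \<circ> chart_inv d) y) = y" using q chart_inv_left[OF A d] chart_inv_left[OF A c] by simp
  qed
  have "continuous_on (?\<Phi> ` ?U) (snd c \<circ> chart_inv d)"
    unfolding im using A c d smooth_on_continuous_on unfolding smooth_atlas_def by (metis (no_types, lifting))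
  then have cinv: "continuous_on (?\<Phi> ` ?U) (inv_into ?U ?\<Phi>)"
    by (subst continuous_on_cong[OF refl inv])
  let ?D = "\<lambda>x. frechet_derivative ?\<Phi> (at x)"
  have "smooth_on ?U (\<lambda>x. det (matrix (?D x)))"
    unfolding matrix_def
    by (intro smooth_on_det U) (simp add: smooth_on_nth smooth_on_frechet_derivative smooth U)
  then have J: "continuous_on ?U (\<lambda>x. det (matrix (?D x)))" by (rule smooth_on_continuous_on)
  have "(\<integral>\<^sup>+ y. ?f y * indicator (?\<Phi> ` ?U) y \<partial>lborel) =
      (\<integral>\<^sup>+ x. ennreal \<bar>det (matrix (?D x))\<bar> * ?f (?\<Phi> x) * indicator ?U x \<partial>lborel)"
  proof (rule nn_integral_change_of_variables[OF U _ _ inj cinv J])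
    show "open (?\<Phi> ` ?U)" unfolding im by (rule open_chart_image_Int[OF A d open_chart[OF A c]])
    show "(?\<Phi> has_derivative ?D x) (at x)" if "x \<in> ?U" for x
      using smooth_on_differentiable[OF smooth that] frechet_derivative_works by blast
    have [measurable]: "snd d ` (fst d \<inter> B) \<in> sets borel" by (rule borel_chart_image[OF d B(1)])
    note [measurable] = measurable_vol[OF d]
    show "?f \<in> borel_measurable borel" by measurable
  qed
  also have "(\<integral>\<^sup>+ y. ?f y * indicator (?\<Phi> ` ?U) y \<partial>lborel) = emeasure (chart_measure d) B"
    unfolding emeasure_chart_measure[OF d B(1)] im
    using B(2,3) by (intro nn_integral_cong) (auto simp: indicator_def)
  also have "(\<integral>\<^sup>+ x. ennreal \<bar>det (matrix (?D x))\<bar> * ?f (?\<Phi> x) * indicator ?U x \<partial>lborel) =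
      emeasure (chart_measure c) B"
    unfolding emeasure_chart_measure[OF c B(1)]
  proof (intro nn_integral_cong)
    fix x
    show "ennreal \<bar>det (matrix (?D x))\<bar> * ?f (?\<Phi> x) * indicator ?U x =
        ennreal (vol c x) * indicator (snd c ` (fst c \<inter> B)) x"
    proof (cases "x \<in> ?U")
      case True
      then obtain p where p: "p \<in> fst c" "p \<in> fst d" "x = snd c p" by auto
      have x: "chart_inv c x = p" using chart_inv_left[OF A c p(1)] p(3) by simp
      have "x \<in> snd c ` (fst c \<inter> B) \<longleftrightarrow> p \<in> B"
        unfolding chart_image_Int[OF A c] using x p by auto
      moreover have "snd d p \<in> snd d ` (fst d \<inter> B) \<longleftrightarrow> p \<in> B"
        unfolding chart_image_Int[OF A d] using p chart_inv_left[OF A d p(2)] by auto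
      ultimately show ?thesis
        using True p vol_transition[OF c d p(1,2)]
        by (simp add: chart_inv_left[OF A c p(1)] ennreal_mult' transition_deriv_def indicator_def)
    next
      case False
      then have "x \<notin> snd c ` (fst c \<inter> B)" using B(2,3) by auto
      with False show ?thesis by simp
    qed
  qed
  finally show ?thesis by simp
qed

end

text \<open>The segment from the identity to M consists of positive definite matrices, whose
  determinants do not vanish; by the intermediate value theorem the determinant keeps the sign it
  has at the identity.\<close>

lemma pos_def_det_pos:
  fixes M :: "real ^ 'n::finite ^ 'n"
  assumes "\<And>v. v \<noteq> 0 \<Longrightarrow> v \<bullet> (M *v v) > 0"
  shows "det M > 0"
proof (rule ccontr)
  define N where "N t = t *\<^sub>R M + (1 - t) *\<^sub>R mat 1" for t
  have nz: "det (N t) \<noteq> 0" if "0 \<le> t" "t \<le> 1" for t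
  proof (rule pos_def_det_nonzero)
    fix v :: "real ^ 'n" assume v: "v \<noteq> 0"
    have "v \<bullet> (N t *v v) = t * (v \<bullet> (M *v v)) + (1 - t) * (v \<bullet> v)"
      by (simp add: N_def matrix_vector_mult_add_rdistrib inner_add_right scaleR_matrix_vector_assoc[symmetric])
    also have "\<dots> > 0"
      using that assms[OF v] v
      by (cases "t = 0") (auto intro: add_pos_nonneg)
    finally show "v \<bullet> (N t *v v) > 0" .
  qed
  have "continuous_on {0..1} (\<lambda>t. det (N t))"
    unfolding det_def N_def by (auto intro!: continuous_intros)
  moreover assume "\<not> det M > 0"
  then have "det (N 1) \<le> 0" "0 \<le> det (N 0)" by (simp_all add: N_def)
  ultimately obtain t where "0 \<le> t" "t \<le> 1" "det (N t) = 0"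
    using IVT2'[of "\<lambda>t. det (N t)" 1 0 0] by auto
  with nz show False by blast
qed

context riemannian_space
begin

section \<open>Existence and uniqueness of the Riemannian measure\<close>

lemma countable_chart_cover:
  obtains cs :: "nat \<Rightarrow> ('a, 'n) chart" where "\<And>n. cs n \<in> \<A>" "(\<Union>n. fst (cs n)) = UNIV"
proof -
  obtain F where F: "F \<subseteq> fst ` \<A>" "countable F" "\<Union>F = \<Union>(fst ` \<A>)"
    using Lindelof[of "fst ` \<A>"] open_chart[OF A] by blast
  have un: "\<Union>(fst ` \<A>) = UNIV" using A by (auto simp: smooth_atlas_def)
  then have "F \<noteq> {}" using F by auto
  then have e: "range (from_nat_into F) = F" using F(2) by (rule range_from_nat_into)
  define e where "e = from_nat_into F"
  have "e n \<in> fst ` \<A>" for n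
    using from_nat_into[OF \<open>F \<noteq> {}\<close>] F(1) unfolding e_def by (rule rev_subsetD)
  then have "\<exists>c. c \<in> \<A> \<and> e n = fst c" for n unfolding image_iff by (simp only: Bex_def)
  then have "\<forall>n. \<exists>c. c \<in> \<A> \<and> e n = fst c" by (rule allI)
  from choice[OF this] obtain cs where cs: "\<forall>n. cs n \<in> \<A> \<and> e n = fst (cs n)" by (rule exE)
  have "(\<Union>n. fst (cs n)) = \<Union>(range e)" using cs by auto
  also have "\<dots> = UNIV" using e F(3) un by (simp add: e_def)
  finally show thesis using that[of cs] cs by blast
qed

definition "measure_on_charts \<mu> \<longleftrightarrow>
  sets \<mu> = sets borel \<and>
  (\<forall>c\<in>\<A>. \<forall>B\<in>sets borel. B \<subseteq> fst c \<longrightarrow> emeasure \<mu> B = emeasure (chart_measure c) B)"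

lemma sets_chart_measure [simp]: "sets (chart_measure c) = sets borel" "space (chart_measure c) = UNIV"
  by (simp_all add: chart_measure_def)

lemma disjoint_chart_pieces:
  assumes cs: "\<And>n. cs n \<in> \<A>" "(\<Union>n. fst (cs n)) = UNIV"
  shows "disjointed (\<lambda>n. fst (cs n)) n \<in> sets borel" "disjointed (\<lambda>n. fst (cs n)) n \<subseteq> fst (cs n)"
    "(\<Union>n. disjointed (\<lambda>n. fst (cs n)) n) = UNIV" "disjoint_family (disjointed (\<lambda>n. fst (cs n)))"
proof -
  have "fst (cs m) \<in> sets borel" for m using borel_open[OF open_chart[OF A cs(1)]] .
  then show "disjointed (\<lambda>n. fst (cs n)) n \<in> sets borel"
    unfolding disjointed_def by (intro sets.Diff sets.finite_UN) auto
  show "disjointed (\<lambda>n. fst (cs n)) n \<subseteq> fst (cs n)" by (rule disjointed_subset)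
  show "(\<Union>n. disjointed (\<lambda>n. fst (cs n)) n) = UNIV" unfolding UN_disjointed_eq by (rule cs(2))
  show "disjoint_family (disjointed (\<lambda>n. fst (cs n)))" by (rule disjoint_family_disjointed)
qed

lemma disjoint_family_Int: "disjoint_family P \<Longrightarrow> disjoint_family (\<lambda>n. B \<inter> P n)"
  unfolding disjoint_family_on_def by blast

text \<open>Countably many chart domains are cut into disjoint Borel pieces, each inside one chart,
  so the values prescribed in charts determine the measure of every Borel set.\<close>

lemma emeasure_pieces:
  assumes cs: "\<And>n. cs n \<in> \<A>" "(\<Union>n. fst (cs n)) = UNIV" and \<mu>: "measure_on_charts \<mu>" and B: "B \<in> sets borel"
  shows "emeasure \<mu> B = (\<Sum>n. emeasure (chart_measure (cs n)) (B \<inter> disjointed (\<lambda>n. fst (cs n)) n))"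
proof -
  let ?P = "disjointed (\<lambda>n. fst (cs n))"
  note P = disjoint_chart_pieces[OF cs]
  have "(\<Sum>n. emeasure \<mu> (B \<inter> ?P n)) = emeasure \<mu> (\<Union>n. B \<inter> ?P n)"
    using P \<mu> B by (intro suminf_emeasure) (auto simp: measure_on_charts_def disjoint_family_Int)
  also have "(\<Union>n. B \<inter> ?P n) = B" using P(3) by blast
  also have "(\<Sum>n. emeasure \<mu> (B \<inter> ?P n)) = (\<Sum>n. emeasure (chart_measure (cs n)) (B \<inter> ?P n))"
  proof (intro suminf_cong)
    fix n
    have "B \<inter> ?P n \<in> sets borel" "B \<inter> ?P n \<subseteq> fst (cs n)" using B P(1,2) by auto
    then show "emeasure \<mu> (B \<inter> ?P n) = emeasure (chart_measure (cs n)) (B \<inter> ?P n)"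
      using \<mu> cs(1) unfolding measure_on_charts_def by blast
  qed
  finally show ?thesis by simp
qed

lemma measure_on_charts_unique:
  assumes "measure_on_charts \<mu>" "measure_on_charts \<mu>'"
  shows "\<mu> = \<mu>'"
proof -
  obtain cs :: "nat \<Rightarrow> ('a, 'n) chart" where cs: "\<And>n. cs n \<in> \<A>" "(\<Union>n. fst (cs n)) = UNIV" using countable_chart_cover by blast
  show ?thesis
  proof (rule measure_eqI)
    show "sets \<mu> = sets \<mu>'" using assms by (simp add: measure_on_charts_def)
    fix B assume "B \<in> sets \<mu>"
    then have "B \<in> sets borel" using assms by (simp add: measure_on_charts_def)
    then show "emeasure \<mu> B = emeasure \<mu>' B"
      using emeasure_pieces[OF cs] assms by simp
  qed
qed

text \<open>The sum over the pieces is a measure. It has the right values inside an arbitrary chart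
  because \<open>chart_measure_agree\<close> lets each piece be measured in that chart.\<close>

lemma measure_on_charts_exists: "\<exists>\<mu>. measure_on_charts \<mu>"
proof -
  obtain cs :: "nat \<Rightarrow> ('a, 'n) chart" where cs: "\<And>n. cs n \<in> \<A>" "(\<Union>n. fst (cs n)) = UNIV" using countable_chart_cover by blast
  let ?P = "disjointed (\<lambda>n. fst (cs n))"
  note P = disjoint_chart_pieces[OF cs]
  \<comment> \<open>Written as an integral over the counting measure, so that countable additivity
    becomes an exchange of a sum with an integral.\<close>
  define m where "m B = (\<integral>\<^sup>+ n. emeasure (chart_measure (cs n)) (B \<inter> ?P n) \<partial>count_space UNIV)" for B
  define \<mu> where "\<mu> = measure_of UNIV (sets borel) m"
  have sets: "sets \<mu> = sets borel"
    unfolding \<mu>_def using sets.sigma_sets_eq[of "borel :: 'a measure"] by (simp add: sets_measure_of)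
  have em: "emeasure \<mu> B = m B" if "B \<in> sets borel" for B
  proof (rule emeasure_measure_of[OF \<mu>_def])
    show "positive (sets \<mu>) m" by (simp add: positive_def m_def)
    show "countably_additive (sets \<mu>) m"
    proof (rule countably_additiveI)
      fix E :: "nat \<Rightarrow> 'a set"
      assume E: "range E \<subseteq> sets \<mu>" "disjoint_family E" "(\<Union>i. E i) \<in> sets \<mu>"
      have "(\<Sum>i. m (E i)) = (\<integral>\<^sup>+ n. (\<Sum>i. emeasure (chart_measure (cs n)) (E i \<inter> ?P n)) \<partial>count_space UNIV)"
        unfolding m_def by (rule nn_integral_suminf[symmetric]) simp
      also have "\<dots> = m (\<Union>i. E i)"
        unfolding m_def
      proof (rule nn_integral_cong)
        fix n
        have "(\<Sum>i. emeasure (chart_measure (cs n)) (E i \<inter> ?P n)) =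
            emeasure (chart_measure (cs n)) (\<Union>i. E i \<inter> ?P n)"
          using E P(1) sets disjoint_family_Int[OF E(2), of "?P n"]
          by (intro suminf_emeasure) (auto simp: Int_commute)
        then show "(\<Sum>i. emeasure (chart_measure (cs n)) (E i \<inter> ?P n)) =
            emeasure (chart_measure (cs n)) ((\<Union>i. E i) \<inter> ?P n)" by simp
      qed
      finally show "(\<Sum>i. m (E i)) = m (\<Union>i. E i)" .
    qed
  qed (use that sets in auto)
  have "emeasure \<mu> B = emeasure (chart_measure c) B" if "c \<in> \<A>" "B \<in> sets borel" "B \<subseteq> fst c" for c B
  proof -
    have "emeasure (chart_measure (cs n)) (B \<inter> ?P n) = emeasure (chart_measure c) (B \<inter> ?P n)" for n
      using that P(1,2)[of n] by (intro chart_measure_agree[OF cs(1)]) auto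
    then have "m B = (\<Sum>n. emeasure (chart_measure c) (B \<inter> ?P n))"
      by (simp add: m_def nn_integral_count_space_nat)
    also have "\<dots> = emeasure (chart_measure c) (\<Union>n. B \<inter> ?P n)"
      using that P by (intro suminf_emeasure) (auto simp: disjoint_family_Int)
    also have "(\<Union>n. B \<inter> ?P n) = B" using P(3) by blast
    finally show ?thesis using em that by simp
  qed
  with sets show ?thesis unfolding measure_on_charts_def by blast
qed

definition "\<mu> = (THE \<mu>. measure_on_charts \<mu>)"

lemma measure_on_charts_\<mu>: "measure_on_charts \<mu>"
  unfolding \<mu>_def using measure_on_charts_exists measure_on_charts_unique by (metis theI')

lemma riemannian_measure_eq: "riemannian_measure \<A> g = completion \<mu>"
proof -
  have "measure_on_charts \<mu>' \<longleftrightarrow> sets \<mu>' = sets borel \<and>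
     (\<forall>c\<in>\<A>. \<forall>B\<in>sets borel. B \<subseteq> fst c \<longrightarrow>
        emeasure \<mu>' B = (\<integral>\<^sup>+ z\<in>snd c ` B. ennreal (sqrt (det (g c (chart_inv c z)))) \<partial>lborel))" for \<mu>'
    unfolding measure_on_charts_def
    by (intro conj_cong refl ball_cong imp_cong) (simp add: emeasure_chart_measure vol_def Int_absorb1)
  then have "measure_on_charts = (\<lambda>\<mu>'. sets \<mu>' = sets borel \<and>
     (\<forall>c\<in>\<A>. \<forall>B\<in>sets borel. B \<subseteq> fst c \<longrightarrow>
        emeasure \<mu>' B = (\<integral>\<^sup>+ z\<in>snd c ` B. ennreal (sqrt (det (g c (chart_inv c z)))) \<partial>lborel)))"
    by (intro ext)
  then show ?thesis unfolding riemannian_measure_def \<mu>_def by (simp only:)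
qed

lemma sets_\<mu> [simp, measurable_cong]: "sets \<mu> = sets borel"
  using measure_on_charts_\<mu> by (simp add: measure_on_charts_def)

lemma space_\<mu> [simp]: "space \<mu> = UNIV"
  using sets_eq_imp_space_eq[OF sets_\<mu>] by simp

lemma emeasure_\<mu>:
  "c \<in> \<A> \<Longrightarrow> B \<in> sets borel \<Longrightarrow> B \<subseteq> fst c \<Longrightarrow> emeasure \<mu> B = emeasure (chart_measure c) B"
  using measure_on_charts_\<mu> by (simp add: measure_on_charts_def)

section \<open>Integrals over one chart\<close>

lemma density_\<mu>_chart:
  assumes "c \<in> \<A>"
  shows "density \<mu> (\<lambda>p. ennreal (indicator (fst c) p)) = chart_measure c"
proof (rule measure_eqI)
  fix B assume "B \<in> sets (density \<mu> (\<lambda>p. ennreal (indicator (fst c) p)))"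
  then have B: "B \<in> sets borel" by simp
  have c: "fst c \<in> sets borel" using open_chart[OF A assms] by simp
  have "emeasure (density \<mu> (\<lambda>p. ennreal (indicator (fst c) p))) B =
      (\<integral>\<^sup>+ p. ennreal (indicator (fst c) p) * indicator B p \<partial>\<mu>)"
    using B c by (intro emeasure_density) auto
  also have "\<dots> = (\<integral>\<^sup>+ p. indicator (fst c \<inter> B) p \<partial>\<mu>)"
    by (intro nn_integral_cong) (auto simp: indicator_def)
  also have "\<dots> = emeasure \<mu> (fst c \<inter> B)" using B c by (intro nn_integral_indicator) auto
  also have "\<dots> = emeasure (chart_measure c) (fst c \<inter> B)" using B c by (intro emeasure_\<mu> assms) auto
  also have "\<dots> = emeasure (chart_measure c) B"
    using B c by (simp add: emeasure_chart_measure assms Int_absorb1 flip: Int_assoc)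
  finally show "emeasure (density \<mu> (\<lambda>p. ennreal (indicator (fst c) p))) B = emeasure (chart_measure c) B" .
qed simp

context
  fixes c and f :: "'a \<Rightarrow> real"
  assumes c: "c \<in> \<A>" and f [measurable]: "f \<in> borel_measurable borel"
begin

lemma chart_measure_integral:
  "integrable (chart_measure c) f \<longleftrightarrow> integrable \<mu> (\<lambda>p. indicator (fst c) p * f p)"
  "integral\<^sup>L (chart_measure c) f = (\<integral>p. indicator (fst c) p * f p \<partial>\<mu>)"
proof -
  have [measurable]: "fst c \<in> sets borel" using open_chart[OF A c] by simp
  show "integrable (chart_measure c) f \<longleftrightarrow> integrable \<mu> (\<lambda>p. indicator (fst c) p * f p)"
    unfolding density_\<mu>_chart[OF c, symmetric] by (subst integrable_density) auto
  show "integral\<^sup>L (chart_measure c) f = (\<integral>p. indicator (fst c) p * f p \<partial>\<mu>)"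
    unfolding density_\<mu>_chart[OF c, symmetric] by (subst integral_density) auto
qed

lemma chart_measure_lborel:
  "integrable (chart_measure c) f \<longleftrightarrow>
    integrable lborel (\<lambda>z. indicator (chart_image c) z * (vol c z * f (chart_inv c z)))"
  "integral\<^sup>L (chart_measure c) f =
    (\<integral>z. indicator (chart_image c) z * (vol c z * f (chart_inv c z)) \<partial>lborel)"
proof -
  let ?u = "\<lambda>z. if z \<in> chart_image c then chart_inv c z else undefined"
  note [measurable] = measurable_vol[OF c] measurable_chart_inv[OF c]
  have eq: "(\<lambda>z. indicator (chart_image c) z * vol c z * f (?u z)) =
      (\<lambda>z. indicator (chart_image c) z * (vol c z * f (chart_inv c z)))"
    by (auto simp: fun_eq_iff indicator_def)
  have pos: "0 \<le> indicator (chart_image c) z * vol c z" for z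
  proof (cases "z \<in> chart_image c")
    case True
    have "det (g c (chart_inv c z)) > 0"
      by (rule pos_def_det_pos) (rule riemannian_metricD(3)[OF R c chart_inv_in[OF True]])
    then show ?thesis by (simp add: vol_def)
  qed simp
  show "integrable (chart_measure c) f \<longleftrightarrow>
      integrable lborel (\<lambda>z. indicator (chart_image c) z * (vol c z * f (chart_inv c z)))"
    unfolding chart_measure_def
    by (subst integrable_distr_eq, measurable, subst integrable_density) (use pos eq in \<open>simp_all add: o_def\<close>)
  show "integral\<^sup>L (chart_measure c) f =
      (\<integral>z. indicator (chart_image c) z * (vol c z * f (chart_inv c z)) \<partial>lborel)"
    unfolding chart_measure_def
    by (subst integral_distr, measurable, subst integral_density) (use pos eq in \<open>simp_all add: o_def\<close>)
qed

end

end

section \<open>Continuous selections of continuously differentiable functions\<close>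

text \<open>The form that piecewise smoothness takes in a chart: locally f picks its values from
  finitely many branches, with no structure on the sets where a branch is picked. Branches of class
  C^1 suffice for integration by parts.\<close>

definition C1_selection :: "'e::euclidean_space set \<Rightarrow> ('e \<Rightarrow> real) \<Rightarrow> bool" where
  "C1_selection U f \<longleftrightarrow> continuous_on U f \<and>
     (\<forall>x\<in>U. \<exists>W H. open W \<and> x \<in> W \<and> W \<subseteq> U \<and> finite H \<and> (\<forall>k\<in>H. Ck_on 1 W k) \<and> (\<forall>y\<in>W. \<exists>k\<in>H. f y = k y))"

lemma C1_has_derivative:
  "Ck_on 1 W k \<Longrightarrow> x \<in> W \<Longrightarrow> (k has_derivative frechet_derivative k (at x)) (at x)"
  using Ck_on_has_derivative[of 0 W k x] by simp

lemma C1_continuous_derivative: "Ck_on 1 W k \<Longrightarrow> continuous_on W (\<lambda>x. frechet_derivative k (at x) v)"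
  by simp

lemma C1_continuous: "Ck_on 1 W k \<Longrightarrow> continuous_on W k"
  using Ck_on_SucD[of 0 W k] by simp

lemma C1_lipschitz_cball:
  fixes k :: "'e::euclidean_space \<Rightarrow> real"
  assumes k: "Ck_on 1 W k" and r: "cball x r \<subseteq> W"
  shows "\<exists>L\<ge>0. \<forall>y\<in>cball x r. \<forall>z\<in>cball x r. \<bar>k y - k z\<bar> \<le> L * norm (y - z)"
proof -
  let ?D = "\<lambda>y. frechet_derivative k (at y)"
  have "\<exists>M\<ge>0. \<forall>y\<in>cball x r. \<bar>?D y b\<bar> \<le> M" for b
  proof -
    have "compact ((\<lambda>y. ?D y b) ` cball x r)"
      by (intro compact_continuous_image continuous_on_subset[OF C1_continuous_derivative[OF k] r] compact_cball)
    then obtain M where "\<forall>y\<in>cball x r. \<bar>?D y b\<bar> \<le> M"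
      using compact_imp_bounded bounded_iff[of "(\<lambda>y. ?D y b) ` cball x r"] by auto
    then show ?thesis by (intro exI[of _ "max M 0"]) fastforce
  qed
  then obtain M where M: "\<And>b. M b \<ge> 0" "\<And>b y. y \<in> cball x r \<Longrightarrow> \<bar>?D y b\<bar> \<le> M b" by metis
  have "onorm (?D y) \<le> (\<Sum>b\<in>Basis. M b)" if y: "y \<in> cball x r" for y
  proof (rule onorm_bound)
    show "0 \<le> (\<Sum>b\<in>Basis. M b)" by (intro sum_nonneg M(1))
    fix v
    have lin: "linear (?D y)" using C1_has_derivative[OF k] r y has_derivative_linear by blast
    have "?D y v = ?D y (\<Sum>b\<in>Basis. (v \<bullet> b) *\<^sub>R b)" by (simp only: euclidean_representation)
    also have "\<dots> = (\<Sum>b\<in>Basis. (v \<bullet> b) * ?D y b)"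
      by (simp only: linear_sum[OF lin] linear_scale[OF lin] real_scaleR_def)
    finally have "norm (?D y v) \<le> (\<Sum>b\<in>Basis. \<bar>(v \<bullet> b) * ?D y b\<bar>)" by (metis real_norm_def sum_abs)
    also have "\<dots> \<le> (\<Sum>b\<in>Basis. norm v * M b)"
      by (intro sum_mono) (auto simp: abs_mult intro!: mult_mono M(2)[OF y] Basis_le_norm)
    finally show "norm (?D y v) \<le> (\<Sum>b\<in>Basis. M b) * norm v" by (simp add: sum_distrib_left mult.commute)
  qed
  then have "norm (k y - k z) \<le> (\<Sum>b\<in>Basis. M b) * norm (y - z)" if "y \<in> cball x r" "z \<in> cball x r" for y z
    using that r
    by (intro differentiable_bound[OF convex_cball, where f' = ?D])
       (auto simp: subset_iff intro!: has_derivative_at_withinI C1_has_derivative[OF k])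
  then show ?thesis using M(1) by (intro exI[of _ "\<Sum>b\<in>Basis. M b"]) (auto intro: sum_nonneg)
qed

text \<open>The hypothesis compares f with its value at one centre, within a radius that depends on
  the centre. Bolzano's bisection along the segment from y to z adds up such estimates without loss
  in L.\<close>

lemma lipschitz_of_pointwise:
  fixes f :: "'e::real_normed_vector \<Rightarrow> real"
  assumes S: "convex S" "y \<in> S" "z \<in> S"
    and loc: "\<And>x. x \<in> S \<Longrightarrow> \<exists>\<delta>>0. \<forall>w\<in>S. norm (w - x) < \<delta> \<longrightarrow> \<bar>f w - f x\<bar> \<le> L * norm (w - x)"
  shows "\<bar>f z - f y\<bar> \<le> L * norm (z - y)"
proof -
  define p where "p t = y + t *\<^sub>R (z - y)" for t :: real
  have pS: "p t \<in> S" if "0 \<le> t" "t \<le> 1" for t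
    using convexD[OF S(1,2,3), of "1 - t" t] that by (simp add: p_def algebra_simps)
  have pd: "p s - p t = (s - t) *\<^sub>R (z - y)" for s t by (simp add: p_def algebra_simps)
  let ?P = "\<lambda>a b. 0 \<le> a \<and> b \<le> 1 \<longrightarrow> \<bar>f (p b) - f (p a)\<bar> \<le> L * norm (z - y) * (b - a)"
  have "?P 0 1"
  proof (rule Bolzano[of 0 1 ?P])
    show "?P a c" if "?P a b" "?P b c" "a \<le> b" "b \<le> c" for a b c
      using that by (auto simp: algebra_simps)
  next
    fix t :: real assume 3: "0 \<le> t" "t \<le> 1"
    obtain \<delta> where \<delta>: "\<delta> > 0" "\<And>w. w \<in> S \<Longrightarrow> norm (w - p t) < \<delta> \<Longrightarrow> \<bar>f w - f (p t)\<bar> \<le> L * norm (w - p t)"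
      using loc[OF pS[OF 3]] by blast
    \<comment> \<open>Parameters closer than d give points closer than \<delta>; the summand 1
      covers the case y = z.\<close>
    define d where "d = \<delta> / (norm (z - y) + 1)"
    have pos: "norm (z - y) + 1 > 0" by (smt (verit) norm_ge_zero)
    have d: "d > 0" using \<delta> pos by (simp add: d_def)
    have near: "\<bar>f (p s) - f (p t)\<bar> \<le> L * norm (z - y) * \<bar>s - t\<bar>" if "0 \<le> s" "s \<le> 1" "\<bar>s - t\<bar> < d" for s
    proof -
      have "\<bar>s - t\<bar> * norm (z - y) \<le> \<bar>s - t\<bar> * (norm (z - y) + 1)" by (simp add: mult_left_mono)
      also have "\<dots> < d * (norm (z - y) + 1)" using that pos by simp
      also have "\<dots> = \<delta>" using pos by (simp add: d_def)
      finally have "norm (p s - p t) < \<delta>" by (simp add: pd)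
      from \<delta>(2)[OF pS[OF that(1,2)] this] show ?thesis by (simp add: pd mult_ac)
    qed
    show "\<exists>d>0. \<forall>a b. a \<le> t \<and> t \<le> b \<and> b - a < d \<longrightarrow> ?P a b"
    proof (intro exI[of _ d] conjI d allI impI)
      fix a b assume ab: "a \<le> t \<and> t \<le> b \<and> b - a < d" "0 \<le> a \<and> b \<le> 1"
      have "\<bar>f (p b) - f (p t)\<bar> \<le> L * norm (z - y) * (b - t)" using near[of b] ab by auto
      moreover have "\<bar>f (p a) - f (p t)\<bar> \<le> L * norm (z - y) * (t - a)" using near[of a] ab by auto
      moreover have "L * norm (z - y) * (b - a) = L * norm (z - y) * (b - t) + L * norm (z - y) * (t - a)"
        by (simp add: algebra_simps)
      ultimately show "\<bar>f (p b) - f (p a)\<bar> \<le> L * norm (z - y) * (b - a)" by linarith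
    qed
  qed simp
  then show ?thesis by (simp add: p_def)
qed

text \<open>A branch that differs from f at y differs from it in a neighbourhood by continuity, and
  there are finitely many branches.\<close>

lemma C1_selection_nearby:
  assumes f: "continuous_on W f" and W: "open W" "y \<in> W" and H: "finite H"
    and cont: "\<And>k. k \<in> H \<Longrightarrow> continuous_on W k"
  shows "\<exists>\<delta>>0. \<forall>z. norm (z - y) < \<delta> \<longrightarrow> (\<forall>k\<in>H. f z = k z \<longrightarrow> f y = (k y :: real))"
proof -
  have "\<exists>\<delta>>0. \<forall>z. norm (z - y) < \<delta> \<longrightarrow> f z = k z \<longrightarrow> f y = k y" if k: "k \<in> H" for k
  proof (cases "f y = k y")
    case False
    have "isCont (\<lambda>z. f z - k z) y"
      using continuous_on_interior[OF continuous_on_diff[OF f cont[OF k]]] W by (simp add: interior_open)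
    then obtain \<delta> where "\<delta> > 0" "\<And>z. dist z y < \<delta> \<Longrightarrow> dist (f z - k z) (f y - k y) < \<bar>f y - k y\<bar>"
      using False unfolding continuous_at_eps_delta by (metis right_minus_eq zero_less_abs_iff)
    then show ?thesis by (intro exI[of _ \<delta>]) (fastforce simp: dist_norm)
  qed (auto intro: exI[of _ 1])
  then obtain \<delta> where \<delta>: "\<And>k. k \<in> H \<Longrightarrow> \<delta> k > 0"
    "\<And>k z. k \<in> H \<Longrightarrow> norm (z - y) < \<delta> k \<Longrightarrow> f z = k z \<Longrightarrow> f y = k y" by metis
  let ?d = "Min (insert 1 (\<delta> ` H))"
  have "?d > 0" using H \<delta>(1) by (subst Min_gr_iff) auto
  moreover have "?d \<le> \<delta> k" if "k \<in> H" for k using H that by (intro Min_le) auto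
  ultimately show ?thesis using \<delta>(2) by (intro exI[of _ ?d]) (metis order_less_le_trans)
qed

text \<open>Two points of the ball need not share a branch, but near each centre w every branch in
  use also attains the value of f at w. That branch gives an estimate with centre w, and
  \<open>lipschitz_of_pointwise\<close> makes it uniform; the constant is the sum over all
  branches.\<close>

lemma C1_selection_locally_lipschitz:
  fixes f :: "'e::euclidean_space \<Rightarrow> real"
  assumes f: "C1_selection U f" and x: "x \<in> U"
  shows "\<exists>r>0. \<exists>L. ball x r \<subseteq> U \<and> (\<forall>y\<in>ball x r. \<forall>z\<in>ball x r. \<bar>f z - f y\<bar> \<le> L * norm (z - y))"
proof -
  obtain W H where W: "open W" "x \<in> W" "W \<subseteq> U" and H: "finite H" "\<And>k. k \<in> H \<Longrightarrow> Ck_on 1 W k"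
    "\<And>y. y \<in> W \<Longrightarrow> \<exists>k\<in>H. f y = k y" using f x unfolding C1_selection_def by meson
  have fW: "continuous_on W f" using f W(3) unfolding C1_selection_def by (blast intro: continuous_on_subset)
  obtain r where r: "r > 0" "cball x r \<subseteq> W" using W open_contains_cball by blast
  have "\<forall>k\<in>H. \<exists>L\<ge>0. \<forall>y\<in>cball x r. \<forall>z\<in>cball x r. \<bar>k y - k z\<bar> \<le> L * norm (y - z)"
    using C1_lipschitz_cball[OF H(2) r(2)] by blast
  then obtain L where L: "\<And>k. k \<in> H \<Longrightarrow> L k \<ge> 0"
    "\<And>k y z. k \<in> H \<Longrightarrow> y \<in> cball x r \<Longrightarrow> z \<in> cball x r \<Longrightarrow> \<bar>k y - k z\<bar> \<le> L k * norm (y - z)" by metis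
  have LH: "L k \<le> sum L H" if "k \<in> H" for k using H(1) L(1) that by (intro member_le_sum) auto
  have "\<bar>f z - f y\<bar> \<le> sum L H * norm (z - y)" if yz: "y \<in> ball x r" "z \<in> ball x r" for y z
  proof (rule lipschitz_of_pointwise[OF convex_ball yz])
    fix w assume w: "w \<in> ball x r"
    then have wW: "w \<in> W" using r by auto
    obtain \<delta> where \<delta>: "\<delta> > 0" "\<And>z k. norm (z - w) < \<delta> \<Longrightarrow> k \<in> H \<Longrightarrow> f z = k z \<Longrightarrow> f w = k w"
      using C1_selection_nearby[OF fW W(1) wW H(1) C1_continuous[OF H(2)]] by blast
    show "\<exists>\<delta>>0. \<forall>z\<in>ball x r. norm (z - w) < \<delta> \<longrightarrow> \<bar>f z - f w\<bar> \<le> sum L H * norm (z - w)"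
    proof (intro exI[of _ \<delta>] conjI \<delta>(1) ballI impI)
      fix z assume z: "z \<in> ball x r" "norm (z - w) < \<delta>"
      then have "z \<in> W" using r(2) by auto
      then obtain k where k: "k \<in> H" "f z = k z" using H(3) by blast
      have "\<bar>f z - f w\<bar> \<le> L k * norm (z - w)"
        using \<delta>(2)[OF z(2) k] k L(2)[OF k(1), of z w] z w by auto
      also have "\<dots> \<le> sum L H * norm (z - w)" by (intro mult_right_mono LH k norm_ge_zero)
      finally show "\<bar>f z - f w\<bar> \<le> sum L H * norm (z - w)" .
    qed
  qed
  moreover have "ball x r \<subseteq> U" using r(2) W(3) by (meson ball_subset_cball order_trans)
  ultimately show ?thesis using r(1) by blast
qed

text \<open>Moving the level set by small multiples of \<open>e\<close> makes \<open>k\<close> strictly increase, so locally the level set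
  has infinitely many disjoint translates in a bounded set.\<close>

lemma negligible_regular_level_set:
  fixes k :: "'e::euclidean_space \<Rightarrow> real"
  assumes k: "Ck_on 1 W k" and W: "open W"
  shows "negligible {x\<in>W. k x = 0 \<and> frechet_derivative k (at x) e > 0}"
proof (subst locally_negligible_alt, intro ballI)
  let ?D = "\<lambda>x. frechet_derivative k (at x) e" and ?S = "{x\<in>W. k x = 0 \<and> frechet_derivative k (at x) e > 0}"
  fix x assume x: "x \<in> ?S"
  have "isCont ?D x"
    using continuous_on_interior[OF C1_continuous_derivative[OF k]] W x by (simp add: interior_open)
  then obtain d1 where d1: "d1 > 0" "\<And>y. dist y x < d1 \<Longrightarrow> dist (?D y) (?D x) < ?D x"
    using x unfolding continuous_at_eps_delta by blast
  obtain d2 where d2: "d2 > 0" "ball x d2 \<subseteq> W" using W x open_contains_ball by blast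
  define r where "r = min d1 d2"
  have r: "r > 0" "ball x r \<subseteq> W" using d1 d2 by (auto simp: r_def)
  have D: "?D y > 0" if "y \<in> ball x r" for y
    using d1(2)[of y] that by (auto simp: r_def dist_commute dist_real_def)
  define T where "T = {y\<in>ball x r. k y = 0}"
  \<comment> \<open>Along e the function k has positive derivative throughout the ball, so no two of
    its zeros there differ by a positive multiple of e.\<close>
  have inc: False if yz: "y \<in> T" "z \<in> T" "z = y + s *\<^sub>R e" "s > 0" for y z s
  proof -
    have seg: "y + t *\<^sub>R e \<in> ball x r" if t: "0 \<le> t" "t \<le> s" for t
    proof -
      have "y + t *\<^sub>R e = (1 - t / s) *\<^sub>R y + (t / s) *\<^sub>R z" using yz(4) by (simp add: yz(3) algebra_simps)
      then show ?thesis
        using convexD[OF convex_ball, of y x r z "1 - t/s" "t/s"] yz t by (auto simp: T_def)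
    qed
    have "((\<lambda>t. k (y + t *\<^sub>R e)) has_real_derivative ?D (y + t *\<^sub>R e)) (at t)" if "0 \<le> t" "t \<le> s" for t
      using seg[OF that] r(2) by (intro has_real_derivative_along_line C1_has_derivative[OF k]) auto
    then have "\<exists>t>0. t < s \<and> k (y + s *\<^sub>R e) - k (y + 0 *\<^sub>R e) = (s - 0) * ?D (y + t *\<^sub>R e)"
      by (intro MVT2[OF yz(4)])
    then obtain t where t: "0 < t" "t < s" "k z - k y = s * ?D (y + t *\<^sub>R e)" by (auto simp: yz(3))
    moreover have "?D (y + t *\<^sub>R e) > 0" using t by (intro D seg) auto
    ultimately have "k z - k y > 0" using yz(4) by simp
    then show False using yz by (simp add: T_def)
  qed
  have T: "T \<in> sets borel"
  proof -
    have "(\<lambda>y. indicator (ball x r) y *\<^sub>R k y) \<in> borel_measurable borel"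
      by (intro borel_measurable_continuous_on_indicator continuous_on_subset[OF C1_continuous[OF k] r(2)]) auto
    from measurable_sets_borel[OF this, of "{0}"]
    have "(\<lambda>y. indicator (ball x r) y *\<^sub>R k y) -` {0} \<in> sets borel" by simp
    moreover have "T = ball x r \<inter> (\<lambda>y. indicator (ball x r) y *\<^sub>R k y) -` {0}" by (auto simp: T_def)
    ultimately show ?thesis by auto
  qed
  define E where "E n = (+) (inverse (real (Suc n)) *\<^sub>R e) ` T" for n
  have En: "E n = (\<lambda>y. - (inverse (real (Suc n)) *\<^sub>R e) + y) -` T" for n
    unfolding E_def by (auto simp: image_iff) (metis add.commute diff_add_cancel)
  have Eb: "E n \<in> sets borel" for n
    unfolding En by (rule measurable_sets_borel[OF _ T]) simp
  have Em: "emeasure lborel (E n) = emeasure lborel T" for n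
  proof -
    have "emeasure lborel T = emeasure (distr lborel borel ((+) (- (inverse (real (Suc n)) *\<^sub>R e)))) T"
      by (simp add: lborel_distr_plus)
    also have "\<dots> = emeasure lborel (E n)"
      using T unfolding En by (subst emeasure_distr) (auto simp: vimage_def)
    finally show ?thesis by simp
  qed
  have dis: "disjoint_family E"
    unfolding disjoint_family_on_def
  proof (intro ballI impI)
    fix m n :: nat assume "m \<noteq> n"
    have no: False if "m < n" "y \<in> T" "z \<in> T"
      "inverse (real (Suc m)) *\<^sub>R e + y = inverse (real (Suc n)) *\<^sub>R e + z" for m n y z
    proof (rule inc[OF that(2,3)])
      show "z = y + (inverse (real (Suc m)) - inverse (real (Suc n))) *\<^sub>R e"
        using that(4) by (simp add: algebra_simps)
      show "inverse (real (Suc m)) - inverse (real (Suc n)) > 0" using that(1) by simp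
    qed
    show "E m \<inter> E n = {}"
      using no[of m n] no[of n m] \<open>m \<noteq> n\<close> unfolding E_def by (fastforce simp: neq_iff)
  qed
  have sub: "(\<Union>n. E n) \<subseteq> cball x (r + norm e)"
  proof (clarsimp simp: E_def T_def)
    fix n y assume y: "dist x y < r"
    have "norm (e /\<^sub>R (1 + real n)) \<le> norm e" by (simp add: divide_le_eq mult_le_cancel_left1 flip: divide_inverse_commute)
    then show "dist x (e /\<^sub>R (1 + real n) + y) \<le> r + norm e"
      using y norm_triangle_ineq4[of "x - y" "e /\<^sub>R (1 + real n)"]
      by (simp add: dist_norm algebra_simps)
  qed
  have "(\<Sum>n. emeasure lborel (E n)) = emeasure lborel (\<Union>n. E n)"
    using Eb dis by (intro suminf_emeasure) auto
  also have "\<dots> \<le> emeasure lborel (cball x (r + norm e))" using sub by (intro emeasure_mono) auto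
  also have "\<dots> < \<infinity>" using emeasure_bounded_finite[OF bounded_cball] by simp
  \<comment> \<open>All translates have the measure of T, so a finite total forces this measure to
    be 0.\<close>
  finally have "(\<integral>\<^sup>+ n. emeasure lborel T \<partial>count_space (UNIV :: nat set)) < \<infinity>"
    unfolding Em nn_integral_count_space_nat[symmetric] .
  then have "emeasure lborel T = 0"
    by (simp add: ennreal_mult_less_top)
  then have "T \<in> null_sets lborel" using T by auto
  then have "negligible T" by (simp add: negligible_iff_null_sets null_sets_completionI)
  moreover have "openin (top_of_set ?S) (?S \<inter> ball x r)" by (simp add: openin_open_Int)
  moreover have "x \<in> ?S \<inter> ball x r" using x r by auto
  moreover have "?S \<inter> ball x r \<subseteq> T" by (auto simp: T_def)
  ultimately show "\<exists>u. openin (top_of_set ?S) u \<and> x \<in> u \<and> negligible u"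
    using negligible_subset by blast
qed

lemma negligible_UN_finite:
  "finite I \<Longrightarrow> (\<And>i. i \<in> I \<Longrightarrow> negligible (A i)) \<Longrightarrow> negligible (\<Union>i\<in>I. A i)"
  by (auto intro!: negligible_Union)

text \<open>A nonzero differential is positive on some basis vector or on its negative, so finitely
  many directions suffice.\<close>

lemma negligible_regular_level_set':
  fixes k :: "'e::euclidean_space \<Rightarrow> real"
  assumes k: "Ck_on 1 W k" and W: "open W"
  shows "negligible {x\<in>W. k x = 0 \<and> frechet_derivative k (at x) \<noteq> (\<lambda>v. 0)}"
proof -
  let ?S = "\<lambda>e. {x\<in>W. k x = 0 \<and> frechet_derivative k (at x) e > 0}"
  have "{x\<in>W. k x = 0 \<and> frechet_derivative k (at x) \<noteq> (\<lambda>v. 0)} \<subseteq>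
      (\<Union>e\<in>Basis \<union> uminus ` Basis. ?S e)"
  proof clarify
    fix x assume x: "x \<in> W" "k x = 0" "frechet_derivative k (at x) \<noteq> (\<lambda>v. 0)"
    let ?D = "frechet_derivative k (at x)"
    have lin: "linear ?D" using C1_has_derivative[OF k x(1)] has_derivative_linear by blast
    have "\<exists>b\<in>Basis. ?D b \<noteq> 0"
    proof (rule ccontr)
      assume "\<not> ?thesis"
      then have "?D = (\<lambda>v. 0)" by (intro linear_eq_stdbasis[OF lin module_hom_zero]) blast
      with x(3) show False ..
    qed
    then obtain b where b: "b \<in> Basis" "?D b \<noteq> 0" by blast
    have "?D (- b) = - ?D b" by (rule linear_neg[OF lin])
    then have "?D b > 0 \<or> ?D (- b) > 0" using b(2) by linarith
    then show "x \<in> (\<Union>e\<in>Basis \<union> uminus ` Basis. ?S e)" using x b(1) by auto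
  qed
  moreover have "negligible (\<Union>e\<in>Basis \<union> uminus ` Basis. ?S e)"
    by (intro negligible_UN_finite negligible_regular_level_set[OF k W]) simp
  ultimately show ?thesis by (rule negligible_subset[rotated])
qed

lemma has_derivative_selection:
  fixes f :: "'e::euclidean_space \<Rightarrow> real"
  assumes H: "finite H" and W: "open W" "x \<in> W" and f: "continuous_on W f"
    and cont: "\<And>k. k \<in> H \<Longrightarrow> continuous_on W k"
    and sel: "\<And>y. y \<in> W \<Longrightarrow> \<exists>k\<in>H. f y = k y"
    and D: "\<And>k. k \<in> H \<Longrightarrow> f x = k x \<Longrightarrow> (k has_derivative D) (at x)"
  shows "(f has_derivative D) (at x)"
  unfolding has_derivative_at_alt
proof (intro conjI allI impI)
  obtain k0 where k0: "k0 \<in> H" "f x = k0 x" using sel W(2) by blast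
  then show "bounded_linear D" using D has_derivative_bounded_linear by blast
  fix e :: real assume e: "e > 0"
  obtain \<delta> where \<delta>: "\<delta> > 0" "\<And>z k. norm (z - x) < \<delta> \<Longrightarrow> k \<in> H \<Longrightarrow> f z = k z \<Longrightarrow> f x = k x"
    using C1_selection_nearby[OF f W H cont] by blast
  obtain \<rho> where \<rho>: "\<rho> > 0" "ball x \<rho> \<subseteq> W" using W open_contains_ball by blast
  have "\<exists>d>0. \<forall>y. norm (y - x) < d \<longrightarrow> f x = k x \<longrightarrow> norm (k y - k x - D (y - x)) \<le> e * norm (y - x)" if "k \<in> H" for k
    using D[OF that] e unfolding has_derivative_at_alt by (cases "f x = k x") (auto intro: exI[of _ 1])
  then obtain d where d: "\<And>k. k \<in> H \<Longrightarrow> d k > 0"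
    "\<And>k y. k \<in> H \<Longrightarrow> norm (y - x) < d k \<Longrightarrow> f x = k x \<Longrightarrow> norm (k y - k x - D (y - x)) \<le> e * norm (y - x)"
    by metis
  let ?d = "Min (insert \<rho> (insert \<delta> (d ` H)))"
  have pos: "?d > 0" using H d(1) \<delta> \<rho> by (subst Min_gr_iff) auto
  have le: "?d \<le> \<rho>" "?d \<le> \<delta>" "\<And>k. k \<in> H \<Longrightarrow> ?d \<le> d k" using H by (intro Min_le; simp)+
  show "\<exists>d>0. \<forall>y. norm (y - x) < d \<longrightarrow> norm (f y - f x - D (y - x)) \<le> e * norm (y - x)"
  proof (intro exI[of _ ?d] conjI pos allI impI)
    fix y assume y: "norm (y - x) < ?d"
    then have "y \<in> W" using le(1) \<rho>(2) by (auto simp: dist_norm norm_minus_commute)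
    then obtain k where k: "k \<in> H" "f y = k y" using sel by blast
    have "f x = k x" using \<delta>(2)[of y k] y le(2) k by auto
    then show "norm (f y - f x - D (y - x)) \<le> e * norm (y - x)"
      using d(2)[of k y] y le(3)[OF k(1)] k by auto
  qed
qed

text \<open>Where f fails to be differentiable, two active branches have different differentials.
  Such a point is a regular zero of the difference of the two branches, and these zeros are
  negligible by \<open>negligible_regular_level_set'\<close>.\<close>

lemma C1_selection_differentiable_ae:
  fixes f :: "'e::euclidean_space \<Rightarrow> real"
  assumes f: "C1_selection U f" and U: "open U"
  shows "\<exists>N\<in>null_sets lborel. \<forall>x\<in>U - N. f differentiable at x"
proof -
  let ?B = "{x\<in>U. \<not> f differentiable at x}"
  have "negligible ?B"
  proof (subst locally_negligible_alt, intro ballI)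
    fix x assume "x \<in> ?B"
    then obtain W H where W: "open W" "x \<in> W" "W \<subseteq> U" and H: "finite H" "\<And>k. k \<in> H \<Longrightarrow> Ck_on 1 W k"
      "\<And>y. y \<in> W \<Longrightarrow> \<exists>k\<in>H. f y = k y" using f unfolding C1_selection_def by (metis (mono_tags, lifting) mem_Collect_eq)
    have fW: "continuous_on W f" using f W(3) unfolding C1_selection_def by (blast intro: continuous_on_subset)
    let ?S = "\<lambda>k l. {x\<in>W. k x - l x = 0 \<and> frechet_derivative (\<lambda>x. k x - l x) (at x) \<noteq> (\<lambda>v. 0)}"
    have "?B \<inter> W \<subseteq> (\<Union>k\<in>H. \<Union>l\<in>H. ?S k l)"
    proof (rule ccontr)
      assume "\<not> ?thesis"
      then obtain y where y: "y \<in> W" "\<not> f differentiable at y" and no: "y \<notin> (\<Union>k\<in>H. \<Union>l\<in>H. ?S k l)" by blast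
      obtain k where k: "k \<in> H" "f y = k y" using H(3)[OF y(1)] by blast
      have "(l has_derivative frechet_derivative k (at y)) (at y)" if l: "l \<in> H" "f y = l y" for l
      proof -
        note dk = C1_has_derivative[OF H(2)[OF k(1)] y(1)] and dl = C1_has_derivative[OF H(2)[OF l(1)] y(1)]
        have "frechet_derivative (\<lambda>x. k x - l x) (at y) = (\<lambda>v. 0)"
          using no k l y(1) by auto
        then have "(\<lambda>v. frechet_derivative k (at y) v - frechet_derivative l (at y) v) = (\<lambda>v. 0)"
          using frechet_derivative_at[OF has_derivative_diff[OF dk dl]] by simp
        then have "frechet_derivative l (at y) = frechet_derivative k (at y)" by (simp add: fun_eq_iff)
        with dl show ?thesis by simp
      qed
      then have "(f has_derivative frechet_derivative k (at y)) (at y)"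
        by (intro has_derivative_selection[OF H(1) W(1) y(1) fW C1_continuous[OF H(2)] H(3)])
      then show False using y(2) differentiable_def by blast
    qed
    moreover have "negligible (\<Union>k\<in>H. \<Union>l\<in>H. ?S k l)"
    proof (intro negligible_UN_finite H(1))
      fix k l assume kl: "k \<in> H" "l \<in> H"
      have "Ck_on 1 W (\<lambda>x. k x + - 1 * l x)"
        by (intro Ck_on_add Ck_on_mult Ck_on_const W(1) H(2) kl)
      then show "negligible (?S k l)" by (intro negligible_regular_level_set' W(1)) simp
    qed
    ultimately have "negligible (?B \<inter> W)" by (rule negligible_subset[rotated])
    moreover have "openin (top_of_set ?B) (?B \<inter> W)" using W(1) by (simp add: openin_open_Int)
    ultimately show "\<exists>u. openin (top_of_set ?B) u \<and> x \<in> u \<and> negligible u"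
      using \<open>x \<in> ?B\<close> W(2) by (intro exI[of _ "?B \<inter> W"]) auto
  qed
  then have "?B \<in> null_sets lebesgue" by (simp add: negligible_iff_null_sets)
  then obtain N where "N \<in> null_sets lborel" "?B \<subseteq> N"
    using null_sets_completion_iff2[of ?B lborel] by blast
  then show ?thesis by (intro bexI[of _ N]) auto
qed

section \<open>The integral of a derivative\<close>

lemma difference_quotient_tendsto:
  fixes f :: "'e::euclidean_space \<Rightarrow> real"
  assumes "f differentiable at x"
  shows "(\<lambda>n. real (Suc n) * (f (x + inverse (real (Suc n)) *\<^sub>R e) - f x)) \<longlonglongrightarrow> frechet_derivative f (at x) e"
proof -
  have "((\<lambda>s. f (x + s *\<^sub>R e)) has_real_derivative frechet_derivative f (at x) e) (at 0)"
    by (rule has_real_derivative_along_line) (use assms in \<open>simp add: frechet_derivative_works\<close>)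
  then have "((\<lambda>s. (f (x + s *\<^sub>R e) - f x) / s) \<longlongrightarrow> frechet_derivative f (at x) e) (at 0)"
    by (simp add: has_field_derivative_iff)
  moreover have "filterlim (\<lambda>n. inverse (real (Suc n))) (at 0) sequentially"
    using LIMSEQ_inverse_real_of_nat by (simp add: filterlim_at)
  ultimately have "(\<lambda>n. (f (x + inverse (real (Suc n)) *\<^sub>R e) - f x) / inverse (real (Suc n))) \<longlonglongrightarrow>
      frechet_derivative f (at x) e" by (rule filterlim_compose)
  then show ?thesis by (simp add: field_simps)
qed

text \<open>The derivative is a limit of difference quotients, which are Borel. The indicator
  removes the points where \<open>frechet_derivative\<close> is unspecified.\<close>

lemma borel_measurable_frechet_derivative:
  fixes f :: "'e::euclidean_space \<Rightarrow> real"
  assumes f: "continuous_on U f" and U: "open U" and N: "N \<in> sets borel"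
    and diff: "\<And>x. x \<in> U - N \<Longrightarrow> f differentiable at x"
  shows "(\<lambda>x. indicator (U - N) x * frechet_derivative f (at x) e) \<in> borel_measurable borel"
proof -
  \<comment> \<open>Extension by 0 makes the quotients Borel on the whole space; near a point of U
    it does not change the derivative.\<close>
  let ?F = "\<lambda>x. indicator U x *\<^sub>R f x"
  have [measurable]: "U \<in> sets borel" "N \<in> sets borel" using U N by auto
  have [measurable]: "?F \<in> borel_measurable borel"
    by (rule borel_measurable_continuous_on_indicator[OF _ f]) simp
  let ?s = "\<lambda>n x. indicator (U - N) x * (real (Suc n) * (?F (x + inverse (real (Suc n)) *\<^sub>R e) - ?F x))"
  show ?thesis
  proof (rule borel_measurable_LIMSEQ_real[where u = ?s])
    show "?s n \<in> borel_measurable borel" for n by measurable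
    fix x
    show "(\<lambda>n. ?s n x) \<longlonglongrightarrow> indicator (U - N) x * frechet_derivative f (at x) e"
    proof (cases "x \<in> U - N")
      case True
      have "?F differentiable at x"
        using diff[OF True] True by (subst differentiable_cong_open[OF U, of _ _ f]) auto
      moreover have "frechet_derivative ?F (at x) = frechet_derivative f (at x)"
        using True by (intro frechet_derivative_cong_open[OF U]) auto
      ultimately show ?thesis using True difference_quotient_tendsto[of ?F x e] by simp
    qed simp
  qed
qed

lemma integral_frechet_derivative_zero:
  fixes f :: "'e::euclidean_space \<Rightarrow> real"
  assumes f: "C1_selection UNIV f" and supp: "\<And>x. x \<notin> cball 0 \<rho> \<Longrightarrow> f x = 0"
    and N: "N \<in> null_sets lborel" "\<And>x. x \<notin> N \<Longrightarrow> f differentiable at x"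
  shows "integrable lborel (\<lambda>x. indicator (- N) x * frechet_derivative f (at x) e)"
    and "(\<integral>x. indicator (- N) x * frechet_derivative f (at x) e \<partial>lborel) = 0"
proof -
  have cont: "continuous_on UNIV f" using f by (simp add: C1_selection_def)
  have [measurable]: "f \<in> borel_measurable borel" using cont by (rule borel_measurable_continuous_onI)
  \<comment> \<open>A global Lipschitz constant: finitely many balls cover the ball that carries f,
    and outside of it f vanishes on an open set.\<close>
  obtain L where L: "L \<ge> 0" "\<And>y z. \<bar>f z - f y\<bar> \<le> L * norm (z - y)"
  proof -
    have "\<forall>x. \<exists>r L. r > 0 \<and> (\<forall>y\<in>ball x r. \<forall>z\<in>ball x r. \<bar>f z - f y\<bar> \<le> L * norm (z - y))"
      using C1_selection_locally_lipschitz[OF f] by (meson UNIV_I)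
    then obtain r l where rl: "\<And>x. r x > 0"
      "\<And>x y z. y \<in> ball x (r x) \<Longrightarrow> z \<in> ball x (r x) \<Longrightarrow> \<bar>f z - f y\<bar> \<le> l x * norm (z - y)" by metis
    have "x \<in> ball x (r x)" for x using rl(1) by simp
    then have cover: "cball 0 \<rho> \<subseteq> (\<Union>x\<in>UNIV. ball x (r x))" by blast
    obtain X where X: "finite X" "cball 0 \<rho> \<subseteq> (\<Union>x\<in>X. ball x (r x))"
      using compactE_image[OF compact_cball _ cover] by (metis open_ball)
    define L where "L = (\<Sum>x\<in>X. \<bar>l x\<bar>)"
    have "\<bar>f z - f y\<bar> \<le> L * norm (z - y)" for y z
    proof (rule lipschitz_of_pointwise[of UNIV])
      fix w
      show "\<exists>\<delta>>0. \<forall>z\<in>UNIV. norm (z - w) < \<delta> \<longrightarrow> \<bar>f z - f w\<bar> \<le> L * norm (z - w)"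
      proof (cases "w \<in> cball 0 \<rho>")
        case True
        then obtain x where x: "x \<in> X" "w \<in> ball x (r x)" using X(2) by blast
        obtain \<delta> where \<delta>: "\<delta> > 0" "ball w \<delta> \<subseteq> ball x (r x)"
          using openE[OF open_ball x(2)] by blast
        have "l x \<le> L" unfolding L_def using member_le_sum[OF x(1), of "\<lambda>x. \<bar>l x\<bar>"] X(1) by simp
        then have "\<bar>f z - f w\<bar> \<le> L * norm (z - w)" if "norm (z - w) < \<delta>" for z
        proof -
          have "z \<in> ball x (r x)" using \<delta>(2) that by (auto simp: dist_norm norm_minus_commute subset_iff)
          from rl(2)[OF x(2) this] show ?thesis
            using mult_right_mono[OF \<open>l x \<le> L\<close> norm_ge_zero[of "z - w"]] by linarith
        qed
        with \<delta>(1) show ?thesis by blast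
      next
        case False
        then obtain \<delta> where \<delta>: "\<delta> > 0" "ball w \<delta> \<subseteq> - cball 0 \<rho>"
          using openE[OF open_Compl[OF closed_cball]] by (metis ComplI)
        have "\<bar>f z - f w\<bar> \<le> L * norm (z - w)" if "norm (z - w) < \<delta>" for z
        proof -
          have "z \<notin> cball 0 \<rho>" using \<delta>(2) that by (auto simp: dist_norm norm_minus_commute subset_iff)
          then show ?thesis using supp False by (simp add: L_def sum_nonneg)
        qed
        with \<delta>(1) show ?thesis by blast
      qed
    qed auto
    moreover have "L \<ge> 0" by (simp add: L_def sum_nonneg)
    ultimately show thesis using that by blast
  qed
  let ?t = "\<lambda>n. inverse (real (Suc n)) *\<^sub>R e"
  let ?s = "\<lambda>n x. real (Suc n) * (f (x + ?t n) - f x)"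
  \<comment> \<open>Enlarged by norm e, the ball contains the supports of f and of all its
    translates, whose shifts have norm at most norm e.\<close>
  let ?K = "cball (0::'e) (\<bar>\<rho>\<bar> + norm e)"
  have intf: "integrable lborel f"
  proof (rule integrableI_bounded_set[where A = "cball 0 \<rho>" and B = "\<bar>L\<bar> * (2 * \<bar>\<rho>\<bar> + 1) + \<bar>f 0\<bar>"])
    show "emeasure lborel (cball (0::'e) \<rho>) < \<infinity>" using emeasure_bounded_finite[OF bounded_cball] by simp
    show "AE x\<in>cball 0 \<rho> in lborel. norm (f x) \<le> \<bar>L\<bar> * (2 * \<bar>\<rho>\<bar> + 1) + \<bar>f 0\<bar>"
    proof (intro AE_I2 impI)
      fix x :: 'e assume "x \<in> cball 0 \<rho>"
      then have "L * norm (x - 0) \<le> \<bar>L\<bar> * (2 * \<bar>\<rho>\<bar> + 1)" using L(1) by (intro mult_mono) auto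
      then show "norm (f x) \<le> \<bar>L\<bar> * (2 * \<bar>\<rho>\<bar> + 1) + \<bar>f 0\<bar>" using L(2)[of x 0] by auto
    qed
  qed (use supp in auto)
  have intt: "integrable lborel (\<lambda>x. f (x + ?t n))" "(\<integral>x. f (x + ?t n) \<partial>lborel) = (\<integral>x. f x \<partial>lborel)" for n
  proof -
    have "integrable (distr lborel borel ((+) (?t n))) f" unfolding lborel_distr_plus by (rule intf)
    then show "integrable lborel (\<lambda>x. f (x + ?t n))" by (simp add: integrable_distr_eq add.commute)
    have "(\<integral>x. f x \<partial>lborel) = (\<integral>x. f x \<partial>distr lborel borel ((+) (?t n)))" unfolding lborel_distr_plus ..
    also have "\<dots> = (\<integral>x. f (?t n + x) \<partial>lborel)" by (subst integral_distr) auto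
    finally show "(\<integral>x. f (x + ?t n) \<partial>lborel) = (\<integral>x. f x \<partial>lborel)" by (simp add: add.commute)
  qed
  have int0: "(\<integral>x. ?s n x \<partial>lborel) = 0" for n
    using Bochner_Integration.integral_diff[OF intt(1)[of n] intf] intt(2)[of n] by simp
  have bound: "\<bar>?s n x\<bar> \<le> indicator ?K x * (L * norm e)" for n x
  proof -
    have ne: "norm (?t n) \<le> norm e"
      using mult_right_mono[of "inverse (real (Suc n))" 1 "norm e"] by (simp add: inverse_le_1_iff)
    show ?thesis
    proof (cases "x \<in> ?K")
      case True
      have "\<bar>?s n x\<bar> = real (Suc n) * \<bar>f (x + ?t n) - f x\<bar>" by (simp add: abs_mult)
      also have "\<dots> \<le> real (Suc n) * (L * norm (?t n))"
        using L(2)[of "x + ?t n" x] by (intro mult_left_mono) auto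
      also have "\<dots> = L * norm e" by (simp add: field_simps)
      finally show ?thesis using True by simp
    next
      case False
      have "norm x \<le> norm (x + ?t n) + norm (?t n)"
        using norm_triangle_ineq4[of "x + ?t n" "?t n"] by simp
      then have "norm (x + ?t n) > \<bar>\<rho>\<bar>" using False ne by (simp add: dist_norm)
      then have "f (x + ?t n) = 0" by (intro supp) auto
      moreover have "norm x > \<rho>" using False by (simp add: dist_norm) (smt (verit) norm_ge_zero)
      then have "f x = 0" by (intro supp) auto
      ultimately show ?thesis using False by simp
    qed
  qed
  let ?g = "\<lambda>x. indicator (- N) x * frechet_derivative f (at x) e"
  have Nb: "N \<in> sets borel" using N(1) by auto
  have gm: "?g \<in> borel_measurable lborel"
    using borel_measurable_frechet_derivative[OF cont open_UNIV Nb N(2)] by (simp add: Compl_eq_Diff_UNIV)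
  have sm: "?s n \<in> borel_measurable lborel" for n by measurable
  have bi: "integrable lborel (\<lambda>x. indicator ?K x * (L * norm e))"
    using emeasure_bounded_finite[OF bounded_cball, of "0::'e" "\<bar>\<rho>\<bar> + norm e"]
    by (intro integrable_mult_left integrable_real_indicator) auto
  have lim: "AE x in lborel. (\<lambda>n. ?s n x) \<longlonglongrightarrow> ?g x"
    using AE_not_in[OF N(1)] by eventually_elim (use difference_quotient_tendsto[OF N(2)] in auto)
  have bd: "AE x in lborel. norm (?s n x) \<le> indicator ?K x * (L * norm e)" for n
    using bound[of n] by simp
  show "integrable lborel ?g"
    by (rule integrable_dominated_convergence[OF gm sm bi lim bd])
  have "(\<lambda>n. \<integral>x. ?s n x \<partial>lborel) \<longlonglongrightarrow> (\<integral>x. ?g x \<partial>lborel)"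
    by (rule integral_dominated_convergence[OF gm sm bi lim bd])
  then show "(\<integral>x. ?g x \<partial>lborel) = 0" unfolding int0 using LIMSEQ_unique tendsto_const by blast
qed

section \<open>Piecewise smooth functions\<close>

text \<open>On the intersection of the two neighbourhoods, the branches are the combinations of all
  pairs of branches.\<close>

lemma piecewise_smooth_pointwise:
  assumes A: "smooth_atlas \<A>" and f: "piecewise_smooth \<A> f" and k: "piecewise_smooth \<A> k"
    and cont: "\<And>u v :: 'a \<Rightarrow> real. continuous_on UNIV u \<Longrightarrow> continuous_on UNIV v \<Longrightarrow> continuous_on UNIV (\<lambda>p. F (u p) (v p :: real) :: real)"
    and smooth: "\<And>S (u :: real ^ 'n \<Rightarrow> real) v. open S \<Longrightarrow> smooth_on S u \<Longrightarrow> smooth_on S v \<Longrightarrow> smooth_on S (\<lambda>x. F (u x) (v x))"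
  shows "piecewise_smooth (\<A> :: ('a::topological_space, 'n::finite) chart set) (\<lambda>p. F (f p) (k p))"
  unfolding piecewise_smooth_def
proof (intro conjI allI)
  show "continuous_on UNIV (\<lambda>p. F (f p) (k p))"
    by (rule cont) (use f k in \<open>auto simp: piecewise_smooth_def\<close>)
  fix p
  obtain W1 H1 where 1: "open W1" "p \<in> W1" "finite H1" "\<forall>h\<in>H1. smooth_fun_on \<A> W1 h" "\<forall>q\<in>W1. \<exists>h\<in>H1. f q = h q"
    using f unfolding piecewise_smooth_def by meson
  obtain W2 H2 where 2: "open W2" "p \<in> W2" "finite H2" "\<forall>h\<in>H2. smooth_fun_on \<A> W2 h" "\<forall>q\<in>W2. \<exists>h\<in>H2. k q = h q"
    using k unfolding piecewise_smooth_def by meson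
  let ?H = "(\<lambda>(u, v) p. F (u p) (v p)) ` (H1 \<times> H2)"
  have "smooth_fun_on \<A> (W1 \<inter> W2) h" if hH: "h \<in> ?H" for h
  proof -
    obtain u v where uv: "u \<in> H1" "v \<in> H2" "h = (\<lambda>p. F (u p) (v p))" using hH by auto
    show ?thesis
      unfolding smooth_fun_on_def uv(3) o_def
    proof (intro ballI smooth)
      fix c assume c: "c \<in> \<A>"
      show "open (snd c ` (fst c \<inter> (W1 \<inter> W2)))" by (rule open_chart_image_Int[OF A c open_Int[OF 1(1) 2(1)]])
      show "smooth_on (snd c ` (fst c \<inter> (W1 \<inter> W2))) (\<lambda>x. u (chart_inv c x))"
        "smooth_on (snd c ` (fst c \<inter> (W1 \<inter> W2))) (\<lambda>x. v (chart_inv c x))"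
        using 1(4) 2(4) uv c unfolding smooth_fun_on_def o_def by (blast intro: smooth_on_subset)+
    qed
  qed
  moreover have "\<exists>h\<in>?H. F (f q) (k q) = h q" if "q \<in> W1 \<inter> W2" for q
  proof -
    obtain u v where "u \<in> H1" "f q = u q" "v \<in> H2" "k q = v q" using 1(5) 2(5) \<open>q \<in> W1 \<inter> W2\<close> by blast
    then show ?thesis by (intro bexI[of _ "\<lambda>p. F (u p) (v p)"]) auto
  qed
  moreover have "finite ?H" using 1(3) 2(3) by simp
  ultimately show "\<exists>W H. open W \<and> p \<in> W \<and> finite H \<and> (\<forall>h\<in>H. smooth_fun_on \<A> W h) \<and>
      (\<forall>q\<in>W. \<exists>h\<in>H. F (f q) (k q) = h q)"
    using 1(1,2) 2(1,2) by (intro exI[of _ "W1 \<inter> W2"] exI[of _ ?H]) auto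
qed

lemma piecewise_smooth_mult:
  "smooth_atlas \<A> \<Longrightarrow> piecewise_smooth \<A> f \<Longrightarrow> piecewise_smooth \<A> k \<Longrightarrow> piecewise_smooth \<A> (\<lambda>p. f p * k p)"
  by (rule piecewise_smooth_pointwise) (auto intro: continuous_on_mult smooth_on_mult)

lemma piecewise_smooth_diff:
  "smooth_atlas \<A> \<Longrightarrow> piecewise_smooth \<A> f \<Longrightarrow> piecewise_smooth \<A> k \<Longrightarrow> piecewise_smooth \<A> (\<lambda>p. f p - k p)"
  by (rule piecewise_smooth_pointwise) (auto intro: continuous_on_diff smooth_on_diff)

lemma smooth_fun_continuous:
  fixes \<A> :: "('a::t2_space, 'n::finite) chart set"
  assumes A: "smooth_atlas \<A>" and f: "smooth_fun \<A> f"
  shows "continuous_on UNIV f"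
proof (intro continuous_at_imp_continuous_on ballI)
  fix p
  define c where "c = chart_at \<A> p"
  have c: "c \<in> \<A>" "p \<in> fst c" using chart_at_in[OF A] by (auto simp: c_def)
  have "continuous_on (chart_image c) (f \<circ> chart_inv c)"
    using f c smooth_on_continuous_on unfolding smooth_fun_iff by blast
  then have "continuous_on (fst c) (\<lambda>q. (f \<circ> chart_inv c) (snd c q))"
    using continuous_on_chart[OF A c(1)] by (auto intro: continuous_on_compose2)
  then have "continuous_on (fst c) f"
    by (rule continuous_on_eq) (simp add: chart_inv_left[OF A c(1)])
  then show "isCont f p" using continuous_on_eq_continuous_at[OF open_chart[OF A c(1)]] c(2) by blast
qed

lemma smooth_fun_piecewise_smooth:
  fixes \<A> :: "('a::t2_space, 'n::finite) chart set"
  assumes A: "smooth_atlas \<A>" and f: "smooth_fun \<A> f"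
  shows "piecewise_smooth \<A> f"
  unfolding piecewise_smooth_def
proof (intro conjI allI)
  show "continuous_on UNIV f" by (rule smooth_fun_continuous[OF A f])
  show "\<exists>W H. open W \<and> p \<in> W \<and> finite H \<and> (\<forall>h\<in>H. smooth_fun_on \<A> W h) \<and> (\<forall>q\<in>W. \<exists>h\<in>H. f q = h q)" for p
    by (rule exI[of _ UNIV], rule exI[of _ "{f}"]) (simp add: f)
qed

lemma smooth_on_Ck: "smooth_on S f \<Longrightarrow> Ck_on k S f"
  by (simp add: smooth_on_def)

lemma piecewise_smooth_C1_selection:
  assumes A: "smooth_atlas \<A>" and f: "piecewise_smooth \<A> f" and c: "c \<in> \<A>"
  shows "C1_selection (chart_image c) (f \<circ> chart_inv c)"
  unfolding C1_selection_def
proof (intro conjI ballI)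
  have "continuous_on UNIV f" using f by (simp add: piecewise_smooth_def)
  then show "continuous_on (chart_image c) (f \<circ> chart_inv c)"
    by (intro continuous_on_compose continuous_on_chart_inv[OF A c]) (auto intro: continuous_on_subset)
  fix x assume x: "x \<in> chart_image c"
  obtain W H where W: "open W" "chart_inv c x \<in> W" "finite H" "\<forall>h\<in>H. smooth_fun_on \<A> W h"
    "\<forall>q\<in>W. \<exists>h\<in>H. f q = h q" using f unfolding piecewise_smooth_def by meson
  let ?V = "snd c ` (fst c \<inter> W)" and ?H = "(\<lambda>h. h \<circ> chart_inv c) ` H"
  show "\<exists>W H. open W \<and> x \<in> W \<and> W \<subseteq> chart_image c \<and> finite H \<and> (\<forall>k\<in>H. Ck_on 1 W k) \<and>
      (\<forall>y\<in>W. \<exists>k\<in>H. (f \<circ> chart_inv c) y = k y)"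
  proof (intro exI[of _ ?V] exI[of _ ?H] conjI)
    show "open ?V" by (rule open_chart_image_Int[OF A c W(1)])
    show "x \<in> ?V" unfolding chart_image_Int[OF A c] using x W(2) by simp
    show "\<forall>k\<in>?H. Ck_on 1 ?V k"
      using W(4) c smooth_on_Ck unfolding smooth_fun_on_def by blast
    show "\<forall>y\<in>?V. \<exists>k\<in>?H. (f \<circ> chart_inv c) y = k y"
      unfolding chart_image_Int[OF A c] using W(5) by auto
  qed (use W(3) in auto)
qed

text \<open>Transition maps are differentiable, so one chart around the point decides.\<close>

lemma differentiable_funI:
  assumes A: "smooth_atlas \<A>" and c: "c \<in> \<A>" "p \<in> fst c" and f: "(f \<circ> chart_inv c) differentiable at (snd c p)"
  shows "differentiable_fun \<A> f p"
  unfolding differentiable_fun_def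
proof (intro ballI impI)
  fix d assume d: "d \<in> \<A>" "p \<in> fst d"
  let ?\<tau> = "snd c \<circ> chart_inv d" and ?U = "snd d ` (fst d \<inter> fst c)"
  have U: "open ?U" by (rule open_chart_image_Int[OF A d(1) open_chart[OF A c(1)]])
  have x: "snd d p \<in> ?U" using c d by auto
  have "smooth_on ?U ?\<tau>" using A c d unfolding smooth_atlas_def by blast
  then have \<tau>: "?\<tau> differentiable at (snd d p)" using smooth_on_differentiable x by blast
  have "?\<tau> (snd d p) = snd c p" using chart_inv_left[OF A d] by simp
  then have "((f \<circ> chart_inv c) \<circ> ?\<tau>) differentiable at (snd d p)"
    using differentiable_chain_at[OF \<tau>] f by simp
  moreover have "((f \<circ> chart_inv c) \<circ> ?\<tau>) y = (f \<circ> chart_inv d) y" if "y \<in> ?U" for y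
    using that chart_inv_left[OF A d(1)] chart_inv_left[OF A c(1)] by auto
  ultimately show "(f \<circ> chart_inv d) differentiable at (snd d p)"
    using differentiable_cong_open[OF U x] by blast
qed

section \<open>Integrability of locally bounded functions\<close>

context riemannian_space
begin

section \<open>Null sets in charts and finite measure of compact sets\<close>

lemma measurable_chart [measurable]:
  "c \<in> \<A> \<Longrightarrow> (\<lambda>p. if p \<in> fst c then snd c p else 0) \<in> borel \<rightarrow>\<^sub>M borel"
  by (rule borel_measurable_continuous_on_if)
     (auto intro: borel_open open_chart[OF A] continuous_on_chart[OF A] continuous_on_const)

lemma borel_chart_preimage:
  assumes c: "c \<in> \<A>" and N: "N \<in> sets borel"
  shows "fst c \<inter> snd c -` N \<in> sets borel"
proof -
  have "fst c \<inter> (\<lambda>p. if p \<in> fst c then snd c p else 0) -` N \<in> sets borel"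
    using measurable_sets_borel[OF measurable_chart[OF c] N] borel_open[OF open_chart[OF A c]] by blast
  moreover have "fst c \<inter> (\<lambda>p. if p \<in> fst c then snd c p else 0) -` N = fst c \<inter> snd c -` N" by auto
  ultimately show ?thesis by simp
qed

lemma null_sets_chart_preimage:
  assumes c: "c \<in> \<A>" and N: "N \<in> null_sets lborel"
  shows "fst c \<inter> snd c -` N \<in> null_sets \<mu>"
proof -
  let ?B = "fst c \<inter> snd c -` N"
  have B: "?B \<in> sets borel" using N by (intro borel_chart_preimage[OF c]) auto
  have "emeasure \<mu> ?B = emeasure (chart_measure c) ?B" by (rule emeasure_\<mu>[OF c B]) simp
  also have "\<dots> = (\<integral>\<^sup>+ z\<in>snd c ` (fst c \<inter> ?B). ennreal (vol c z) \<partial>lborel)" by (rule emeasure_chart_measure[OF c B])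
  also have "\<dots> = 0"
    using N borel_chart_image[OF c B]
    by (intro nn_integral_null_set null_sets_subset[OF N]) auto
  finally show ?thesis using B by auto
qed

lemma vol_pos: "c \<in> \<A> \<Longrightarrow> z \<in> chart_image c \<Longrightarrow> vol c z > 0"
  unfolding vol_def using pos_def_det_pos[OF riemannian_metricD(3)[OF R _ chart_inv_in]] by simp

text \<open>This direction of the transfer of null sets rests on the positivity of the density
  \<open>vol\<close> on the chart image.\<close>

lemma null_sets_chart_image:
  assumes c: "c \<in> \<A>" and N: "N \<in> null_sets \<mu>"
  shows "snd c ` (fst c \<inter> N) \<in> null_sets lborel"
proof -
  have Nb: "N \<in> sets borel" "fst c \<inter> N \<in> sets borel" using N open_chart[OF A c] by auto
  let ?B = "snd c ` (fst c \<inter> N)"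
  have B: "?B \<in> sets borel" by (rule borel_chart_image[OF c Nb(1)])
  note [measurable] = measurable_vol[OF c]
  have "emeasure \<mu> (fst c \<inter> N) = 0" using null_sets_subset[OF N, of "fst c \<inter> N"] Nb by auto
  then have "(\<integral>\<^sup>+ z. ennreal (vol c z) * indicator ?B z \<partial>lborel) = 0"
    using emeasure_\<mu>[OF c Nb(2)] emeasure_chart_measure[OF c Nb(2)] by simp
  also have "(\<integral>\<^sup>+ z. ennreal (vol c z) * indicator ?B z \<partial>lborel) =
      (\<integral>\<^sup>+ z. ennreal (indicator (chart_image c) z * vol c z) * indicator ?B z \<partial>lborel)"
    by (intro nn_integral_cong) (auto simp: indicator_def)
  finally have "AE z in lborel. ennreal (indicator (chart_image c) z * vol c z) * indicator ?B z = 0"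
    using B by (subst (asm) nn_integral_0_iff_AE) auto
  then have "AE z in lborel. z \<notin> ?B"
  proof eventually_elim
    case (elim z)
    show ?case
    proof
      assume z: "z \<in> ?B"
      then have "z \<in> chart_image c" by auto
      from vol_pos[OF c this] this z elim show False by (simp add: ennreal_eq_0_iff)
    qed
  qed
  then show ?thesis using B by (simp add: AE_iff_null_sets)
qed

lemma piecewise_smooth_differentiable_ae:
  assumes f: "piecewise_smooth \<A> f"
  shows "\<exists>N\<in>null_sets \<mu>. \<forall>p. p \<notin> N \<longrightarrow> differentiable_fun \<A> f p"
proof -
  obtain cs :: "nat \<Rightarrow> ('a, 'n) chart" where cs: "\<And>n. cs n \<in> \<A>" "(\<Union>n. fst (cs n)) = UNIV"
    using countable_chart_cover by blast
  have "\<exists>N\<in>null_sets lborel. \<forall>x\<in>chart_image (cs n) - N. f \<circ> chart_inv (cs n) differentiable at x" for n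
    by (rule C1_selection_differentiable_ae[OF piecewise_smooth_C1_selection[OF A f cs(1)] open_chart_image[OF A cs(1)]])
  then obtain N where N: "\<And>n. N n \<in> null_sets lborel"
    "\<And>n x. x \<in> chart_image (cs n) - N n \<Longrightarrow> f \<circ> chart_inv (cs n) differentiable at x" by metis
  let ?N = "\<Union>n. fst (cs n) \<inter> snd (cs n) -` N n"
  have "?N \<in> null_sets \<mu>" by (intro null_sets_UN null_sets_chart_preimage cs N)
  moreover have "differentiable_fun \<A> f p" if "p \<notin> ?N" for p
  proof -
    obtain n where n: "p \<in> fst (cs n)" using cs(2) by blast
    then show ?thesis using that by (intro differentiable_funI[OF A cs(1) n] N(2)) auto
  qed
  ultimately show ?thesis by blast
qed

lemma finite_measure_nbhd: "\<exists>W. open W \<and> p \<in> W \<and> emeasure \<mu> W < \<infinity>"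
proof -
  define c where "c = chart_at \<A> p"
  have c: "c \<in> \<A>" "p \<in> fst c" using chart_at_in[OF A] by (auto simp: c_def)
  obtain r where r: "r > 0" "cball (snd c p) r \<subseteq> chart_image c"
    using open_chart_image[OF A c(1)] c(2) open_contains_cball by blast
  have "compact (vol c ` cball (snd c p) r)"
    by (intro compact_continuous_image continuous_on_subset[OF vol_continuous[OF c(1)] r(2)] compact_cball)
  from compact_imp_bounded[OF this] obtain C where "\<forall>x\<in>vol c ` cball (snd c p) r. norm x \<le> C"
    unfolding bounded_iff by blast
  then have C: "\<bar>vol c z\<bar> \<le> C" if "z \<in> cball (snd c p) r" for z using that by simp
  let ?W = "fst c \<inter> snd c -` ball (snd c p) r"
  have W: "open ?W"
    by (rule continuous_open_preimage[OF continuous_on_chart[OF A c(1)] open_chart[OF A c(1)] open_ball])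
  have "emeasure \<mu> ?W = emeasure (chart_measure c) ?W" by (rule emeasure_\<mu>[OF c(1)]) (use W in auto)
  also have "\<dots> = (\<integral>\<^sup>+ z\<in>snd c ` (fst c \<inter> ?W). ennreal (vol c z) \<partial>lborel)"
    by (rule emeasure_chart_measure[OF c(1)]) (use W in auto)
  also have "\<dots> \<le> (\<integral>\<^sup>+ z. ennreal C * indicator (cball (snd c p) r) z \<partial>lborel)"
    using C by (intro nn_integral_mono) (force simp: indicator_def intro: ennreal_leI)
  also have "\<dots> = ennreal C * emeasure lborel (cball (snd c p) r)" by (simp add: nn_integral_cmult_indicator)
  also have "\<dots> < \<infinity>"
    using emeasure_bounded_finite[OF bounded_cball, of "snd c p" r] by (simp add: ennreal_mult_less_top)
  finally have "emeasure \<mu> ?W < \<infinity>" .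
  moreover have "p \<in> ?W" using c(2) r(1) by simp
  ultimately show ?thesis using W by blast
qed

lemma finite_measure_compact:
  assumes "compact K"
  shows "emeasure \<mu> K < \<infinity>"
proof -
  obtain W where W: "\<And>p. open (W p)" "\<And>p. p \<in> W p" "\<And>p. emeasure \<mu> (W p) < \<infinity>"
    using finite_measure_nbhd by metis
  have "K \<subseteq> (\<Union>p\<in>UNIV. W p)" using W(2) by blast
  from compactE_image[OF assms W(1) this] obtain X where X: "finite X" "K \<subseteq> (\<Union>p\<in>X. W p)" by metis
  have "emeasure \<mu> K \<le> emeasure \<mu> (\<Union>p\<in>X. W p)" using X W by (intro emeasure_mono) auto
  also have "\<dots> \<le> (\<Sum>p\<in>X. emeasure \<mu> (W p))" using X W by (intro emeasure_subadditive_finite) auto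
  also have "\<dots> < \<infinity>" using W(3) X(1) by (simp add: ennreal_sum_less_top less_top)
  finally show ?thesis .
qed

text \<open>Borel measurable and locally bounded off one null set. The class is closed under sums
  and products, contains continuous functions and the inner products of gradients of piecewise
  smooth functions, and its members are integrable once they vanish off a compact set.\<close>

definition loc_bounded :: "('a \<Rightarrow> real) \<Rightarrow> bool" where
  "loc_bounded f \<longleftrightarrow> (\<exists>N\<in>null_sets \<mu>. (\<lambda>p. indicator (- N) p * f p) \<in> borel_measurable borel \<and>
     (\<forall>p. \<exists>W C. open W \<and> p \<in> W \<and> (\<forall>x\<in>W - N. \<bar>f x\<bar> \<le> C)))"

lemma loc_bounded_combine:
  assumes f: "loc_bounded f" and k: "loc_bounded k"
    and meas: "(\<lambda>z. F (fst z) (snd z)) \<in> borel_measurable (borel \<Otimes>\<^sub>M borel)"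
    and bound: "\<And>C D u v. \<bar>u\<bar> \<le> C \<Longrightarrow> \<bar>v\<bar> \<le> D \<Longrightarrow> \<bar>F u v\<bar> \<le> B C D"
  shows "loc_bounded (\<lambda>p. F (f p) (k p))"
proof -
  obtain N where N: "N \<in> null_sets \<mu>" "(\<lambda>p. indicator (- N) p * f p) \<in> borel_measurable borel"
    "\<And>p. \<exists>W C. open W \<and> p \<in> W \<and> (\<forall>x\<in>W - N. \<bar>f x\<bar> \<le> C)" using f unfolding loc_bounded_def by blast
  obtain M where M: "M \<in> null_sets \<mu>" "(\<lambda>p. indicator (- M) p * k p) \<in> borel_measurable borel"
    "\<And>p. \<exists>W C. open W \<and> p \<in> W \<and> (\<forall>x\<in>W - M. \<bar>k x\<bar> \<le> C)" using k unfolding loc_bounded_def by blast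
  note [measurable] = N(2) M(2)
  have [measurable]: "N \<in> sets borel" "M \<in> sets borel" using N(1) M(1) by auto
  have "(\<lambda>p. (\<lambda>z. F (fst z) (snd z)) (indicator (- N) p * f p, indicator (- M) p * k p)) \<in> borel_measurable borel"
    by (rule measurable_compose[OF _ meas]) measurable
  then have "(\<lambda>p. indicator (- (N \<union> M)) p * F (indicator (- N) p * f p) (indicator (- M) p * k p)) \<in> borel_measurable borel"
    by simp
  then have "(\<lambda>p. indicator (- (N \<union> M)) p * F (f p) (k p)) \<in> borel_measurable borel"
    by (rule measurable_cong[THEN iffD1, rotated]) (auto simp: indicator_def)
  moreover have "\<exists>W C. open W \<and> p \<in> W \<and> (\<forall>x\<in>W - (N \<union> M). \<bar>F (f x) (k x)\<bar> \<le> C)" for p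
  proof -
    obtain W1 C where 1: "open W1" "p \<in> W1" "\<forall>x\<in>W1 - N. \<bar>f x\<bar> \<le> C" using N(3) by blast
    obtain W2 D where 2: "open W2" "p \<in> W2" "\<forall>x\<in>W2 - M. \<bar>k x\<bar> \<le> D" using M(3) by blast
    show ?thesis
      by (rule exI[of _ "W1 \<inter> W2"], rule exI[of _ "B C D"]) (use 1 2 bound in auto)
  qed
  moreover have "N \<union> M \<in> null_sets \<mu>" using N M by auto
  ultimately show ?thesis unfolding loc_bounded_def by blast
qed

lemma loc_bounded_add: "loc_bounded f \<Longrightarrow> loc_bounded k \<Longrightarrow> loc_bounded (\<lambda>p. f p + k p)"
  by (rule loc_bounded_combine[where F = "(+)" and B = "(+)"]) auto

lemma loc_bounded_mult: "loc_bounded f \<Longrightarrow> loc_bounded k \<Longrightarrow> loc_bounded (\<lambda>p. f p * k p)"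
proof (rule loc_bounded_combine[where F = "(*)" and B = "(*)"])
  show "\<bar>u * v\<bar> \<le> C * D" if "\<bar>u\<bar> \<le> C" "\<bar>v\<bar> \<le> D" for C D u v :: real
    unfolding abs_mult using that by (intro mult_mono) auto
qed auto

lemma loc_bounded_continuous:
  assumes "continuous_on UNIV f"
  shows "loc_bounded f"
  unfolding loc_bounded_def
proof (intro bexI[of _ "{}"] conjI allI)
  show "(\<lambda>p. indicator (- {}) p * f p) \<in> borel_measurable borel"
    using borel_measurable_continuous_onI[OF assms] by simp
  fix p
  have "open (f -` ball (f p) 1)" using assms by (simp add: open_vimage)
  moreover have "\<bar>f x\<bar> \<le> \<bar>f p\<bar> + 1" if "x \<in> f -` ball (f p) 1 - {}" for x
    using that by (auto simp: dist_real_def)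
  ultimately show "\<exists>W C. open W \<and> p \<in> W \<and> (\<forall>x\<in>W - {}. \<bar>f x\<bar> \<le> C)"
    by (intro exI[of _ "f -` ball (f p) 1"] exI[of _ "\<bar>f p\<bar> + 1"]) auto
qed simp

text \<open>Integrands with gradients are unspecified on a null set and need not be Borel there; on
  the completion they may be replaced by a Borel function that agrees almost everywhere.\<close>

lemma integral_completion_AE:
  fixes f f' :: "'a \<Rightarrow> real"
  assumes f': "f' \<in> borel_measurable borel" and ae: "AE p in \<mu>. f p = f' p"
  shows "integrable (completion \<mu>) f \<longleftrightarrow> integrable \<mu> f'" "integral\<^sup>L (completion \<mu>) f = integral\<^sup>L \<mu> f'"
proof -
  have m': "f' \<in> borel_measurable \<mu>" using f' by simp
  have mc: "f' \<in> borel_measurable (completion \<mu>)" by (rule measurable_completion[OF m'])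
  have ae': "AE p in completion \<mu>. f p = f' p" by (rule AE_completion[OF ae])
  have m: "f \<in> borel_measurable (completion \<mu>)"
  proof (rule measurableI)
    fix S :: "real set" assume S: "S \<in> sets borel"
    show "f -` S \<inter> space (completion \<mu>) \<in> sets (completion \<mu>)"
      by (rule completion.in_sets_AE[OF _ measurable_sets[OF mc S]]) (use ae' in \<open>auto\<close>)
  qed simp
  show "integrable (completion \<mu>) f \<longleftrightarrow> integrable \<mu> f'"
    using integrable_cong_AE[OF m mc ae'] integrable_completion[OF m'] by simp
  show "integral\<^sup>L (completion \<mu>) f = integral\<^sup>L \<mu> f'"
    using integral_cong_AE[OF m mc ae'] integral_completion[OF m'] by simp
qed

lemma integrable_loc_bounded:
  assumes f: "loc_bounded f" and K: "compact K" "\<And>p. p \<notin> K \<Longrightarrow> f p = 0"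
  shows "integrable (completion \<mu>) f"
proof -
  obtain N where N: "N \<in> null_sets \<mu>" "(\<lambda>p. indicator (- N) p * f p) \<in> borel_measurable borel"
    "\<And>p. \<exists>W C. open W \<and> p \<in> W \<and> (\<forall>x\<in>W - N. \<bar>f x\<bar> \<le> C)" using f unfolding loc_bounded_def by blast
  obtain W C where W: "\<And>p. open (W p)" "\<And>p. p \<in> W p" "\<And>p x. x \<in> W p - N \<Longrightarrow> \<bar>f x\<bar> \<le> C p"
    using N(3) by metis
  have "K \<subseteq> (\<Union>p\<in>UNIV. W p)" using W(2) by blast
  from compactE_image[OF K(1) W(1) this] obtain X where X: "finite X" "K \<subseteq> (\<Union>p\<in>X. W p)" by metis
  have bnd: "\<bar>indicator (- N) x * f x\<bar> \<le> (\<Sum>p\<in>X. \<bar>C p\<bar>)" if xK: "x \<in> K" for x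
  proof (cases "x \<in> N")
    case False
    obtain p where p: "p \<in> X" "x \<in> W p" using X(2) xK by blast
    have "\<bar>f x\<bar> \<le> \<bar>C p\<bar>" using W(3)[of x p] False p by auto
    also have "\<dots> \<le> (\<Sum>p\<in>X. \<bar>C p\<bar>)" using p X(1) by (intro member_le_sum) auto
    finally show ?thesis using False by simp
  qed (simp add: sum_nonneg)
  have "integrable \<mu> (\<lambda>p. indicator (- N) p * f p)"
  proof (rule integrableI_bounded_set[where A = K and B = "\<Sum>p\<in>X. \<bar>C p\<bar>"])
    show "K \<in> sets \<mu>" using K(1) by (simp add: borel_compact)
    show "emeasure \<mu> K < \<infinity>" by (rule finite_measure_compact[OF K(1)])
    show "AE x\<in>K in \<mu>. norm (indicator (- N) x * f x) \<le> (\<Sum>p\<in>X. \<bar>C p\<bar>)" using bnd by simp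
  qed (use N(2) K(2) in auto)
  moreover have "AE p in \<mu>. f p = indicator (- N) p * f p"
    using AE_not_in[OF N(1)] by eventually_elim simp
  ultimately show ?thesis using integral_completion_AE(1)[OF N(2)] by blast
qed

end

section \<open>Inner products of gradients\<close>

lemma coord_deriv_mult:
  assumes "smooth_atlas \<A>" "c \<in> \<A>" "p \<in> fst c" "differentiable_fun \<A> f p" "differentiable_fun \<A> k p"
  shows "coord_deriv c i (\<lambda>p. f p * k p) p = coord_deriv c i f p * k p + f p * coord_deriv c i k p"
proof -
  have "f \<circ> chart_inv c differentiable at (snd c p)" "k \<circ> chart_inv c differentiable at (snd c p)"
    using assms unfolding differentiable_fun_def by blast+
  from pd_mult[OF this] show ?thesis
    by (simp add: coord_deriv_pd o_def chart_inv_left[OF assms(1-3)])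
qed

lemma coord_deriv_diff:
  assumes "c \<in> \<A>" "p \<in> fst c" "differentiable_fun \<A> f p" "differentiable_fun \<A> k p"
  shows "coord_deriv c i (\<lambda>p. f p - k p) p = coord_deriv c i f p - coord_deriv c i k p"
proof -
  have "f \<circ> chart_inv c differentiable at (snd c p)" "k \<circ> chart_inv c differentiable at (snd c p)"
    using assms unfolding differentiable_fun_def by blast+
  from pd_diff[OF this] show ?thesis by (simp add: coord_deriv_pd o_def)
qed

context riemannian
begin

lemma gip_mult_left:
  assumes "differentiable_fun \<A> f p" "differentiable_fun \<A> k p"
  shows "gip \<A> g (\<lambda>p. f p * k p) u p = f p * gip \<A> g k u p + k p * gip \<A> g f u p"
  unfolding gip_chart_at Let_def coord_deriv_mult[OF A chart_at_in[OF A] assms]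
  by (simp add: sum_distrib_left sum.distrib algebra_simps)

lemma gip_diff_left:
  assumes "differentiable_fun \<A> f p" "differentiable_fun \<A> k p"
  shows "gip \<A> g (\<lambda>p. f p - k p) u p = gip \<A> g f u p - gip \<A> g k u p"
  unfolding gip_chart_at Let_def coord_deriv_diff[OF chart_at_in[OF A] assms]
  by (simp add: sum_subtractf algebra_simps)

lemma gip_commute: "gip \<A> g f k p = gip \<A> g k f p"
  unfolding gip_def Let_def
  by (rule inner_with_commute[OF riemannian_metricD(2)[OF R chart_at_in[OF A]]])

lemma gip_zero_left:
  assumes "open W" "p \<in> W" "\<And>q. q \<in> W \<Longrightarrow> f q = 0"
  shows "gip \<A> g f u p = 0"
proof -
  define c where "c = chart_at \<A> p"
  have c: "c \<in> \<A>" "p \<in> fst c" using chart_at_in[OF A] by (auto simp: c_def)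
  have "coord_deriv c i f p = 0" for i
  proof -
    have "coord_deriv c i f p = pd i (\<lambda>x. 0) (snd c p)"
      unfolding coord_deriv_pd
      by (rule pd_cong[OF open_chart_image_Int[OF A c(1) assms(1)]])
         (use c assms chart_inv_left[OF A c(1)] in auto)
    then show ?thesis by (simp add: pd_const)
  qed
  then show ?thesis by (simp add: gip_chart_at Let_def c_def)
qed

end

lemma frechet_derivative_lipschitz_bound:
  fixes f :: "'e::euclidean_space \<Rightarrow> real"
  assumes lip: "\<And>y z. y \<in> ball x r \<Longrightarrow> z \<in> ball x r \<Longrightarrow> \<bar>f z - f y\<bar> \<le> L * norm (z - y)"
    and x: "y \<in> ball x r" and f: "f differentiable at y"
  shows "\<bar>frechet_derivative f (at y) e\<bar> \<le> L * norm e"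
proof -
  let ?t = "\<lambda>n. inverse (real (Suc n)) *\<^sub>R e"
  have lim: "(\<lambda>n. \<bar>real (Suc n) * (f (y + ?t n) - f y)\<bar>) \<longlonglongrightarrow> \<bar>frechet_derivative f (at y) e\<bar>"
    by (intro tendsto_rabs difference_quotient_tendsto f)
  have "(\<lambda>n. y + ?t n) \<longlonglongrightarrow> y + 0 *\<^sub>R e"
    by (intro tendsto_intros LIMSEQ_inverse_real_of_nat)
  then have "eventually (\<lambda>n. y + ?t n \<in> ball x r) sequentially"
    using topological_tendstoD[OF _ open_ball] x by fastforce
  then have "eventually (\<lambda>n. \<bar>real (Suc n) * (f (y + ?t n) - f y)\<bar> \<le> L * norm e) sequentially"
  proof eventually_elim
    case (elim n)
    have "\<bar>real (Suc n) * (f (y + ?t n) - f y)\<bar> = real (Suc n) * \<bar>f (y + ?t n) - f y\<bar>" by (simp add: abs_mult)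
    also have "\<dots> \<le> real (Suc n) * (L * norm (?t n))"
      using lip[OF x elim] by (intro mult_left_mono) auto
    also have "\<dots> = L * norm e" by (simp add: field_simps)
    finally show ?case .
  qed
  then show ?thesis using tendsto_upperbound[OF lim] by simp
qed

context riemannian_space
begin

text \<open>\<open>gip\<close> uses the chart picked by \<open>chart_at\<close>, a choice that need
  not be measurable. Off N its value is the same in every chart, so a fixed chart is used on each of
  countably many domains.\<close>

lemma borel_measurable_gip:
  assumes N: "N \<in> sets borel" and f: "continuous_on UNIV f" "\<And>p. p \<notin> N \<Longrightarrow> differentiable_fun \<A> f p"
    and k: "continuous_on UNIV k" "\<And>p. p \<notin> N \<Longrightarrow> differentiable_fun \<A> k p"
  shows "(\<lambda>p. indicator (- N) p * gip \<A> g f k p) \<in> borel_measurable borel"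
proof -
  obtain cs :: "nat \<Rightarrow> ('a, 'n) chart" where cs: "\<And>n. cs n \<in> \<A>" "(\<Union>n. fst (cs n)) = UNIV"
    using countable_chart_cover by blast
  show ?thesis
  proof (rule measurable_piecewise_restrict2[where A = "\<lambda>n. fst (cs n)"])
    show "fst (cs n) \<in> sets borel" for n using open_chart[OF A cs(1)] by simp
    show "space borel = (\<Union>n. fst (cs n))" using cs(2) by simp
    fix n
    let ?c = "cs n"
    let ?U = "chart_image ?c" and ?N = "snd ?c ` (fst ?c \<inter> N)"
    interpret G: metric_field "metric_in ?c g" ?U by (rule metric_field_chart[OF A R cs(1)])
    have Nc: "?N \<in> sets borel" by (rule borel_chart_image[OF cs(1) N])
    have Nin: "z \<in> ?U \<Longrightarrow> z \<in> ?N \<longleftrightarrow> chart_inv ?c z \<in> N" for z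
      unfolding chart_image_Int[OF A cs(1)] by simp
    have d: "(\<lambda>z. indicator (?U - ?N) z * pd i (u \<circ> chart_inv ?c) z) \<in> borel_measurable borel"
      if u: "continuous_on UNIV u" "\<And>p. p \<notin> N \<Longrightarrow> differentiable_fun \<A> u p" for u i
      unfolding pd_def
    proof (rule borel_measurable_frechet_derivative[OF _ G.W Nc])
      show "continuous_on ?U (u \<circ> chart_inv ?c)"
        by (intro continuous_on_compose continuous_on_chart_inv[OF A cs(1)] continuous_on_subset[OF u(1)]) simp
      show "u \<circ> chart_inv ?c differentiable at z" if "z \<in> ?U - ?N" for z
        using u(2)[of "chart_inv ?c z"] that Nin cs(1) chart_inv_in[of z ?c] chart_inv_right[of z ?c]
        unfolding differentiable_fun_def by fastforce
    qed
    have i: "(\<lambda>z. indicator ?U z * matrix_inv (metric_in ?c g z) $ i $ j) \<in> borel_measurable borel" for i j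
      using borel_measurable_continuous_on_indicator[OF borel_open[OF G.W]
          smooth_on_continuous_on[OF smooth_on_matrix_inv[OF G.smooth_G G.nondeg G.W]]]
      by simp
    let ?B = "\<lambda>z. \<Sum>i\<in>UNIV. \<Sum>j\<in>UNIV. (indicator ?U z * matrix_inv (metric_in ?c g z) $ i $ j) *
        (indicator (?U - ?N) z * pd i (f \<circ> chart_inv ?c) z) * (indicator (?U - ?N) z * pd j (k \<circ> chart_inv ?c) z)"
    have "?B \<in> borel_measurable borel"
      by (intro borel_measurable_sum borel_measurable_times i d f k)
    then have m: "(\<lambda>p. ?B (if p \<in> fst ?c then snd ?c p else 0)) \<in> borel_measurable borel"
      by (rule measurable_compose[OF measurable_chart[OF cs(1)]])
    show "\<exists>h\<in>borel_measurable borel. \<forall>p\<in>fst ?c. indicator (- N) p * gip \<A> g f k p = h p"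
    proof (intro bexI[OF _ m] ballI)
      fix p assume p: "p \<in> fst ?c"
      have inv: "chart_inv ?c (snd ?c p) = p" by (rule chart_inv_left[OF A cs(1) p])
      show "indicator (- N) p * gip \<A> g f k p = ?B (if p \<in> fst ?c then snd ?c p else 0)"
      proof (cases "p \<in> N")
        case True
        then have "snd ?c p \<in> ?N" using p by auto
        then show ?thesis using True p by simp
      next
        case False
        then have "snd ?c p \<notin> ?N" using p Nin[of "snd ?c p"] inv by auto
        then show ?thesis
          using False p by (simp add: gip_in_chart[OF cs(1) p f(2)[OF False] k(2)[OF False]] coord_deriv_pd inv)
      qed
    qed
  qed
qed

text \<open>Local Lipschitz constants of f and k bound their partial derivatives wherever these
  exist, and the inverse metric is bounded on a compact ball.\<close>

lemma loc_bounded_gip: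
  assumes f: "piecewise_smooth \<A> f" and k: "piecewise_smooth \<A> k"
  shows "loc_bounded (gip \<A> g f k)"
proof -
  obtain N where N: "N \<in> null_sets \<mu>" "\<And>p. p \<notin> N \<Longrightarrow> differentiable_fun \<A> f p"
    using piecewise_smooth_differentiable_ae[OF f] by blast
  obtain M where M: "M \<in> null_sets \<mu>" "\<And>p. p \<notin> M \<Longrightarrow> differentiable_fun \<A> k p"
    using piecewise_smooth_differentiable_ae[OF k] by blast
  let ?N = "N \<union> M"
  have null: "?N \<in> null_sets \<mu>" using N M by auto
  have cont: "continuous_on UNIV f" "continuous_on UNIV k" using f k by (auto simp: piecewise_smooth_def)
  have "(\<lambda>p. indicator (- ?N) p * gip \<A> g f k p) \<in> borel_measurable borel"
    by (rule borel_measurable_gip[OF _ cont(1) _ cont(2)]) (use N M null in auto)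
  moreover have "\<exists>W C. open W \<and> p \<in> W \<and> (\<forall>x\<in>W - ?N. \<bar>gip \<A> g f k x\<bar> \<le> C)" for p
  proof -
    define c where "c = chart_at \<A> p"
    have c: "c \<in> \<A>" "p \<in> fst c" using chart_at_in[OF A] by (auto simp: c_def)
    let ?U = "chart_image c" and ?x = "snd c p"
    interpret G: metric_field "metric_in c g" ?U by (rule metric_field_chart[OF A R c(1)])
    let ?I = "\<lambda>z i j. matrix_inv (metric_in c g z) $ i $ j"
    have x: "?x \<in> ?U" using c by auto
    obtain r1 L1 where 1: "r1 > 0" "ball ?x r1 \<subseteq> ?U"
      "\<And>y z. y \<in> ball ?x r1 \<Longrightarrow> z \<in> ball ?x r1 \<Longrightarrow> \<bar>(f \<circ> chart_inv c) z - (f \<circ> chart_inv c) y\<bar> \<le> L1 * norm (z - y)"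
      using C1_selection_locally_lipschitz[OF piecewise_smooth_C1_selection[OF A f c(1)] x] by blast
    obtain r2 L2 where 2: "r2 > 0" "ball ?x r2 \<subseteq> ?U"
      "\<And>y z. y \<in> ball ?x r2 \<Longrightarrow> z \<in> ball ?x r2 \<Longrightarrow> \<bar>(k \<circ> chart_inv c) z - (k \<circ> chart_inv c) y\<bar> \<le> L2 * norm (z - y)"
      using C1_selection_locally_lipschitz[OF piecewise_smooth_C1_selection[OF A k c(1)] x] by blast
    define r where "r = min r1 r2 / 2"
    have r: "r > 0" "cball ?x r \<subseteq> ball ?x r1" "cball ?x r \<subseteq> ball ?x r2" using 1(1) 2(1) by (auto simp: r_def)
    have "\<exists>M. \<forall>z\<in>cball ?x r. \<bar>?I z i j\<bar> \<le> M" for i j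
    proof -
      have "compact ((\<lambda>z. ?I z i j) ` cball ?x r)"
        by (intro compact_continuous_image compact_cball continuous_on_subset[OF
            smooth_on_continuous_on[OF smooth_on_matrix_inv[OF G.smooth_G G.nondeg G.W]]
            order_trans[OF r(2) 1(2)]])
      from compact_imp_bounded[OF this] show ?thesis unfolding bounded_iff by auto
    qed
    then obtain Mb where Mb: "\<And>i j z. z \<in> cball ?x r \<Longrightarrow> \<bar>?I z i j\<bar> \<le> Mb i j" by metis
    let ?W = "fst c \<inter> snd c -` ball ?x r" and ?C = "\<Sum>i\<in>UNIV. \<Sum>j\<in>UNIV. Mb i j * L1 * L2"
    have W: "open ?W"
      by (rule continuous_open_preimage[OF continuous_on_chart[OF A c(1)] open_chart[OF A c(1)] open_ball])
    have "\<bar>gip \<A> g f k q\<bar> \<le> ?C" if q: "q \<in> ?W - ?N" for q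
    proof -
      have qc: "q \<in> fst c" "snd c q \<in> cball ?x r" using q by auto
      have dq: "differentiable_fun \<A> f q" "differentiable_fun \<A> k q" using q N(2) M(2) by auto
      then have dc: "f \<circ> chart_inv c differentiable at (snd c q)" "k \<circ> chart_inv c differentiable at (snd c q)"
        using c(1) qc(1) unfolding differentiable_fun_def by blast+
      have df: "\<bar>coord_deriv c i f q\<bar> \<le> L1" for i
        using frechet_derivative_lipschitz_bound[OF 1(3) subsetD[OF r(2) qc(2)] dc(1), where e = "axis i 1"]
        by (simp add: coord_deriv_def norm_axis_1)
      have dk: "\<bar>coord_deriv c i k q\<bar> \<le> L2" for i
        using frechet_derivative_lipschitz_bound[OF 2(3) subsetD[OF r(3) qc(2)] dc(2), where e = "axis i 1"]
        by (simp add: coord_deriv_def norm_axis_1)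
      have I: "\<bar>matrix_inv (g c q) $ i $ j\<bar> \<le> Mb i j" for i j
        using Mb[OF qc(2), of i j] by (simp add: chart_inv_left[OF A c(1) qc(1)])
      have "\<bar>gip \<A> g f k q\<bar> \<le> (\<Sum>i\<in>UNIV. \<Sum>j\<in>UNIV. \<bar>matrix_inv (g c q) $ i $ j * coord_deriv c i f q * coord_deriv c j k q\<bar>)"
        unfolding gip_in_chart[OF c(1) qc(1) dq] by (intro order_trans[OF sum_abs] sum_mono sum_abs)
      also have "\<dots> \<le> ?C"
        unfolding abs_mult
        by (intro sum_mono mult_mono I df dk mult_nonneg_nonneg abs_ge_zero
            order_trans[OF abs_ge_zero I] order_trans[OF abs_ge_zero df])
      finally show ?thesis .
    qed
    moreover have "p \<in> ?W" using c(2) r(1) by simp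
    ultimately show ?thesis using W by blast
  qed
  ultimately show ?thesis using null unfolding loc_bounded_def by blast
qed

end

section \<open>The divergence form of the Laplacian\<close>

lemma matrix_inv_dim2:
  fixes M :: "real ^ 2 ^ 2"
  assumes "det M \<noteq> 0"
  shows "matrix_inv M $ 1 $ 1 = M $ 2 $ 2 / det M" "matrix_inv M $ 1 $ 2 = - (M $ 1 $ 2) / det M"
    "matrix_inv M $ 2 $ 1 = - (M $ 2 $ 1) / det M" "matrix_inv M $ 2 $ 2 = M $ 1 $ 1 / det M"
  by (simp_all add: matrix_inv_component[OF assms] det_2)

text \<open>The i-th component of the gradient of f times the volume density; its coordinate
  divergence is the density times the Laplacian.\<close>

definition flux :: "(real ^ 2 \<Rightarrow> real ^ 2 ^ 2) \<Rightarrow> (real ^ 2 \<Rightarrow> real) \<Rightarrow> 2 \<Rightarrow> real ^ 2 \<Rightarrow> real" where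
  "flux G f i z = sqrt (det (G z)) * (\<Sum>j\<in>UNIV. matrix_inv (G z) $ i $ j * pd j f z)"

lemma pd_sqrt:
  fixes u :: "real ^ 'n::finite \<Rightarrow> real"
  assumes "u differentiable at z" "u z > 0"
  shows "pd i (\<lambda>z. sqrt (u z)) z = pd i u z / (2 * sqrt (u z))"
proof -
  have "((\<lambda>z. sqrt (u z)) has_derivative (\<lambda>v. frechet_derivative u (at z) v * (inverse (sqrt (u z)) / 2))) (at z)"
    using assms by (auto intro!: derivative_eq_intros simp: frechet_derivative_works)
  from has_derivative_pd[OF this] show ?thesis unfolding pd_def by (simp add: field_simps)
qed

text \<open>The identity div grad = trace Hess in dimension 2, after all derivatives have been
  computed. E, F, H are the metric coefficients and s is the root of the determinant, whose
  derivatives are D1 and D2; a suffix 1 or 2 denotes a partial derivative, and f11, f12, f22 are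
  second derivatives of f.\<close>

lemma divergence_identity:
  fixes E F H s :: real
  assumes s: "s > 0" and D: "s * s = E * H - F * F"
    and D1: "D1 = E1 * H + E * H1 - 2 * F * F1" and D2: "D2 = E2 * H + E * H2 - 2 * F * F2"
  shows "((H1 * f1 + H * f11 - F1 * f2 - F * f12) * s - (H * f1 - F * f2) * (D1 / (2 * s))) / (s * s)
      + ((E2 * f2 + E * f22 - F2 * f1 - F * f12) * s - (E * f2 - F * f1) * (D2 / (2 * s))) / (s * s) =
    s * (H / (s * s) * (f11 - ((H / (s * s) * (E1 / 2) + - F / (s * s) * (F1 - E2 / 2)) * f1
                          + (- F / (s * s) * (E1 / 2) + E / (s * s) * (F1 - E2 / 2)) * f2))
       + 2 * (- F / (s * s)) * (f12 - ((H / (s * s) * (E2 / 2) + - F / (s * s) * (H1 / 2)) * f1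
                          + (- F / (s * s) * (E2 / 2) + E / (s * s) * (H1 / 2)) * f2))
       + E / (s * s) * (f22 - ((H / (s * s) * (F2 - H1 / 2) + - F / (s * s) * (H2 / 2)) * f1
                          + (- F / (s * s) * (F2 - H1 / 2) + E / (s * s) * (H2 / 2)) * f2)))"
    (is "?L = ?R")
proof -
  define d where "d = s * s"
  have d: "d \<noteq> 0" "d = E * H - F * F" using s D by (auto simp: d_def)
  \<comment> \<open>Multiplying by s d clears every denominator. Both sides become polynomials, in
    which d and the derivatives D1, D2 are replaced by their expressions in E, F, H.\<close>
  let ?P = "(H1 * f1 + H * f11 - F1 * f2 - F * f12) + (E2 * f2 + E * f22 - F2 * f1 - F * f12)"
  let ?Q = "(H * f1 - F * f2) * D1 + (E * f2 - F * f1) * D2"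
  have L: "?L * s * d = ?P * d - ?Q / 2"
    using s by (simp add: d_def field_simps)
  let ?A = "H * (d * f11 - ((H * (E1 / 2) - F * (F1 - E2 / 2)) * f1 + (- F * (E1 / 2) + E * (F1 - E2 / 2)) * f2))
       - 2 * F * (d * f12 - ((H * (E2 / 2) - F * (H1 / 2)) * f1 + (- F * (E2 / 2) + E * (H1 / 2)) * f2))
       + E * (d * f22 - ((H * (F2 - H1 / 2) - F * (H2 / 2)) * f1 + (- F * (F2 - H1 / 2) + E * (H2 / 2)) * f2))"
  \<comment> \<open>The quotient pattern common to the three Hessian terms; the factor d * d removes
    its outer and its inner denominators.\<close>
  have t: "d * d * (X / d * (u - ((p1 / d * q1 + p2 / d * q2) * v + (p3 / d * q1 + p4 / d * q2) * w))) =
      X * (d * u - ((p1 * q1 + p2 * q2) * v + (p3 * q1 + p4 * q2) * w))" for X u v w p1 p2 p3 p4 q1 q2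
  proof -
    have "(p1 / d * q1 + p2 / d * q2) * v + (p3 / d * q1 + p4 / d * q2) * w =
        ((p1 * q1 + p2 * q2) * v + (p3 * q1 + p4 * q2) * w) / d"
      by (simp add: add_divide_distrib distrib_right)
    then show ?thesis using d(1) by (simp add: right_diff_distrib)
  qed
  have R: "?R * s * d = ?A"
  proof -
    have sp: "s * (X + 2 * (Y / d) * Z + T) * s * d = d * d * X + d * d * (2 * Y / d * Z) + d * d * T" for X Y Z T
      by (simp add: d_def algebra_simps)
    show ?thesis unfolding d_def[symmetric] sp t by simp
  qed
  have "?P * d - ?Q / 2 = ?A"
    unfolding d(2) D1 D2 by (simp add: field_simps)
  then have "?L * (s * d) = ?R * (s * d)" using L R by (simp add: mult.assoc)
  then show ?thesis using s d(1) by simp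
qed

lemma pd_divide:
  fixes u v :: "real ^ 'n::finite \<Rightarrow> real"
  assumes "u differentiable at z" "v differentiable at z" "v z \<noteq> 0"
  shows "pd i (\<lambda>z. u z / v z) z = (pd i u z * v z - u z * pd i v z) / (v z * v z)"
proof -
  have "((\<lambda>z. u z / v z) has_derivative (\<lambda>w. (frechet_derivative u (at z) w * v z -
      u z * frechet_derivative v (at z) w) / (v z * v z))) (at z)"
    using assms unfolding frechet_derivative_works by (rule has_derivative_divide')
  from has_derivative_pd[OF this] show ?thesis by (simp add: pd_def)
qed

lemma smooth_flux:
  assumes "metric_field G U" "\<And>z. z \<in> U \<Longrightarrow> det (G z) > 0" "smooth_on U f"
  shows "smooth_on U (flux G f i)"
proof -
  interpret metric_field G U by fact
  show ?thesis
    unfolding flux_def[abs_def]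
    by (intro smooth_on_mult smooth_on_sum smooth_on_sqrt smooth_on_det smooth_on_matrix_inv smooth_on_pd
        smooth_G nondeg assms W)
qed

lemma divergence_flux:
  assumes "metric_field G U" and pos: "\<And>z. z \<in> U \<Longrightarrow> det (G z) > 0" and f: "smooth_on U f" and z: "z \<in> U"
  shows "pd 1 (flux G f 1) z + pd 2 (flux G f 2) z =
    sqrt (det (G z)) * (\<Sum>i\<in>UNIV. \<Sum>j\<in>UNIV. matrix_inv (G z) $ i $ j * hess G f z $ i $ j)"
proof -
  interpret metric_field G U by fact
  define E where "E z = G z $ 1 $ 1" for z
  define F where "F z = G z $ 1 $ 2" for z
  define H where "H z = G z $ 2 $ 2" for z
  define s where "s z = sqrt (det (G z))" for z
  have G21: "G z $ 2 $ 1 = F z" if "z \<in> U" for z using sym[OF that] by (simp add: F_def)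
  have det: "det (G z) = E z * H z - F z * F z" if "z \<in> U" for z
    using G21[OF that] by (simp add: det_2 E_def F_def H_def)
  have s: "s z > 0" "s z * s z = det (G z)" if "z \<in> U" for z
    using pos[OF that] by (simp_all add: s_def)
  have sm: "smooth_on U E" "smooth_on U F" "smooth_on U H" "smooth_on U (pd j f)" for j
    unfolding E_def F_def H_def by (intro smooth_G smooth_on_pd f)+
  have dif: "E differentiable at z" "F differentiable at z" "H differentiable at z"
    "pd j f differentiable at z" for j
    using sm smooth_on_differentiable[OF _ z] by blast+
  have smdet: "smooth_on U (\<lambda>z. det (G z))" by (intro smooth_on_det smooth_G W)
  have sms: "smooth_on U s" unfolding s_def[abs_def] by (intro smooth_on_sqrt smdet pos W)
  have pdet: "pd i (\<lambda>z. det (G z)) z = pd i E z * H z + E z * pd i H z - 2 * F z * pd i F z" for i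
  proof -
    have "pd i (\<lambda>z. det (G z)) z = pd i (\<lambda>z. E z * H z - F z * F z) z"
      by (rule pd_cong[OF W z det])
    also have "\<dots> = pd i (\<lambda>z. E z * H z) z - pd i (\<lambda>z. F z * F z) z"
      by (intro pd_diff differentiable_mult dif)
    finally show ?thesis by (simp add: pd_mult dif algebra_simps)
  qed
  have ps: "pd i s z = pd i (\<lambda>z. det (G z)) z / (2 * s z)" for i
    unfolding s_def by (rule pd_sqrt[OF smooth_on_differentiable[OF smdet z] pos[OF z]])
  have inv: "matrix_inv (G z) $ 1 $ 1 = H z / (s z * s z)" "matrix_inv (G z) $ 1 $ 2 = - F z / (s z * s z)"
    "matrix_inv (G z) $ 2 $ 1 = - F z / (s z * s z)" "matrix_inv (G z) $ 2 $ 2 = E z / (s z * s z)" if "z \<in> U" for z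
    using matrix_inv_dim2[OF nondeg[OF that]] G21[OF that] s(2)[OF that] by (simp_all add: E_def F_def H_def)
  have fl: "flux G f 1 z = (H z * pd 1 f z - F z * pd 2 f z) / s z"
    "flux G f 2 z = (E z * pd 2 f z - F z * pd 1 f z) / s z" if "z \<in> U" for z
    using s(1)[OF that] by (simp_all add: flux_def sum_2 inv[OF that] s_def[symmetric] field_simps)
  have x1: "pd 1 (flux G f 1) z = ((pd 1 H z * pd 1 f z + H z * pd 1 (pd 1 f) z - pd 1 F z * pd 2 f z
      - F z * pd 1 (pd 2 f) z) * s z - (H z * pd 1 f z - F z * pd 2 f z) * pd 1 s z) / (s z * s z)"
  proof -
    have "pd 1 (flux G f 1) z = pd 1 (\<lambda>z. (H z * pd 1 f z - F z * pd 2 f z) / s z) z"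
      by (rule pd_cong[OF W z fl(1)])
    also have "\<dots> = (pd 1 (\<lambda>z. H z * pd 1 f z - F z * pd 2 f z) z * s z
        - (H z * pd 1 f z - F z * pd 2 f z) * pd 1 s z) / (s z * s z)"
      using s(1)[OF z]
      by (intro pd_divide differentiable_diff differentiable_mult dif smooth_on_differentiable[OF sms z]) simp
    also have "pd 1 (\<lambda>z. H z * pd 1 f z - F z * pd 2 f z) z =
        pd 1 (\<lambda>z. H z * pd 1 f z) z - pd 1 (\<lambda>z. F z * pd 2 f z) z"
      by (intro pd_diff differentiable_mult dif)
    finally show ?thesis by (simp add: pd_mult dif algebra_simps)
  qed
  have x2: "pd 2 (flux G f 2) z = ((pd 2 E z * pd 2 f z + E z * pd 2 (pd 2 f) z - pd 2 F z * pd 1 f z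
      - F z * pd 2 (pd 1 f) z) * s z - (E z * pd 2 f z - F z * pd 1 f z) * pd 2 s z) / (s z * s z)"
  proof -
    have "pd 2 (flux G f 2) z = pd 2 (\<lambda>z. (E z * pd 2 f z - F z * pd 1 f z) / s z) z"
      by (rule pd_cong[OF W z fl(2)])
    also have "\<dots> = (pd 2 (\<lambda>z. E z * pd 2 f z - F z * pd 1 f z) z * s z
        - (E z * pd 2 f z - F z * pd 1 f z) * pd 2 s z) / (s z * s z)"
      using s(1)[OF z]
      by (intro pd_divide differentiable_diff differentiable_mult dif smooth_on_differentiable[OF sms z]) simp
    also have "pd 2 (\<lambda>z. E z * pd 2 f z - F z * pd 1 f z) z =
        pd 2 (\<lambda>z. E z * pd 2 f z) z - pd 2 (\<lambda>z. F z * pd 1 f z) z"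
      by (intro pd_diff differentiable_mult dif)
    finally show ?thesis by (simp add: pd_mult dif algebra_simps)
  qed
  have c21: "pd i (\<lambda>x. G x $ 2 $ 1) z = pd i F z" for i
    using pd_G_sym[OF z, of i 2 1] by (simp add: F_def[abs_def])
  have cE: "pd i (\<lambda>x. G x $ 1 $ 1) z = pd i E z" and cF: "pd i (\<lambda>x. G x $ 1 $ 2) z = pd i F z"
    and cH: "pd i (\<lambda>x. G x $ 2 $ 2) z = pd i H z" for i by (simp_all add: E_def[abs_def] F_def[abs_def] H_def[abs_def])
  have c1: "chr1 G 1 1 1 z = pd 1 E z / 2" "chr1 G 1 1 2 z = pd 1 F z - pd 2 E z / 2"
    "chr1 G 1 2 1 z = pd 2 E z / 2" "chr1 G 1 2 2 z = pd 1 H z / 2"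
    "chr1 G 2 1 1 z = pd 2 E z / 2" "chr1 G 2 1 2 z = pd 1 H z / 2"
    "chr1 G 2 2 1 z = pd 2 F z - pd 1 H z / 2" "chr1 G 2 2 2 z = pd 2 H z / 2"
    by (simp_all add: chr1_def c21 cE cF cH field_simps)
  have f21: "pd 2 (pd 1 f) z = pd 1 (pd 2 f) z" by (rule pd_commute[OF f W z])
  have R: "(\<Sum>i\<in>UNIV. \<Sum>j\<in>UNIV. matrix_inv (G z) $ i $ j * hess G f z $ i $ j) =
      H z / (s z * s z) * hess G f z $ 1 $ 1 + 2 * (- F z / (s z * s z)) * hess G f z $ 1 $ 2
      + E z / (s z * s z) * hess G f z $ 2 $ 2"
  proof -
    have "hess G f z $ 2 $ 1 = hess G f z $ 1 $ 2"
      by (simp add: hess_def f21 chr_sym[OF z, of _ 2 1])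
    then show ?thesis by (simp add: sum_2 inv[OF z])
  qed
  have hs: "hess G f z $ i $ j = pd i (pd j f) z
      - ((matrix_inv (G z) $ 1 $ 1 * chr1 G i j 1 z + matrix_inv (G z) $ 1 $ 2 * chr1 G i j 2 z) * pd 1 f z
       + (matrix_inv (G z) $ 2 $ 1 * chr1 G i j 1 z + matrix_inv (G z) $ 2 $ 2 * chr1 G i j 2 z) * pd 2 f z)" for i j
    by (simp add: hess_def chr_def sum_2)
  show ?thesis
    unfolding R unfolding hs inv[OF z] c1 x1 x2 ps f21 s_def[symmetric]
    by (rule divergence_identity[OF s(1)[OF z] _ pdet pdet]) (simp add: s(2)[OF z] det[OF z])
qed

section \<open>Integration by parts\<close>

locale riemannian_surface = riemannian_space \<A> g
  for \<A> :: "('a::{t2_space,second_countable_topology}, 2) chart set" and g :: "('a, 2) metric"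
begin

text \<open>The divergence of the vector field w grad f.\<close>

definition gproduct :: "('a \<Rightarrow> real) \<Rightarrow> ('a \<Rightarrow> real) \<Rightarrow> 'a \<Rightarrow> real" where
  "gproduct w f p = w p * laplacian \<A> g f p + gip \<A> g w f p"

lemma loc_bounded_gproduct:
  assumes w: "piecewise_smooth \<A> w" and f: "smooth_fun \<A> f"
  shows "loc_bounded (gproduct w f)"
proof -
  have "continuous_on UNIV w" using w by (simp add: piecewise_smooth_def)
  then show ?thesis
    unfolding gproduct_def[abs_def]
    by (intro loc_bounded_add loc_bounded_mult loc_bounded_gip[OF w smooth_fun_piecewise_smooth[OF A f]]
        loc_bounded_continuous smooth_fun_continuous[OF A smooth_fun_laplacian[OF f]])
qed

lemma gproduct_outside_support:
  assumes "closed K" "\<And>p. p \<notin> K \<Longrightarrow> w p = 0" "p \<notin> K"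
  shows "gproduct w f p = 0"
  using assms gip_zero_left[of "- K" p w f] by (simp add: gproduct_def open_Compl)

text \<open>In the chart, the volume density times the integrand is, up to a null set, the
  coordinate divergence of w times the flux of f. Each component has compact support, so its
  derivative integrates to 0.\<close>

lemma integral_gproduct_chart:
  assumes c: "c \<in> \<A>" and w: "piecewise_smooth \<A> w" and f: "smooth_fun \<A> f"
    and K: "compact K" "K \<subseteq> fst c" "\<And>p. p \<notin> K \<Longrightarrow> w p = 0"
  shows "(\<integral>p. gproduct w f p \<partial>completion \<mu>) = 0"
proof -
  let ?U = "chart_image c" and ?f = "f \<circ> chart_inv c" and ?w = "w \<circ> chart_inv c" and ?G = "metric_in c g"
  interpret G: metric_field ?G ?U by (rule metric_field_chart[OF A R c])
  have U: "open ?U" by (rule open_chart_image[OF A c])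
  have sf: "smooth_on ?U ?f" using f c by (simp add: smooth_fun_iff)
  have pos: "det (?G z) > 0" if "z \<in> ?U" for z
    using pos_def_det_pos[OF riemannian_metricD(3)[OF R c chart_inv_in[OF that]]] by simp
  note X = smooth_flux[where G = ?G, OF G.metric_field_axioms pos sf]
  have selw: "C1_selection ?U ?w" by (rule piecewise_smooth_C1_selection[OF A w c])
  define K' where "K' = snd c ` K"
  have K': "compact K'" "K' \<subseteq> ?U"
    using K(1,2) compact_continuous_image[OF continuous_on_subset[OF continuous_on_chart[OF A c] K(2)]] by (auto simp: K'_def)
  have w0: "?w z = 0" if "z \<in> ?U" "z \<notin> K'" for z
  proof -
    have "chart_inv c z \<notin> K"
    proof
      assume "chart_inv c z \<in> K"
      then have "snd c (chart_inv c z) \<in> K'" unfolding K'_def by (rule imageI)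
      then show False using that(2) unfolding chart_inv_right[OF that(1)] by contradiction
    qed
    then show ?thesis using K(3) by simp
  qed
  \<comment> \<open>The extension by 0 remains a C^1 selection: w vanishes off K', and the chart
    image and the complement of K' are open and cover the plane.\<close>
  define V where "V i z = (if z \<in> ?U then ?w z * flux ?G ?f i z else 0)" for i z
  have V0: "V i z = 0" if "z \<notin> K'" for i z using w0[of z] that by (simp add: V_def)
  have oK: "open (- K')" using compact_imp_closed[OF K'(1)] by (simp add: open_Compl)
  have selV: "C1_selection UNIV (V i)" for i
    unfolding C1_selection_def
  proof (intro conjI ballI)
    have "continuous_on ?U (\<lambda>z. ?w z * flux ?G ?f i z)"
      using selw unfolding C1_selection_def by (intro continuous_on_mult smooth_on_continuous_on[OF X]) blast
    then have 1: "continuous_on ?U (V i)" by (rule continuous_on_eq) (simp add: V_def)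
    have 2: "continuous_on (- K') (V i)"
      by (rule continuous_on_eq[OF continuous_on_const]) (simp add: V0)
    have "continuous_on (?U \<union> - K') (V i)" by (rule continuous_on_open_Un[OF U oK 1 2])
    moreover have "?U \<union> - K' = UNIV" using K'(2) by blast
    ultimately show "continuous_on UNIV (V i)" by simp
    fix z :: "real ^ 2"
    show "\<exists>W H. open W \<and> z \<in> W \<and> W \<subseteq> UNIV \<and> finite H \<and> (\<forall>k\<in>H. Ck_on 1 W k) \<and> (\<forall>y\<in>W. \<exists>k\<in>H. V i y = k y)"
    proof (cases "z \<in> ?U")
      case True
      then obtain W H where W: "open W" "z \<in> W" "W \<subseteq> ?U" "finite H" "\<And>k. k \<in> H \<Longrightarrow> Ck_on 1 W k"
        "\<And>y. y \<in> W \<Longrightarrow> \<exists>k\<in>H. ?w y = k y" using selw unfolding C1_selection_def by meson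
      let ?H = "(\<lambda>k z. k z * flux ?G ?f i z) ` H"
      have "Ck_on 1 W k" if kH: "k \<in> ?H" for k
      proof -
        obtain k0 where k0: "k0 \<in> H" "k = (\<lambda>z. k0 z * flux ?G ?f i z)" using kH by blast
        show ?thesis
          unfolding k0(2) by (rule Ck_on_mult[OF W(1) W(5)[OF k0(1)] smooth_on_Ck[OF smooth_on_subset[OF X W(3)]]])
      qed
      moreover have "\<exists>k\<in>?H. V i y = k y" if "y \<in> W" for y
        using W(6)[OF that] W(3) that by (auto simp: V_def)
      ultimately show ?thesis using W(1,2,4) by (intro exI[of _ W] exI[of _ ?H]) auto
    next
      case False
      then have "z \<in> - K'" using K'(2) by blast
      then show ?thesis
        using oK V0 Ck_on_const[OF oK, of 1 "0::real"]
        by (intro exI[of _ "- K'"] exI[of _ "{\<lambda>z. 0}"]) auto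
    qed
  qed
  obtain \<rho> where "\<forall>y\<in>K'. dist 0 y \<le> \<rho>"
    using compact_imp_bounded[OF K'(1)] unfolding bounded_any_center[of _ 0] by (rule exE)
  then have \<rho>: "K' \<subseteq> cball 0 \<rho>" by auto
  have "\<exists>N\<in>null_sets lborel. \<forall>z. z \<notin> N \<longrightarrow> V i differentiable at z" for i
    using C1_selection_differentiable_ae[OF selV open_UNIV, of i]
    by (simp only: Ball_def Diff_iff UNIV_I simp_thms)
  then obtain N where N: "\<And>i. N i \<in> null_sets lborel" "\<And>i z. z \<notin> N i \<Longrightarrow> V i differentiable at z" by metis
  obtain Nw where Nw: "Nw \<in> null_sets lborel" "\<And>z. z \<in> ?U - Nw \<Longrightarrow> ?w differentiable at z"
    using C1_selection_differentiable_ae[OF selw U] by blast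
  have int: "integrable lborel (\<lambda>z. indicator (- N i) z * pd i (V i) z)"
    "(\<integral>z. indicator (- N i) z * pd i (V i) z \<partial>lborel) = 0" for i
  proof -
    have supp: "V i z = 0" if "z \<notin> cball 0 \<rho>" for z using V0 \<rho> that by blast
    show "integrable lborel (\<lambda>z. indicator (- N i) z * pd i (V i) z)"
      unfolding pd_def by (rule integral_frechet_derivative_zero(1)[OF selV supp N])
    show "(\<integral>z. indicator (- N i) z * pd i (V i) z \<partial>lborel) = 0"
      unfolding pd_def by (rule integral_frechet_derivative_zero(2)[OF selV supp N])
  qed
  obtain M where M: "M \<in> null_sets \<mu>" "(\<lambda>p. indicator (- M) p * gproduct w f p) \<in> borel_measurable borel"
    using loc_bounded_gproduct[OF w f] unfolding loc_bounded_def by blast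
  \<comment> \<open>\<open>gproduct w f\<close> is known to be Borel off the null set M only, so its
    restriction is what is carried over to the chart.\<close>
  let ?F = "\<lambda>p. indicator (- M) p * gproduct w f p"
  let ?M = "snd c ` (fst c \<inter> M)"
  have out: "gproduct w f p = 0" if "p \<notin> K" for p
    by (rule gproduct_outside_support[OF compact_imp_closed[OF K(1)] K(3) that])
  \<comment> \<open>The excluded null sets are those off which the components of V and w are
    differentiable, and the image of M.\<close>
  have key: "indicator ?U z * (vol c z * ?F (chart_inv c z)) =
      indicator (- N 1) z * pd 1 (V 1) z + indicator (- N 2) z * pd 2 (V 2) z"
    if z: "z \<notin> N 1" "z \<notin> N 2" "z \<notin> Nw" "z \<notin> ?M" for z
  proof (cases "z \<in> ?U")
    case True
    let ?p = "chart_inv c z"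
    have p: "?p \<in> fst c" "snd c ?p = z" using chart_inv_in[OF True] chart_inv_right[OF True] by auto
    have dw: "?w differentiable at z" using Nw(2) True z by blast
    have dX: "flux ?G ?f i differentiable at z" for i by (rule smooth_on_differentiable[OF X True])
    have "pd i (V i) z = pd i ?w z * flux ?G ?f i z + ?w z * pd i (flux ?G ?f i) z" for i
    proof -
      have "pd i (V i) z = pd i (\<lambda>z. ?w z * flux ?G ?f i z) z"
        by (rule pd_cong[OF U True]) (simp add: V_def)
      then show ?thesis using pd_mult[OF dw dX] by simp
    qed
    then have "pd 1 (V 1) z + pd 2 (V 2) z = (pd 1 ?w z * flux ?G ?f 1 z + pd 2 ?w z * flux ?G ?f 2 z)
        + ?w z * (pd 1 (flux ?G ?f 1) z + pd 2 (flux ?G ?f 2) z)" by (simp add: algebra_simps)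
    also have "\<dots> = vol c z * (\<Sum>i\<in>UNIV. \<Sum>j\<in>UNIV. matrix_inv (?G z) $ i $ j * pd i ?w z * pd j ?f z)
        + ?w z * (vol c z * (\<Sum>i\<in>UNIV. \<Sum>j\<in>UNIV. matrix_inv (?G z) $ i $ j * hess ?G ?f z $ i $ j))"
    proof -
      have d: "pd 1 (flux ?G ?f 1) z + pd 2 (flux ?G ?f 2) z =
          vol c z * (\<Sum>i\<in>UNIV. \<Sum>j\<in>UNIV. matrix_inv (?G z) $ i $ j * hess ?G ?f z $ i $ j)"
        using divergence_flux[where G = ?G, OF G.metric_field_axioms pos sf True] unfolding vol_def by (simp only: o_apply)
      have "pd 1 ?w z * flux ?G ?f 1 z + pd 2 ?w z * flux ?G ?f 2 z =
          vol c z * (\<Sum>i\<in>UNIV. \<Sum>j\<in>UNIV. matrix_inv (?G z) $ i $ j * pd i ?w z * pd j ?f z)"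
        by (simp add: flux_def sum_2 vol_def algebra_simps)
      with d show ?thesis by (simp only:)
    qed
    also have "(\<Sum>i\<in>UNIV. \<Sum>j\<in>UNIV. matrix_inv (?G z) $ i $ j * hess ?G ?f z $ i $ j) = laplacian \<A> g f ?p"
      by (simp add: laplacian_chart_eq[OF c p(1) f] metric_trace_def hessian_hess[OF A c p(1)] p(2))
    also have "(\<Sum>i\<in>UNIV. \<Sum>j\<in>UNIV. matrix_inv (?G z) $ i $ j * pd i ?w z * pd j ?f z) = gip \<A> g w f ?p"
      using gip_in_chart[OF c p(1) differentiable_funI[OF A c p(1)] smooth_fun_differentiable[OF f], of w] dw
      by (simp add: p(2) coord_deriv_pd)
    finally have "pd 1 (V 1) z + pd 2 (V 2) z = vol c z * gproduct w f ?p"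
      by (simp add: gproduct_def algebra_simps)
    moreover have "?p \<notin> M" using z(4) p True unfolding chart_image_Int[OF A c] by auto
    ultimately show ?thesis using True z by simp
  next
    case False
    then have zK: "z \<in> - K'" using K'(2) by blast
    have "pd i (V i) z = pd i (\<lambda>z. 0) z" for i by (rule pd_cong[OF oK zK]) (simp add: V0)
    then show ?thesis using False by (simp add: pd_const)
  qed
  have "(\<integral>p. gproduct w f p \<partial>completion \<mu>) = (\<integral>p. ?F p \<partial>\<mu>)"
  proof (rule integral_completion_AE(2)[OF M(2)])
    show "AE p in \<mu>. gproduct w f p = ?F p" using AE_not_in[OF M(1)] by eventually_elim simp
  qed
  also have "\<dots> = (\<integral>p. indicator (fst c) p * ?F p \<partial>\<mu>)"
    by (intro Bochner_Integration.integral_cong refl) (use out K(2) in \<open>force simp: indicator_def\<close>)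
  also have "\<dots> = (\<integral>z. indicator ?U z * (vol c z * ?F (chart_inv c z)) \<partial>lborel)"
    using chart_measure_integral(2)[OF c M(2)] chart_measure_lborel(2)[OF c M(2)] by simp
  also have "\<dots> = (\<integral>z. indicator (- N 1) z * pd 1 (V 1) z + indicator (- N 2) z * pd 2 (V 2) z \<partial>lborel)"
  proof (rule integral_cong_AE)
    show "(\<lambda>z. indicator (- N 1) z * pd 1 (V 1) z + indicator (- N 2) z * pd 2 (V 2) z) \<in> borel_measurable lborel"
      using borel_measurable_integrable[OF int(1)] by (intro borel_measurable_add) auto
    have "(\<lambda>z. (indicator ?U z * vol c z) * ?F (if z \<in> ?U then chart_inv c z else undefined)) \<in> borel_measurable borel"
      by (intro borel_measurable_times measurable_vol[OF c] measurable_compose[OF measurable_chart_inv[OF c] M(2)])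
    also have "(\<lambda>z. (indicator ?U z * vol c z) * ?F (if z \<in> ?U then chart_inv c z else undefined)) =
        (\<lambda>z. indicator ?U z * (vol c z * ?F (chart_inv c z)))" by (auto simp: fun_eq_iff indicator_def)
    finally show "(\<lambda>z. indicator ?U z * (vol c z * ?F (chart_inv c z))) \<in> borel_measurable lborel" by simp
    show "AE z in lborel. indicator ?U z * (vol c z * ?F (chart_inv c z)) =
        indicator (- N 1) z * pd 1 (V 1) z + indicator (- N 2) z * pd 2 (V 2) z"
      using AE_not_in[OF N(1)[of 1]] AE_not_in[OF N(1)[of 2]] AE_not_in[OF Nw(1)]
        AE_not_in[OF null_sets_chart_image[OF c M(1)]]
      by eventually_elim (rule key)
  qed
  also have "\<dots> = 0" by (simp add: Bochner_Integration.integral_add[OF int(1) int(1)] int(2))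
  finally show ?thesis .
qed

end

text \<open>A truncated quadratic function is enough, since the cutoff only has to be piecewise
  smooth.\<close>

lemma bump_function:
  fixes \<A> :: "('a::t2_space, 'n::finite) chart set"
  assumes A: "smooth_atlas \<A>"
  shows "\<exists>\<eta> V K. piecewise_smooth \<A> \<eta> \<and> open V \<and> p0 \<in> V \<and> (\<forall>p\<in>V. \<eta> p = 1) \<and>
    compact K \<and> K \<subseteq> fst (chart_at \<A> p0) \<and> (\<forall>p. p \<notin> K \<longrightarrow> \<eta> p = 0)"
proof -
  define c where "c = chart_at \<A> p0"
  have c: "c \<in> \<A>" "p0 \<in> fst c" using chart_at_in[OF A] by (auto simp: c_def)
  define x0 where "x0 = snd c p0"
  have x0: "x0 \<in> chart_image c" using c by (simp add: x0_def)
  obtain \<rho> where \<rho>: "\<rho> > 0" "cball x0 \<rho> \<subseteq> chart_image c"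
    using open_chart_image[OF A c(1)] x0 open_contains_cball by blast
  define r where "r = \<rho> / 2"
  have r: "r > 0" "cball x0 (2 * r) \<subseteq> chart_image c" using \<rho> by (auto simp: r_def)
  \<comment> \<open>This q is at least 1 inside radius r and negative outside radius 2 r, so
    clamping it to [0,1] gives the plateau and the compact support.\<close>
  define q where "q x = 2 - (x - x0) \<bullet> (x - x0) / r\<^sup>2" for x :: "real ^ 'n"
  define \<eta> where "\<eta> p = (if p \<in> fst c then max 0 (min 1 (q (snd c p))) else 0)" for p
  define K where "K = chart_inv c ` cball x0 (2 * r)"
  define V where "V = fst c \<inter> snd c -` ball x0 r"
  have K: "compact K" unfolding K_def
    by (intro compact_continuous_image compact_cball continuous_on_subset[OF continuous_on_chart_inv[OF A c(1)] r(2)])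
  have Kc: "K \<subseteq> fst c" unfolding K_def by (rule image_subsetI[OF chart_inv_in[OF subsetD[OF r(2)]]])
  have \<eta>0: "\<eta> p = 0" if "p \<notin> K" for p
  proof (cases "p \<in> fst c")
    case True
    have "snd c p \<notin> cball x0 (2 * r)"
    proof
      assume "snd c p \<in> cball x0 (2 * r)"
      then have "chart_inv c (snd c p) \<in> K" unfolding K_def by (rule imageI)
      then show False using that chart_inv_left[OF A c(1) True] by simp
    qed
    then have "norm (snd c p - x0) > 2 * r" by (simp add: dist_norm norm_minus_commute)
    then have "(norm (snd c p - x0))\<^sup>2 > (2 * r)\<^sup>2" using r(1) by (intro power_strict_mono) auto
    then have "(snd c p - x0) \<bullet> (snd c p - x0) > 4 * r\<^sup>2" by (simp add: power2_norm_eq_inner power_mult_distrib)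
    then have "q (snd c p) < 0" using r(1) by (simp add: q_def field_simps) (smt (verit) zero_less_power)
    then show ?thesis by (simp add: \<eta>_def)
  qed (simp add: \<eta>_def)
  have \<eta>1: "\<eta> p = 1" if "p \<in> V" for p
  proof -
    have "norm (snd c p - x0) < r" using that by (simp add: V_def dist_norm norm_minus_commute)
    then have "(norm (snd c p - x0))\<^sup>2 < r\<^sup>2" by (intro power_strict_mono) auto
    then have "q (snd c p) \<ge> 1" using r(1) by (simp add: q_def power2_norm_eq_inner field_simps)
    then show ?thesis using that by (simp add: \<eta>_def V_def)
  qed
  have V: "open V" unfolding V_def
    by (rule continuous_open_preimage[OF continuous_on_chart[OF A c(1)] open_chart[OF A c(1)] open_ball])
  have oK: "open (- K)" using compact_imp_closed[OF K] by (simp add: open_Compl)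
  have "piecewise_smooth \<A> \<eta>"
    unfolding piecewise_smooth_def
  proof (intro conjI allI)
    have "continuous_on (fst c) (\<lambda>p. max 0 (min 1 (q (snd c p))))"
      unfolding q_def using r(1) by (intro continuous_intros continuous_on_chart[OF A c(1)]) auto
    then have 1: "continuous_on (fst c) \<eta>" by (rule continuous_on_eq) (simp add: \<eta>_def)
    have 2: "continuous_on (- K) \<eta>" by (rule continuous_on_eq[OF continuous_on_const]) (simp add: \<eta>0)
    have "continuous_on (fst c \<union> - K) \<eta>" by (rule continuous_on_open_Un[OF open_chart[OF A c(1)] oK 1 2])
    moreover have "fst c \<union> - K = UNIV" using Kc by blast
    ultimately show "continuous_on UNIV \<eta>" by simp
    fix p
    have const: "smooth_fun_on \<A> W (\<lambda>p. a)" if "open W" for W a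
      unfolding smooth_fun_on_def o_def by (intro ballI smooth_on_const open_chart_image_Int[OF A _ that])
    show "\<exists>W H. open W \<and> p \<in> W \<and> finite H \<and> (\<forall>h\<in>H. smooth_fun_on \<A> W h) \<and> (\<forall>y\<in>W. \<exists>h\<in>H. \<eta> y = h y)"
    proof (cases "p \<in> fst c")
      case True
      have "smooth_fun_on \<A> (fst c) (\<lambda>p. q (snd c p))"
        unfolding smooth_fun_on_def
      proof
        fix d assume d: "d \<in> \<A>"
        let ?S = "snd d ` (fst d \<inter> fst c)"
        have S: "open ?S" by (rule open_chart_image_Int[OF A d open_chart[OF A c(1)]])
        have "smooth_on ?S (snd c \<circ> chart_inv d)" using A c d unfolding smooth_atlas_def by blast
        then have "smooth_on ?S (\<lambda>x. 2 - ((snd c \<circ> chart_inv d) x - x0) \<bullet> ((snd c \<circ> chart_inv d) x - x0) / r\<^sup>2)"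
          by (intro smooth_on_diff smooth_on_divide_const smooth_on_const
              smooth_on_bounded_bilinear[OF bounded_bilinear_inner] S)
        then show "smooth_on ?S ((\<lambda>p. q (snd c p)) \<circ> chart_inv d)" by (simp add: q_def o_def)
      qed
      then show ?thesis
        using open_chart[OF A c(1)] True const
        by (intro exI[of _ "fst c"] exI[of _ "{\<lambda>p. 0, \<lambda>p. 1, \<lambda>p. q (snd c p)}"])
           (auto simp: \<eta>_def max_def min_def)
    next
      case False
      then show ?thesis
        using oK Kc const \<eta>0 by (intro exI[of _ "- K"] exI[of _ "{\<lambda>p. 0}"]) auto
    qed
  qed
  moreover have "p0 \<in> V" using c r by (simp add: V_def x0_def)
  ultimately show ?thesis using V \<eta>1 K Kc \<eta>0 unfolding c_def by blast
qed

context riemannian_surface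
begin

text \<open>In place of a partition of unity, one cutoff is split off at a time: w \<eta> is
  supported in one chart, and w - w \<eta> vanishes on V i, so the remaining sets cover its nonzero
  points. The induction is therefore over all w.\<close>

lemma integral_gproduct_cover:
  assumes f: "smooth_fun \<A> f" and X: "finite X"
    and \<eta>: "\<And>i. piecewise_smooth \<A> (\<eta> i)" "\<And>i p. p \<in> V i \<Longrightarrow> \<eta> i p = 1"
    and Q: "\<And>i. compact (Q i)" "\<And>i. Q i \<subseteq> fst (chart_at \<A> i)" "\<And>i p. p \<notin> Q i \<Longrightarrow> \<eta> i p = 0"
    and K: "compact K"
  shows "piecewise_smooth \<A> w \<Longrightarrow> (\<And>p. p \<notin> K \<Longrightarrow> w p = 0) \<Longrightarrow> (\<And>p. w p \<noteq> 0 \<Longrightarrow> p \<in> (\<Union>i\<in>X. V i)) \<Longrightarrow>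
    (\<integral>p. gproduct w f p \<partial>completion \<mu>) = 0"
  using X
proof (induction X arbitrary: w rule: finite_induct)
  case empty
  then have "w p = 0" for p by auto
  then have "gproduct w f p = 0" for p by (intro gproduct_outside_support[of "{}"]) auto
  then show ?case by simp
next
  case (insert i X)
  let ?w1 = "\<lambda>p. w p * \<eta> i p" and ?w2 = "\<lambda>p. w p - w p * \<eta> i p"
  note ps1 = piecewise_smooth_mult[OF A insert.prems(1) \<eta>(1)[of i]]
  note ps = ps1 piecewise_smooth_diff[OF A insert.prems(1) ps1]
  have int: "integrable (completion \<mu>) (gproduct u f)" if "piecewise_smooth \<A> u" "\<And>p. p \<notin> K \<Longrightarrow> u p = 0" for u
    by (rule integrable_loc_bounded[OF loc_bounded_gproduct[OF that(1) f] K])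
       (rule gproduct_outside_support[OF compact_imp_closed[OF K] that(2)])
  have i1: "integrable (completion \<mu>) (gproduct ?w1 f)" by (rule int[OF ps(1)]) (simp add: insert.prems(2))
  have i2: "integrable (completion \<mu>) (gproduct ?w2 f)" by (rule int[OF ps(2)]) (simp add: insert.prems(2))
  have i0: "integrable (completion \<mu>) (gproduct w f)" by (rule int[OF insert.prems(1,2)])
  have "(\<integral>p. gproduct ?w1 f p \<partial>completion \<mu>) = 0"
    by (rule integral_gproduct_chart[OF chart_at_in(1)[OF A] ps(1) f Q(1,2)[of i]]) (simp add: Q(3))
  moreover have "(\<integral>p. gproduct ?w2 f p \<partial>completion \<mu>) = 0"
  proof (rule insert.IH[OF ps(2)])
    show "?w2 p = 0" if "p \<notin> K" for p using insert.prems(2)[OF that] by simp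
    show "p \<in> (\<Union>i\<in>X. V i)" if nz: "?w2 p \<noteq> 0" for p
    proof -
      have "p \<notin> V i" using nz \<eta>(2)[of p i] by auto
      moreover have "w p \<noteq> 0" using nz by auto
      ultimately show ?thesis using insert.prems(3)[of p] by auto
    qed
  qed
  \<comment> \<open>Additivity in w is available almost everywhere, where w and its product with the
    cutoff are differentiable.\<close>
  moreover have "(\<integral>p. gproduct w f p \<partial>completion \<mu>) = (\<integral>p. gproduct ?w1 f p + gproduct ?w2 f p \<partial>completion \<mu>)"
  proof (rule integral_cong_AE)
    obtain N where N: "N \<in> null_sets \<mu>" "\<And>p. p \<notin> N \<Longrightarrow> differentiable_fun \<A> w p"
      using piecewise_smooth_differentiable_ae[OF insert.prems(1)] by blast
    obtain N' where N': "N' \<in> null_sets \<mu>" "\<And>p. p \<notin> N' \<Longrightarrow> differentiable_fun \<A> ?w1 p"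
      using piecewise_smooth_differentiable_ae[OF ps(1)] by blast
    have "AE p in \<mu>. gproduct w f p = gproduct ?w1 f p + gproduct ?w2 f p"
      using AE_not_in[OF N(1)] AE_not_in[OF N'(1)]
    proof eventually_elim
      case (elim p)
      show ?case
        unfolding gproduct_def gip_diff_left[OF N(2)[OF elim(1)] N'(2)[OF elim(2)]]
        by (simp add: algebra_simps)
    qed
    then show "AE p in completion \<mu>. gproduct w f p = gproduct ?w1 f p + gproduct ?w2 f p"
      by (rule AE_completion)
  qed (use i0 i1 i2 in auto)
  ultimately show ?case using Bochner_Integration.integral_add[OF i1 i2] by simp
qed

theorem integral_gproduct_zero:
  assumes f: "smooth_fun \<A> f" and w: "piecewise_smooth \<A> w"
    and K: "compact K" "\<And>p. p \<notin> K \<Longrightarrow> w p = 0"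
  shows "(\<integral>p. gproduct w f p \<partial>completion \<mu>) = 0"
proof -
  from bump_function[OF A] have "\<forall>i. \<exists>\<eta> V Q. piecewise_smooth \<A> \<eta> \<and> open V \<and> i \<in> V \<and> (\<forall>p\<in>V. \<eta> p = 1) \<and>
    compact Q \<and> Q \<subseteq> fst (chart_at \<A> i) \<and> (\<forall>p. p \<notin> Q \<longrightarrow> \<eta> p = 0)" by blast
  then obtain \<eta> V Q where b: "\<And>i. piecewise_smooth \<A> (\<eta> i)" "\<And>i. open (V i)" "\<And>i. i \<in> V i"
    "\<And>i p. p \<in> V i \<Longrightarrow> \<eta> i p = 1" "\<And>i. compact (Q i)" "\<And>i. Q i \<subseteq> fst (chart_at \<A> i)"
    "\<And>i p. p \<notin> Q i \<Longrightarrow> \<eta> i p = 0" by metis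
  have "K \<subseteq> (\<Union>i\<in>UNIV. V i)" using b(3) by blast
  from compactE_image[OF K(1) b(2) this] obtain X where X: "finite X" "K \<subseteq> (\<Union>i\<in>X. V i)" by metis
  show ?thesis
  proof (rule integral_gproduct_cover[OF f X(1) b(1,4,5,6,7) K(1) w K(2)])
    show "p \<in> (\<Union>i\<in>X. V i)" if "w p \<noteq> 0" for p using that K(2) X(2) by blast
  qed
qed

text \<open>Expand the nonnegative squared length of 2 grad f - (f/2) grad k and divide by
  2.\<close>

lemma gip_young: "f p * gip \<A> g f k p \<le> 2 * gip \<A> g f f p + 1/8 * ((f p)\<^sup>2 * gip \<A> g k k p)"
proof -
  define c where "c = chart_at \<A> p"
  have c: "c \<in> \<A>" "p \<in> fst c" using chart_at_in[OF A] by (auto simp: c_def)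
  let ?I = "inner_with (g c p)" and ?u = "grad c g f p" and ?v = "grad c g k p"
  let ?w = "2 *\<^sub>R ?u - (f p / 2) *\<^sub>R ?v"
  have "0 \<le> ?I ?w ?w"
    using riemannian_metricD(3)[OF R c, of ?w] by (cases "?w = 0") (auto simp: inner_with_def)
  also have "?I ?w ?w = 4 * ?I ?u ?u - f p * ?I ?u ?v - f p * ?I ?v ?u + (f p)\<^sup>2 / 4 * ?I ?v ?v"
    by (simp add: inner_with_diff_left inner_with_diff_right inner_with_scale_left inner_with_scale_right
        power2_eq_square algebra_simps)
  also have "?I ?v ?u = ?I ?u ?v" by (rule inner_with_commute[OF riemannian_metricD(2)[OF R c]])
  finally show ?thesis by (simp add: gip_def Let_def c_def[symmetric])
qed

lemma gip_exp_left:
  assumes "differentiable_fun \<A> f p"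
  shows "gip \<A> g (\<lambda>p. exp (- f p / 2)) k p = - 1/2 * exp (- f p / 2) * gip \<A> g f k p"
proof -
  have "coord_deriv c i (\<lambda>p. exp (- f p / 2)) p = - 1/2 * exp (- f p / 2) * coord_deriv c i f p"
    if "c \<in> \<A>" "p \<in> fst c" for c i
  proof -
    define u where "u = f \<circ> chart_inv c"
    have "u differentiable at (snd c p)" using assms that unfolding differentiable_fun_def u_def by blast
    then have "((\<lambda>x. exp (- u x / 2)) has_derivative
        (\<lambda>v. exp (- u (snd c p) / 2) * (- frechet_derivative u (at (snd c p)) v / 2))) (at (snd c p))"
      by (auto intro!: derivative_eq_intros simp: frechet_derivative_works)
    from has_derivative_pd[OF this] show ?thesis
      by (simp add: coord_deriv_pd pd_def u_def o_def chart_inv_left[OF A that])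
  qed
  from this[OF chart_at_in[OF A]] show ?thesis
    unfolding gip_chart_at Let_def by (simp add: sum_distrib_left mult_ac)
qed

end

section \<open>The stability inequality\<close>

context surface
begin

sublocale S: riemannian_surface \<S> h by unfold_locales

lemma smooth_exp_half: "smooth_fun \<S> (\<lambda>p. exp (- (\<phi> \<circ> F) p / 2))"
  unfolding smooth_fun_iff
proof
  fix c assume c: "c \<in> \<S>"
  have "smooth_on (chart_image c) (\<lambda>x. exp (- (\<phi> \<circ> F \<circ> chart_inv c) x / 2))"
    using \<phi>F_smooth c unfolding smooth_fun_iff
    by (intro smooth_on_exp smooth_on_divide_const smooth_on_minus open_chart_image[OF S_atlas c]) blast
  then show "smooth_on (chart_image c) ((\<lambda>p. exp (- (\<phi> \<circ> F) p / 2)) \<circ> chart_inv c)" by (simp add: o_def)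
qed

text \<open>The weight e^\<phi> cancels the two factors e^(-\<phi>/2), and the right side is the
  expansion of |\<nabla>f - (f/2)\<nabla>\<phi>|^2.\<close>

lemma grad_norm_sq_conformal:
  assumes f: "differentiable_fun \<S> f p"
  shows "grad_norm_sq \<S> h (\<lambda>p. f p * exp (- (\<phi> \<circ> F) p / 2)) p * exp (\<phi> (F p)) =
    gip \<S> h f f p - f p * gip \<S> h f (\<phi> \<circ> F) p + 1/4 * ((f p)\<^sup>2 * gip \<S> h (\<phi> \<circ> F) (\<phi> \<circ> F) p)"
proof -
  let ?\<psi> = "\<phi> \<circ> F"
  let ?e = "\<lambda>p. exp (- ?\<psi> p / 2)"
  have d\<psi>: "differentiable_fun \<S> ?\<psi> p" by (rule smooth_fun_differentiable[OF \<phi>F_smooth])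
  have de: "differentiable_fun \<S> ?e p" by (rule smooth_fun_differentiable[OF smooth_exp_half])
  have L: "gip \<S> h (\<lambda>p. f p * ?e p) k p = ?e p * (gip \<S> h f k p - f p / 2 * gip \<S> h ?\<psi> k p)" for k
    unfolding S.gip_mult_left[OF f de] S.gip_exp_left[OF d\<psi>] by (simp add: algebra_simps)
  have c: "gip \<S> h k (\<lambda>p. f p * ?e p) p = ?e p * (gip \<S> h f k p - f p / 2 * gip \<S> h ?\<psi> k p)" for k
    unfolding L[symmetric] by (rule S.gip_commute)
  have ee: "?e p * ?e p * exp (\<phi> (F p)) = 1" by (simp flip: exp_add)
  have "grad_norm_sq \<S> h (\<lambda>p. f p * ?e p) p * exp (\<phi> (F p)) = ?e p * ?e p * exp (\<phi> (F p)) *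
      (gip \<S> h f f p - f p / 2 * gip \<S> h ?\<psi> f p - f p / 2 * (gip \<S> h f ?\<psi> p - f p / 2 * gip \<S> h ?\<psi> ?\<psi> p))"
    unfolding grad_norm_sq_gip L c by (simp add: algebra_simps)
  then show ?thesis
    unfolding ee using S.gip_commute[of ?\<psi> f p] by (simp add: power2_eq_square algebra_simps)
qed

text \<open>The integrability claims belong to the result because \<open>schroedinger_stable\<close>
  integrates a difference, and the integral of a difference is split only for integrable
  functions.\<close>

lemma weighted_stable_schroedinger:
  assumes stable: "weighted_stable \<S> \<N> g \<phi> F \<nu>"
    and q: "q = (\<lambda>p. 1/3 * (1/2 * perelman_scalar_curvature \<N> g \<phi> (F p)
      + 1/2 * (weighted_mean_curvature \<S> \<N> g \<phi> F \<nu> p)\<^sup>2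
      + 1/2 * sff_norm_sq \<S> \<N> g F \<nu> p
      + 1/8 * grad_norm_sq \<S> h (\<phi> \<circ> F) p) - 1/3 * gaussian_curvature \<S> h p)"
  shows "smooth_fun \<S> q"
    and "piecewise_smooth \<S> f \<Longrightarrow> compactly_supported f \<Longrightarrow>
      integrable (riemannian_measure \<S> h) (\<lambda>p. q p * (f p)\<^sup>2)"
    and "piecewise_smooth \<S> f \<Longrightarrow> compactly_supported f \<Longrightarrow>
      integrable (riemannian_measure \<S> h) (grad_norm_sq \<S> h f)"
    and "piecewise_smooth \<S> f \<Longrightarrow> compactly_supported f \<Longrightarrow>
      (\<integral>p. q p * (f p)\<^sup>2 \<partial>riemannian_measure \<S> h) \<le> (\<integral>p. grad_norm_sq \<S> h f p \<partial>riemannian_measure \<S> h)"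
proof -
  obtain H0 where "\<And>p. weighted_mean_curvature \<S> \<N> g \<phi> F \<nu> p = H0"
    using stable unfolding weighted_stable_def by blast
  then show smq: "smooth_fun \<S> q"
    unfolding q by (rule smooth_schroedinger_potential)
  let ?\<psi> = "\<phi> \<circ> F" and ?M = "completion S.\<mu>"
  let ?E = "gip \<S> h ?\<psi> ?\<psi>" and ?L = "laplacian \<S> h ?\<psi>"
  note RM = S.riemannian_measure_eq
  \<comment> \<open>3 q carries |\<nabla>\<phi>|^2/8 and the potential carries |\<nabla>\<phi>|^2/2;
    the difference is the coefficient 3/8.\<close>
  have pot: "bakry_emery_ricci_normal \<N> g \<phi> F \<nu> p + sff_norm_sq \<S> \<N> g F \<nu> p = 3 * q p + 3/8 * ?E p + ?L p" for p
    unfolding stability_potential q grad_norm_sq_gip by (simp add: field_simps)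
  assume f: "piecewise_smooth \<S> f" and cf: "compactly_supported f"
  define K where "K = closure {p. f p \<noteq> 0}"
  have K: "compact K" using cf by (simp add: K_def compactly_supported_def)
  have f0: "f p = 0" if "p \<notin> K" for p
    using that closure_subset[of "{p. f p \<noteq> 0}"] unfolding K_def by blast
  have ff: "piecewise_smooth \<S> (\<lambda>p. f p * f p)" by (rule piecewise_smooth_mult[OF S_atlas f f])
  have ps\<psi>: "piecewise_smooth \<S> ?\<psi>" by (rule smooth_fun_piecewise_smooth[OF S_atlas \<phi>F_smooth])
  have fc: "continuous_on UNIV f" using f by (simp add: piecewise_smooth_def)
  have bsq: "S.loc_bounded (\<lambda>p. k p * (f p)\<^sup>2)" if "smooth_fun \<S> k" for k
    unfolding power2_eq_square
    by (intro S.loc_bounded_mult S.loc_bounded_continuous smooth_fun_continuous[OF S_atlas that] fc)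
  have isq: "integrable ?M (\<lambda>p. k p * (f p)\<^sup>2)" if "smooth_fun \<S> k" for k
    by (rule S.integrable_loc_bounded[OF bsq[OF that] K]) (simp add: f0)
  have iq: "integrable ?M (\<lambda>p. q p * (f p)\<^sup>2)" by (rule isq[OF smq])
  have iE: "integrable ?M (\<lambda>p. ?E p * (f p)\<^sup>2)" by (rule isq[OF S.smooth_fun_gip[OF \<phi>F_smooth \<phi>F_smooth]])
  have iL: "integrable ?M (\<lambda>p. ?L p * (f p)\<^sup>2)" by (rule isq[OF S.smooth_fun_laplacian[OF \<phi>F_smooth]])
  have iD: "integrable ?M (gip \<S> h f f)"
    by (rule S.integrable_loc_bounded[OF S.loc_bounded_gip[OF f f] K])
       (rule S.gip_zero_left[OF open_Compl[OF compact_imp_closed[OF K]]], auto simp: f0)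
  have iX: "integrable ?M (\<lambda>p. f p * gip \<S> h f ?\<psi> p)"
    by (rule S.integrable_loc_bounded[OF S.loc_bounded_mult[OF S.loc_bounded_continuous[OF fc]
        S.loc_bounded_gip[OF f ps\<psi>]] K]) (simp add: f0)
  show "integrable (riemannian_measure \<S> h) (\<lambda>p. q p * (f p)\<^sup>2)" unfolding RM by (rule iq)
  show "integrable (riemannian_measure \<S> h) (grad_norm_sq \<S> h f)"
    using iD unfolding RM by (simp add: grad_norm_sq_gip[abs_def])
  define a b l d x where "a = (\<integral>p. q p * (f p)\<^sup>2 \<partial>?M)" and "b = (\<integral>p. ?E p * (f p)\<^sup>2 \<partial>?M)"
    and "l = (\<integral>p. ?L p * (f p)\<^sup>2 \<partial>?M)" and "d = (\<integral>p. gip \<S> h f f p \<partial>?M)"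
    and "x = (\<integral>p. f p * gip \<S> h f ?\<psi> p \<partial>?M)"
  obtain N where N: "N \<in> null_sets S.\<mu>" "\<And>p. p \<notin> N \<Longrightarrow> differentiable_fun \<S> f p"
    using S.piecewise_smooth_differentiable_ae[OF f] by blast
  have AE: "AE p in ?M. differentiable_fun \<S> f p"
    by (rule AE_completion) (use AE_not_in[OF N(1)] in eventually_elim, rule N(2))
  let ?u = "\<lambda>p. f p * exp (- ?\<psi> p / 2)"
  have u: "piecewise_smooth \<S> ?u"
    by (rule piecewise_smooth_mult[OF S_atlas f smooth_fun_piecewise_smooth[OF S_atlas smooth_exp_half]])
  have cu: "compactly_supported ?u" using cf by (simp add: compactly_supported_def)
  have "(\<integral>p. (bakry_emery_ricci_normal \<N> g \<phi> F \<nu> p + sff_norm_sq \<S> \<N> g F \<nu> p) * (?u p)\<^sup>2 * exp (\<phi> (F p)) \<partial>?M)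
      \<le> (\<integral>p. grad_norm_sq \<S> h ?u p * exp (\<phi> (F p)) \<partial>?M)"
    using stable u cu unfolding weighted_stable_def RM by blast
  also have "(\<integral>p. (bakry_emery_ricci_normal \<N> g \<phi> F \<nu> p + sff_norm_sq \<S> \<N> g F \<nu> p) * (?u p)\<^sup>2 * exp (\<phi> (F p)) \<partial>?M) =
      (\<integral>p. 3 * (q p * (f p)\<^sup>2) + 3/8 * (?E p * (f p)\<^sup>2) + ?L p * (f p)\<^sup>2 \<partial>?M)"
  proof (rule Bochner_Integration.integral_cong[OF refl])
    fix p
    have "(exp (- \<phi> (F p) / 2))\<^sup>2 * exp (\<phi> (F p)) = 1" by (simp add: power2_eq_square flip: exp_add)
    then have eQ: "Q * (?u p)\<^sup>2 * exp (\<phi> (F p)) = Q * (f p)\<^sup>2" for Q by (simp add: power_mult_distrib mult.assoc)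
    then show "(bakry_emery_ricci_normal \<N> g \<phi> F \<nu> p + sff_norm_sq \<S> \<N> g F \<nu> p) * (?u p)\<^sup>2 * exp (\<phi> (F p)) =
        3 * (q p * (f p)\<^sup>2) + 3/8 * (?E p * (f p)\<^sup>2) + ?L p * (f p)\<^sup>2"
      unfolding pot eQ by (simp add: algebra_simps)
  qed
  also have "\<dots> = 3 * a + 3/8 * b + l"
    unfolding a_def b_def l_def by (simp add: iq iE iL)
  also have "(\<integral>p. grad_norm_sq \<S> h ?u p * exp (\<phi> (F p)) \<partial>?M) =
      (\<integral>p. gip \<S> h f f p - f p * gip \<S> h f ?\<psi> p + 1/4 * (?E p * (f p)\<^sup>2) \<partial>?M)"
  proof (rule integral_cong_AE)
    have e: "continuous_on UNIV (\<lambda>p. exp (\<phi> (F p)))"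
      using smooth_fun_continuous[OF S_atlas \<phi>F_smooth] by (simp add: o_def continuous_on_exp)
    have "integrable ?M (\<lambda>p. gip \<S> h ?u ?u p * exp (\<phi> (F p)))"
      by (rule S.integrable_loc_bounded[OF S.loc_bounded_mult[OF S.loc_bounded_gip[OF u u]
          S.loc_bounded_continuous[OF e]] K])
         (subst S.gip_zero_left[OF open_Compl[OF compact_imp_closed[OF K]]], auto simp: f0)
    then show "(\<lambda>p. grad_norm_sq \<S> h ?u p * exp (\<phi> (F p))) \<in> borel_measurable ?M"
      by (simp add: grad_norm_sq_gip)
    show "(\<lambda>p. gip \<S> h f f p - f p * gip \<S> h f ?\<psi> p + 1/4 * (?E p * (f p)\<^sup>2)) \<in> borel_measurable ?M"
      by (intro borel_measurable_integrable Bochner_Integration.integrable_add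
          Bochner_Integration.integrable_diff integrable_mult_right iD iX iE)
    show "AE p in ?M. grad_norm_sq \<S> h ?u p * exp (\<phi> (F p)) =
        gip \<S> h f f p - f p * gip \<S> h f ?\<psi> p + 1/4 * (?E p * (f p)\<^sup>2)"
      using AE by eventually_elim (use grad_norm_sq_conformal in \<open>simp add: mult.commute\<close>)
  qed
  also have "\<dots> = d - x + 1/4 * b"
    unfolding d_def x_def b_def by (simp add: iD iX iE)
  finally have 1: "3 * a + 3/8 * b + l \<le> d - x + 1/4 * b" .
  \<comment> \<open>The integrand is the divergence of f^2 grad \<phi>, since grad f^2 = 2 f grad f
    wherever f is differentiable.\<close>
  have "(\<integral>p. ?L p * (f p)\<^sup>2 + 2 * (f p * gip \<S> h f ?\<psi> p) \<partial>?M) =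
      (\<integral>p. S.gproduct (\<lambda>p. f p * f p) ?\<psi> p \<partial>?M)"
  proof (rule integral_cong_AE)
    show "(\<lambda>p. ?L p * (f p)\<^sup>2 + 2 * (f p * gip \<S> h f ?\<psi> p)) \<in> borel_measurable ?M"
      by (intro borel_measurable_integrable Bochner_Integration.integrable_add integrable_mult_right iL iX)
    have "integrable ?M (S.gproduct (\<lambda>p. f p * f p) ?\<psi>)"
      by (rule S.integrable_loc_bounded[OF S.loc_bounded_gproduct[OF ff \<phi>F_smooth] K])
         (rule S.gproduct_outside_support[OF compact_imp_closed[OF K]], auto simp: f0)
    then show "S.gproduct (\<lambda>p. f p * f p) ?\<psi> \<in> borel_measurable ?M" by (rule borel_measurable_integrable)
    show "AE p in ?M. ?L p * (f p)\<^sup>2 + 2 * (f p * gip \<S> h f ?\<psi> p) = S.gproduct (\<lambda>p. f p * f p) ?\<psi> p"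
      using AE
      by eventually_elim (simp add: S.gproduct_def S.gip_mult_left power2_eq_square)
  qed
  also have "\<dots> = 0"
    by (rule S.integral_gproduct_zero[OF \<phi>F_smooth ff K]) (simp add: f0)
  finally have 2: "l + 2 * x = 0"
    unfolding l_def x_def by (simp add: iL iX)
  have "x \<le> (\<integral>p. 2 * gip \<S> h f f p + 1/8 * (?E p * (f p)\<^sup>2) \<partial>?M)"
    unfolding x_def
    by (intro integral_mono iX Bochner_Integration.integrable_add integrable_mult_right iD iE)
       (use S.gip_young[of f _ ?\<psi>] in \<open>simp add: mult.commute\<close>)
  also have "\<dots> = 2 * d + 1/8 * b" unfolding d_def b_def by (simp add: iD iE)
  finally have 3: "x \<le> 2 * d + 1/8 * b" .
  \<comment> \<open>Eliminating l and then x gives 3 a \<le> d + x - b/8 \<le> 3 d.\<close>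
  have "a \<le> d" using 1 2 3 by linarith
  then show "(\<integral>p. q p * (f p)\<^sup>2 \<partial>riemannian_measure \<S> h) \<le> (\<integral>p. grad_norm_sq \<S> h f p \<partial>riemannian_measure \<S> h)"
    unfolding RM a_def d_def grad_norm_sq_gip .
qed

end

theorem mainTheorem6:
  fixes \<N> :: "('a::{t2_space,second_countable_topology}, 3) chart set"
    and g :: "('a, 3) metric"
    and \<phi> :: "'a \<Rightarrow> real"
    and \<S> :: "('s::{t2_space,second_countable_topology}, 2) chart set"
    and F :: "'s \<Rightarrow> 'a"
    and \<nu> :: "('a, 3) chart \<Rightarrow> 's \<Rightarrow> real ^ 3"
    and h :: "('s, 2) metric"
    and K V :: "'s \<Rightarrow> real"
    and a :: real
  defines "h \<equiv> induced_metric \<N> g F"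
    and "K \<equiv> gaussian_curvature \<S> h"
    and "V \<equiv> \<lambda>p. 1/3 * (1/2 * perelman_scalar_curvature \<N> g \<phi> (F p)
                        + 1/2 * (weighted_mean_curvature \<S> \<N> g \<phi> F \<nu> p)\<^sup>2
                        + 1/2 * sff_norm_sq \<S> \<N> g F \<nu> p
                        + 1/8 * grad_norm_sq \<S> h (\<phi> \<circ> F) p)"
    and "a \<equiv> 1/3"
  assumes "manifold_with_density \<N> g \<phi>"
    and "smooth_manifold \<S>"
    and "immersion \<S> \<N> F"
    and "unit_normal \<S> \<N> g F \<nu>"
    and "complete_metric \<S> h"
    and "weighted_stable \<S> \<N> g \<phi> F \<nu>"
  shows "(\<forall>f. piecewise_smooth \<S> f \<longrightarrow> compactly_supported f \<longrightarrow>
            (\<integral>p. (V p - a * K p) * (f p)\<^sup>2 \<partial>riemannian_measure \<S> h)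
            \<le> (\<integral>p. grad_norm_sq \<S> h f p \<partial>riemannian_measure \<S> h))
       \<and> schroedinger_stable \<S> h (\<lambda>p. V p - a * K p)"
proof -
  interpret surface \<N> g \<phi> \<S> F \<nu>
    using assms(5-8) by unfold_locales
  have q: "(\<lambda>p. V p - a * K p) = (\<lambda>p. 1/3 * (1/2 * perelman_scalar_curvature \<N> g \<phi> (F p)
      + 1/2 * (weighted_mean_curvature \<S> \<N> g \<phi> F \<nu> p)\<^sup>2 + 1/2 * sff_norm_sq \<S> \<N> g F \<nu> p
      + 1/8 * grad_norm_sq \<S> (induced_metric \<N> g F) (\<phi> \<circ> F) p)
      - 1/3 * gaussian_curvature \<S> (induced_metric \<N> g F) p)"
    unfolding V_def K_def a_def h_def ..
  note W = weighted_stable_schroedinger[OF assms(10) q, folded h_def]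
  have "schroedinger_stable \<S> h (\<lambda>p. V p - a * K p)"
    unfolding schroedinger_stable_def
    using W(1) by (simp add: Bochner_Integration.integral_diff[OF W(3) W(2)] W(4))
  then show ?thesis using W(4) by blast
qed

end
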